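(* Let $\alpha\in(0,1]$ and let $F:\mathbb{H}\to\mathbb{H}$ be a holomorphic function that is uniformly bounded and globally $\alpha$-Hölder. Let $B$ be a standard real Brownian motion with $B_0=0$ on a filtered probability space $(\Omega,\{\mathcal{F}_t\}_{t\ge 0},\mathcal{F},\mathbb{P})$. Then for almost every $\omega\in\Omega$, taking $U=B(\omega)$ and letting $\varphi:\Delta\times\mathbb{H}\to\mathbb{H}$ be the flow associated to $dZ_t=F(Z_t)\,dt+dU_t$, and $\mathcal{H}=\{H_{s,t}\}_{(s,t)\in\Delta}$ the corresponding planar evolution, the following hold. (i) $\varphi$ extends continuously to $\Delta\times\overline{\mathbb{H}}$. In fact, $\varphi$ is jointly $\eta$-Hölder on compact subsets of $\Delta\times\overline{\mathbb{H}}$ for all $\eta<\frac12$. Further, for all $s\le t$, $\varphi(s,t,\cdot)$ is injective on $\overline{\mathbb{H}}$. In particular, the boundaries of the domains in $\mathcal{H}$ are continuously varying Jordan arcs (the boundary of $H_{s,t}$ being parametrized by $x\in\mathbb{R}\mapsto\varphi(s,t,x)$). (ii) $\varphi'$ extends continuously to $\Delta\times\overline{\mathbb{H}}$, and for each $s\le t$, $\varphi'(s,t,\cdot)$ is $\eta$-Hölder on compact subsets of $\overline{\mathbb{H}}$ for all $\eta<\alpha$.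
   Context: $\mathbb{H}=\{z\in\mathbb{C}:\operatorname{Im}(z)>0\}$, $\overline{\mathbb{H}}=\mathbb{H}\cup\mathbb{R}$, and $\Delta=\{(s,t):0\le s\le t<\infty\}$. $F$ is globally $\alpha$-Hölder if $\sup_{z\ne w\in\mathbb{H}}|F(z)-F(w)|/|z-w|^{\alpha}<\infty$. Given a continuous function $U:[0,\infty)\to\mathbb{R}$ with $U_0=0$, for $(s,t)\in\Delta$ and $z\in\mathbb{H}$, $\varphi(s,t,z)$ denotes the value at time $t$ of the unique solution $Z$ of $dZ_t=F(Z_t)\,dt+dU_t$, $Z_s=z$, i.e. of $Z_t=z+\int_s^tF(Z_r)\,dr+U_t-U_s$ for $t\ge s$. (Since $F$ is holomorphic with values in $\mathbb{H}$ and bounded, the solution exists for all times, is unique and stays in $\mathbb{H}$.) The map $\varphi:\Delta\times\mathbb{H}\to\mathbb{H}$ is called the flow; for fixed $(s,t)$ the map $\varphi(s,t,\cdot)$ is injective and holomorphic on $\mathbb{H}$, and $\varphi'(s,t,z)$ denotes its complex derivative in $z$. The planar evolution associated to $(F,U)$ is the family $\mathcal{H}=\{H_{s,t}\}_{(s,t)\in\Delta}$ of domains $H_{s,t}=\varphi(s,t,\mathbb{H})$. The extensions to $\Delta\times\overline{\mathbb{H}}$ are denoted by the same symbols. *)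

theory Defs
  imports "HOL-Probability.Probability"
begin

abbreviation upper_half_plane :: "complex set" where
  "upper_half_plane \<equiv> {z. Im z > 0}"

abbreviation closed_upper_half_plane :: "complex set" where
  "closed_upper_half_plane \<equiv> {z. Im z \<ge> 0}"

abbreviation time_simplex :: "(real \<times> real) set" where
  "time_simplex \<equiv> {(s, t). 0 \<le> s \<and> s \<le> t}"

text \<open>Finiteness of the Hoelder seminorm of \<open>f\<close> on \<open>S\<close>. On products, \<open>dist\<close> is the Euclidean
  product metric.\<close>

definition holder_on :: "real \<Rightarrow> 'a::metric_space set \<Rightarrow> ('a \<Rightarrow> 'b::metric_space) \<Rightarrow> bool" where
  "holder_on \<eta> S f \<longleftrightarrow>
     bdd_above {dist (f x) (f y) / dist x y powr \<eta> | x y. x \<in> S \<and> y \<in> S \<and> x \<noteq> y}"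

definition continuous_extension ::
    "'a::topological_space set \<Rightarrow> 'a set \<Rightarrow> ('a \<Rightarrow> 'b::topological_space) \<Rightarrow> ('a \<Rightarrow> 'b) \<Rightarrow> bool" where
  "continuous_extension S T f g \<longleftrightarrow>
     S \<subseteq> T \<and> continuous_on T g \<and> (\<forall>x\<in>S. g x = f x)"

text \<open>The differential equation is driven by a path that need not be differentiable, so it is
  stated in integral form. Values of \<open>F\<close> outside the upper half plane and values of \<open>Z\<close> before
  time \<open>s\<close> play no role.\<close>

definition flow_solution ::
    "(complex \<Rightarrow> complex) \<Rightarrow> (real \<Rightarrow> real) \<Rightarrow> real \<Rightarrow> complex \<Rightarrow> (real \<Rightarrow> complex) \<Rightarrow> bool" where
  "flow_solution F U s z Z \<longleftrightarrow>
     continuous_on {s..} Z \<and>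
     (\<forall>t\<ge>s. Z t \<in> upper_half_plane \<and>
             Z t = z + integral {s..t} (\<lambda>r. F (Z r)) + complex_of_real (U t - U s))"

text \<open>The description ranges over the value at time \<open>t\<close> rather than over \<open>Z\<close>, because \<open>Z\<close> is
  determined only on \<open>{s..}\<close>.\<close>

definition flow :: "(complex \<Rightarrow> complex) \<Rightarrow> (real \<Rightarrow> real) \<Rightarrow> real \<Rightarrow> real \<Rightarrow> complex \<Rightarrow> complex" where
  "flow F U s t z = (THE w. \<exists>Z. flow_solution F U s z Z \<and> Z t = w)"

definition planar_evolution ::
    "(complex \<Rightarrow> complex) \<Rightarrow> (real \<Rightarrow> real) \<Rightarrow> real \<Rightarrow> real \<Rightarrow> complex set" where
  "planar_evolution F U s t = flow F U s t ` upper_half_plane"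

text \<open>\<open>J\<close> is a Jordan arc parametrized by the real line, that is, \<open>\<gamma>\<close> is a homeomorphism from the
  line onto \<open>J\<close>. When \<open>J\<close> is closed in the plane (such as a frontier), this forces \<open>\<gamma>\<close> to tend
  to infinity at both ends.\<close>

definition jordan_arc_param :: "(real \<Rightarrow> complex) \<Rightarrow> complex set \<Rightarrow> bool" where
  "jordan_arc_param \<gamma> J \<longleftrightarrow> (\<exists>g. homeomorphism UNIV J \<gamma> g)"

locale filtered_prob_space = prob_space M for M :: "'a measure" +
  fixes Fil :: "real \<Rightarrow> 'a measure"
  assumes subalgebra_Fil: "0 \<le> t \<Longrightarrow> subalgebra M (Fil t)"
    and Fil_mono: "0 \<le> s \<Longrightarrow> s \<le> t \<Longrightarrow> subalgebra (Fil t) (Fil s)"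

locale standard_brownian_motion = filtered_prob_space M Fil
  for M :: "'a measure" and Fil :: "real \<Rightarrow> 'a measure" +
  fixes B :: "real \<Rightarrow> 'a \<Rightarrow> real"
  assumes adapted: "0 \<le> t \<Longrightarrow> B t \<in> borel_measurable (Fil t)"
    and start: "AE \<omega> in M. B 0 \<omega> = 0"
    and indep_increments: "0 \<le> s \<Longrightarrow> s \<le> t \<Longrightarrow>
      indep_set (sets (Fil s)) (sets (vimage_algebra (space M) (\<lambda>\<omega>. B t \<omega> - B s \<omega>) borel))"
    and normal_increments: "0 \<le> s \<Longrightarrow> s < t \<Longrightarrow>
      distributed M lborel (\<lambda>\<omega>. B t \<omega> - B s \<omega>) (normal_density 0 (sqrt (t - s)))"
    and continuous_paths: "AE \<omega> in M. continuous_on {0..} (\<lambda>t. B t \<omega>)"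

end

theory Submission
  imports Defs "HOL-Complex_Analysis.Complex_Analysis"
begin

text \<open>The derivative of the flow is \<open>exp L\<close> with \<open>L(s, t, z) = \<integral> F'(Z\<^sub>r) dr\<close> over \<open>[s, t]\<close>, and \<open>F'\<close> may blow up at
  the real line. If \<open>G\<close> is a primitive of \<open>F\<close>, then Ito's formula for \<open>G(Z)\<close> gives
  \<open>L / 2 = G(Z\<^sub>t) - G(z) - \<integral> F(Z\<^sub>r)\<^sup>2 dr - \<integral> F(Z\<^sub>r) dB\<^sub>r\<close>, in which \<open>F'\<close> no longer occurs: all terms are controlled by
  the bound and the Hoelder constant of \<open>F\<close>, uniformly up to the boundary. First this yields exponential moments of
  \<open>L\<close>, hence moments of \<open>\<phi>(s, t, z) - \<phi>(s, t, w)\<close>, and then moments of \<open>L(s, t, z) - L(s, t, w)\<close> of order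
  \<open>\<bar>z - w\<bar>\<close> to the power \<open>\<alpha>\<close>. Stochastic integrals are limits of Riemann sums along partitions, so that independence of increments
  and Fatou's lemma suffice. Kolmogorov's criterion is applied only on dyadic time intervals; since \<open>L\<close> is additive
  along trajectories, a deterministic chaining argument extends the bounds to all \<open>s \<le> t\<close> and to the closed half plane.
  Injectivity on the boundary holds because \<open>\<phi>'\<close> is uniformly close to 1 for short times.\<close>

section \<open>The drift\<close>

text \<open>Pathwise estimates at height y = Im z cost constants such as 2C/y that explode at the
  real line, so they are used only qualitatively: for existence, differentiability and convergence
  of sums. Size is controlled in expectation, where y drops out. Two moments of L of order 2m are
  available: h^m over a time interval of length h, with no gain in space, and |z - w|^(2m \<alpha>)
  for a difference, with no gain in h. Kolmogorov's criterion must beat 2^n intervals and about 4^l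
  grid steps at once. Since both moments bound the difference, so does their geometric mean with
  weight \<theta> on time; a small \<theta> loses little of \<alpha>, and a large m makes both
  series converge. The resulting factor 2^(-\<epsilon> n) is what chaining in time sums up, while an
  arbitrary starting time s costs nothing because L restarts from wherever the trajectory
  is.\<close>

lemma exp_weight_integral:
  fixes L s t :: real
  assumes "L > 0" "s \<le> t"
  shows "((\<lambda>r. L * exp (2 * L * (r - s))) has_integral (exp (2 * L * (t - s)) - 1) / 2) {s..t}"
proof -
  have "((\<lambda>r. exp (2 * L * (r - s)) / 2) has_vector_derivative L * exp (2 * L * (x - s))) (at x within {s..t})" for x
    by (auto intro!: derivative_eq_intros simp: has_real_derivative_iff_has_vector_derivative[symmetric])
  from fundamental_theorem_of_calculus[OF assms(2) this]
  show ?thesis by (simp add: diff_divide_distrib)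
qed

text \<open>Divided by exp(2L(r - s)), |D| attains a maximum m. The weight makes L times the
  integral at most half of the weighted maximum, so m is at most a + m/2 and absorbs itself; this is
  where both factors 2 come from.\<close>

lemma weighted_gronwall:
  fixes D :: "real \<Rightarrow> complex"
  assumes cont: "continuous_on {s..T} D" and "L > 0" "a \<ge> 0"
    and bound: "\<And>t. t \<in> {s..T} \<Longrightarrow> cmod (D t) \<le> a + L * integral {s..t} (\<lambda>r. cmod (D r))"
    and t: "t \<in> {s..T}"
  shows "cmod (D t) \<le> 2 * a * exp (2 * L * (t - s))"
proof -
  let ?g = "\<lambda>r. exp (- (2 * L * (r - s))) * cmod (D r)"
  have cg: "continuous_on {s..T} ?g"
    by (intro continuous_intros cont)
  obtain u where u: "u \<in> {s..T}" and umax: "\<And>r. r \<in> {s..T} \<Longrightarrow> ?g r \<le> ?g u"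
    using continuous_attains_sup[OF compact_Icc _ cg] t by (metis empty_iff)
  define m where "m = ?g u"
  have Dm: "cmod (D r) \<le> m * exp (2 * L * (r - s))" if "r \<in> {s..T}" for r
  proof -
    have "cmod (D r) = ?g r * exp (2 * L * (r - s))"
      by (simp add: exp_minus)
    also have "\<dots> \<le> m * exp (2 * L * (r - s))"
      unfolding m_def using umax[OF that] by (intro mult_right_mono) auto
    finally show ?thesis .
  qed
  have m0: "m \<ge> 0" unfolding m_def by simp
  have cD: "continuous_on {s..u} D" using cont u by (auto intro: continuous_on_subset)
  have "L * integral {s..u} (\<lambda>r. cmod (D r)) = integral {s..u} (\<lambda>r. L * cmod (D r))"
    by simp
  also have "\<dots> \<le> integral {s..u} (\<lambda>r. m * (L * exp (2 * L * (r - s))))"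
    using Dm u \<open>L > 0\<close> cD
    by (intro integral_le integrable_continuous_interval continuous_intros) (auto simp: mult_ac)
  also have "\<dots> = m * ((exp (2 * L * (u - s)) - 1) / 2)"
    using integral_unique[OF exp_weight_integral[OF \<open>L > 0\<close>, of s u]] u by simp
  also have "\<dots> \<le> m * exp (2 * L * (u - s)) / 2"
    using m0 by (simp add: algebra_simps)
  finally have "cmod (D u) \<le> a + m * exp (2 * L * (u - s)) / 2"
    using bound[OF u] by linarith
  then have "m \<le> exp (- (2 * L * (u - s))) * (a + m * exp (2 * L * (u - s)) / 2)"
    unfolding m_def by (intro mult_left_mono) auto
  also have "\<dots> = exp (- (2 * L * (u - s))) * a + m / 2"
    by (simp only: distrib_left) (simp add: exp_minus)
  also have "\<dots> \<le> a + m / 2"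
    using \<open>a \<ge> 0\<close> \<open>L > 0\<close> u by (simp add: mult_left_le_one_le)
  finally have "m \<le> 2 * a" by simp
  then have "m * exp (2 * L * (t - s)) \<le> 2 * a * exp (2 * L * (t - s))"
    by (intro mult_right_mono) auto
  with Dm[OF t] show ?thesis by linarith
qed

text \<open>\<open>C\<close> and \<open>A\<close> are any admissible bound and Hoelder constant
  rather than the optimal ones; enlarging \<open>C\<close> to at least 1 spares case
  distinctions.\<close>

locale holomorphic_drift =
  fixes F :: "complex \<Rightarrow> complex" and C A \<alpha> :: real
  assumes holF: "F holomorphic_on upper_half_plane"
    and F_in: "0 < Im z \<Longrightarrow> 0 < Im (F z)"
    and F_bound: "0 < Im z \<Longrightarrow> cmod (F z) \<le> C"
    and F_holder: "0 < Im z \<Longrightarrow> 0 < Im w \<Longrightarrow> cmod (F z - F w) \<le> A * cmod (z - w) powr \<alpha>"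
    and \<alpha>_pos: "0 < \<alpha>" and \<alpha>_le: "\<alpha> \<le> 1" and C_ge: "1 \<le> C" and A_ge: "0 \<le> A"
begin

lemma open_H: "open upper_half_plane"
  by (rule open_halfspace_Im_gt)

lemma convex_Im_ge: "convex {z. y \<le> Im z}"
  using convex_halfspace_Im_ge[of y] by simp

lemma convex_H: "convex upper_half_plane"
  using convex_halfspace_Im_gt[of 0] by simp

lemma hol_iter: "(deriv ^^ n) F holomorphic_on upper_half_plane"
  by (induction n) (auto intro: holF holomorphic_deriv open_H)

lemma iter_deriv:
  assumes "0 < Im z"
  shows "((deriv ^^ n) F has_field_derivative (deriv ^^ Suc n) F z) (at z)"
  using holomorphic_derivI[OF hol_iter open_H, of z] assms by simp

text \<open>Cauchy's inequality on the disc of radius y/2, at most half the distance to the real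
  line, so that the closed disc stays inside the half plane.\<close>

lemma iter_deriv_bound:
  assumes "0 < y" "y \<le> Im z"
  shows "cmod ((deriv ^^ n) F z) \<le> fact n * C / (y / 2) ^ n"
proof (rule Cauchy_inequality)
  have *: "0 < Im w" if "dist z w \<le> y / 2" for w
  proof -
    have "\<bar>Im (z - w)\<bar> \<le> y / 2" using abs_Im_le_cmod[of "z - w"] that by (simp add: dist_norm)
    then show ?thesis using assms unfolding minus_complex.simps by linarith
  qed
  show "F holomorphic_on ball z (y / 2)"
    using * by (intro holomorphic_on_subset[OF holF]) auto
  show "continuous_on (cball z (y / 2)) F"
    using * by (intro continuous_on_subset[OF holomorphic_on_imp_continuous_on[OF holF]]) auto
  show "cmod (F w) \<le> C" if "cmod (z - w) = y / 2" for w
    using * that by (intro F_bound) (auto simp: dist_norm)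
qed (use assms in auto)

text \<open>The Cauchy bounds for F' and F'' above height y. Their blow-up as y tends to 0 is the
  difficulty of the theorem.\<close>

definition K1 :: "real \<Rightarrow> real" where "K1 y = 2 * C / y"
definition K2 :: "real \<Rightarrow> real" where "K2 y = 8 * C / y\<^sup>2"

lemma K1_pos: "0 < y \<Longrightarrow> 0 < K1 y" and K2_pos: "0 < y \<Longrightarrow> 0 < K2 y"
  using C_ge by (auto simp: K1_def K2_def)

lemma dF_bound: "0 < y \<Longrightarrow> y \<le> Im z \<Longrightarrow> cmod (deriv F z) \<le> K1 y"
  using iter_deriv_bound[of y z 1] by (simp add: K1_def field_simps)

lemma ddF_bound: "0 < y \<Longrightarrow> y \<le> Im z \<Longrightarrow> cmod (deriv (deriv F) z) \<le> K2 y"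
  using iter_deriv_bound[of y z 2] by (simp add: K2_def field_simps numeral_2_eq_2 power2_eq_square)

lemma F_deriv: "0 < Im z \<Longrightarrow> (F has_field_derivative deriv F z) (at z)"
  using iter_deriv[of z 0] by simp

lemma dF_deriv: "0 < Im z \<Longrightarrow> (deriv F has_field_derivative deriv (deriv F) z) (at z)"
  using iter_deriv[of z 1] by simp

lemma F_cont: "continuous_on upper_half_plane F"
  using holF by (rule holomorphic_on_imp_continuous_on)

lemma dF_cont: "continuous_on upper_half_plane (deriv F)"
  using hol_iter[of 1] by (auto intro: holomorphic_on_imp_continuous_on)

lemma F_lip:
  assumes "0 < y" "y \<le> Im z" "y \<le> Im w"
  shows "cmod (F z - F w) \<le> K1 y * cmod (z - w)"
  by (rule field_differentiable_bound[OF convex_Im_ge[of y], where f' = "deriv F"])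
     (use assms in \<open>auto intro!: DERIV_subset[OF F_deriv] dF_bound\<close>)

lemma dF_lip:
  assumes "0 < y" "y \<le> Im z" "y \<le> Im w"
  shows "cmod (deriv F z - deriv F w) \<le> K2 y * cmod (z - w)"
  by (rule field_differentiable_bound[OF convex_Im_ge[of y], where f' = "deriv (deriv F)"])
     (use assms in \<open>auto intro!: DERIV_subset[OF dF_deriv] ddF_bound\<close>)

lemma F_taylor:
  assumes "0 < y" "y \<le> Im z" "y \<le> Im w"
  shows "cmod (F w - F z - deriv F z * (w - z)) \<le> K2 y * cmod (w - z) ^ 2"
proof -
  have "cmod ((deriv ^^ 0) F w - (\<Sum>i\<le>1. (deriv ^^ i) F z * (w - z) ^ i / fact i))
      \<le> K2 y * cmod (w - z) ^ Suc 1 / fact 1"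
    by (rule complex_Taylor[OF convex_Im_ge[of y]])
       (use assms in \<open>auto intro!: DERIV_subset[OF iter_deriv] ddF_bound simp del: funpow.simps simp: numeral_2_eq_2\<close>,
        auto intro!: ddF_bound)
  then show ?thesis by (simp add: numeral_2_eq_2 diff_diff_eq)
qed

lemma F_primitive_ex: "\<exists>G. \<forall>z. 0 < Im z \<longrightarrow> (G has_field_derivative F z) (at z)"
proof -
  obtain G where "\<And>z. z \<in> upper_half_plane \<Longrightarrow> (G has_field_derivative F z) (at z within upper_half_plane)"
    using holomorphic_convex_primitive'[OF convex_H open_H holF] by blast
  then show ?thesis using open_H by (metis (mono_tags) at_within_open mem_Collect_eq)
qed

definition G :: "complex \<Rightarrow> complex" where
  "G = (SOME G. \<forall>z. 0 < Im z \<longrightarrow> (G has_field_derivative F z) (at z))"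

lemma G_deriv: "0 < Im z \<Longrightarrow> (G has_field_derivative F z) (at z)"
  unfolding G_def using someI_ex[OF F_primitive_ex] by blast

text \<open>The reason for passing to \<open>G\<close>: its derivative is bounded by
  \<open>C\<close> at all heights, so this bound, unlike those involving F', does not blow
  up.\<close>

lemma G_lip:
  assumes "0 < Im z" "0 < Im w"
  shows "cmod (G z - G w) \<le> C * cmod (z - w)"
  by (rule field_differentiable_bound[OF convex_H, where f' = F])
     (use assms in \<open>auto intro!: DERIV_subset[OF G_deriv] F_bound\<close>)

lemma G_taylor:
  assumes "0 < y" "y \<le> Im z" "y \<le> Im w"
  shows "cmod (G w - G z - F z * (w - z) - deriv F z * (w - z)\<^sup>2 / 2) \<le> K2 y * cmod (w - z) ^ 3"
proof -
  \<comment> \<open>The chain G, F, F', F'' is listed as one sequence, the form in which the complex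
    Taylor theorem takes successive derivatives.\<close>
  define g where "g i = (if i = 0 then G else (deriv ^^ (i - 1)) F)" for i :: nat
  have "cmod (g 0 w - (\<Sum>i\<le>2. g i z * (w - z) ^ i / fact i))
      \<le> K2 y * cmod (w - z) ^ Suc 2 / fact 2"
  proof (rule complex_Taylor[OF convex_Im_ge[of y]])
    show "(g i has_field_derivative g (Suc i) x) (at x within {z. y \<le> Im z})" if "x \<in> {z. y \<le> Im z}" for i x
    proof (cases i)
      case 0 then show ?thesis using that assms by (auto simp: g_def intro!: DERIV_subset[OF G_deriv])
    next
      case (Suc j) then show ?thesis
        using that assms DERIV_subset[OF iter_deriv[of x j]] by (auto simp: g_def)
    qed
    show "cmod (g (Suc 2) x) \<le> K2 y" if "x \<in> {z. y \<le> Im z}" for x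
      using that assms ddF_bound by (auto simp: g_def numeral_2_eq_2)
  qed (use assms in auto)
  then have "cmod (G w - G z - F z * (w - z) - deriv F z * (w - z)\<^sup>2 / 2) \<le> K2 y * cmod (w - z) ^ 3 / 2"
    by (simp add: g_def numeral_2_eq_2 numeral_3_eq_3 diff_diff_eq add.assoc)
  also have "\<dots> \<le> K2 y * cmod (w - z) ^ 3" using K2_pos[OF assms(1)] by simp
  finally show ?thesis .
qed

end

section \<open>Flows of the integral equation\<close>

lemma indefinite_integral_has_vector_derivative:
  fixes g :: "real \<Rightarrow> complex"
  assumes "continuous_on {s..} g" "s \<le> t"
  shows "((\<lambda>t. integral {s..t} g) has_vector_derivative g t) (at t within {s..})"
proof -
  have "((\<lambda>t. integral {s..t} g) has_vector_derivative g t) (at t within {s..t + 1})"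
    using assms by (intro integral_has_vector_derivative) (auto intro: continuous_on_subset)
  moreover have "at t within {s..t + 1} = at t within {s..}"
    by (rule at_within_nhd[of _ "{t - 1<..<t + 1}"]) auto
  ultimately show ?thesis by simp
qed

lemma indefinite_integral_continuous:
  fixes g :: "real \<Rightarrow> complex"
  assumes "continuous_on {s..} g"
  shows "continuous_on {s..} (\<lambda>t. integral {s..t} g)"
  unfolding continuous_on_eq_continuous_within
  using indefinite_integral_has_vector_derivative[OF assms]
  by (auto intro: has_vector_derivative_continuous)

locale driven_flow = holomorphic_drift +
  fixes U :: "real \<Rightarrow> real"
  assumes contU: "continuous_on {0..} U"
begin

lemma contU_from: "0 \<le> s \<Longrightarrow> continuous_on {s..} U"
  by (rule continuous_on_subset[OF contU]) auto

text \<open>Picard iteration on the whole half line for a globally Lipschitz drift: F is frozen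
  below height y = Im z. Since Im F > 0 and the noise is real, the solution never falls below y and
  does not see the change.\<close>

lemma solution_exists:
  assumes s: "0 \<le> s" and z: "0 < Im z"
  shows "\<exists>Z. flow_solution F U s z Z"
proof -
  define y where "y = Im z"
  define L where "L = K1 y"
  have y: "0 < y" and L: "0 < L" using z K1_pos by (auto simp: y_def L_def)
  define cl where "cl v = Complex (Re v) (max y (Im v))" for v
  define Ft where "Ft v = F (cl v)" for v
  have cl_ge: "y \<le> Im (cl v)" for v by (simp add: cl_def)
  have cl_lip: "cmod (cl v - cl w) \<le> cmod (v - w)" for v w
    unfolding cmod_def cl_def
    by (intro real_sqrt_le_mono add_mono) (auto simp: abs_le_square_iff[symmetric] max_def)
  have Ft_lip: "cmod (Ft v - Ft w) \<le> L * cmod (v - w)" for v w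
    unfolding Ft_def L_def
    by (rule order_trans[OF F_lip[OF y cl_ge cl_ge]])
       (use cl_lip K1_pos[OF y] in \<open>auto intro!: mult_left_mono\<close>)
  have Ft_bound: "cmod (Ft v) \<le> C" for v
    unfolding Ft_def using cl_ge[of v] y by (intro F_bound) simp
  have Ft_cont: "continuous_on UNIV Ft"
  proof (rule continuous_onI)
    fix x e :: complex and e' :: real assume "0 < e'"
    then show "\<exists>d>0. \<forall>x'\<in>UNIV. dist x' x < d \<longrightarrow> dist (Ft x') (Ft x) \<le> e'"
      using Ft_lip L
      by (intro exI[of _ "e' / L"])
         (auto simp: dist_norm field_simps intro: order_trans[OF Ft_lip])
  qed
  \<comment> \<open>The unknown f is exp(-2L(r - s)) times the drift integral. In this weighted form
    the Picard map contracts by 1/2 in the sup norm, without any restriction on the time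
    horizon.\<close>
  define N where "N f r = Ft (z + exp (2 * L * (r - s)) *\<^sub>R apply_bcontfun f r + complex_of_real (U r - U s))"
    for f :: "real \<Rightarrow>\<^sub>C complex" and r
  have N_cont: "continuous_on {s..} (N f)" for f
    unfolding N_def
    by (rule continuous_on_compose2[OF Ft_cont]) (auto intro!: continuous_intros contU_from s)
  have N_cont': "continuous_on {s..t} (N f)" for f t
    by (rule continuous_on_subset[OF N_cont]) auto
  \<comment> \<open>\<open>max s t\<close> extends the function by 0 to times before s, because the
    Banach space consists of functions on the whole real line.\<close>
  define h where "h f t = exp (- (2 * L * (max s t - s))) *\<^sub>R integral {s..max s t} (N f)" for f t
  have h_cont: "continuous_on UNIV (h f)" for f
    unfolding h_def
    by (intro continuous_intros continuous_on_compose2[OF indefinite_integral_continuous[OF N_cont]]) auto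
  have weight: "exp (- (2 * L * x)) * x \<le> 1 / (2 * L)" if "0 \<le> x" for x
  proof -
    have "2 * L * x \<le> exp (2 * L * x)"
      using exp_ge_add_one_self[of "2 * L * x"] by linarith
    then show ?thesis using L by (simp add: exp_minus field_simps)
  qed
  have h_bdd: "cmod (h f t) \<le> C / (2 * L)" for f t
  proof -
    have "cmod (integral {s..max s t} (N f)) \<le> C * (max s t - s)"
      by (rule integral_bound[OF _ N_cont']) (auto simp: N_def Ft_bound)
    then have "cmod (h f t) \<le> exp (- (2 * L * (max s t - s))) * (C * (max s t - s))"
      unfolding h_def by (auto intro!: mult_left_mono)
    also have "\<dots> = C * (exp (- (2 * L * (max s t - s))) * (max s t - s))" by simp
    also have "\<dots> \<le> C * (1 / (2 * L))"
      using C_ge by (intro mult_left_mono weight) auto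
    finally show ?thesis by simp
  qed
  have h_in: "h f \<in> bcontfun" for f
    unfolding bcontfun_def bounded_iff using h_cont h_bdd by auto
  define T where "T f = Bcontfun (h f)" for f
  have T_app: "apply_bcontfun (T f) = h f" for f
    unfolding T_def using h_in by (rule Bcontfun_inverse)
  have "\<exists>!f. T f = f"
  proof (rule banach_fix_type[of "1/2"])
    show "\<forall>f g. dist (T f) (T g) \<le> 1 / 2 * dist f g"
    proof (intro allI dist_bound)
      fix f g :: "real \<Rightarrow>\<^sub>C complex" and t :: real
      let ?t = "max s t"
      have fg: "cmod (apply_bcontfun f r - apply_bcontfun g r) \<le> dist f g" for r
        using dist_bounded[of f r g] by (simp add: dist_norm)
      have NN: "cmod (N f r - N g r) \<le> dist f g * (L * exp (2 * L * (r - s)))" for r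
      proof -
        have "cmod (N f r - N g r) \<le> L * cmod (exp (2 * L * (r - s)) *\<^sub>R (apply_bcontfun f r - apply_bcontfun g r))"
          unfolding N_def by (rule order_trans[OF Ft_lip]) (simp add: scaleR_diff_right)
        also have "\<dots> \<le> L * (exp (2 * L * (r - s)) * dist f g)"
          using fg[of r] L by auto
        finally show ?thesis by (simp add: mult_ac)
      qed
      have "integral {s..?t} (N f) - integral {s..?t} (N g) = integral {s..?t} (\<lambda>r. N f r - N g r)"
        by (intro Henstock_Kurzweil_Integration.integral_diff[symmetric] integrable_continuous_interval N_cont')
      then have "cmod (h f t - h g t) = exp (- (2 * L * (?t - s))) * cmod (integral {s..?t} (\<lambda>r. N f r - N g r))"
        unfolding h_def by (simp flip: scaleR_diff_right)
      also have "cmod (integral {s..?t} (\<lambda>r. N f r - N g r)) \<le> integral {s..?t} (\<lambda>r. dist f g * (L * exp (2 * L * (r - s))))"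
        by (intro integral_norm_bound_integral integrable_continuous_interval continuous_intros N_cont' NN)
      also have "\<dots> = dist f g * ((exp (2 * L * (?t - s)) - 1) / 2)"
        using integral_unique[OF exp_weight_integral[OF L, of s ?t]] by simp
      finally have "cmod (h f t - h g t) \<le> exp (- (2 * L * (?t - s))) * (dist f g * ((exp (2 * L * (?t - s)) - 1) / 2))"
        by simp
      also have "\<dots> \<le> exp (- (2 * L * (?t - s))) * (dist f g * (exp (2 * L * (?t - s)) / 2))"
        by (intro mult_left_mono) auto
      also have "\<dots> = 1 / 2 * dist f g" by (simp add: exp_minus)
      finally show "dist (apply_bcontfun (T f) t) (apply_bcontfun (T g) t) \<le> 1 / 2 * dist f g"
        by (simp add: T_app dist_norm)
    qed
  qed auto
  then obtain f where f: "T f = f" by blast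
  define Z where "Z t = z + exp (2 * L * (t - s)) *\<^sub>R apply_bcontfun f t + complex_of_real (U t - U s)" for t
  have Z_cont: "continuous_on {s..} Z"
    unfolding Z_def by (intro continuous_intros continuous_on_apply_bcontfun contU_from s)
  have N_Z: "N f = (\<lambda>r. Ft (Z r))" by (simp add: N_def Z_def fun_eq_iff)
  have Z_eq: "Z t = z + integral {s..t} (\<lambda>r. Ft (Z r)) + complex_of_real (U t - U s)" if "s \<le> t" for t
  proof -
    have "apply_bcontfun f t = exp (- (2 * L * (t - s))) *\<^sub>R integral {s..t} (\<lambda>r. Ft (Z r))"
      using T_app[of f] f that by (simp add: h_def N_Z)
    then show ?thesis unfolding Z_def by (simp add: exp_minus)
  qed
  have Z_ge: "y \<le> Im (Z t)" if "s \<le> t" for t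
  proof -
    have int: "(\<lambda>r. Ft (Z r)) integrable_on {s..t}"
      using N_cont'[of t f] by (auto simp: N_Z intro: integrable_continuous_interval)
    have "Im (integral {s..t} (\<lambda>r. Ft (Z r))) = integral {s..t} (\<lambda>r. Im (Ft (Z r)))"
      using integral_linear[OF int bounded_linear_Im] by (simp add: o_def)
    also have "\<dots> \<ge> 0"
      using integrable_linear[OF int bounded_linear_Im] F_in y cl_ge
      by (intro Henstock_Kurzweil_Integration.integral_nonneg) (auto simp: o_def Ft_def intro!: less_imp_le[OF F_in] less_le_trans[OF _ cl_ge])
    finally show ?thesis using arg_cong[OF Z_eq[OF that], of Im] by (simp add: y_def)
  qed
  have "Ft (Z t) = F (Z t)" if "s \<le> t" for t
    using Z_ge[OF that] by (simp add: Ft_def cl_def max_def complex_eq_iff)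
  then have "integral {s..t} (\<lambda>r. Ft (Z r)) = integral {s..t} (\<lambda>r. F (Z r))" for t
    by (intro Henstock_Kurzweil_Integration.integral_cong) auto
  then have "flow_solution F U s z Z"
    unfolding flow_solution_def using Z_cont Z_eq Z_ge y by force
  then show ?thesis by blast
qed

text \<open>The driving path is real and Im F > 0, so trajectories only move away from the real
  line. Bounds valid above the initial height thus persist in time.\<close>

lemma solution_Im_mono:
  assumes "flow_solution F U s z Z" "s \<le> r" "r \<le> t"
  shows "Im (Z r) \<le> Im (Z t)"
proof -
  have cZ: "continuous_on {s..} Z" and ZH: "\<And>t. s \<le> t \<Longrightarrow> 0 < Im (Z t)"
    and eq: "\<And>t. s \<le> t \<Longrightarrow> Z t = z + integral {s..t} (\<lambda>r. F (Z r)) + complex_of_real (U t - U s)"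
    using assms(1) by (auto simp: flow_solution_def)
  have cFZ: "continuous_on {s..} (\<lambda>r. F (Z r))"
    by (rule continuous_on_compose2[OF F_cont cZ]) (use ZH in auto)
  have int: "(\<lambda>r. F (Z r)) integrable_on {a..b}" if "s \<le> a" for a b
    by (rule integrable_continuous_interval, rule continuous_on_subset[OF cFZ]) (use that in auto)
  have "integral {s..t} (\<lambda>r. F (Z r)) = integral {s..r} (\<lambda>r. F (Z r)) + integral {r..t} (\<lambda>r. F (Z r))"
    using assms int[of s t] by (intro Henstock_Kurzweil_Integration.integral_combine[symmetric]) auto
  moreover have "0 \<le> Im (integral {r..t} (\<lambda>r. F (Z r)))"
  proof -
    have "Im (integral {r..t} (\<lambda>r. F (Z r))) = integral {r..t} (\<lambda>r. Im (F (Z r)))"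
      using integral_linear[OF int bounded_linear_Im, of r t] assms by (simp add: o_def)
    also have "\<dots> \<ge> 0"
      using integrable_linear[OF int bounded_linear_Im, of r t] assms
      by (intro Henstock_Kurzweil_Integration.integral_nonneg) (auto simp: o_def intro!: less_imp_le[OF F_in] ZH)
    finally show ?thesis .
  qed
  ultimately show ?thesis using eq[of r] eq[of t] assms by simp
qed

lemma solution_lipschitz:
  assumes Z: "flow_solution F U s z Z" and W: "flow_solution F U s w W"
    and y: "0 < y" "y \<le> Im z" "y \<le> Im w" and t: "s \<le> t"
  shows "cmod (Z t - W t) \<le> 2 * cmod (z - w) * exp (2 * K1 y * (t - s))"
proof (rule weighted_gronwall[where T = t])
  note defs = Z[unfolded flow_solution_def] W[unfolded flow_solution_def]
  have Zs: "Z s = z" and Ws: "W s = w" using defs by auto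
  have ge: "y \<le> Im (Z r)" "y \<le> Im (W r)" if "s \<le> r" for r
    using solution_Im_mono[OF Z order_refl that] solution_Im_mono[OF W order_refl that] Zs Ws y by auto
  have cZ: "continuous_on {s..r} Z" and cW: "continuous_on {s..r} W" for r
    using defs by (auto intro: continuous_on_subset)
  show "continuous_on {s..t} (\<lambda>t. Z t - W t)" by (intro continuous_intros cZ cW)
  show "cmod (Z r - W r) \<le> cmod (z - w) + K1 y * integral {s..r} (\<lambda>r. cmod (Z r - W r))" if "r \<in> {s..t}" for r
  proof -
    have cFZ: "continuous_on {s..r} (\<lambda>r. F (Z r))" and cFW: "continuous_on {s..r} (\<lambda>r. F (W r))"
      using defs by (auto intro!: continuous_on_compose2[OF F_cont] cZ cW)
    have "Z r - W r = (z - w) + integral {s..r} (\<lambda>r. F (Z r) - F (W r))"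
    proof -
      have "Z r = z + integral {s..r} (\<lambda>r. F (Z r)) + complex_of_real (U r - U s)"
        "W r = w + integral {s..r} (\<lambda>r. F (W r)) + complex_of_real (U r - U s)"
        using defs that by auto
      then show ?thesis
        by (simp add: Henstock_Kurzweil_Integration.integral_diff integrable_continuous_interval cFZ cFW)
    qed
    also have "cmod \<dots> \<le> cmod (z - w) + cmod (integral {s..r} (\<lambda>r. F (Z r) - F (W r)))"
      by (rule norm_triangle_ineq)
    also have "cmod (integral {s..r} (\<lambda>r. F (Z r) - F (W r))) \<le> integral {s..r} (\<lambda>r. K1 y * cmod (Z r - W r))"
      using ge by (intro integral_norm_bound_integral integrable_continuous_interval continuous_intros cFZ cFW cZ cW F_lip y) auto
    finally show ?thesis by simp
  qed
qed (use t K1_pos[OF y(1)] in auto)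

abbreviation "\<phi> \<equiv> flow F U"

lemma flow_eqI:
  assumes Z: "flow_solution F U s z Z" and t: "s \<le> t"
  shows "\<phi> s t z = Z t"
  unfolding flow_def
proof (rule the_equality)
  show "\<exists>Z'. flow_solution F U s z Z' \<and> Z' t = Z t" using Z by blast
  fix w assume "\<exists>Z'. flow_solution F U s z Z' \<and> Z' t = w"
  then obtain W where W: "flow_solution F U s z W" "W t = w" by blast
  have "Z s = z" "Z s \<in> upper_half_plane" using Z by (auto simp: flow_solution_def)
  then have "0 < Im z" by auto
  \<comment> \<open>For equal starting points the Lipschitz bound is 0, which is uniqueness.\<close>
  with solution_lipschitz[OF Z W(1), of "Im z" t] t W(2) show "w = Z t" by simp
qed

lemma flow_solution_flow:
  assumes "0 \<le> s" "0 < Im z"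
  shows "flow_solution F U s z (\<lambda>t. \<phi> s t z)"
proof -
  obtain Z where Z: "flow_solution F U s z Z" using solution_exists[OF assms] by blast
  have eq: "\<phi> s t z = Z t" if "s \<le> t" for t using flow_eqI[OF Z that] .
  have "integral {s..t} (\<lambda>r. F (\<phi> s r z)) = integral {s..t} (\<lambda>r. F (Z r))" for t
    by (intro Henstock_Kurzweil_Integration.integral_cong) (auto simp: eq)
  moreover have "continuous_on {s..} (\<lambda>t. \<phi> s t z) = continuous_on {s..} Z"
    by (intro continuous_on_cong) (auto simp: eq)
  ultimately show ?thesis using Z eq unfolding flow_solution_def by metis
qed

lemma flow_cont: "0 \<le> s \<Longrightarrow> 0 < Im z \<Longrightarrow> continuous_on {s..} (\<lambda>t. \<phi> s t z)"
  and flow_in_H: "0 \<le> s \<Longrightarrow> 0 < Im z \<Longrightarrow> s \<le> t \<Longrightarrow> 0 < Im (\<phi> s t z)"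
  and flow_eq: "0 \<le> s \<Longrightarrow> 0 < Im z \<Longrightarrow> s \<le> t \<Longrightarrow>
    \<phi> s t z = z + integral {s..t} (\<lambda>r. F (\<phi> s r z)) + complex_of_real (U t - U s)"
  using flow_solution_flow[of s z] by (auto simp: flow_solution_def)

lemma flow_start [simp]: "0 \<le> s \<Longrightarrow> 0 < Im z \<Longrightarrow> \<phi> s s z = z"
  using flow_eq[of s z s] by simp

lemma flow_Im_ge: "0 \<le> s \<Longrightarrow> 0 < Im z \<Longrightarrow> s \<le> t \<Longrightarrow> Im z \<le> Im (\<phi> s t z)"
  using solution_Im_mono[OF flow_solution_flow, of s z s t] by simp

lemma flow_lipschitz:
  "0 \<le> s \<Longrightarrow> s \<le> t \<Longrightarrow> 0 < y \<Longrightarrow> y \<le> Im z \<Longrightarrow> y \<le> Im w \<Longrightarrow>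
    cmod (\<phi> s t z - \<phi> s t w) \<le> 2 * cmod (z - w) * exp (2 * K1 y * (t - s))"
  by (rule solution_lipschitz) (auto intro!: flow_solution_flow)

lemma flow_F_cont: "0 \<le> s \<Longrightarrow> 0 < Im z \<Longrightarrow> continuous_on {s..} (\<lambda>t. F (\<phi> s t z))"
  by (rule continuous_on_compose2[OF F_cont flow_cont]) (auto intro: flow_in_H)

lemma flow_dF_cont: "0 \<le> s \<Longrightarrow> 0 < Im z \<Longrightarrow> continuous_on {s..} (\<lambda>t. deriv F (\<phi> s t z))"
  by (rule continuous_on_compose2[OF dF_cont flow_cont]) (auto intro: flow_in_H)

text \<open>A trajectory observed from time r on solves the equation started at its position at r,
  so uniqueness identifies the two.\<close>

lemma flow_semigroup:
  assumes s: "0 \<le> s" "s \<le> r" "r \<le> t" and z: "0 < Im z"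
  shows "\<phi> r t (\<phi> s r z) = \<phi> s t z"
proof (rule flow_eqI[OF _ \<open>r \<le> t\<close>])
  show "flow_solution F U r (\<phi> s r z) (\<lambda>t. \<phi> s t z)"
    unfolding flow_solution_def
  proof (intro conjI allI impI)
    show "continuous_on {r..} (\<lambda>t. \<phi> s t z)"
      using s z by (intro continuous_on_subset[OF flow_cont]) auto
    fix t assume t: "r \<le> t"
    show "\<phi> s t z \<in> upper_half_plane" using s z t flow_in_H by auto
    have "(\<lambda>x. F (\<phi> s x z)) integrable_on {s..t}"
      using s z by (intro integrable_continuous_interval continuous_on_subset[OF flow_F_cont]) auto
    then have "integral {s..t} (\<lambda>r. F (\<phi> s r z)) = integral {s..r} (\<lambda>r. F (\<phi> s r z)) + integral {r..t} (\<lambda>r. F (\<phi> s r z))"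
      using s t by (intro Henstock_Kurzweil_Integration.integral_combine[symmetric]) auto
    then show "\<phi> s t z = \<phi> s r z + integral {r..t} (\<lambda>r. F (\<phi> s r z)) + complex_of_real (U t - U r)"
      using flow_eq[of s z t] flow_eq[of s z r] s z t by simp
  qed
qed

lemma flow_increment:
  assumes "0 \<le> s" "s \<le> r" "r \<le> t" "0 < Im z"
  shows "\<phi> s t z - \<phi> s r z = integral {r..t} (\<lambda>u. F (\<phi> s u z)) + complex_of_real (U t - U r)"
    and "cmod (integral {r..t} (\<lambda>u. F (\<phi> s u z))) \<le> C * (t - r)"
proof -
  have "(\<lambda>x. F (\<phi> s x z)) integrable_on {s..t}"
    using assms by (intro integrable_continuous_interval continuous_on_subset[OF flow_F_cont]) auto
  then have "integral {s..t} (\<lambda>r. F (\<phi> s r z)) = integral {s..r} (\<lambda>r. F (\<phi> s r z)) + integral {r..t} (\<lambda>r. F (\<phi> s r z))"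
    using assms by (intro Henstock_Kurzweil_Integration.integral_combine[symmetric]) auto
  then show "\<phi> s t z - \<phi> s r z = integral {r..t} (\<lambda>u. F (\<phi> s u z)) + complex_of_real (U t - U r)"
    using flow_eq[of s z t] flow_eq[of s z r] assms by simp
  show "cmod (integral {r..t} (\<lambda>u. F (\<phi> s u z))) \<le> C * (t - r)"
    by (rule integral_bound)
       (use assms in \<open>auto intro!: continuous_on_subset[OF flow_F_cont] F_bound flow_in_H\<close>)
qed

lemma flow_increment_bound:
  assumes "0 \<le> s" "s \<le> r" "r \<le> t" "0 < Im z"
  shows "cmod (\<phi> s t z - \<phi> s r z) \<le> C * (t - r) + \<bar>U t - U r\<bar>"
  unfolding flow_increment(1)[OF assms]
  using flow_increment(2)[OF assms] norm_triangle_ineq[of "integral {r..t} (\<lambda>u. F (\<phi> s u z))" "complex_of_real (U t - U r)"]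
    norm_of_real[of "U t - U r", where 'a = complex]
  by linarith

definition logderiv :: "real \<Rightarrow> real \<Rightarrow> complex \<Rightarrow> complex" where
  "logderiv s t z = integral {s..t} (\<lambda>r. deriv F (\<phi> s r z))"

text \<open>Variation of constants. The driving path cancels in the difference \<open>D\<close> of
  two trajectories, and the factor exp(-E) removes the linear part of its equation, so that only the
  Taylor remainder of F is left in the derivative of \<open>q\<close>. In the exponent 6, squaring
  the Lipschitz bound for \<open>D\<close> accounts for 4, exp(-E) and exp(E) for 1 each.\<close>

lemma flow_taylor:
  assumes s: "0 \<le> s" "s \<le> t" and y: "0 < y" "y \<le> Im z" "y \<le> Im w"
  shows "cmod (\<phi> s t w - \<phi> s t z - (w - z) * exp (logderiv s t z))
      \<le> 4 * K2 y * (t - s) * exp (6 * K1 y * (t - s)) * cmod (w - z) ^ 2"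
proof -
  have z: "0 < Im z" and w: "0 < Im w" using y by auto
  define D where "D r = \<phi> s r w - \<phi> s r z" for r
  define E where "E r = logderiv s r z" for r
  define q where "q r = D r * exp (- E r)" for r
  define K where "K = K1 y"
  have K: "0 < K" using K1_pos y by (simp add: K_def)
  have D': "(D has_vector_derivative F (\<phi> s r w) - F (\<phi> s r z)) (at r within {s..})" if "s \<le> r" for r
  proof -
    have "((\<lambda>r. (w + integral {s..r} (\<lambda>r. F (\<phi> s r w))) - (z + integral {s..r} (\<lambda>r. F (\<phi> s r z))))
        has_vector_derivative F (\<phi> s r w) - F (\<phi> s r z)) (at r within {s..})"
      using s z w that
      by (auto intro!: derivative_eq_intros indefinite_integral_has_vector_derivative flow_F_cont)
    then show ?thesis
      by (rule has_vector_derivative_transform[rotated 2])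
         (use that s z w flow_eq in \<open>auto simp: D_def\<close>)
  qed
  have E': "(E has_vector_derivative deriv F (\<phi> s r z)) (at r within {s..})" if "s \<le> r" for r
    unfolding E_def logderiv_def
    using s z that by (intro indefinite_integral_has_vector_derivative flow_dF_cont) auto
  have Ebound: "cmod (E r) \<le> K * (r - s)" if "s \<le> r" for r
    unfolding E_def logderiv_def K_def
  proof (rule integral_bound[OF that])
    show "continuous_on {s..r} (\<lambda>r. deriv F (\<phi> s r z))"
      using s z by (intro continuous_on_subset[OF flow_dF_cont]) auto
    show "cmod (deriv F (\<phi> s u z)) \<le> K1 y" if "u \<in> {s..r}" for u
      using flow_Im_ge[of s z u] that s z y by (intro dF_bound) auto
  qed
  have Dbound: "cmod (D r) \<le> 2 * cmod (w - z) * exp (2 * K * (r - s))" if "s \<le> r" for r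
    unfolding D_def K_def using flow_lipschitz[of s r y w z] that s y by auto
  have q': "(q has_vector_derivative
      (F (\<phi> s r w) - F (\<phi> s r z) - deriv F (\<phi> s r z) * D r) * exp (- E r)) (at r within {s..})" if "s \<le> r" for r
  proof -
    have "((\<lambda>r. exp (- E r)) has_vector_derivative (- deriv F (\<phi> s r z)) * exp (- E r)) (at r within {s..})"
      using field_vector_diff_chain_within[OF has_vector_derivative_minus[OF E'[OF that]]
          has_field_derivative_at_within[OF DERIV_exp]]
      by (simp add: o_def)
    from has_vector_derivative_mult[OF D'[OF that] this] show ?thesis
      unfolding q_def by (rule has_vector_derivative_eq_rhs) (simp add: algebra_simps)
  qed
  define M where "M = 4 * K2 y * cmod (w - z) ^ 2 * exp (5 * K * (t - s))"
  have rhs_bound: "cmod ((F (\<phi> s r w) - F (\<phi> s r z) - deriv F (\<phi> s r z) * D r) * exp (- E r)) \<le> M"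
    if "s \<le> r" "r \<le> t" for r
  proof -
    have "cmod (F (\<phi> s r w) - F (\<phi> s r z) - deriv F (\<phi> s r z) * D r) \<le> K2 y * cmod (D r) ^ 2"
      unfolding D_def using flow_Im_ge[of s z r] flow_Im_ge[of s w r] that s z w y by (intro F_taylor) auto
    also have "\<dots> \<le> K2 y * (2 * cmod (w - z) * exp (2 * K * (r - s))) ^ 2"
      using K2_pos[OF y(1)] Dbound[OF that(1)] by (intro mult_left_mono power_mono) auto
    also have "\<dots> = 4 * K2 y * cmod (w - z) ^ 2 * exp (4 * K * (r - s))"
      by (simp add: power_mult_distrib exp_double[symmetric])
    also have "\<dots> \<le> 4 * K2 y * cmod (w - z) ^ 2 * exp (4 * K * (t - s))"
      using K2_pos[OF y(1)] that K by (intro mult_left_mono) auto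
    finally have 1: "cmod (F (\<phi> s r w) - F (\<phi> s r z) - deriv F (\<phi> s r z) * D r)
        \<le> 4 * K2 y * cmod (w - z) ^ 2 * exp (4 * K * (t - s))" .
    have "Re (- E r) \<le> K * (r - s)" using Ebound[OF that(1)] abs_Re_le_cmod[of "E r"] by simp
    also have "\<dots> \<le> K * (t - s)" using K that by simp
    finally have 2: "cmod (exp (- E r)) \<le> exp (K * (t - s))" by (simp add: norm_exp_eq_Re)
    have "cmod ((F (\<phi> s r w) - F (\<phi> s r z) - deriv F (\<phi> s r z) * D r) * exp (- E r))
        \<le> (4 * K2 y * cmod (w - z) ^ 2 * exp (4 * K * (t - s))) * exp (K * (t - s))"
      unfolding norm_mult using 1 2 K2_pos[OF y(1)] by (intro mult_mono) auto
    also have "\<dots> = M" by (simp add: M_def mult_exp_exp distrib_right[symmetric] flip: mult.assoc)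
    finally show ?thesis .
  qed
  have "cmod (q t - q s) \<le> M * \<bar>t - s\<bar>"
  proof -
    have "(q has_derivative (\<lambda>x. x *\<^sub>R ((F (\<phi> s r w) - F (\<phi> s r z) - deriv F (\<phi> s r z) * D r) * exp (- E r))))
        (at r within {s..t})" if "r \<in> {s..t}" for r
      by (rule has_derivative_subset[OF q'[unfolded has_vector_derivative_def]]) (use that in auto)
    note q'' = this
    have "norm (q t - q s) \<le> M * norm (t - s)"
      by (rule differentiable_bound[where S = "{s..t}" and f' = "\<lambda>r x. x *\<^sub>R ((F (\<phi> s r w) - F (\<phi> s r z) - deriv F (\<phi> s r z) * D r) * exp (- E r))"])
         (use s q'' rhs_bound in \<open>auto simp: onorm_scaleR_left onorm_id\<close>)
    then show ?thesis by simp
  qed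
  moreover have "q s = w - z" using s z w by (simp add: q_def D_def E_def logderiv_def)
  ultimately have qq: "cmod (q t - (w - z)) \<le> M * (t - s)" using s by simp
  have "\<phi> s t w - \<phi> s t z - (w - z) * exp (logderiv s t z) = (q t - (w - z)) * exp (E t)"
    by (simp add: q_def D_def E_def exp_minus algebra_simps)
  also have "cmod \<dots> \<le> (M * (t - s)) * exp (K * (t - s))"
  proof -
    have "Re (E t) \<le> K * (t - s)" using Ebound[OF s(2)] abs_Re_le_cmod[of "E t"] by simp
    then show ?thesis unfolding norm_mult using qq K2_pos[OF y(1)] s by (intro mult_mono) (auto simp: norm_exp_eq_Re M_def)
  qed
  also have "\<dots> = 4 * K2 y * (t - s) * exp (6 * K * (t - s)) * cmod (w - z) ^ 2"
  proof -
    have "exp (6 * K * (t - s)) = exp (5 * K * (t - s)) * exp (K * (t - s))"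
      by (simp add: mult_exp_exp algebra_simps)
    then show ?thesis by (simp add: M_def)
  qed
  finally show ?thesis by (simp add: K_def)
qed

lemma flow_has_field_derivative:
  assumes s: "0 \<le> s" "s \<le> t" and z: "0 < Im z"
  shows "(\<phi> s t has_field_derivative exp (logderiv s t z)) (at z)"
proof -
  define y where "y = Im z / 2"
  define K where "K = 4 * K2 y * (t - s) * exp (6 * K1 y * (t - s))"
  have y: "0 < y" "y \<le> Im z" using z by (auto simp: y_def)
  have K: "0 \<le> K" using s K2_pos[OF y(1)] by (simp add: K_def)
  have "((\<lambda>w. (\<phi> s t w - \<phi> s t z) / (w - z)) \<longlongrightarrow> exp (logderiv s t z)) (at z)"
  proof (rule Lim_null_comparison[THEN Lim_null[THEN iffD2]])
    have "eventually (\<lambda>w. w \<in> {w. y < Im w}) (at z)"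
      by (rule eventually_at_in_open'[OF open_halfspace_Im_gt]) (use z in \<open>auto simp: y_def\<close>)
    then show "\<forall>\<^sub>F w in at z. cmod ((\<phi> s t w - \<phi> s t z) / (w - z) - exp (logderiv s t z)) \<le> K * cmod (w - z)"
      using eventually_neq_at_within[of z z UNIV]
    proof eventually_elim
      case (elim w)
      have "cmod (\<phi> s t w - \<phi> s t z - (w - z) * exp (logderiv s t z)) \<le> K * cmod (w - z) ^ 2"
        unfolding K_def using flow_taylor[OF s y, of w] elim by auto
      moreover have "(\<phi> s t w - \<phi> s t z) / (w - z) - exp (logderiv s t z)
          = (\<phi> s t w - \<phi> s t z - (w - z) * exp (logderiv s t z)) / (w - z)"
        using elim by (simp add: field_simps)
      ultimately show ?case using elim
        by (simp add: norm_divide divide_le_eq power2_eq_square mult.assoc)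
    qed
    show "((\<lambda>w. K * cmod (w - z)) \<longlongrightarrow> 0) (at z)"
      by (auto intro!: tendsto_eq_intros)
  qed
  then show ?thesis by (simp add: has_field_derivative_iff)
qed

lemma deriv_flow: "0 \<le> s \<Longrightarrow> s \<le> t \<Longrightarrow> 0 < Im z \<Longrightarrow> deriv (\<phi> s t) z = exp (logderiv s t z)"
  by (rule DERIV_imp_deriv[OF flow_has_field_derivative])

lemma flow_holomorphic: "0 \<le> s \<Longrightarrow> s \<le> t \<Longrightarrow> \<phi> s t holomorphic_on upper_half_plane"
  by (auto simp: holomorphic_on_def field_differentiable_def
      intro!: exI field_differentiable_at_within DERIV_subset[OF flow_has_field_derivative])

lemma logderiv_combine:
  assumes s: "0 \<le> s" "s \<le> r" "r \<le> t" and z: "0 < Im z"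
  shows "logderiv s t z = logderiv s r z + integral {r..t} (\<lambda>u. deriv F (\<phi> s u z))"
  unfolding logderiv_def
  using assms by (intro Henstock_Kurzweil_Integration.integral_combine[symmetric] integrable_continuous_interval
      continuous_on_subset[OF flow_dF_cont]) auto

lemma logderiv_restart:
  assumes s: "0 \<le> s" "s \<le> r" "r \<le> t" and z: "0 < Im z"
  shows "logderiv r t (\<phi> s r z) = integral {r..t} (\<lambda>u. deriv F (\<phi> s u z))"
  unfolding logderiv_def
  using flow_semigroup[OF s(1,2) _ z] by (intro Henstock_Kurzweil_Integration.integral_cong) auto

text \<open>The chain rule for the flow in logarithmic form. It lets bounds over fixed dyadic
  intervals, uniform in the starting point, serve all earlier starting times s.\<close>

lemma logderiv_split:
  assumes s: "0 \<le> s" "s \<le> r" "r \<le> t" and z: "0 < Im z"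
  shows "logderiv s t z = logderiv s r z + logderiv r t (\<phi> s r z)"
  using logderiv_combine[OF assms] logderiv_restart[OF assms] by simp

lemma logderiv_cont: "0 \<le> s \<Longrightarrow> 0 < Im z \<Longrightarrow> continuous_on {s..} (\<lambda>t. logderiv s t z)"
  unfolding logderiv_def by (intro indefinite_integral_continuous flow_dF_cont)

lemma logderiv_lip:
  assumes s: "0 \<le> s" "s \<le> t" and y: "0 < y" "y \<le> Im z" "y \<le> Im w"
  shows "cmod (logderiv s t z - logderiv s t w) \<le> K2 y * (2 * cmod (z - w) * exp (2 * K1 y * (t - s))) * (t - s)"
proof -
  have z: "0 < Im z" and w: "0 < Im w" using y by auto
  have c: "continuous_on {s..t} (\<lambda>r. deriv F (\<phi> s r v))" if "0 < Im v" for v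
    using s that by (intro continuous_on_subset[OF flow_dF_cont]) auto
  have "logderiv s t z - logderiv s t w = integral {s..t} (\<lambda>r. deriv F (\<phi> s r z) - deriv F (\<phi> s r w))"
    unfolding logderiv_def
    by (intro Henstock_Kurzweil_Integration.integral_diff[symmetric] integrable_continuous_interval c z w)
  also have "cmod \<dots> \<le> K2 y * (2 * cmod (z - w) * exp (2 * K1 y * (t - s))) * (t - s)"
  proof (rule integral_bound[OF s(2)])
    show "continuous_on {s..t} (\<lambda>r. deriv F (\<phi> s r z) - deriv F (\<phi> s r w))"
      by (intro continuous_intros c z w)
    fix r assume r: "r \<in> {s..t}"
    have "cmod (deriv F (\<phi> s r z) - deriv F (\<phi> s r w)) \<le> K2 y * cmod (\<phi> s r z - \<phi> s r w)"
      using flow_Im_ge[of s z r] flow_Im_ge[of s w r] r s z w y by (intro dF_lip) auto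
    also have "cmod (\<phi> s r z - \<phi> s r w) \<le> 2 * cmod (z - w) * exp (2 * K1 y * (r - s))"
      using r s y by (intro flow_lipschitz) auto
    also have "\<dots> \<le> 2 * cmod (z - w) * exp (2 * K1 y * (t - s))"
      using r K1_pos[OF y(1)] by (intro mult_left_mono) auto
    finally show "cmod (deriv F (\<phi> s r z) - deriv F (\<phi> s r w)) \<le> K2 y * (2 * cmod (z - w) * exp (2 * K1 y * (t - s)))"
      using K2_pos[OF y(1)] by auto
  qed
  finally show ?thesis .
qed

text \<open>Only continuity in the open half plane, with constants that depend on the height; it is
  what carries grid estimates over to all points.\<close>

lemma logderiv_cont_space: "0 \<le> s \<Longrightarrow> s \<le> t \<Longrightarrow> continuous_on upper_half_plane (logderiv s t)"
proof (rule continuous_at_imp_continuous_on, intro ballI)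
  fix z assume s: "0 \<le> s" "s \<le> t" and "z \<in> upper_half_plane"
  then have z: "0 < Im z" by simp
  define y where "y = Im z / 2"
  define K where "K = K2 y * (2 * exp (2 * K1 y * (t - s))) * (t - s)"
  have "((\<lambda>w. logderiv s t w - logderiv s t z) \<longlongrightarrow> 0) (at z)"
  proof (rule Lim_null_comparison)
    have "eventually (\<lambda>w. w \<in> {w. y < Im w}) (at z)"
      by (rule eventually_at_in_open'[OF open_halfspace_Im_gt]) (use z in \<open>auto simp: y_def\<close>)
    then show "\<forall>\<^sub>F w in at z. cmod (logderiv s t w - logderiv s t z) \<le> K * cmod (w - z)"
    proof eventually_elim
      case (elim w)
      then show ?case using logderiv_lip[OF s, of y w z] z by (auto simp: y_def K_def mult_ac)
    qed
    show "((\<lambda>w. K * cmod (w - z)) \<longlongrightarrow> 0) (at z)"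
      by (auto intro!: tendsto_eq_intros)
  qed
  then show "isCont (logderiv s t) z" by (simp add: isCont_def Lim_null[symmetric])
qed

end

section \<open>Uniform partitions, the Euler scheme and Ito's formula along a path\<close>

lemma integral_uniform_partition:
  fixes g :: "real \<Rightarrow> complex"
  assumes "0 \<le> h" "continuous_on {s..s + real n * h} g"
  shows "integral {s..s + real n * h} g = (\<Sum>k<n. integral {s + real k * h..s + real (Suc k) * h} g)"
  using assms(2)
proof (induction n)
  case (Suc n)
  have le: "s \<le> s + real n * h" "s + real n * h \<le> s + real (Suc n) * h"
    using assms(1) by (auto simp: algebra_simps)
  have "integral {s..s + real (Suc n) * h} g
      = integral {s..s + real n * h} g + integral {s + real n * h..s + real (Suc n) * h} g"
    using le Suc.prems
    by (intro Henstock_Kurzweil_Integration.integral_combine[symmetric] integrable_continuous_interval) auto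
  moreover have "continuous_on {s..s + real n * h} g"
    using le by (intro continuous_on_subset[OF Suc.prems]) auto
  ultimately show ?case using Suc.IH by simp
qed simp

lemma mesh_tendsto_zero:
  fixes N :: "nat \<Rightarrow> nat"
  assumes "filterlim N at_top sequentially"
  shows "(\<lambda>j. c / real (N j)) \<longlonglongrightarrow> 0"
  by (rule tendsto_divide_0[OF tendsto_const filterlim_at_top_imp_at_infinity[OF
        filterlim_compose[OF filterlim_real_sequentially assms]]])

lemma uniform_partition_oscillation:
  fixes f :: "real \<Rightarrow> 'b::metric_space" and N :: "nat \<Rightarrow> nat"
  assumes "continuous_on {s..t} f" "s \<le> t" "filterlim N at_top sequentially" "\<And>j. 0 < N j" "0 < e"
  shows "\<forall>\<^sub>F j in sequentially. \<forall>k<N j. \<forall>r\<in>{s + real k * ((t - s) / real (N j))..s + real (Suc k) * ((t - s) / real (N j))}.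
    r \<in> {s..t} \<and> dist (f r) (f (s + real k * ((t - s) / real (N j)))) < e"
proof -
  have "uniformly_continuous_on {s..t} f"
    using assms by (intro compact_uniformly_continuous) auto
  then obtain d where d: "0 < d" "\<And>x x'. x \<in> {s..t} \<Longrightarrow> x' \<in> {s..t} \<Longrightarrow> dist x' x < d \<Longrightarrow> dist (f x') (f x) < e"
    using \<open>0 < e\<close> unfolding uniformly_continuous_on_def by meson
  have "\<forall>\<^sub>F j in sequentially. (t - s) / real (N j) < d"
    using mesh_tendsto_zero[OF assms(3)] d(1) by (rule order_tendstoD)
  then show ?thesis
  proof eventually_elim
    case (elim j)
    define h where "h = (t - s) / real (N j)"
    have h: "0 \<le> h" "real (N j) * h = t - s" using assms(2) assms(4)[of j] by (auto simp: h_def)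
    show ?case
      unfolding h_def[symmetric]
    proof (intro allI impI ballI)
      fix k r assume k: "k < N j" and r: "r \<in> {s + real k * h..s + real (Suc k) * h}"
      have "real (Suc k) * h \<le> real (N j) * h" using k h by (intro mult_right_mono) auto
      moreover have "0 \<le> real k * h" using h by simp
      moreover have "real (Suc k) * h = real k * h + h" by (simp add: algebra_simps)
      moreover have "s + real k * h \<le> r" "r \<le> s + real (Suc k) * h" "h < d" using r elim by (auto simp: h_def)
      ultimately have "s \<le> r" "r \<le> t" "\<bar>r - (s + real k * h)\<bar> < d" "s \<le> s + real k * h" "s + real k * h \<le> t"
        using h by linarith+
      then show "r \<in> {s..t} \<and> dist (f r) (f (s + real k * h)) < e"
        by (auto intro!: d(2) simp: dist_real_def)
    qed
  qed
qed

text \<open>Only \<open>f\<close> is sampled; \<open>g\<close> is integrated exactly over each cell.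
  With g = 1 this is an ordinary Riemann sum, with g = F(Z) it handles the drift part of the
  increments of Z.\<close>

lemma riemann_sum_product:
  fixes f g :: "real \<Rightarrow> complex" and N :: "nat \<Rightarrow> nat"
  assumes f: "continuous_on {s..t} f" and g: "continuous_on {s..t} g" and st: "s \<le> t"
    and N: "filterlim N at_top sequentially" "\<And>j. 0 < N j"
  defines "h \<equiv> \<lambda>j. (t - s) / real (N j)"
  shows "(\<lambda>j. \<Sum>k<N j. f (s + real k * h j) * integral {s + real k * h j..s + real (Suc k) * h j} g)
    \<longlonglongrightarrow> integral {s..t} (\<lambda>r. f r * g r)"
proof -
  obtain b where b: "0 < b" "\<And>r. r \<in> {s..t} \<Longrightarrow> cmod (g r) \<le> b"
    using compact_imp_bounded[OF compact_continuous_image[OF g]] unfolding bounded_pos by auto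
  have h: "0 \<le> h j" "real (N j) * h j = t - s" for j using st N(2)[of j] by (auto simp: h_def)
  show ?thesis
  proof (rule metric_LIMSEQ_I)
    fix e :: real assume e: "0 < e"
    \<comment> \<open>Makes the total error e' b (t - s) less than e; the summand 1 allows s =
      t.\<close>
    define e' where "e' = e / (2 * b * (t - s + 1))"
    have e': "0 < e'" using e b st by (simp add: e'_def)
    have "\<forall>\<^sub>F j in sequentially. dist (\<Sum>k<N j. f (s + real k * h j) * integral {s + real k * h j..s + real (Suc k) * h j} g)
        (integral {s..t} (\<lambda>r. f r * g r)) < e"
      using uniform_partition_oscillation[OF f st N e']
    proof eventually_elim
      case (elim j)
      let ?I = "\<lambda>k. {s + real k * h j..s + real (Suc k) * h j}"
      have sub: "?I k \<subseteq> {s..t}" if "k < N j" for k using elim that unfolding h_def by blast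
      have "integral {s..t} (\<lambda>r. f r * g r) = (\<Sum>k<N j. integral (?I k) (\<lambda>r. f r * g r))"
        using integral_uniform_partition[OF h(1), of s "N j" j "\<lambda>r. f r * g r"] f g
        by (simp add: h(2) continuous_on_mult)
      then have "dist (\<Sum>k<N j. f (s + real k * h j) * integral (?I k) g) (integral {s..t} (\<lambda>r. f r * g r))
          = cmod (\<Sum>k<N j. f (s + real k * h j) * integral (?I k) g - integral (?I k) (\<lambda>r. f r * g r))"
        by (simp add: dist_norm sum_subtractf)
      also have "\<dots> \<le> (\<Sum>k<N j. e' * b * h j)"
      proof (rule sum_norm_le)
        fix k assume "k \<in> {..<N j}"
        then have k: "k < N j" by simp
        have fk: "continuous_on (?I k) f" and gk: "continuous_on (?I k) g"
          using sub[OF k] f g by (auto intro: continuous_on_subset)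
        have "f (s + real k * h j) * integral (?I k) g - integral (?I k) (\<lambda>r. f r * g r)
            = integral (?I k) (\<lambda>r. (f (s + real k * h j) - f r) * g r)"
          using fk gk
          by (simp add: left_diff_distrib Henstock_Kurzweil_Integration.integral_diff
              integrable_continuous_interval continuous_intros)
        also have "cmod \<dots> \<le> e' * b * (s + real (Suc k) * h j - (s + real k * h j))"
        proof (rule integral_bound)
          show "s + real k * h j \<le> s + real (Suc k) * h j" using h(1)[of j] by (simp add: algebra_simps)
          show "continuous_on (?I k) (\<lambda>r. (f (s + real k * h j) - f r) * g r)"
            by (intro continuous_intros fk gk)
          fix r assume r: "r \<in> ?I k"
          then have "dist (f r) (f (s + real k * h j)) < e'" "cmod (g r) \<le> b"
            using elim k b(2) sub[OF k] unfolding h_def by blast+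
          then show "cmod ((f (s + real k * h j) - f r) * g r) \<le> e' * b"
            unfolding norm_mult using e' by (intro mult_mono) (auto simp: dist_norm norm_minus_commute)
        qed
        finally show "cmod (f (s + real k * h j) * integral (?I k) g - integral (?I k) (\<lambda>r. f r * g r)) \<le> e' * b * h j"
          by (simp add: algebra_simps)
      qed
      also have "\<dots> = e' * b * (t - s)" using h(2)[of j] by (simp add: mult_ac)
      also have "\<dots> < e"
      proof -
        have "e / (2 * b * (w + 1)) * b * w = e * (w / (2 * (w + 1)))" if "0 \<le> w" for w :: real
        proof -
          have "2 * b * (w + 1) \<noteq> 0" "2 * (w + 1) \<noteq> 0" using b that by auto
          then show ?thesis by (simp add: divide_simps)
        qed
        from this[of "t - s"] have "e' * b * (t - s) = e * ((t - s) / (2 * (t - s + 1)))" using st by (simp add: e'_def)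
        also have "\<dots> < e * 1" using e st by (intro mult_strict_left_mono) (auto simp: divide_less_eq)
        finally show ?thesis by simp
      qed
      finally show ?case .
    qed
    then show "\<exists>no. \<forall>n\<ge>no. dist (\<Sum>k<N n. f (s + real k * h n) * integral {s + real k * h n..s + real (Suc k) * h n} g)
        (integral {s..t} (\<lambda>r. f r * g r)) < e"
      unfolding eventually_sequentially .
  qed
qed

text \<open>The scheme serves measurability: at a fixed time it exhibits the solution as a limit of
  explicit functions of finitely many values of the path.\<close>

primrec euler :: "(complex \<Rightarrow> complex) \<Rightarrow> (real \<Rightarrow> real) \<Rightarrow> real \<Rightarrow> real \<Rightarrow> complex \<Rightarrow> nat \<Rightarrow> complex" where
  "euler F U s h z 0 = z"
| "euler F U s h z (Suc k) = euler F U s h z k + h *\<^sub>R F (euler F U s h z k)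
     + complex_of_real (U (s + real (Suc k) * h) - U (s + real k * h))"

context holomorphic_drift
begin

lemma euler_Im_ge:
  assumes "0 \<le> h" "0 < Im z"
  shows "Im z \<le> Im (euler F U s h z k)"
proof (induction k)
  case (Suc k)
  then have "0 \<le> Im (F (euler F U s h z k))"
    using assms by (intro less_imp_le[OF F_in]) auto
  then show ?case using Suc assms by (auto intro!: order_trans[OF Suc])
qed simp

end

context driven_flow
begin

lemma flow_cont_on: "0 \<le> s \<Longrightarrow> 0 < Im z \<Longrightarrow> continuous_on {s..t} (\<lambda>t. \<phi> s t z)"
  by (rule continuous_on_subset[OF flow_cont]) auto

text \<open>Scheme and flow share the noise, so the error satisfies e_(k+1) <= (1 + L h) e_k + L h
  e', where e' bounds the oscillation of the trajectory over a step. This is solved by e' ((1 + L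
  h)^k - 1), which stays below e' exp(L(t - s)).\<close>

lemma euler_tendsto_flow:
  assumes s: "0 \<le> s" "s \<le> t" and z: "0 < Im z"
  shows "(\<lambda>n. euler F U s ((t - s) / real (Suc n)) z (Suc n)) \<longlonglongrightarrow> \<phi> s t z"
proof -
  define y where "y = Im z"
  define L where "L = K1 y"
  define h where "h n = (t - s) / real (Suc n)" for n
  have y: "0 < y" and L: "0 < L" using z K1_pos by (auto simp: y_def L_def)
  have h: "0 \<le> h n" "real (Suc n) * h n = t - s" for n using s by (auto simp: h_def)
  have dom: "y \<le> Im (\<phi> s r z)" if "s \<le> r" for r using flow_Im_ge s z that by (simp add: y_def)
  show ?thesis
  proof (rule metric_LIMSEQ_I)
    fix e :: real assume e: "0 < e"
    define e' where "e' = e / exp (L * (t - s))"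
    have e': "0 < e'" using e by (simp add: e'_def)
    have "\<forall>\<^sub>F n in sequentially. dist (euler F U s (h n) z (Suc n)) (\<phi> s t z) < e"
      using uniform_partition_oscillation[OF flow_cont_on[OF s(1) z, of t] s(2) filterlim_Suc zero_less_Suc e']
    proof eventually_elim
      case (elim n)
      have "cmod (euler F U s (h n) z k - \<phi> s (s + real k * h n) z) \<le> e' * ((1 + L * h n) ^ k - 1)"
        if "k \<le> Suc n" for k using that
      proof (induction k)
        case 0 then show ?case using s z by simp
      next
        case (Suc k)
        let ?a = "s + real k * h n" and ?b = "s + real (Suc k) * h n"
        let ?E = "euler F U s (h n) z k"
        have ab: "s \<le> ?a" "?a \<le> ?b" "?b - ?a = h n" using h(1)[of n] by (auto simp: algebra_simps)
        have osc: "cmod (\<phi> s r z - \<phi> s ?a z) \<le> e'" if "r \<in> {?a..?b}" for r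
        proof -
          have "k < Suc n" using Suc.prems by simp
          from elim[rule_format, folded h_def, OF this that] show ?thesis by (simp add: dist_norm)
        qed
        have c: "continuous_on {?a..?b} (\<lambda>r. F (\<phi> s r z))"
          using ab s z by (intro continuous_on_subset[OF flow_F_cont]) auto
        have "integral {?a..?b} (\<lambda>r. F (\<phi> s r z) - F ?E) = integral {?a..?b} (\<lambda>r. F (\<phi> s r z)) - h n *\<^sub>R F ?E"
          using c ab by (simp add: Henstock_Kurzweil_Integration.integral_diff integrable_continuous_interval)
        then have "euler F U s (h n) z (Suc k) - \<phi> s ?b z
            = (?E - \<phi> s ?a z) - integral {?a..?b} (\<lambda>r. F (\<phi> s r z) - F ?E)"
          using flow_increment(1)[of s ?a ?b z] s ab z by (simp add: algebra_simps)
        then have "cmod (euler F U s (h n) z (Suc k) - \<phi> s ?b z)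
            \<le> cmod (?E - \<phi> s ?a z) + cmod (integral {?a..?b} (\<lambda>r. F (\<phi> s r z) - F ?E))"
          by (simp only: norm_triangle_ineq4)
        also have "cmod (integral {?a..?b} (\<lambda>r. F (\<phi> s r z) - F ?E)) \<le> L * (e' + cmod (?E - \<phi> s ?a z)) * (?b - ?a)"
        proof (rule integral_bound[OF ab(2)])
          show "continuous_on {?a..?b} (\<lambda>r. F (\<phi> s r z) - F ?E)" by (intro continuous_intros c)
          fix r assume r: "r \<in> {?a..?b}"
          have "cmod (F (\<phi> s r z) - F ?E) \<le> L * cmod (\<phi> s r z - ?E)"
          proof -
            have "?a \<le> r" using r by simp
            from order_trans[OF ab(1) this] show ?thesis
              unfolding L_def using dom euler_Im_ge[OF h(1) z] by (intro F_lip y) (auto simp: y_def)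
          qed
          also have "cmod (\<phi> s r z - ?E) \<le> e' + cmod (?E - \<phi> s ?a z)"
            using osc[OF r] norm_triangle_ineq[of "\<phi> s r z - \<phi> s ?a z" "\<phi> s ?a z - ?E"]
            by (simp add: norm_minus_commute)
          finally show "cmod (F (\<phi> s r z) - F ?E) \<le> L * (e' + cmod (?E - \<phi> s ?a z))"
            using L by simp
        qed
        also have "cmod (?E - \<phi> s ?a z) + L * (e' + cmod (?E - \<phi> s ?a z)) * (?b - ?a)
            = cmod (?E - \<phi> s ?a z) * (1 + L * h n) + L * h n * e'"
          unfolding ab(3) by (simp add: algebra_simps)
        also have "\<dots> \<le> e' * ((1 + L * h n) ^ k - 1) * (1 + L * h n) + L * h n * e'"
          using Suc.IH Suc.prems L h(1)[of n] by (intro add_right_mono mult_right_mono) auto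
        also have "\<dots> = e' * ((1 + L * h n) ^ Suc k - 1)" by (simp add: algebra_simps)
        finally show ?case by simp
      qed
      from this[OF order_refl] have "cmod (euler F U s (h n) z (Suc n) - \<phi> s t z) \<le> e' * ((1 + L * h n) ^ Suc n - 1)"
        unfolding h(2) by simp
      also have "\<dots> < e' * exp (L * (t - s))"
      proof -
        have "(1 + L * h n) ^ Suc n \<le> exp (L * h n) ^ Suc n"
          using L h(1)[of n] exp_ge_add_one_self[of "L * h n"] by (intro power_mono) auto
        also have "\<dots> = exp (L * (t - s))"
        proof -
          have "real (Suc n) * (L * h n) = L * (real (Suc n) * h n)" by simp
          then show ?thesis unfolding h(2) by (simp only: exp_of_nat_mult[symmetric])
        qed
        finally show ?thesis using e' by simp
      qed
      finally show ?case by (simp add: dist_norm e'_def)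
    qed
    then show "\<exists>no. \<forall>n\<ge>no. dist (euler F U s ((t - s) / real (Suc n)) z (Suc n)) (\<phi> s t z) < e"
      unfolding eventually_sequentially h_def .
  qed
qed

text \<open>Ito's formula for the primitive \<^term>\<open>G\<close> of \<^term>\<open>F\<close>. The only properties of a Brownian path that
  enter are the two quadratic variation limits.\<close>

lemma ito_limit:
  fixes N :: "nat \<Rightarrow> nat"
  assumes s: "0 \<le> s" "s \<le> t" and z: "0 < Im z"
    and N: "filterlim N at_top sequentially" "\<And>j. 0 < N j"
  defines "h \<equiv> \<lambda>j. (t - s) / real (N j)"
  defines "\<tau> \<equiv> \<lambda>j k. s + real k * h j"
  defines "\<xi> \<equiv> \<lambda>j k. U (\<tau> j (Suc k)) - U (\<tau> j k)"
  assumes qv: "(\<lambda>j. \<Sum>k<N j. (\<xi> j k)\<^sup>2 - h j) \<longlonglongrightarrow> 0"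
    and qvF: "(\<lambda>j. \<Sum>k<N j. deriv F (\<phi> s (\<tau> j k) z) * complex_of_real ((\<xi> j k)\<^sup>2 - h j)) \<longlonglongrightarrow> 0"
  shows "(\<lambda>j. \<Sum>k<N j. F (\<phi> s (\<tau> j k) z) * complex_of_real (\<xi> j k))
    \<longlonglongrightarrow> G (\<phi> s t z) - G z - integral {s..t} (\<lambda>r. (F (\<phi> s r z))\<^sup>2) - logderiv s t z / 2"
proof -
  define y where "y = Im z"
  have y: "0 < y" using z by (simp add: y_def)
  define Z where "Z r = \<phi> s r z" for r
  have Zy: "y \<le> Im (Z r)" and ZH: "0 < Im (Z r)" if "s \<le> r" for r
    using flow_Im_ge flow_in_H s z that by (auto simp: y_def Z_def)
  have h: "0 \<le> h j" "real (N j) * h j = t - s" for j using s N(2)[of j] by (auto simp: h_def)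
  have \<tau>_ge: "s \<le> \<tau> j k" and \<tau>_Suc: "\<tau> j (Suc k) = \<tau> j k + h j" for j k
    using h(1)[of j] by (auto simp: \<tau>_def algebra_simps)
  define a where "a j k = integral {\<tau> j k..\<tau> j (Suc k)} (\<lambda>r. F (Z r))" for j k
  have dZ: "Z (\<tau> j (Suc k)) - Z (\<tau> j k) = a j k + complex_of_real (\<xi> j k)"
    and a: "cmod (a j k) \<le> C * h j" for j k
    using flow_increment[of s "\<tau> j k" "\<tau> j (Suc k)" z] s z \<tau>_ge[of j k] \<tau>_Suc[of j k] h(1)[of j]
    by (auto simp: Z_def a_def \<xi>_def)
  \<comment> \<open>The drift part \<open>a\<close> is of order h and the noise \<xi> typically of
    order sqrt h, so in the second-order Taylor term of \<open>G\<close> only \<xi>^2 is kept and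
    \<open>err\<close> collects the rest. Up to constants it is at most the size d of the increment
    times h + \<xi>^2, and such sums vanish in the limit.\<close>
  define err where "err j k = G (Z (\<tau> j (Suc k))) - G (Z (\<tau> j k)) - F (Z (\<tau> j k)) * (a j k + complex_of_real (\<xi> j k))
     - deriv F (Z (\<tau> j k)) * complex_of_real ((\<xi> j k)\<^sup>2) / 2" for j k
  have err: "cmod (err j k) \<le> d * (K1 y * C * h j + 2 * K2 y * (C\<^sup>2 * (h j)\<^sup>2 + (\<xi> j k)\<^sup>2))"
    if d: "C * h j + \<bar>\<xi> j k\<bar> \<le> d" for j k d
  proof -
    let ?x = "complex_of_real (\<xi> j k)" and ?d = "deriv F (Z (\<tau> j k))"
    have dd: "cmod ?d \<le> K1 y" using Zy \<tau>_ge y by (intro dF_bound) auto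
    have n1: "cmod (a j k + ?x) \<le> C * h j + \<bar>\<xi> j k\<bar>"
      using norm_triangle_ineq[of "a j k" ?x] a[of j k] by simp
    have "err j k = (G (Z (\<tau> j (Suc k))) - G (Z (\<tau> j k)) - F (Z (\<tau> j k)) * (a j k + ?x) - ?d * (a j k + ?x)\<^sup>2 / 2)
       + ?d * (a j k * (a j k + 2 * ?x)) / 2"
      unfolding err_def by (simp add: power2_eq_square algebra_simps add_divide_distrib)
    then have e1: "cmod (err j k) \<le> cmod (G (Z (\<tau> j (Suc k))) - G (Z (\<tau> j k)) - F (Z (\<tau> j k)) * (a j k + ?x) - ?d * (a j k + ?x)\<^sup>2 / 2)
       + cmod (?d * (a j k * (a j k + 2 * ?x)) / 2)" by (metis norm_triangle_ineq)
    have e2: "cmod (G (Z (\<tau> j (Suc k))) - G (Z (\<tau> j k)) - F (Z (\<tau> j k)) * (a j k + ?x) - ?d * (a j k + ?x)\<^sup>2 / 2)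
       \<le> K2 y * cmod (a j k + ?x) ^ 3"
      using G_taylor[OF y Zy[OF \<tau>_ge[of j k]] Zy[OF \<tau>_ge[of j "Suc k"]]] by (simp only: dZ)
    have e3: "K2 y * cmod (a j k + ?x) ^ 3 \<le> K2 y * (d * (2 * (C\<^sup>2 * (h j)\<^sup>2 + (\<xi> j k)\<^sup>2)))"
    proof (rule mult_left_mono)
      have "cmod (a j k + ?x) ^ 3 = cmod (a j k + ?x) * (cmod (a j k + ?x))\<^sup>2"
        by (simp add: power3_eq_cube power2_eq_square)
      also have "\<dots> \<le> d * (C * h j + \<bar>\<xi> j k\<bar>)\<^sup>2"
        using n1 d norm_ge_zero[of "a j k + ?x"] by (intro mult_mono power_mono) (auto simp del: norm_ge_zero)
      also have "(C * h j + \<bar>\<xi> j k\<bar>)\<^sup>2 \<le> 2 * (C\<^sup>2 * (h j)\<^sup>2 + (\<xi> j k)\<^sup>2)"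
        using sum_squares_ge_zero[of "C * h j - \<bar>\<xi> j k\<bar>" 0]
        by (simp add: power2_eq_square algebra_simps)
      finally show "cmod (a j k + ?x) ^ 3 \<le> d * (2 * (C\<^sup>2 * (h j)\<^sup>2 + (\<xi> j k)\<^sup>2))"
        using n1 d norm_ge_zero[of "a j k + ?x"] by (smt (verit) mult_left_mono)
    qed (use K2_pos[OF y] in simp)
    have e4: "cmod (?d * (a j k * (a j k + 2 * ?x)) / 2) \<le> K1 y * (C * h j * (2 * d)) / 2"
    proof -
      have "cmod (a j k + 2 * ?x) \<le> C * h j + 2 * \<bar>\<xi> j k\<bar>"
        using norm_triangle_ineq[of "a j k" "2 * ?x"] a[of j k] by (simp add: norm_mult)
      also have "\<dots> \<le> 2 * d" using d h(1)[of j] C_ge by (smt (verit) mult_nonneg_nonneg)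
      finally have "cmod ?d * (cmod (a j k) * cmod (a j k + 2 * ?x)) \<le> K1 y * (C * h j * (2 * d))"
        using dd a[of j k] K1_pos[OF y] C_ge h(1)[of j] by (intro mult_mono) auto
      then show ?thesis by (simp add: norm_mult norm_divide)
    qed
    from e1 e2 e3 e4 show ?thesis by (simp add: algebra_simps)
  qed
  have cont: "continuous_on {s..t} (\<lambda>r. F (Z r))" "continuous_on {s..t} (\<lambda>r. deriv F (Z r))"
    using s z unfolding Z_def by (auto intro!: continuous_on_subset[OF flow_F_cont] continuous_on_subset[OF flow_dF_cont])
  have err_lim: "(\<lambda>j. \<Sum>k<N j. err j k) \<longlonglongrightarrow> 0"
  proof (rule metric_LIMSEQ_I)
    fix e :: real assume e: "0 < e"
    \<comment> \<open>Bounds the sum of the brackets in the estimate of \<open>err\<close>: the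
      steps h add up to t - s, and by \<open>qv\<close> the squares of \<xi> eventually to at most t
      - s + 1.\<close>
    define b where "b = K1 y * C * (t - s) + 2 * K2 y * (C\<^sup>2 * (t - s) + (t - s) + 1) + 1"
    have b: "0 < b" using s K1_pos[OF y] K2_pos[OF y] C_ge unfolding b_def
      by (intro add_nonneg_pos add_nonneg_nonneg mult_nonneg_nonneg) auto
    define d where "d = e / (2 * b)"
    have d: "0 < d" using e b by (simp add: d_def)
    have cU: "continuous_on {s..t} U" using s by (intro continuous_on_subset[OF contU]) auto
    have "0 < d / 2" using d by simp
    from uniform_partition_oscillation[OF cU s(2) N this]
    have ev1: "\<forall>\<^sub>F j in sequentially. \<forall>k<N j. \<bar>\<xi> j k\<bar> \<le> d / 2"
    proof eventually_elim
      case (elim j)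
      show ?case
      proof (intro allI impI)
        fix k assume "k < N j"
        then have "\<tau> j (Suc k) \<in> {\<tau> j k..\<tau> j (Suc k)}" using \<tau>_Suc[of j k] h(1)[of j] by simp
        from elim[rule_format, OF \<open>k < N j\<close> this[unfolded \<tau>_def h_def]]
        have "dist (U (\<tau> j (Suc k))) (U (\<tau> j k)) < d / 2" unfolding \<tau>_def h_def by blast
        then show "\<bar>\<xi> j k\<bar> \<le> d / 2" by (simp add: \<xi>_def dist_real_def)
      qed
    qed
    have h0: "h \<longlonglongrightarrow> 0" unfolding h_def by (rule mesh_tendsto_zero[OF N(1)])
    have ev2: "\<forall>\<^sub>F j in sequentially. C * h j < d / 2"
      using tendsto_mult_left[OF h0, of C] d by (intro order_tendstoD) auto
    have ev3: "\<forall>\<^sub>F j in sequentially. h j < 1" using h0 by (rule order_tendstoD) simp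
    have ev4: "\<forall>\<^sub>F j in sequentially. (\<Sum>k<N j. (\<xi> j k)\<^sup>2 - h j) < 1" using qv by (rule order_tendstoD) simp
    have "\<forall>\<^sub>F j in sequentially. dist (\<Sum>k<N j. err j k) 0 < e"
      using ev1 ev2 ev3 ev4
    proof eventually_elim
      case (elim j)
      have "cmod (\<Sum>k<N j. err j k) \<le> (\<Sum>k<N j. d * (K1 y * C * h j + 2 * K2 y * (C\<^sup>2 * (h j)\<^sup>2 + (\<xi> j k)\<^sup>2)))"
      proof (rule sum_norm_le)
        fix k assume "k \<in> {..<N j}"
        then have "\<bar>\<xi> j k\<bar> \<le> d / 2" using elim(1) by auto
        with elim(2) show "cmod (err j k) \<le> d * (K1 y * C * h j + 2 * K2 y * (C\<^sup>2 * (h j)\<^sup>2 + (\<xi> j k)\<^sup>2))"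
          by (intro err) linarith
      qed
      also have "\<dots> = d * (K1 y * C * (real (N j) * h j) + 2 * K2 y * (C\<^sup>2 * (real (N j) * h j) * h j + (\<Sum>k<N j. (\<xi> j k)\<^sup>2)))"
        by (simp add: sum.distrib sum_distrib_left power2_eq_square algebra_simps)
      also have "\<dots> \<le> d * (K1 y * C * (t - s) + 2 * K2 y * (C\<^sup>2 * (t - s) + (t - s + 1)))"
      proof (intro mult_left_mono add_mono)
        show "C\<^sup>2 * (real (N j) * h j) * h j \<le> C\<^sup>2 * (t - s)"
          unfolding h(2) using elim(3) h(1)[of j] s by (intro mult_left_le) auto
        show "(\<Sum>k<N j. (\<xi> j k)\<^sup>2) \<le> t - s + 1"
          using elim(4) h(2)[of j] by (simp add: sum_subtractf)
      qed (use d K1_pos[OF y] K2_pos[OF y] C_ge h(2)[of j] in auto)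
      also have "\<dots> \<le> d * b" using d by (simp add: b_def add.assoc)
      also have "\<dots> < e" using e b by (simp add: d_def)
      finally show ?case by simp
    qed
    then show "\<exists>no. \<forall>n\<ge>no. dist (\<Sum>k<N n. err n k) 0 < e" unfolding eventually_sequentially .
  qed
  have lim1: "(\<lambda>j. \<Sum>k<N j. F (Z (\<tau> j k)) * a j k) \<longlonglongrightarrow> integral {s..t} (\<lambda>r. (F (Z r))\<^sup>2)"
    using riemann_sum_product[OF cont(1) cont(1) s(2) N]
    by (simp add: a_def \<tau>_def h_def power2_eq_square)
  have lim2: "(\<lambda>j. \<Sum>k<N j. deriv F (Z (\<tau> j k)) * complex_of_real (h j)) \<longlonglongrightarrow> logderiv s t z"
  proof -
    have "integral {\<tau> j k..\<tau> j (Suc k)} (\<lambda>_. 1) = complex_of_real (h j)" for j k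
      using h(1)[of j] \<tau>_Suc[of j k] by (simp add: scaleR_conv_of_real)
    then show ?thesis
      using riemann_sum_product[OF cont(2) continuous_on_const[of _ 1] s(2) N]
      by (simp add: \<tau>_def h_def logderiv_def Z_def)
  qed
  \<comment> \<open>Telescoping in \<open>G\<close>, with F dZ split into drift and noise and
    \<xi>^2 into (\<xi>^2 - h) + h. The last summand produces the Riemann sum of F', that is, the
    Ito correction.\<close>
  have tele: "(\<Sum>k<N j. F (Z (\<tau> j k)) * complex_of_real (\<xi> j k))
      = G (Z t) - G z - (\<Sum>k<N j. F (Z (\<tau> j k)) * a j k)
        - (\<Sum>k<N j. deriv F (Z (\<tau> j k)) * complex_of_real ((\<xi> j k)\<^sup>2 - h j)) / 2
        - (\<Sum>k<N j. deriv F (Z (\<tau> j k)) * complex_of_real (h j)) / 2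
        - (\<Sum>k<N j. err j k)" for j
  proof -
    have "(\<Sum>k<N j. G (Z (\<tau> j (Suc k))) - G (Z (\<tau> j k))) = G (Z (\<tau> j (N j))) - G (Z (\<tau> j 0))"
      by (rule sum_lessThan_telescope)
    also have "\<dots> = G (Z t) - G z" using h(2)[of j] s z by (simp add: \<tau>_def Z_def)
    finally have "G (Z t) - G z = (\<Sum>k<N j. F (Z (\<tau> j k)) * complex_of_real (\<xi> j k) + F (Z (\<tau> j k)) * a j k
        + deriv F (Z (\<tau> j k)) * complex_of_real ((\<xi> j k)\<^sup>2 - h j) / 2
        + deriv F (Z (\<tau> j k)) * complex_of_real (h j) / 2 + err j k)"
      by (simp add: err_def algebra_simps diff_divide_distrib)
    then show ?thesis by (simp add: sum.distrib sum_divide_distrib)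
  qed
  have "(\<lambda>j. G (Z t) - G z - (\<Sum>k<N j. F (Z (\<tau> j k)) * a j k)
        - (\<Sum>k<N j. deriv F (Z (\<tau> j k)) * complex_of_real ((\<xi> j k)\<^sup>2 - h j)) / 2
        - (\<Sum>k<N j. deriv F (Z (\<tau> j k)) * complex_of_real (h j)) / 2
        - (\<Sum>k<N j. err j k)) \<longlonglongrightarrow> G (Z t) - G z - integral {s..t} (\<lambda>r. (F (Z r))\<^sup>2) - 0 / 2 - logderiv s t z / 2 - 0"
    using qvF unfolding Z_def[symmetric]
    by (intro tendsto_intros lim1 lim2 err_lim) auto
  then show ?thesis unfolding tele[symmetric] by (simp add: Z_def)
qed

end

section \<open>Martingale transforms of Brownian increments\<close>

abbreviation gauss :: "real \<Rightarrow> real measure" where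
  "gauss h \<equiv> density lborel (\<lambda>x. ennreal (normal_density 0 (sqrt h) x))"

text \<open>The moment of order 2i of the standard normal law, also known as the double factorial
  (2i - 1)!!.\<close>

definition gauss_moment :: "nat \<Rightarrow> real" where
  "gauss_moment i = fact (2 * i) / (2 ^ i * fact i)"

lemma gauss_moment_nonneg: "0 \<le> gauss_moment i"
  by (simp add: gauss_moment_def)

lemma nn_integral_gauss:
  assumes "has_bochner_integral lborel (\<lambda>x. normal_density 0 (sqrt h) x * p x) c"
    and "\<And>x. 0 \<le> p x" "p \<in> borel_measurable borel"
  shows "(\<integral>\<^sup>+x. ennreal (p x) \<partial>gauss h) = ennreal c"
proof -
  have "(\<integral>\<^sup>+x. ennreal (p x) \<partial>gauss h) = (\<integral>\<^sup>+x. ennreal (normal_density 0 (sqrt h) x) * ennreal (p x) \<partial>lborel)"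
    using assms(3) by (intro nn_integral_density) auto
  also have "\<dots> = (\<integral>\<^sup>+x. ennreal (normal_density 0 (sqrt h) x * p x) \<partial>lborel)"
    using assms(2) by (simp add: ennreal_mult)
  also have "\<dots> = ennreal c"
    using assms(1,2) by (subst nn_integral_eq_integral) (auto simp: has_bochner_integral_iff)
  finally show ?thesis .
qed

lemma prob_space_gauss: "0 < h \<Longrightarrow> prob_space (gauss h)"
  by (rule prob_space_normal_density) simp

text \<open>Completing the square turns the tilted density into a multiple of a shifted normal
  density, which has total mass 1.\<close>

lemma gauss_exp:
  assumes "0 < h"
  shows "(\<integral>\<^sup>+x. ennreal (exp (c * x)) \<partial>gauss h) = ennreal (exp (c\<^sup>2 * h / 2))"
proof (rule nn_integral_gauss)
  have "normal_density 0 (sqrt h) x * exp (c * x) = exp (c\<^sup>2 * h / 2) * normal_density (c * h) (sqrt h) x" for x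
  proof -
    have "- (x - 0)\<^sup>2 / (2 * (sqrt h)\<^sup>2) + c * x = c\<^sup>2 * h / 2 + - (x - c * h)\<^sup>2 / (2 * (sqrt h)\<^sup>2)"
      using assms by (simp add: field_simps power2_eq_square)
    then have "exp (- (x - 0)\<^sup>2 / (2 * (sqrt h)\<^sup>2)) * exp (c * x)
        = exp (c\<^sup>2 * h / 2) * exp (- (x - c * h)\<^sup>2 / (2 * (sqrt h)\<^sup>2))"
      unfolding exp_add[symmetric] by (rule arg_cong)
    then show ?thesis unfolding normal_density_def by (simp add: algebra_simps)
  qed
  moreover have "has_bochner_integral lborel (\<lambda>x. exp (c\<^sup>2 * h / 2) * normal_density (c * h) (sqrt h) x) (exp (c\<^sup>2 * h / 2) * 1)"
    using assms by (intro has_bochner_integral_mult_right) (auto simp: has_bochner_integral_iff)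
  ultimately show "has_bochner_integral lborel (\<lambda>x. normal_density 0 (sqrt h) x * exp (c * x)) (exp (c\<^sup>2 * h / 2))"
    by simp
qed auto

lemma gauss_power:
  assumes "0 < h"
  shows "has_bochner_integral lborel (\<lambda>x. normal_density 0 (sqrt h) x * x ^ j)
    (if even j then gauss_moment (j div 2) * h ^ (j div 2) else 0)"
proof (cases "even j")
  case True
  then obtain k where k: "j = 2 * k" by blast
  have "fact (2 * k) / ((2 / (sqrt h)\<^sup>2) ^ k * fact k) = gauss_moment k * h ^ k"
    using assms by (simp add: gauss_moment_def power_divide)
  then show ?thesis using normal_moment_even[of "sqrt h" 0 k] assms k by simp
next
  case False
  then obtain k where k: "j = 2 * k + 1" by (rule oddE)
  then show ?thesis using normal_moment_odd[of "sqrt h" 0 k] assms by simp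
qed

text \<open>Dominates the coefficients in the binomial expansion of E(a + bX)^(2m) for a centred
  normal X. For odd j the true moment is 0 and the formula overestimates it.\<close>

definition burkholder_const :: "nat \<Rightarrow> real" where
  "burkholder_const m = (\<Sum>j\<le>2 * m. real (2 * m choose j) * gauss_moment (j div 2))"

lemma burkholder_const_nonneg: "0 \<le> burkholder_const m"
  unfolding burkholder_const_def by (intro sum_nonneg mult_nonneg_nonneg gauss_moment_nonneg) auto

text \<open>Young's inequality with weights adapted to \<open>n\<close> steps of length \<open>h\<close>, so that iterating it \<open>n\<close> times costs
  only a constant factor.\<close>

lemma young_step:
  fixes a b h :: real and n :: nat
  assumes "1 \<le> i" "i \<le> m" "0 < h" "1 \<le> n"
  shows "b ^ (2 * i) * h ^ i * a ^ (2 * m - 2 * i) \<le> a ^ (2 * m) / real n + real n ^ (m - 1) * h ^ m * b ^ (2 * m)"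
proof -
  define P where "P = a\<^sup>2"
  define Q where "Q = real n * b\<^sup>2 * h"
  have PQ: "0 \<le> P" "0 \<le> Q" using assms by (auto simp: P_def Q_def)
  have n: "1 \<le> real n" using assms by simp
  have "P ^ (m - i) * Q ^ i \<le> max P Q ^ (m - i) * max P Q ^ i"
    using PQ by (intro mult_mono power_mono) auto
  also have "\<dots> = max P Q ^ m" using assms by (simp flip: power_add)
  also have "\<dots> \<le> P ^ m + Q ^ m" using PQ by (auto simp: max_def)
  finally have 1: "P ^ (m - i) * Q ^ i \<le> P ^ m + Q ^ m" .
  have "b ^ (2 * i) * h ^ i * a ^ (2 * m - 2 * i) = P ^ (m - i) * Q ^ i / real n ^ i"
    using n by (simp add: P_def Q_def power_mult_distrib power_mult[symmetric] diff_mult_distrib2)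
  also have "\<dots> \<le> (P ^ m + Q ^ m) / real n ^ i" using 1 n by (intro divide_right_mono) auto
  also have "\<dots> \<le> (P ^ m + Q ^ m) / real n"
    using n assms PQ power_increasing[of 1 i "real n"] by (intro divide_left_mono) auto
  also have "\<dots> = a ^ (2 * m) / real n + real n ^ (m - 1) * h ^ m * b ^ (2 * m)"
  proof -
    have "real n ^ m = real n ^ (m - 1) * real n" using assms by (metis le_trans power_minus_mult less_eq_Suc_le One_nat_def)
    then show ?thesis using n by (simp add: P_def Q_def power_mult_distrib power_mult[symmetric] add_divide_distrib)
  qed
  finally show ?thesis .
qed

text \<open>The term j = 0 is a^(2m) with coefficient exactly 1, and j = 1 vanishes because the
  increment is centred. Every other nonzero term has a factor h, which \<open>young_step\<close>
  trades for 1/n; this is how the martingale property enters the moment bounds.\<close>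

lemma gauss_even_step:
  fixes a b h :: real and n :: nat
  assumes h: "0 < h" and n: "1 \<le> n" and m: "1 \<le> m"
  shows "(\<integral>\<^sup>+x. ennreal ((a + b * x) ^ (2 * m)) \<partial>gauss h)
    \<le> ennreal ((1 + burkholder_const m / real n) * a ^ (2 * m) + burkholder_const m * real n ^ (m - 1) * h ^ m * b ^ (2 * m))"
proof -
  define \<mu> where "\<mu> j = (if even j then gauss_moment (j div 2) * h ^ (j div 2) else 0)" for j
  define T where "T j = real (2 * m choose j) * (b ^ j * \<mu> j * a ^ (2 * m - j))" for j
  have "has_bochner_integral lborel (\<lambda>x. normal_density 0 (sqrt h) x * (a + b * x) ^ (2 * m)) (\<Sum>j\<le>2 * m. T j)"
  proof -
    have "has_bochner_integral lborel
        (\<lambda>x. \<Sum>j\<le>2 * m. real (2 * m choose j) * b ^ j * a ^ (2 * m - j) * (normal_density 0 (sqrt h) x * x ^ j))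
        (\<Sum>j\<le>2 * m. real (2 * m choose j) * b ^ j * a ^ (2 * m - j) * \<mu> j)"
      unfolding \<mu>_def by (intro has_bochner_integral_sum has_bochner_integral_mult_right gauss_power h)
    moreover have "normal_density 0 (sqrt h) x * (a + b * x) ^ (2 * m)
        = (\<Sum>j\<le>2 * m. real (2 * m choose j) * b ^ j * a ^ (2 * m - j) * (normal_density 0 (sqrt h) x * x ^ j))" for x
      unfolding add.commute[of a] binomial_ring[of "b * x" a "2 * m"]
      by (simp add: sum_distrib_left power_mult_distrib mult_ac)
    ultimately show ?thesis by (simp add: T_def mult_ac)
  qed
  then have "(\<integral>\<^sup>+x. ennreal ((a + b * x) ^ (2 * m)) \<partial>gauss h) = ennreal (\<Sum>j\<le>2 * m. T j)"
    by (rule nn_integral_gauss) (auto simp: zero_le_even_power)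
  moreover have "(\<Sum>j\<le>2 * m. T j) \<le> (1 + burkholder_const m / real n) * a ^ (2 * m) + burkholder_const m * real n ^ (m - 1) * h ^ m * b ^ (2 * m)"
  proof -
    define R where "R = a ^ (2 * m) / real n + real n ^ (m - 1) * h ^ m * b ^ (2 * m)"
    have R: "0 \<le> R" using h n by (auto simp: R_def zero_le_even_power)
    have Tj: "T j \<le> real (2 * m choose j) * gauss_moment (j div 2) * R" if j: "j \<in> {1..2 * m}" for j
    proof (cases "even j")
      case True
      then obtain i where i: "j = 2 * i" by blast
      then have "b ^ (2 * i) * h ^ i * a ^ (2 * m - 2 * i) \<le> R"
        unfolding R_def using j h n by (intro young_step) auto
      then have "real (2 * m choose j) * gauss_moment i * (b ^ (2 * i) * h ^ i * a ^ (2 * m - 2 * i))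
          \<le> real (2 * m choose j) * gauss_moment i * R"
        by (intro mult_left_mono) (auto simp: gauss_moment_nonneg)
      then show ?thesis by (simp add: T_def \<mu>_def i mult_ac)
    next
      case False
      then show ?thesis using R by (simp add: T_def \<mu>_def gauss_moment_nonneg)
    qed
    have "(\<Sum>j\<le>2 * m. T j) = T 0 + (\<Sum>j\<in>{1..2 * m}. T j)"
    proof -
      have "{..2 * m} = insert 0 {1..2 * m}" by auto
      then show ?thesis by simp
    qed
    also have "T 0 = a ^ (2 * m)" by (simp add: T_def \<mu>_def gauss_moment_def)
    also have "(\<Sum>j\<in>{1..2 * m}. T j) \<le> (\<Sum>j\<in>{1..2 * m}. real (2 * m choose j) * gauss_moment (j div 2) * R)"
      by (intro sum_mono Tj)
    also have "\<dots> \<le> (\<Sum>j\<le>2 * m. real (2 * m choose j) * gauss_moment (j div 2) * R)"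
      by (intro sum_mono2) (auto simp: gauss_moment_nonneg R)
    also have "\<dots> = burkholder_const m * R"
      by (simp add: burkholder_const_def sum_distrib_right)
    finally show ?thesis by (simp add: R_def algebra_simps)
  qed
  ultimately show ?thesis by (simp add: ennreal_leI)
qed

text \<open>x^2 - h is centred with variance 2 h^2, so the cross term disappears.\<close>

lemma gauss_square_step:
  fixes a b h :: real
  assumes h: "0 < h"
  shows "(\<integral>\<^sup>+x. ennreal ((a + b * (x\<^sup>2 - h))\<^sup>2) \<partial>gauss h) = ennreal (a\<^sup>2 + 2 * b\<^sup>2 * h\<^sup>2)"
proof (rule nn_integral_gauss)
  have p4: "has_bochner_integral lborel (\<lambda>x. normal_density 0 (sqrt h) x * x ^ 4) (3 * h\<^sup>2)"
    using gauss_power[OF h, of 4] by (simp add: gauss_moment_def fact_numeral)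
  have p2: "has_bochner_integral lborel (\<lambda>x. normal_density 0 (sqrt h) x * x\<^sup>2) h"
    using gauss_power[OF h, of 2] by (simp add: gauss_moment_def fact_numeral)
  have p0: "has_bochner_integral lborel (\<lambda>x. normal_density 0 (sqrt h) x) 1"
    using gauss_power[OF h, of 0] by (simp add: gauss_moment_def)
  have "has_bochner_integral lborel
      (\<lambda>x. b\<^sup>2 * (normal_density 0 (sqrt h) x * x ^ 4) + (2 * a * b - 2 * b\<^sup>2 * h) * (normal_density 0 (sqrt h) x * x\<^sup>2)
        + (a - b * h)\<^sup>2 * normal_density 0 (sqrt h) x)
      (b\<^sup>2 * (3 * h\<^sup>2) + (2 * a * b - 2 * b\<^sup>2 * h) * h + (a - b * h)\<^sup>2 * 1)"
    by (intro has_bochner_integral_add has_bochner_integral_mult_right p4 p2 p0)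
  moreover have "b\<^sup>2 * (3 * h\<^sup>2) + (2 * a * b - 2 * b\<^sup>2 * h) * h + (a - b * h)\<^sup>2 * 1 = a\<^sup>2 + 2 * b\<^sup>2 * h\<^sup>2"
    by (simp add: power2_eq_square algebra_simps)
  moreover have "b\<^sup>2 * (normal_density 0 (sqrt h) x * x ^ 4) + (2 * a * b - 2 * b\<^sup>2 * h) * (normal_density 0 (sqrt h) x * x\<^sup>2)
        + (a - b * h)\<^sup>2 * normal_density 0 (sqrt h) x = normal_density 0 (sqrt h) x * (a + b * (x\<^sup>2 - h))\<^sup>2" for x
    by (simp add: power2_eq_square power4_eq_xxxx algebra_simps)
  ultimately show "has_bochner_integral lborel (\<lambda>x. normal_density 0 (sqrt h) x * (a + b * (x\<^sup>2 - h))\<^sup>2) (a\<^sup>2 + 2 * b\<^sup>2 * h\<^sup>2)"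
    by (simp only:)
qed auto

context standard_brownian_motion
begin

lemma increment_measurable [measurable]:
  assumes "0 \<le> s" "s \<le> t"
  shows "(\<lambda>\<omega>. B t \<omega> - B s \<omega>) \<in> borel_measurable (Fil t)"
  using adapted[of t] measurable_from_subalg[OF Fil_mono adapted, of s t] assms
  by (intro borel_measurable_diff) auto

lemma measurable_Fil_M:
  "0 \<le> t \<Longrightarrow> X \<in> measurable (Fil t) N \<Longrightarrow> X \<in> measurable M N"
  by (rule measurable_from_subalg[OF subalgebra_Fil])

lemma measurable_Fil_mono:
  "0 \<le> s \<Longrightarrow> s \<le> t \<Longrightarrow> X \<in> measurable (Fil s) N \<Longrightarrow> X \<in> measurable (Fil t) N"
  by (rule measurable_from_subalg[OF Fil_mono])

text \<open>Stands in for conditional expectation: by independence the joint law of \<open>X\<close>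
  and the next increment is a product measure, and Tonelli's theorem integrates the increment with
  \<open>X\<close> frozen.\<close>

lemma nn_integral_step:
  assumes s: "0 \<le> s" "s < t" and X: "X \<in> measurable (Fil s) N"
    and f: "f \<in> borel_measurable (N \<Otimes>\<^sub>M borel)"
  shows "(\<integral>\<^sup>+\<omega>. f (X \<omega>, B t \<omega> - B s \<omega>) \<partial>M) = (\<integral>\<^sup>+\<omega>. (\<integral>\<^sup>+x. f (X \<omega>, x) \<partial>gauss (t - s)) \<partial>M)"
proof -
  define \<xi> where "\<xi> = (\<lambda>\<omega>. B t \<omega> - B s \<omega>)"
  have XM: "X \<in> measurable M N" using measurable_Fil_M s X by auto
  have \<xi>: "\<xi> \<in> borel_measurable M"
    using measurable_Fil_M[OF _ increment_measurable, of t s] s by (simp add: \<xi>_def)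
  have spF: "space (Fil s) = space M" using subalgebra_Fil[OF s(1)] by (simp add: subalgebra_def)
  have ind: "indep_set (sets (Fil s)) (sets (vimage_algebra (space M) \<xi> borel))"
    using indep_increments[of s t] s by (simp add: \<xi>_def)
  interpret DX: prob_space "distr M N X" by (rule prob_space_distr[OF XM])
  interpret D\<xi>: prob_space "distr M borel \<xi>" by (rule prob_space_distr[OF \<xi>])
  have pair: "distr M N X \<Otimes>\<^sub>M distr M borel \<xi> = distr M (N \<Otimes>\<^sub>M borel) (\<lambda>\<omega>. (X \<omega>, \<xi> \<omega>))"
  proof (rule pair_measure_eqI)
    show "sigma_finite_measure (distr M N X)" "sigma_finite_measure (distr M borel \<xi>)" by unfold_locales
    show "sets (distr M N X \<Otimes>\<^sub>M distr M borel \<xi>) = sets (distr M (N \<Otimes>\<^sub>M borel) (\<lambda>\<omega>. (X \<omega>, \<xi> \<omega>)))"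
      by (simp cong: sets_pair_measure_cong)
    fix P Q assume "P \<in> sets (distr M N X)" "Q \<in> sets (distr M borel \<xi>)"
    then have P: "P \<in> sets N" and Q: "Q \<in> sets borel" by auto
    have XP: "X -` P \<inter> space M \<in> sets (Fil s)" using measurable_sets[OF X P] spF by simp
    have \<xi>Q: "\<xi> -` Q \<inter> space M \<in> sets (vimage_algebra (space M) \<xi> borel)" by (rule in_vimage_algebra[OF Q])
    have "emeasure (distr M (N \<Otimes>\<^sub>M borel) (\<lambda>\<omega>. (X \<omega>, \<xi> \<omega>))) (P \<times> Q)
        = emeasure M ((X -` P \<inter> space M) \<inter> (\<xi> -` Q \<inter> space M))"
      using XM \<xi> P Q by (subst emeasure_distr) (auto intro!: arg_cong[where f = "emeasure M"])
    also have "\<dots> = emeasure M (X -` P \<inter> space M) * emeasure M (\<xi> -` Q \<inter> space M)"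
      using indep_setD[OF ind XP \<xi>Q] by (simp add: emeasure_eq_measure ennreal_mult)
    finally show "emeasure (distr M N X) P * emeasure (distr M borel \<xi>) Q
        = emeasure (distr M (N \<Otimes>\<^sub>M borel) (\<lambda>\<omega>. (X \<omega>, \<xi> \<omega>))) (P \<times> Q)"
      using XM \<xi> P Q by (simp add: emeasure_distr)
  qed
  have dist: "distr M borel \<xi> = gauss (t - s)"
  proof -
    have "distr M lborel \<xi> = gauss (t - s)"
      using normal_increments[of s t] s by (simp add: distributed_def \<xi>_def)
    moreover have "distr M borel \<xi> = distr M lborel \<xi>" by (rule distr_cong) auto
    ultimately show ?thesis by simp
  qed
  interpret G: prob_space "gauss (t - s)" using s by (intro prob_space_gauss) simp
  have f': "f \<in> borel_measurable (distr M N X \<Otimes>\<^sub>M gauss (t - s))"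
  proof -
    have "sets (distr M N X \<Otimes>\<^sub>M gauss (t - s)) = sets (N \<Otimes>\<^sub>M borel)"
      by (rule sets_pair_measure_cong) auto
    then show ?thesis using f measurable_cong_sets by blast
  qed
  have "(\<integral>\<^sup>+\<omega>. f (X \<omega>, \<xi> \<omega>) \<partial>M) = (\<integral>\<^sup>+p. f p \<partial>distr M (N \<Otimes>\<^sub>M borel) (\<lambda>\<omega>. (X \<omega>, \<xi> \<omega>)))"
    using XM \<xi> f by (intro nn_integral_distr[symmetric]) auto
  also have "\<dots> = (\<integral>\<^sup>+p. f p \<partial>(distr M N X \<Otimes>\<^sub>M gauss (t - s)))"
    unfolding pair[symmetric] dist ..
  also have "\<dots> = (\<integral>\<^sup>+a. (\<integral>\<^sup>+x. f (a, x) \<partial>gauss (t - s)) \<partial>distr M N X)"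
    by (rule G.nn_integral_fst[OF f', symmetric])
  also have "\<dots> = (\<integral>\<^sup>+\<omega>. (\<integral>\<^sup>+x. f (X \<omega>, x) \<partial>gauss (t - s)) \<partial>M)"
  proof (rule nn_integral_distr[OF XM])
    show "(\<lambda>a. \<integral>\<^sup>+x. f (a, x) \<partial>gauss (t - s)) \<in> borel_measurable (distr M N X)"
      using f' by (intro G.borel_measurable_nn_integral_fst) auto
  qed
  finally show ?thesis by (simp add: \<xi>_def)
qed

text \<open>For p x = x a discrete stochastic integral; for p x = x^2 - h the weighted deviation of
  the quadratic variation from its mean.\<close>

definition transform_sum :: "(real \<Rightarrow> real) \<Rightarrow> real \<Rightarrow> real \<Rightarrow> (nat \<Rightarrow> 'a \<Rightarrow> real) \<Rightarrow> nat \<Rightarrow> 'a \<Rightarrow> real" where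
  "transform_sum p s h X n \<omega> =
     (\<Sum>k<n. X k \<omega> * p (B (s + real (Suc k) * h) \<omega> - B (s + real k * h) \<omega>))"

lemma transform_sum_measurable:
  assumes "0 \<le> s" "0 \<le> h" "\<And>k. k < n \<Longrightarrow> X k \<in> borel_measurable (Fil (s + real k * h))"
    and p: "p \<in> borel_measurable borel"
  shows "transform_sum p s h X n \<in> borel_measurable (Fil (s + real n * h))"
  unfolding transform_sum_def
proof (intro borel_measurable_sum borel_measurable_times)
  fix k assume "k \<in> {..<n}"
  then have k: "k < n" by simp
  have le: "0 \<le> s + real k * h" "s + real k * h \<le> s + real (Suc k) * h" "s + real (Suc k) * h \<le> s + real n * h"
    using assms(1,2) k by (auto intro!: mult_right_mono add_nonneg_nonneg mult_nonneg_nonneg)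
  show "X k \<in> borel_measurable (Fil (s + real n * h))"
    by (rule measurable_Fil_mono[OF _ _ assms(3)[OF k]]) (use le in auto)
  have "(\<lambda>\<omega>. B (s + real (Suc k) * h) \<omega> - B (s + real k * h) \<omega>) \<in> borel_measurable (Fil (s + real n * h))"
    using increment_measurable[OF le(1,2)] le by (intro measurable_Fil_mono[OF _ le(3)]) auto
  then show "(\<lambda>\<omega>. p (B (s + real (Suc k) * h) \<omega> - B (s + real k * h) \<omega>)) \<in> borel_measurable (Fil (s + real n * h))"
    by (rule measurable_compose[OF _ p])
qed

lemma transform_sum_step:
  assumes s: "0 \<le> s" "0 < h" and X: "\<And>k. k < Suc n \<Longrightarrow> X k \<in> borel_measurable (Fil (s + real k * h))"
    and p: "p \<in> borel_measurable borel" and g: "g \<in> borel_measurable (borel :: real measure)"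
  shows "(\<integral>\<^sup>+\<omega>. g (transform_sum p s h X (Suc n) \<omega>) \<partial>M)
    = (\<integral>\<^sup>+\<omega>. (\<integral>\<^sup>+x. g (transform_sum p s h X n \<omega> + X n \<omega> * p x) \<partial>gauss h) \<partial>M)"
proof -
  let ?Y = "\<lambda>\<omega>. (transform_sum p s h X n \<omega>, X n \<omega>)"
  let ?f = "\<lambda>q. g (fst (fst q) + snd (fst q) * p (snd q))"
  note [measurable] = g p
  have "?Y \<in> measurable (Fil (s + real n * h)) (borel \<Otimes>\<^sub>M borel)"
    using s X p by (intro measurable_Pair transform_sum_measurable) auto
  moreover have "?f \<in> borel_measurable ((borel \<Otimes>\<^sub>M borel) \<Otimes>\<^sub>M borel)"
    by measurable
  ultimately have "(\<integral>\<^sup>+\<omega>. ?f (?Y \<omega>, B (s + real (Suc n) * h) \<omega> - B (s + real n * h) \<omega>) \<partial>M)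
      = (\<integral>\<^sup>+\<omega>. (\<integral>\<^sup>+x. ?f (?Y \<omega>, x) \<partial>gauss (s + real (Suc n) * h - (s + real n * h))) \<partial>M)"
    using s by (intro nn_integral_step) (auto simp: algebra_simps)
  moreover have "s + real (Suc n) * h - (s + real n * h) = h" by (simp add: algebra_simps)
  ultimately show ?thesis by (simp add: transform_sum_def)
qed

text \<open>Integrating the last increment first, with everything earlier frozen, multiplies the
  exponential moment by at most exp(h \<theta>^2 c^2 / 2) per step.\<close>

lemma martingale_transform_exp:
  assumes s: "0 \<le> s" "0 < h" and X: "\<And>k. k < n \<Longrightarrow> X k \<in> borel_measurable (Fil (s + real k * h))"
    and c: "\<And>k \<omega>. k < n \<Longrightarrow> \<omega> \<in> space M \<Longrightarrow> \<bar>X k \<omega>\<bar> \<le> c"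
  shows "(\<integral>\<^sup>+\<omega>. ennreal (exp (\<theta> * transform_sum (\<lambda>x. x) s h X n \<omega>)) \<partial>M) \<le> ennreal (exp (real n * h * \<theta>\<^sup>2 * c\<^sup>2 / 2))"
  using X c
proof (induction n)
  case 0 then show ?case by (simp add: transform_sum_def emeasure_space_1)
next
  case (Suc n)
  let ?S = "transform_sum (\<lambda>x. x) s h X n"
  have Sm: "?S \<in> borel_measurable M"
    using transform_sum_measurable[of s h n X "\<lambda>x. x"] Suc.prems s by (intro measurable_Fil_M[of "s + real n * h"]) auto
  have "(\<integral>\<^sup>+\<omega>. ennreal (exp (\<theta> * transform_sum (\<lambda>x. x) s h X (Suc n) \<omega>)) \<partial>M)
     = (\<integral>\<^sup>+\<omega>. (\<integral>\<^sup>+x. ennreal (exp (\<theta> * (?S \<omega> + X n \<omega> * x))) \<partial>gauss h) \<partial>M)"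
    by (rule transform_sum_step[OF s Suc.prems(1)]) auto
  also have "\<dots> \<le> (\<integral>\<^sup>+\<omega>. ennreal (exp (h * \<theta>\<^sup>2 * c\<^sup>2 / 2)) * ennreal (exp (\<theta> * ?S \<omega>)) \<partial>M)"
  proof (rule nn_integral_mono)
    fix \<omega> assume \<omega>: "\<omega> \<in> space M"
    have "(\<integral>\<^sup>+x. ennreal (exp (\<theta> * (?S \<omega> + X n \<omega> * x))) \<partial>gauss h)
        = (\<integral>\<^sup>+x. ennreal (exp (\<theta> * ?S \<omega>)) * ennreal (exp ((\<theta> * X n \<omega>) * x)) \<partial>gauss h)"
      by (intro nn_integral_cong) (simp add: ennreal_mult[symmetric] mult_exp_exp algebra_simps)
    also have "\<dots> = ennreal (exp (\<theta> * ?S \<omega>)) * ennreal (exp ((\<theta> * X n \<omega>)\<^sup>2 * h / 2))"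
      by (subst nn_integral_cmult) (auto simp: gauss_exp[OF s(2)])
    also have "\<dots> \<le> ennreal (exp (\<theta> * ?S \<omega>)) * ennreal (exp (h * \<theta>\<^sup>2 * c\<^sup>2 / 2))"
    proof (intro mult_left_mono ennreal_leI)
      have "(X n \<omega>)\<^sup>2 \<le> c\<^sup>2" using Suc.prems(2)[of n \<omega>] \<omega> by (simp add: abs_le_square_iff[symmetric])
      then have "(\<theta>\<^sup>2 * h) * (X n \<omega>)\<^sup>2 \<le> (\<theta>\<^sup>2 * h) * c\<^sup>2" using s by (intro mult_left_mono) auto
      then show "exp ((\<theta> * X n \<omega>)\<^sup>2 * h / 2) \<le> exp (h * \<theta>\<^sup>2 * c\<^sup>2 / 2)"
        by (simp add: power_mult_distrib mult_ac)
    qed auto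
    finally show "(\<integral>\<^sup>+x. ennreal (exp (\<theta> * (?S \<omega> + X n \<omega> * x))) \<partial>gauss h)
        \<le> ennreal (exp (h * \<theta>\<^sup>2 * c\<^sup>2 / 2)) * ennreal (exp (\<theta> * ?S \<omega>))" by (simp add: mult.commute)
  qed
  also have "\<dots> = ennreal (exp (h * \<theta>\<^sup>2 * c\<^sup>2 / 2)) * (\<integral>\<^sup>+\<omega>. ennreal (exp (\<theta> * ?S \<omega>)) \<partial>M)"
    using Sm by (intro nn_integral_cmult) auto
  also have "\<dots> \<le> ennreal (exp (h * \<theta>\<^sup>2 * c\<^sup>2 / 2)) * ennreal (exp (real n * h * \<theta>\<^sup>2 * c\<^sup>2 / 2))"
    using Suc.prems by (intro mult_left_mono Suc.IH) auto
  also have "\<dots> = ennreal (exp (real (Suc n) * h * \<theta>\<^sup>2 * c\<^sup>2 / 2))"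
    by (simp add: ennreal_mult[symmetric] mult_exp_exp algebra_simps add_divide_distrib)
  finally show ?case .
qed

text \<open>A discrete Burkholder inequality for even moments. Only moments of the integrand enter,
  which is essential later, where the integrand is a difference F(Z) - F(W) whose smallness is known
  only in mean.\<close>

lemma martingale_transform_moment:
  fixes b :: real
  assumes s: "0 \<le> s" "0 < h" and X: "\<And>k. k < n \<Longrightarrow> X k \<in> borel_measurable (Fil (s + real k * h))"
    and b: "\<And>k. k < n \<Longrightarrow> (\<integral>\<^sup>+\<omega>. ennreal (X k \<omega> ^ (2 * m)) \<partial>M) \<le> ennreal b" "0 \<le> b"
    and m: "1 \<le> m" and n: "1 \<le> n"
  shows "(\<integral>\<^sup>+\<omega>. ennreal (transform_sum (\<lambda>x. x) s h X n \<omega> ^ (2 * m)) \<partial>M)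
    \<le> ennreal (burkholder_const m * exp (burkholder_const m) * (real n * h) ^ m * b)"
proof -
  define c where "c = burkholder_const m"
  \<comment> \<open>A step multiplies the moment by at most 1 + c/n and then adds at most
    \<open>q\<close>. Hence the bound k q (1 + c/n)^k after k steps; after n steps the accumulated
    factor is at most exp(c).\<close>
  define q where "q = c * real n ^ (m - 1) * h ^ m * b"
  have c: "0 \<le> c" by (simp add: c_def burkholder_const_nonneg)
  have q: "0 \<le> q" using c s b by (simp add: q_def)
  have "(\<integral>\<^sup>+\<omega>. ennreal (transform_sum (\<lambda>x. x) s h X k \<omega> ^ (2 * m)) \<partial>M) \<le> ennreal (real k * q * (1 + c / real n) ^ k)"
    if "k \<le> n" for k using that
  proof (induction k)
    case 0 then show ?case using m by (simp add: transform_sum_def)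
  next
    case (Suc k)
    let ?S = "transform_sum (\<lambda>x. x) s h X k"
    have Sm: "?S \<in> borel_measurable M" and Xm: "X k \<in> borel_measurable M"
      using transform_sum_measurable[of s h k X "\<lambda>x. x"] Suc.prems s X
      by (auto intro!: measurable_Fil_M[of "s + real k * h"])
    have "(\<integral>\<^sup>+\<omega>. ennreal (transform_sum (\<lambda>x. x) s h X (Suc k) \<omega> ^ (2 * m)) \<partial>M)
       = (\<integral>\<^sup>+\<omega>. (\<integral>\<^sup>+x. ennreal ((?S \<omega> + X k \<omega> * x) ^ (2 * m)) \<partial>gauss h) \<partial>M)"
      using Suc.prems X by (intro transform_sum_step[OF s]) auto
    also have "\<dots> \<le> (\<integral>\<^sup>+\<omega>. ennreal (1 + c / real n) * ennreal (?S \<omega> ^ (2 * m))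
        + ennreal (c * real n ^ (m - 1) * h ^ m) * ennreal (X k \<omega> ^ (2 * m)) \<partial>M)"
    proof (rule nn_integral_mono)
      fix \<omega>
      have "(\<integral>\<^sup>+x. ennreal ((?S \<omega> + X k \<omega> * x) ^ (2 * m)) \<partial>gauss h)
          \<le> ennreal ((1 + c / real n) * ?S \<omega> ^ (2 * m) + c * real n ^ (m - 1) * h ^ m * X k \<omega> ^ (2 * m))"
        unfolding c_def by (rule gauss_even_step[OF s(2) n m])
      also have "\<dots> = ennreal (1 + c / real n) * ennreal (?S \<omega> ^ (2 * m))
        + ennreal (c * real n ^ (m - 1) * h ^ m) * ennreal (X k \<omega> ^ (2 * m))"
        using c s by (simp add: ennreal_mult[symmetric] ennreal_plus[symmetric] zero_le_even_power del: ennreal_plus)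
      finally show "(\<integral>\<^sup>+x. ennreal ((?S \<omega> + X k \<omega> * x) ^ (2 * m)) \<partial>gauss h) \<le> \<dots>" .
    qed
    also have "\<dots> = ennreal (1 + c / real n) * (\<integral>\<^sup>+\<omega>. ennreal (?S \<omega> ^ (2 * m)) \<partial>M)
        + ennreal (c * real n ^ (m - 1) * h ^ m) * (\<integral>\<^sup>+\<omega>. ennreal (X k \<omega> ^ (2 * m)) \<partial>M)"
      using Sm Xm by (subst nn_integral_add) (auto simp: nn_integral_cmult)
    also have "\<dots> \<le> ennreal (1 + c / real n) * ennreal (real k * q * (1 + c / real n) ^ k)
        + ennreal (c * real n ^ (m - 1) * h ^ m) * ennreal b"
      using Suc b by (intro add_mono mult_left_mono) auto
    also have "\<dots> = ennreal ((1 + c / real n) * (real k * q * (1 + c / real n) ^ k) + q)"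
      using c s b q by (simp add: ennreal_mult[symmetric] ennreal_plus[symmetric] q_def del: ennreal_plus)
    also have "\<dots> \<le> ennreal (real (Suc k) * q * (1 + c / real n) ^ Suc k)"
    proof (rule ennreal_leI)
      have "1 \<le> (1 + c / real n) ^ Suc k" using c by (intro one_le_power) auto
      then have "q * 1 \<le> q * (1 + c / real n) ^ Suc k" using q by (intro mult_left_mono)
      moreover have "real (Suc k) * q * e ^ Suc k = e * (real k * q * e ^ k) + q * e ^ Suc k" for e :: real
        by (simp add: algebra_simps)
      ultimately show "(1 + c / real n) * (real k * q * (1 + c / real n) ^ k) + q \<le> real (Suc k) * q * (1 + c / real n) ^ Suc k"
        by simp
    qed
    finally show ?case .
  qed
  from this[OF order_refl] have "(\<integral>\<^sup>+\<omega>. ennreal (transform_sum (\<lambda>x. x) s h X n \<omega> ^ (2 * m)) \<partial>M)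
      \<le> ennreal (real n * q * (1 + c / real n) ^ n)" .
  also have "\<dots> \<le> ennreal (c * exp c * (real n * h) ^ m * b)"
  proof (rule ennreal_leI)
    have "(1 + c / real n) ^ n \<le> exp (c / real n) ^ n"
      using c exp_ge_add_one_self[of "c / real n"] by (intro power_mono) auto
    also have "\<dots> = exp c" using n by (simp flip: exp_of_nat_mult)
    finally have "real n * q * (1 + c / real n) ^ n \<le> real n * q * exp c"
      using q by (intro mult_left_mono) auto
    moreover have "real n ^ m = real n ^ (m - 1) * real n" using m by (metis power_minus_mult less_eq_Suc_le One_nat_def)
    ultimately show "real n * q * (1 + c / real n) ^ n \<le> c * exp c * (real n * h) ^ m * b"
      by (simp add: q_def power_mult_distrib mult_ac)
  qed
  finally show ?thesis by (simp add: c_def)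
qed

text \<open>The summands are orthogonal, so their variances, at most 2 c^2 h^2 each, add up.\<close>

lemma quadratic_variation_moment:
  assumes s: "0 \<le> s" "0 < h" and X: "\<And>k. k < n \<Longrightarrow> X k \<in> borel_measurable (Fil (s + real k * h))"
    and c: "\<And>k \<omega>. k < n \<Longrightarrow> \<omega> \<in> space M \<Longrightarrow> \<bar>X k \<omega>\<bar> \<le> c"
  shows "(\<integral>\<^sup>+\<omega>. ennreal ((transform_sum (\<lambda>x. x\<^sup>2 - h) s h X n \<omega>)\<^sup>2) \<partial>M) \<le> ennreal (real n * (2 * c\<^sup>2 * h\<^sup>2))"
  using X c
proof (induction n)
  case 0 then show ?case by (simp add: transform_sum_def)
next
  case (Suc n)
  let ?S = "transform_sum (\<lambda>x. x\<^sup>2 - h) s h X n"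
  have Sm: "?S \<in> borel_measurable M"
    using transform_sum_measurable[of s h n X "\<lambda>x. x\<^sup>2 - h"] Suc.prems s by (intro measurable_Fil_M[of "s + real n * h"]) auto
  have "(\<integral>\<^sup>+\<omega>. ennreal ((transform_sum (\<lambda>x. x\<^sup>2 - h) s h X (Suc n) \<omega>)\<^sup>2) \<partial>M)
     = (\<integral>\<^sup>+\<omega>. (\<integral>\<^sup>+x. ennreal ((?S \<omega> + X n \<omega> * (x\<^sup>2 - h))\<^sup>2) \<partial>gauss h) \<partial>M)"
    by (rule transform_sum_step[OF s Suc.prems(1)]) auto
  also have "\<dots> \<le> (\<integral>\<^sup>+\<omega>. ennreal ((?S \<omega>)\<^sup>2) + ennreal (2 * c\<^sup>2 * h\<^sup>2) \<partial>M)"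
  proof (rule nn_integral_mono)
    fix \<omega> assume \<omega>: "\<omega> \<in> space M"
    have "(X n \<omega>)\<^sup>2 \<le> c\<^sup>2" using Suc.prems(2)[of n \<omega>] \<omega> by (simp add: abs_le_square_iff[symmetric])
    then show "(\<integral>\<^sup>+x. ennreal ((?S \<omega> + X n \<omega> * (x\<^sup>2 - h))\<^sup>2) \<partial>gauss h) \<le> ennreal ((?S \<omega>)\<^sup>2) + ennreal (2 * c\<^sup>2 * h\<^sup>2)"
      unfolding gauss_square_step[OF s(2)]
      by (subst ennreal_plus[symmetric]) (auto intro!: ennreal_leI mult_right_mono)
  qed
  also have "\<dots> = (\<integral>\<^sup>+\<omega>. ennreal ((?S \<omega>)\<^sup>2) \<partial>M) + ennreal (2 * c\<^sup>2 * h\<^sup>2)"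
    using Sm by (subst nn_integral_add) (auto simp: emeasure_space_1)
  also have "\<dots> \<le> ennreal (real n * (2 * c\<^sup>2 * h\<^sup>2)) + ennreal (2 * c\<^sup>2 * h\<^sup>2)"
    using Suc.prems by (intro add_right_mono Suc.IH) auto
  also have "\<dots> = ennreal (real (Suc n) * (2 * c\<^sup>2 * h\<^sup>2))"
    by (subst ennreal_plus[symmetric]) (auto simp: algebra_simps)
  finally show ?case .
qed

end

section \<open>Dyadic chaining\<close>

lemma geometric_chain_bound:
  fixes a :: "nat \<Rightarrow> 'b::real_normed_vector"
  assumes step: "\<And>l. m \<le> l \<Longrightarrow> norm (a (Suc l) - a l) \<le> K * q ^ Suc l"
    and lim: "a \<longlonglongrightarrow> b" and q: "0 \<le> q" "q < 1" and K: "0 \<le> K"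
  shows "norm (b - a m) \<le> K * q ^ m * (q / (1 - q))"
proof -
  have part: "norm (a (m + j) - a m) \<le> K * q ^ m * (q / (1 - q))" for j
  proof -
    have "a (m + j) - a m = (\<Sum>i<j. a (m + Suc i) - a (m + i))"
      using sum_lessThan_telescope[of "\<lambda>i. a (m + i)" j] by simp
    also have "norm \<dots> \<le> (\<Sum>i<j. K * q ^ m * q * q ^ i)"
      using step by (intro sum_norm_le) (simp add: power_add mult_ac order_trans[OF step])
    also have "\<dots> = K * q ^ m * q * (\<Sum>i<j. q ^ i)" by (simp add: sum_distrib_left)
    also have "(\<Sum>i<j. q ^ i) \<le> 1 / (1 - q)"
      using q by (simp add: sum_gp_strict divide_right_mono)
    finally show ?thesis using K q by (simp add: mult_left_mono)
  qed
  have "(\<lambda>j. a (m + j)) \<longlonglongrightarrow> b" using LIMSEQ_ignore_initial_segment[OF lim, of m] by (simp add: add.commute)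
  then have "(\<lambda>j. norm (a (m + j) - a m)) \<longlonglongrightarrow> norm (b - a m)"
    by (intro tendsto_intros)
  then show ?thesis by (rule LIMSEQ_le_const2) (use part in auto)
qed

text \<open>Rounding to dyadic level l. Left end points and heights will be rounded up, right end
  points and real parts down, so that the approximating points stay inside the interval and heights
  stay positive.\<close>

definition dfloor :: "nat \<Rightarrow> real \<Rightarrow> real" where "dfloor l x = of_int \<lfloor>2 ^ l * x\<rfloor> / 2 ^ l"
definition dceil :: "nat \<Rightarrow> real \<Rightarrow> real" where "dceil l x = of_int \<lceil>2 ^ l * x\<rceil> / 2 ^ l"

lemma dfloor_bounds: "dfloor l x \<le> x" "x - 1 / 2 ^ l < dfloor l x"
  and dceil_bounds: "x \<le> dceil l x" "dceil l x < x + 1 / 2 ^ l"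
proof -
  have pos: "(0::real) < 2 ^ l" by simp
  show "dfloor l x \<le> x" "x - 1 / 2 ^ l < dfloor l x" "x \<le> dceil l x" "dceil l x < x + 1 / 2 ^ l"
    unfolding dfloor_def dceil_def using pos
    by (simp_all add: divide_le_eq less_divide_eq le_divide_eq divide_less_eq algebra_simps)
       (linarith+)?
qed

lemma inverse_power_two_tendsto: "(\<lambda>l. 1 / 2 ^ l :: real) \<longlonglongrightarrow> 0"
  using LIMSEQ_realpow_zero[of "1 / 2 :: real"] by (simp add: power_one_over)

lemma dfloor_tendsto: "(\<lambda>l. dfloor l x) \<longlonglongrightarrow> x"
proof (rule tendsto_sandwich[OF _ _ _ tendsto_const])
  show "(\<lambda>l. x - 1 / 2 ^ l) \<longlonglongrightarrow> x" using tendsto_diff[OF tendsto_const inverse_power_two_tendsto, of x] by simp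
qed (auto intro!: always_eventually less_imp_le dfloor_bounds)

lemma dceil_tendsto: "(\<lambda>l. dceil l x) \<longlonglongrightarrow> x"
proof (rule tendsto_sandwich[OF _ _ tendsto_const])
  show "(\<lambda>l. x + 1 / 2 ^ l) \<longlonglongrightarrow> x" using tendsto_add[OF tendsto_const inverse_power_two_tendsto, of x] by simp
qed (auto intro!: always_eventually less_imp_le dceil_bounds)

lemma floor_double: "\<lfloor>2 * x\<rfloor> \<in> {2 * \<lfloor>x\<rfloor>, 2 * \<lfloor>x\<rfloor> + 1}" for x :: real
  by auto linarith

lemma ceiling_double: "\<lceil>2 * x\<rceil> \<in> {2 * \<lceil>x\<rceil> - 1, 2 * \<lceil>x\<rceil>}" for x :: real
  by auto linarith

text \<open>Passing to the next level moves the rounded point by at most one step of the finer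
  level, so that chaining involves elementary increments only.\<close>

lemma dfloor_refine:
  obtains i b :: int where "dfloor l x = of_int i / 2 ^ Suc l" "dfloor (Suc l) x = of_int (i + b) / 2 ^ Suc l" "b \<in> {0, 1}"
proof
  have "\<lfloor>2 ^ Suc l * x\<rfloor> \<in> {2 * \<lfloor>2 ^ l * x\<rfloor>, 2 * \<lfloor>2 ^ l * x\<rfloor> + 1}"
    using floor_double[of "2 ^ l * x"] by (simp add: mult.assoc)
  then show "\<lfloor>2 ^ Suc l * x\<rfloor> - 2 * \<lfloor>2 ^ l * x\<rfloor> \<in> {0, 1}" by auto
  show "dfloor l x = of_int (2 * \<lfloor>2 ^ l * x\<rfloor>) / 2 ^ Suc l" by (simp add: dfloor_def)
  show "dfloor (Suc l) x = of_int (2 * \<lfloor>2 ^ l * x\<rfloor> + (\<lfloor>2 ^ Suc l * x\<rfloor> - 2 * \<lfloor>2 ^ l * x\<rfloor>)) / 2 ^ Suc l"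
    by (simp add: dfloor_def)
qed

lemma dceil_refine:
  obtains i b :: int where "dceil l x = of_int i / 2 ^ Suc l" "dceil (Suc l) x = of_int (i - b) / 2 ^ Suc l" "b \<in> {0, 1}"
proof
  have "\<lceil>2 ^ Suc l * x\<rceil> \<in> {2 * \<lceil>2 ^ l * x\<rceil> - 1, 2 * \<lceil>2 ^ l * x\<rceil>}"
    using ceiling_double[of "2 ^ l * x"] by (simp add: mult.assoc)
  then show "2 * \<lceil>2 ^ l * x\<rceil> - \<lceil>2 ^ Suc l * x\<rceil> \<in> {0, 1}" by auto
  show "dceil l x = of_int (2 * \<lceil>2 ^ l * x\<rceil>) / 2 ^ Suc l" by (simp add: dceil_def)
  show "dceil (Suc l) x = of_int (2 * \<lceil>2 ^ l * x\<rceil> - (2 * \<lceil>2 ^ l * x\<rceil> - \<lceil>2 ^ Suc l * x\<rceil>)) / 2 ^ Suc l"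
    by (simp add: dceil_def)
qed

lemma powr_two_bounds:
  assumes "0 < \<epsilon>"
  shows "0 < (2::real) powr - \<epsilon>" "(2::real) powr - \<epsilon> < 1" "((2::real) powr - \<epsilon>) ^ n = (1 / 2 ^ n) powr \<epsilon>"
proof -
  show "0 < (2::real) powr - \<epsilon>" "(2::real) powr - \<epsilon> < 1" using assms by (auto simp: powr_less_one)
  have "((2::real) powr - \<epsilon>) ^ n = 2 powr (- real n * \<epsilon>)" by (simp add: powr_realpow[symmetric] powr_powr mult.commute)
  also have "\<dots> = (2 powr - real n) powr \<epsilon>" by (simp add: powr_powr)
  also have "(2::real) powr - real n = 1 / 2 ^ n" by (simp add: powr_minus powr_realpow divide_inverse)
  finally show "((2::real) powr - \<epsilon>) ^ n = (1 / 2 ^ n) powr \<epsilon>" .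
qed

text \<open>Twice the factor 2/(1 - q), q = 2^(-\<epsilon>), that bounds the geometric series of a
  chain. The extra factor 2 is spent in \<open>grid_holder\<close>; one constant serves both
  chainings.\<close>

definition chain_const :: "real \<Rightarrow> real" where "chain_const \<epsilon> = 4 / (1 - 2 powr - \<epsilon>)"

lemma chain_const_pos: "0 < \<epsilon> \<Longrightarrow> 0 < chain_const \<epsilon>"
  using powr_two_bounds(2)[of \<epsilon>] by (simp add: chain_const_def)

lemma dyadic_scale:
  fixes d :: real
  assumes "0 < d" "d \<le> 1"
  obtains m :: nat where "1 / 2 ^ Suc m < d" "d \<le> 1 / 2 ^ m"
proof -
  have "\<exists>n. 1 / 2 ^ n < d"
    using order_tendstoD(2)[OF inverse_power_two_tendsto assms(1)] by (auto simp: eventually_sequentially)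
  define n where "n = (LEAST n. 1 / 2 ^ n < d)"
  have n: "1 / 2 ^ n < d" unfolding n_def using \<open>\<exists>n. 1 / 2 ^ n < d\<close> by (rule LeastI_ex)
  have "n \<noteq> 0" using n assms(2) by (intro notI) simp
  then obtain m where m: "n = Suc m" by (cases n) auto
  have "\<not> 1 / 2 ^ m < d" using not_less_Least[of m "\<lambda>n. 1 / 2 ^ n < d"] by (simp add: n_def[symmetric] m)
  with n m show thesis by (intro that[of m]) auto
qed

lemma dyadic_steps:
  fixes f :: "real \<Rightarrow> 'b::real_normed_vector" and a b :: real
  assumes inc: "\<And>k. of_int k / 2 ^ m \<in> {a..b} \<Longrightarrow> of_int (k + 1) / 2 ^ m \<in> {a..b} \<Longrightarrow>
      norm (f (of_int (k + 1) / 2 ^ m) - f (of_int k / 2 ^ m)) \<le> K"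
    and "a \<le> of_int k / 2 ^ m" "of_int (k + int j) / 2 ^ m \<le> b"
  shows "norm (f (of_int (k + int j) / 2 ^ m) - f (of_int k / 2 ^ m)) \<le> real j * K"
  using assms(3)
proof (induction j)
  case (Suc j)
  have mono: "of_int i / 2 ^ m \<le> (of_int i' / 2 ^ m :: real)" if "i \<le> i'" for i i' :: int
    using that by (simp add: divide_right_mono)
  have "of_int (k + int j) / 2 ^ m \<le> b" "a \<le> of_int (k + int j) / 2 ^ m" "a \<le> of_int (k + int (Suc j)) / 2 ^ m"
    using Suc.prems assms(2) mono[of "k + int j" "k + int (Suc j)"] mono[of k "k + int j"] mono[of k "k + int (Suc j)"]
    by linarith+
  then have 1: "norm (f (of_int (k + int j) / 2 ^ m) - f (of_int k / 2 ^ m)) \<le> real j * K"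
    and 2: "norm (f (of_int (k + int (Suc j)) / 2 ^ m) - f (of_int (k + int j) / 2 ^ m)) \<le> K"
    using Suc.IH inc[of "k + int j"] Suc.prems by (auto simp: add.assoc add.commute[of 1])
  show ?case
    using norm_triangle_mono[OF 2 1] by (simp add: algebra_simps)
qed simp

text \<open>Chaining from both ends inwards. Increments are assumed only on dyadic intervals inside
  {a..b}, since functions such as t to L(s, t, z) are considered only from an arbitrary time s
  on.\<close>

lemma dyadic_holder:
  fixes f :: "real \<Rightarrow> 'b::real_normed_vector"
  assumes cont: "continuous_on {a..b} f" and \<epsilon>: "0 < \<epsilon>" and K: "0 \<le> K"
    and inc: "\<And>n k. of_int k / 2 ^ n \<in> {a..b} \<Longrightarrow> of_int (k + 1) / 2 ^ n \<in> {a..b} \<Longrightarrow>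
      norm (f (of_int (k + 1) / 2 ^ n) - f (of_int k / 2 ^ n)) \<le> K * (2 powr - \<epsilon>) ^ n"
    and u: "a \<le> u" "u \<le> v" "v \<le> b" "v - u \<le> 1"
  shows "norm (f v - f u) \<le> K * chain_const \<epsilon> * (v - u) powr \<epsilon>"
proof (cases "u = v")
  case True then show ?thesis by simp
next
  case False
  define q where "q = 2 powr - \<epsilon>"
  have q: "0 < q" "q < 1" "\<And>n. q ^ n = (1 / 2 ^ n) powr \<epsilon>" using powr_two_bounds[OF \<epsilon>] by (auto simp: q_def)
  obtain m' where m': "1 / 2 ^ Suc m' < v - u" "v - u \<le> 1 / 2 ^ m'"
    using dyadic_scale[of "v - u"] u False by auto
  \<comment> \<open>One level finer than the scale of v - u: then 2^(-m) < v - u leaves room for a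
    dyadic point of level m between u and v, and the two rounded ends are at most two steps
    apart.\<close>
  define m where "m = Suc m'"
  have m: "1 / 2 ^ m < v - u" "v - u \<le> 2 / 2 ^ m" using m' by (auto simp: m_def)
  have uin: "u \<le> dceil l u" "dceil l u \<le> v" and vin: "u \<le> dfloor l v" "dfloor l v \<le> v" if "m \<le> l" for l
  proof -
    have "(1::real) / 2 ^ l \<le> 1 / 2 ^ m" using that by (intro divide_left_mono power_increasing) auto
    then show "u \<le> dceil l u" "dceil l u \<le> v" "u \<le> dfloor l v" "dfloor l v \<le> v"
      using m dceil_bounds(1)[of u l] dceil_bounds(2)[of l u] dfloor_bounds(1)[of l v] dfloor_bounds(2)[of v l] by linarith+
  qed
  have us: "norm (f (dceil (Suc l) u) - f (dceil l u)) \<le> K * q ^ Suc l" if l: "m \<le> l" for l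
  proof -
    obtain i b' :: int where ib: "dceil l u = of_int i / 2 ^ Suc l" "dceil (Suc l) u = of_int (i - b') / 2 ^ Suc l" "b' \<in> {0, 1}"
      by (rule dceil_refine)
    show ?thesis
    proof (cases "b' = 0")
      case True then show ?thesis using ib K q by simp
    next
      case False
      then have b': "b' = 1" using ib by simp
      show ?thesis
        using inc[of "i - 1" "Suc l"] uin[OF l] uin[of "Suc l"] l u unfolding ib(1,2) b' q_def
        by (auto simp: norm_minus_commute)
    qed
  qed
  have vs: "norm (f (dfloor (Suc l) v) - f (dfloor l v)) \<le> K * q ^ Suc l" if l: "m \<le> l" for l
  proof -
    obtain i b' :: int where ib: "dfloor l v = of_int i / 2 ^ Suc l" "dfloor (Suc l) v = of_int (i + b') / 2 ^ Suc l" "b' \<in> {0, 1}"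
      by (rule dfloor_refine)
    show ?thesis
    proof (cases "b' = 0")
      case True then show ?thesis using ib K q by simp
    next
      case False
      then have b': "b' = 1" using ib by simp
      show ?thesis
        using inc[of i "Suc l"] vin[OF l] vin[of "Suc l"] l u unfolding ib(1,2) b' q_def by auto
    qed
  qed
  have flim: "(\<lambda>l. f (g l)) \<longlonglongrightarrow> f x" if "g \<longlonglongrightarrow> x" "x \<in> {u, v}" "\<And>l. m \<le> l \<Longrightarrow> u \<le> g l" "\<And>l. m \<le> l \<Longrightarrow> g l \<le> v" for g x
  proof (rule continuous_on_tendsto_compose[OF cont that(1)])
    show "x \<in> {a..b}" using that(2) u by auto
    show "\<forall>\<^sub>F l in sequentially. g l \<in> {a..b}"
      unfolding eventually_sequentially using that(3,4) u by (intro exI[of _ m]) force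
  qed
  have 1: "norm (f u - f (dceil m u)) \<le> K * q ^ m * (q / (1 - q))"
    using q K uin by (intro geometric_chain_bound us flim dceil_tendsto) auto
  have 2: "norm (f v - f (dfloor m v)) \<le> K * q ^ m * (q / (1 - q))"
    using q K vin by (intro geometric_chain_bound vs flim dfloor_tendsto) auto
  have 3: "norm (f (dfloor m v) - f (dceil m u)) \<le> K * q ^ m * 2"
  proof -
    define i where "i = \<lceil>2 ^ m * u\<rceil>"
    define j where "j = nat (\<lfloor>2 ^ m * v\<rfloor> - i)"
    have "of_int i / 2 ^ m \<le> v" using uin[of m] by (simp add: dceil_def i_def)
    then have "of_int i \<le> 2 ^ m * v" by (simp add: divide_le_eq mult.commute)
    then have ij: "\<lfloor>2 ^ m * v\<rfloor> = i + int j" by (simp add: j_def le_floor_iff)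
    have "2 ^ m * v - 2 ^ m * u \<le> 2" using m(2) by (simp add: le_divide_eq algebra_simps)
    then have "j \<le> 2" unfolding j_def i_def by linarith
    have "norm (f (of_int (i + int j) / 2 ^ m) - f (of_int i / 2 ^ m)) \<le> real j * (K * q ^ m)"
    proof (rule dyadic_steps[where a = a and b = b])
      show "a \<le> of_int i / 2 ^ m" using uin[of m] u by (simp add: dceil_def i_def)
      show "of_int (i + int j) / 2 ^ m \<le> b" using vin[of m] u by (simp add: dfloor_def ij)
    qed (use inc q_def in auto)
    also have "\<dots> \<le> 2 * (K * q ^ m)" using \<open>j \<le> 2\<close> K q by (intro mult_right_mono) auto
    finally show ?thesis by (simp add: dfloor_def dceil_def ij i_def[symmetric])
  qed
  have "norm (f v - f u) \<le> K * q ^ m * (q / (1 - q)) + K * q ^ m * 2 + K * q ^ m * (q / (1 - q))"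
  proof -
    have "f v - f u = (f v - f (dfloor m v)) + (f (dfloor m v) - f (dceil m u)) - (f u - f (dceil m u))" by simp
    also have "norm \<dots> \<le> norm (f v - f (dfloor m v)) + norm (f (dfloor m v) - f (dceil m u)) + norm (f u - f (dceil m u))"
      by (rule order_trans[OF norm_triangle_ineq4 add_right_mono[OF norm_triangle_ineq]])
    finally show ?thesis using 1 2 3 by linarith
  qed
  also have "\<dots> = K * q ^ m * (2 / (1 - q))"
  proof -
    have "q / (1 - q) + 2 + q / (1 - q) = 2 / (1 - q)" proof -
      have "1 - q \<noteq> 0" using q by simp
      then show ?thesis by (simp add: divide_simps)
    qed
    then show ?thesis by (simp only: distrib_left[symmetric])
  qed
  also have "\<dots> \<le> K * q ^ m * (4 / (1 - q))" using K q by (intro mult_left_mono divide_right_mono) auto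
  also have "\<dots> \<le> K * (v - u) powr \<epsilon> * (4 / (1 - q))"
    unfolding q(3) using K q m \<epsilon> by (intro mult_right_mono mult_left_mono powr_mono2) auto
  finally show ?thesis by (simp add: chain_const_def q_def mult_ac)
qed

text \<open>The box touches the real line without containing it: the flow is defined on it, and a
  constant valid on all of it is uniform up to the boundary.\<close>

definition half_box :: "nat \<Rightarrow> complex set" where
  "half_box N = {z. \<bar>Re z\<bar> \<le> real N \<and> 0 < Im z \<and> Im z \<le> real N}"

definition grid_point :: "nat \<Rightarrow> int \<Rightarrow> int \<Rightarrow> complex" where
  "grid_point l i j = Complex (of_int i / 2 ^ l) (of_int j / 2 ^ l)"

definition grid_round :: "nat \<Rightarrow> complex \<Rightarrow> complex" where
  "grid_round l z = Complex (dfloor l (Re z)) (dceil l (Im z))"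

text \<open>The sides of the box have integer coordinates, hence are grid lines of every level, so
  rounding cannot cross them.\<close>

lemma grid_round_box:
  assumes "z \<in> half_box N"
  shows "grid_round l z \<in> half_box N"
proof -
  have p: "(0::real) < 2 ^ l" by simp
  have N: "\<bar>Re z\<bar> \<le> real N" "0 < Im z" "Im z \<le> real N" using assms by (auto simp: half_box_def)
  have "2 ^ l * (- real N) \<le> 2 ^ l * Re z" using N p by (intro mult_left_mono) auto
  then have "of_int (- (2 ^ l * int N)) \<le> 2 ^ l * Re z" by simp
  then have "- (2 ^ l * int N) \<le> \<lfloor>2 ^ l * Re z\<rfloor>" by (simp only: le_floor_iff)
  then have "real_of_int (- (2 ^ l * int N)) \<le> of_int \<lfloor>2 ^ l * Re z\<rfloor>" by (simp only: of_int_le_iff)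
  then have 1: "- real N \<le> dfloor l (Re z)" by (simp add: dfloor_def le_divide_eq mult.commute)
  have "2 ^ l * Im z \<le> 2 ^ l * real N" using N p by (intro mult_left_mono) auto
  then have "2 ^ l * Im z \<le> of_int (2 ^ l * int N)" by simp
  then have "\<lceil>2 ^ l * Im z\<rceil> \<le> 2 ^ l * int N" by (simp only: ceiling_le_iff)
  then have "real_of_int \<lceil>2 ^ l * Im z\<rceil> \<le> of_int (2 ^ l * int N)" by (simp only: of_int_le_iff)
  then have 2: "dceil l (Im z) \<le> real N" by (simp add: dceil_def divide_le_eq mult.commute)
  show ?thesis
    using 1 2 N dfloor_bounds(1)[of l "Re z"] dceil_bounds(1)[of "Im z" l] by (auto simp: half_box_def grid_round_def)
qed

lemma grid_round_tendsto: "(\<lambda>l. grid_round l z) \<longlonglongrightarrow> z"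
proof -
  have "(\<lambda>l. Complex (dfloor l (Re z)) (dceil l (Im z))) \<longlonglongrightarrow> Complex (Re z) (Im z)"
    by (intro tendsto_Complex dfloor_tendsto dceil_tendsto)
  then show ?thesis by (simp add: grid_round_def)
qed

text \<open>Kolmogorov chaining in the plane. The steps (a, b) include the diagonals because both
  coordinates are rounded at once, independently of each other.\<close>

lemma grid_holder:
  fixes f :: "complex \<Rightarrow> 'b::real_normed_vector"
  assumes cont: "continuous_on upper_half_plane f" and \<eta>: "0 < \<eta>" "\<eta> \<le> 1" and K: "0 \<le> K"
    and inc: "\<And>l i j a b. \<bar>a\<bar> \<le> 1 \<Longrightarrow> \<bar>b\<bar> \<le> 1 \<Longrightarrow> grid_point l i j \<in> half_box N \<Longrightarrow> grid_point l (i + a) (j + b) \<in> half_box N \<Longrightarrow>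
      norm (f (grid_point l (i + a) (j + b)) - f (grid_point l i j)) \<le> K * (2 powr - \<eta>) ^ l"
    and z: "z \<in> half_box N" and w: "w \<in> half_box N" and zw: "cmod (z - w) \<le> 1"
  shows "norm (f z - f w) \<le> K * chain_const \<eta> * cmod (z - w) powr \<eta>"
proof (cases "z = w")
  case True then show ?thesis by simp
next
  case False
  define q where "q = 2 powr - \<eta>"
  have q: "0 < q" "q < 1" "\<And>n. q ^ n = (1 / 2 ^ n) powr \<eta>" using powr_two_bounds[OF \<eta>(1)] by (auto simp: q_def)
  obtain m where m: "1 / 2 ^ Suc m < cmod (z - w)" "cmod (z - w) \<le> 1 / 2 ^ m"
    using dyadic_scale[of "cmod (z - w)"] zw False by auto
  have step: "norm (f (grid_round (Suc l) x) - f (grid_round l x)) \<le> K * q ^ Suc l" if x: "x \<in> half_box N" for l x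
  proof -
    obtain i a :: int where ia: "dfloor l (Re x) = of_int i / 2 ^ Suc l" "dfloor (Suc l) (Re x) = of_int (i + a) / 2 ^ Suc l" "a \<in> {0, 1}"
      by (rule dfloor_refine)
    obtain j b :: int where jb: "dceil l (Im x) = of_int j / 2 ^ Suc l" "dceil (Suc l) (Im x) = of_int (j - b) / 2 ^ Suc l" "b \<in> {0, 1}"
      by (rule dceil_refine)
    have eq: "grid_round l x = grid_point (Suc l) i j" "grid_round (Suc l) x = grid_point (Suc l) (i + a) (j + - b)"
      by (auto simp: grid_round_def grid_point_def ia jb)
    show ?thesis
      unfolding eq q_def using grid_round_box[OF x, of l] grid_round_box[OF x, of "Suc l"] ia(3) jb(3)
      by (intro inc) (auto simp: eq)
  qed
  have lim: "norm (f x - f (grid_round m x)) \<le> K * q ^ m * (q / (1 - q))" if x: "x \<in> half_box N" for x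
  proof (rule geometric_chain_bound[OF step[OF x]])
    show "(\<lambda>l. f (grid_round l x)) \<longlonglongrightarrow> f x"
      by (rule continuous_on_tendsto_compose[OF cont grid_round_tendsto])
         (use x grid_round_box[OF x] in \<open>auto simp: half_box_def\<close>)
  qed (use q K in auto)
  have mid: "norm (f (grid_round m z) - f (grid_round m w)) \<le> K * q ^ m"
  proof -
    define a where "a = \<lfloor>2 ^ m * Re z\<rfloor> - \<lfloor>2 ^ m * Re w\<rfloor>"
    define b where "b = \<lceil>2 ^ m * Im z\<rceil> - \<lceil>2 ^ m * Im w\<rceil>"
    \<comment> \<open>At level m the scaled coordinates differ by at most 1, hence so do their
      floors and ceilings: the rounded points are equal or neighbours.\<close>
    have "2 ^ m * cmod (z - w) \<le> 1" using m(2) by (simp add: le_divide_eq mult.commute)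
    moreover have "2 ^ m * \<bar>Re (z - w)\<bar> \<le> 2 ^ m * cmod (z - w)" "2 ^ m * \<bar>Im (z - w)\<bar> \<le> 2 ^ m * cmod (z - w)"
      by (intro mult_left_mono abs_Re_le_cmod abs_Im_le_cmod; simp)+
    ultimately have "2 ^ m * \<bar>Re (z - w)\<bar> \<le> 1" "2 ^ m * \<bar>Im (z - w)\<bar> \<le> 1" by linarith+
    moreover have "\<bar>2 ^ m * Re z - 2 ^ m * Re w\<bar> = 2 ^ m * \<bar>Re (z - w)\<bar>" "\<bar>2 ^ m * Im z - 2 ^ m * Im w\<bar> = 2 ^ m * \<bar>Im (z - w)\<bar>"
      by (simp_all add: abs_mult flip: right_diff_distrib)
    ultimately have "\<bar>2 ^ m * Re z - 2 ^ m * Re w\<bar> \<le> 1" "\<bar>2 ^ m * Im z - 2 ^ m * Im w\<bar> \<le> 1" by linarith+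
    then have ab: "\<bar>a\<bar> \<le> 1" "\<bar>b\<bar> \<le> 1" unfolding a_def b_def by linarith+
    have eq: "grid_round m w = grid_point m \<lfloor>2 ^ m * Re w\<rfloor> \<lceil>2 ^ m * Im w\<rceil>"
      "grid_round m z = grid_point m (\<lfloor>2 ^ m * Re w\<rfloor> + a) (\<lceil>2 ^ m * Im w\<rceil> + b)"
      by (auto simp: grid_round_def grid_point_def dfloor_def dceil_def a_def b_def)
    show ?thesis
      unfolding eq q_def using grid_round_box[OF z, of m] grid_round_box[OF w, of m] ab by (intro inc) (auto simp: eq)
  qed
  have "f z - f w = (f z - f (grid_round m z)) + (f (grid_round m z) - f (grid_round m w)) - (f w - f (grid_round m w))" by simp
  also have "norm \<dots> \<le> norm (f z - f (grid_round m z)) + norm (f (grid_round m z) - f (grid_round m w)) + norm (f w - f (grid_round m w))"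
    by (rule order_trans[OF norm_triangle_ineq4 add_right_mono[OF norm_triangle_ineq]])
  also have "\<dots> \<le> K * q ^ m * (q / (1 - q)) + K * q ^ m * 1 + K * q ^ m * (q / (1 - q))"
    using lim[OF z] lim[OF w] mid by linarith
  also have "\<dots> = K * q ^ m * ((1 + q) / (1 - q))"
  proof -
    have "q / (1 - q) + 1 + q / (1 - q) = (1 + q) / (1 - q)" proof -
      have "1 - q \<noteq> 0" using q by simp
      then show ?thesis by (simp add: divide_simps)
    qed
    then show ?thesis by (simp only: distrib_left[symmetric])
  qed
  also have "\<dots> \<le> K * q ^ m * (2 / (1 - q))" using K q by (intro mult_left_mono divide_right_mono) auto
  also have "\<dots> \<le> K * (2 * cmod (z - w) powr \<eta>) * (2 / (1 - q))"
  proof -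
    have "(1 / 2 ^ m) powr \<eta> \<le> (2 * cmod (z - w)) powr \<eta>" using m(1) \<eta> by (intro powr_mono2) auto
    also have "\<dots> = 2 powr \<eta> * cmod (z - w) powr \<eta>" by (simp add: powr_mult)
    also have "\<dots> \<le> 2 * cmod (z - w) powr \<eta>" using powr_mono[of \<eta> 1 2] \<eta> by (intro mult_right_mono) auto
    finally show ?thesis using K q unfolding q(3)[symmetric] by (intro mult_right_mono mult_left_mono) auto
  qed
  finally show ?thesis by (simp add: chain_const_def q_def mult_ac)
qed

lemma convex_box: "convex (half_box N)"
proof -
  have "half_box N = {z. Re z \<le> real N} \<inter> {z. Re z \<ge> - real N} \<inter> {z. 0 < Im z} \<inter> {z. Im z \<le> real N}"
    by (auto simp: half_box_def)
  also have "convex \<dots>"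
    by (intro convex_Int convex_halfspace_Re_le convex_halfspace_Re_ge convex_halfspace_Im_gt convex_halfspace_Im_le)
  finally show ?thesis .
qed

section \<open>The random flow\<close>

text \<open>Jensen's inequality for the even power, applied to the average of the
  \<open>x k\<close>.\<close>

lemma power_mean_sum_le:
  fixes x :: "nat \<Rightarrow> real"
  assumes "even p" "0 < n"
  shows "(\<Sum>k<n. x k) ^ p \<le> real n ^ p / real n * (\<Sum>k<n. x k ^ p)"
proof -
  have "(\<Sum>k<n. (1 / real n) *\<^sub>R x k) ^ p \<le> (\<Sum>k<n. (1 / real n) * x k ^ p)"
    by (rule convex_on_sum[OF _ _ convex_power_even[OF assms(1)]]) (use assms in auto)
  then have "(\<Sum>k<n. x k) ^ p / real n ^ p \<le> (\<Sum>k<n. x k ^ p) / real n"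
    by (simp flip: sum_divide_distrib add: power_divide)
  then show ?thesis using assms(2) by (simp add: divide_simps mult_ac)
qed

lemma power_sum2_le:
  fixes a b :: real
  assumes "0 \<le> a" "0 \<le> b"
  shows "(a + b) ^ p \<le> 2 ^ p * (a ^ p + b ^ p)"
proof -
  have "(a + b) ^ p \<le> (2 * max a b) ^ p" using assms by (intro power_mono) auto
  also have "\<dots> \<le> 2 ^ p * (a ^ p + b ^ p)"
    using assms by (auto simp: power_mult_distrib max_def)
  finally show ?thesis .
qed

lemma cmod_power_le:
  "cmod w ^ (2 * m) \<le> 2 ^ (2 * m) * (Re w ^ (2 * m) + Im w ^ (2 * m))"
proof -
  have "cmod w ^ (2 * m) \<le> (\<bar>Re w\<bar> + \<bar>Im w\<bar>) ^ (2 * m)"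
    by (intro power_mono cmod_le) auto
  also have "\<dots> \<le> 2 ^ (2 * m) * (\<bar>Re w\<bar> ^ (2 * m) + \<bar>Im w\<bar> ^ (2 * m))"
    by (intro power_sum2_le) auto
  finally show ?thesis by (simp add: power_even_abs)
qed

lemma Re_Im_power_le:
  "Re w ^ (2 * m) \<le> cmod w ^ (2 * m)" "Im w ^ (2 * m) \<le> cmod w ^ (2 * m)"
  using power_mono[OF abs_Re_le_cmod, of w "2 * m"] power_mono[OF abs_Im_le_cmod, of w "2 * m"]
  by (auto simp: power_even_abs)

text \<open>Carries moment bounds from Riemann sums to their almost sure limits without any uniform
  integrability.\<close>

lemma nn_integral_fatou:
  fixes f :: "nat \<Rightarrow> 'a \<Rightarrow> ennreal"
  assumes "\<And>j. f j \<in> borel_measurable M" "\<And>j. (\<integral>\<^sup>+\<omega>. f j \<omega> \<partial>M) \<le> c"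
    and "AE \<omega> in M. (\<lambda>j. f j \<omega>) \<longlonglongrightarrow> g \<omega>"
  shows "(\<integral>\<^sup>+\<omega>. g \<omega> \<partial>M) \<le> c"
proof -
  have "(\<integral>\<^sup>+\<omega>. g \<omega> \<partial>M) \<le> (\<integral>\<^sup>+\<omega>. liminf (\<lambda>j. f j \<omega>) \<partial>M)"
  proof (rule nn_integral_mono_AE)
    show "AE \<omega> in M. g \<omega> \<le> liminf (\<lambda>j. f j \<omega>)"
      using assms(3) by eventually_elim (simp add: lim_imp_Liminf)
  qed
  also have "\<dots> \<le> liminf (\<lambda>j. \<integral>\<^sup>+\<omega>. f j \<omega> \<partial>M)"
    using assms(1) by (rule nn_integral_liminf)
  also have "\<dots> \<le> c"
    using assms(2) by (intro Liminf_le) auto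
  finally show ?thesis .
qed

text \<open>The series of squares has finite expectation, so it converges almost surely and its
  terms tend to 0.\<close>

lemma AE_tendsto_zero_of_summable_moments:
  fixes X :: "nat \<Rightarrow> 'a \<Rightarrow> real"
  assumes X: "\<And>j. X j \<in> borel_measurable M" and c: "\<And>j. (\<integral>\<^sup>+\<omega>. ennreal ((X j \<omega>)\<^sup>2) \<partial>M) \<le> ennreal (c j)"
    and c0: "\<And>j. 0 \<le> c j" "summable c"
  shows "AE \<omega> in M. (\<lambda>j. X j \<omega>) \<longlonglongrightarrow> 0"
proof -
  have "(\<integral>\<^sup>+\<omega>. (\<Sum>j. ennreal ((X j \<omega>)\<^sup>2)) \<partial>M) = (\<Sum>j. \<integral>\<^sup>+\<omega>. ennreal ((X j \<omega>)\<^sup>2) \<partial>M)"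
    using X by (intro nn_integral_suminf) auto
  also have "\<dots> \<le> (\<Sum>j. ennreal (c j))" by (intro suminf_le c) auto
  also have "\<dots> < \<infinity>" using c0 by (simp add: suminf_ennreal2)
  finally have "AE \<omega> in M. (\<Sum>j. ennreal ((X j \<omega>)\<^sup>2)) \<noteq> \<infinity>"
    using X by (intro nn_integral_PInf_AE) auto
  then show ?thesis
  proof eventually_elim
    case (elim \<omega>)
    then have "summable (\<lambda>j. (X j \<omega>)\<^sup>2)" by (intro summable_suminf_not_top) auto
    then have "(\<lambda>j. sqrt ((X j \<omega>)\<^sup>2)) \<longlonglongrightarrow> sqrt 0"
      by (intro tendsto_real_sqrt summable_LIMSEQ_zero)
    then show ?case by (simp add: tendsto_rabs_zero_iff)
  qed
qed

locale brownian_flow = standard_brownian_motion M Fil B + holomorphic_drift F C A \<alpha>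
  for M :: "'a measure" and Fil :: "real \<Rightarrow> 'a measure" and B :: "real \<Rightarrow> 'a \<Rightarrow> real"
    and F :: "complex \<Rightarrow> complex" and C A \<alpha> :: real
begin

definition continuous_path :: "'a \<Rightarrow> bool" where
  "continuous_path \<omega> \<longleftrightarrow> continuous_on {0..} (\<lambda>t. B t \<omega>)"

lemma AE_continuous_path: "AE \<omega> in M. continuous_path \<omega>"
  using continuous_paths by (simp add: continuous_path_def)

abbreviation path_flow :: "'a \<Rightarrow> real \<Rightarrow> real \<Rightarrow> complex \<Rightarrow> complex" where
  "path_flow \<omega> \<equiv> flow F (\<lambda>t. B t \<omega>)"

abbreviation path_logderiv :: "'a \<Rightarrow> real \<Rightarrow> real \<Rightarrow> complex \<Rightarrow> complex" where
  "path_logderiv \<omega> \<equiv> driven_flow.logderiv F (\<lambda>t. B t \<omega>)"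

lemma driven_flow_path: "continuous_path \<omega> \<Longrightarrow> driven_flow F C A \<alpha> (\<lambda>t. B t \<omega>)"
  by unfold_locales (simp add: continuous_path_def)

lemma measurable_on_H:
  assumes "continuous_on upper_half_plane f" "Z \<in> borel_measurable N" "\<And>\<omega>. \<omega> \<in> space N \<Longrightarrow> 0 < Im (Z \<omega>)"
  shows "(\<lambda>\<omega>. f (Z \<omega>)) \<in> borel_measurable (N :: 'b measure)"
proof -
  have "(\<lambda>w. if w \<in> upper_half_plane then f w else undefined) \<in> borel_measurable borel"
    using open_H assms(1) by (intro borel_measurable_continuous_on_if) auto
  from measurable_compose[OF assms(2) this]
  have "(\<lambda>\<omega>. if Z \<omega> \<in> upper_half_plane then f (Z \<omega>) else undefined) \<in> borel_measurable N" .
  then show ?thesis by (rule measurable_cong[THEN iffD1, rotated]) (use assms(3) in auto)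
qed

lemma euler_measurable:
  assumes "0 \<le> s" "0 \<le> h" "0 < Im z"
  shows "(\<lambda>\<omega>. euler F (\<lambda>t. B t \<omega>) s h z k) \<in> borel_measurable (Fil (s + real k * h))"
proof (induction k)
  case (Suc k)
  have le: "0 \<le> s + real k * h" "s + real k * h \<le> s + real (Suc k) * h"
    using assms by (auto intro!: mult_right_mono add_nonneg_nonneg mult_nonneg_nonneg)
  have E: "(\<lambda>\<omega>. euler F (\<lambda>t. B t \<omega>) s h z k) \<in> borel_measurable (Fil (s + real (Suc k) * h))"
    by (rule measurable_Fil_mono[OF le Suc])
  moreover have "(\<lambda>\<omega>. F (euler F (\<lambda>t. B t \<omega>) s h z k)) \<in> borel_measurable (Fil (s + real (Suc k) * h))"
    by (rule measurable_on_H[OF F_cont E]) (use assms in \<open>auto intro!: less_le_trans[OF _ euler_Im_ge]\<close>)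
  ultimately show ?case
    using measurable_compose[OF increment_measurable[OF le] borel_measurable_of_real]
    by (auto intro!: borel_measurable_add borel_measurable_scaleR)
qed simp

text \<open>The solution is measurable only up to the null set of discontinuous paths. \<open>Zv\<close> is a version of it that is
  adapted to the given filtration; \<open>sol\<close> moves it back into the half plane where the Euler scheme fails to converge.\<close>

definition Zv :: "real \<Rightarrow> real \<Rightarrow> complex \<Rightarrow> 'a \<Rightarrow> complex" where
  "Zv s t z \<omega> = lim (\<lambda>n. euler F (\<lambda>t. B t \<omega>) s ((t - s) / real (Suc n)) z (Suc n))"

definition sol :: "real \<Rightarrow> real \<Rightarrow> complex \<Rightarrow> 'a \<Rightarrow> complex" where
  "sol s t z \<omega> = (if Im z \<le> Im (Zv s t z \<omega>) then Zv s t z \<omega> else z)"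

lemma sol_Im_ge: "Im z \<le> Im (sol s t z \<omega>)"
  by (simp add: sol_def)

lemma sol_measurable:
  assumes "0 \<le> s" "s \<le> t" "0 < Im z"
  shows "sol s t z \<in> borel_measurable (Fil t)"
proof -
  have "(\<lambda>\<omega>. euler F (\<lambda>t. B t \<omega>) s ((t - s) / real (Suc n)) z (Suc n)) \<in> borel_measurable (Fil t)" for n
    using euler_measurable[of s "(t - s) / real (Suc n)" z "Suc n"] assms by simp
  then have [measurable]: "Zv s t z \<in> borel_measurable (Fil t)"
    unfolding Zv_def by (rule borel_measurable_lim_metric)
  show ?thesis unfolding sol_def by measurable
qed

lemma sol_measurable_M: "0 \<le> s \<Longrightarrow> s \<le> t \<Longrightarrow> 0 < Im z \<Longrightarrow> sol s t z \<in> borel_measurable M"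
  by (rule measurable_Fil_M[OF _ sol_measurable]) auto

lemma sol_eq:
  assumes "continuous_path \<omega>" "0 \<le> s" "s \<le> t" "0 < Im z"
  shows "sol s t z \<omega> = path_flow \<omega> s t z"
proof -
  interpret driven_flow F C A \<alpha> "\<lambda>t. B t \<omega>" by (rule driven_flow_path[OF assms(1)])
  have "Zv s t z \<omega> = path_flow \<omega> s t z"
    unfolding Zv_def by (rule limI[OF euler_tendsto_flow[OF assms(2-4)]])
  then show ?thesis using flow_Im_ge[OF assms(2,4,3)] by (simp add: sol_def)
qed

lemma sol_comp_measurable:
  assumes "continuous_on upper_half_plane f" "0 \<le> s" "s \<le> t" "0 < Im z"
  shows "(\<lambda>\<omega>. f (sol s t z \<omega>)) \<in> borel_measurable (Fil t)"
  by (rule measurable_on_H[OF assms(1) sol_measurable]) (use assms in \<open>auto intro: less_le_trans[OF _ sol_Im_ge]\<close>)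

text \<open>The partitions of \<open>[s, t]\<close> have \<open>4 ^ j\<close> steps, which makes the second moments summable.\<close>

definition mesh :: "real \<Rightarrow> real \<Rightarrow> nat \<Rightarrow> real" where "mesh s t j = (t - s) / 4 ^ j"
definition node :: "real \<Rightarrow> real \<Rightarrow> nat \<Rightarrow> nat \<Rightarrow> real" where "node s t j k = s + real k * mesh s t j"
definition incr :: "real \<Rightarrow> real \<Rightarrow> nat \<Rightarrow> nat \<Rightarrow> 'a \<Rightarrow> real" where
  "incr s t j k \<omega> = B (node s t j (Suc k)) \<omega> - B (node s t j k) \<omega>"

lemma mesh_pos: "s < t \<Longrightarrow> 0 < mesh s t j" and mesh_total: "4 ^ j * mesh s t j = t - s"
  by (auto simp: mesh_def)

lemma node_in:
  assumes "s < t" "k < 4 ^ j"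
  shows "s \<le> node s t j k" "node s t j k \<le> t"
proof -
  have "real k \<le> real (4 ^ j)" using assms(2) by (simp only: of_nat_le_iff)
  then have "real k * mesh s t j \<le> 4 ^ j * mesh s t j"
    using mesh_pos[OF assms(1), of j] by (intro mult_right_mono) auto
  then show "s \<le> node s t j k" "node s t j k \<le> t"
    using mesh_pos[OF assms(1), of j] mesh_total[of j s t] by (auto simp: node_def)
qed

lemma transform_sum_incr:
  "transform_sum p s (mesh s t j) X n \<omega> = (\<Sum>k<n. X k \<omega> * p (incr s t j k \<omega>))"
  by (simp add: transform_sum_def incr_def node_def)

text \<open>With 4^j steps the second moment is of order 4^(-j), so the convergence is almost sure
  along the full sequence of partitions.\<close>

lemma quadratic_variation_AE:
  assumes s: "0 \<le> s" "s < t"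
    and X: "\<And>j k. k < 4 ^ j \<Longrightarrow> X (node s t j k) \<in> borel_measurable (Fil (node s t j k))"
    and c: "\<And>r \<omega>. \<bar>X r \<omega>\<bar> \<le> c"
  shows "AE \<omega> in M. (\<lambda>j. \<Sum>k<4 ^ j. X (node s t j k) \<omega> * ((incr s t j k \<omega>)\<^sup>2 - mesh s t j)) \<longlonglongrightarrow> 0"
proof -
  let ?T = "\<lambda>j. transform_sum (\<lambda>x. x\<^sup>2 - mesh s t j) s (mesh s t j) (\<lambda>k. X (node s t j k)) (4 ^ j)"
  have "AE \<omega> in M. (\<lambda>j. ?T j \<omega>) \<longlonglongrightarrow> 0"
  proof (rule AE_tendsto_zero_of_summable_moments[where c = "\<lambda>j. 2 * c\<^sup>2 * (t - s)\<^sup>2 * (1 / 4) ^ j"])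
    fix j
    show "?T j \<in> borel_measurable M"
      using transform_sum_measurable[of s "mesh s t j" "4 ^ j" "\<lambda>k. X (node s t j k)" "\<lambda>x. x\<^sup>2 - mesh s t j"]
        s X mesh_pos[OF s(2), of j] mesh_total[of j s t]
      by (intro measurable_Fil_M[of t]) (auto simp: node_def)
    have "(\<integral>\<^sup>+\<omega>. ennreal ((?T j \<omega>)\<^sup>2) \<partial>M) \<le> ennreal (real (4 ^ j) * (2 * c\<^sup>2 * (mesh s t j)\<^sup>2))"
      using s X c mesh_pos[OF s(2), of j] by (intro quadratic_variation_moment) (auto simp: node_def)
    also have "real (4 ^ j) * (2 * c\<^sup>2 * (mesh s t j)\<^sup>2) = 2 * c\<^sup>2 * (t - s)\<^sup>2 * (1 / 4) ^ j"
      by (simp add: mesh_def power2_eq_square field_simps)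
    finally show "(\<integral>\<^sup>+\<omega>. ennreal ((?T j \<omega>)\<^sup>2) \<partial>M) \<le> ennreal (2 * c\<^sup>2 * (t - s)\<^sup>2 * (1 / 4) ^ j)" .
  qed (auto intro!: summable_mult summable_geometric)
  then show ?thesis by (simp add: transform_sum_incr)
qed

text \<open>Measurable versions of \<open>\<integral> F(Z\<^sub>r) dB\<^sub>r\<close>, of \<open>\<integral> F(Z\<^sub>r)\<^sup>2 dr\<close> and of \<open>log \<phi>'\<close>.\<close>

definition Mv :: "real \<Rightarrow> real \<Rightarrow> complex \<Rightarrow> 'a \<Rightarrow> complex" where
  "Mv s t z \<omega> = lim (\<lambda>j. \<Sum>k<4 ^ j. F (sol s (node s t j k) z \<omega>) * complex_of_real (incr s t j k \<omega>))"

definition Qv :: "real \<Rightarrow> real \<Rightarrow> complex \<Rightarrow> 'a \<Rightarrow> complex" where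
  "Qv s t z \<omega> = lim (\<lambda>j. \<Sum>k<4 ^ j. (F (sol s (node s t j k) z \<omega>))\<^sup>2 * complex_of_real (mesh s t j))"

definition Lv :: "real \<Rightarrow> real \<Rightarrow> complex \<Rightarrow> 'a \<Rightarrow> complex" where
  "Lv s t z \<omega> = 2 * (G (sol s t z \<omega>) - G z - Qv s t z \<omega> - Mv s t z \<omega>)"

lemma G_cont: "continuous_on upper_half_plane G"
  by (rule DERIV_continuous_on[where D = F]) (auto intro: DERIV_subset[OF G_deriv])

lemma node_meas:
  assumes "0 \<le> s" "s < t" "0 < Im z" "continuous_on upper_half_plane f" "k < 4 ^ j"
  shows "(\<lambda>\<omega>. f (sol s (node s t j k) z \<omega>)) \<in> borel_measurable (Fil (node s t j k))"
  using node_in[OF assms(2,5)] assms by (intro sol_comp_measurable) auto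

lemma node_meas_M:
  assumes "0 \<le> s" "s < t" "0 < Im z" "continuous_on upper_half_plane f" "k < 4 ^ j"
  shows "(\<lambda>\<omega>. f (sol s (node s t j k) z \<omega>)) \<in> borel_measurable M"
  using node_in[OF assms(2,5)] assms node_meas[OF assms] by (auto intro: measurable_Fil_M[of "node s t j k"])

lemma incr_measurable:
  assumes "0 \<le> s" "s < t"
  shows "incr s t j k \<in> borel_measurable M"
proof -
  have "0 \<le> node s t j k" "node s t j k \<le> node s t j (Suc k)" 
    using assms mesh_pos[OF assms(2), of j] by (auto simp: node_def algebra_simps)
  then show ?thesis
    using increment_measurable[of "node s t j k" "node s t j (Suc k)"] unfolding incr_def
    by (intro measurable_Fil_M[of "node s t j (Suc k)"]) auto
qed

lemma Mv_measurable: "0 \<le> s \<Longrightarrow> s < t \<Longrightarrow> 0 < Im z \<Longrightarrow> Mv s t z \<in> borel_measurable M"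
  unfolding Mv_def
  by (intro borel_measurable_lim_metric borel_measurable_sum borel_measurable_times measurable_compose[OF _ borel_measurable_of_real]
      node_meas_M F_cont incr_measurable) auto

lemma Qv_measurable: "0 \<le> s \<Longrightarrow> s < t \<Longrightarrow> 0 < Im z \<Longrightarrow> Qv s t z \<in> borel_measurable M"
  unfolding Qv_def
  by (intro borel_measurable_lim_metric borel_measurable_sum borel_measurable_times borel_measurable_power
      node_meas_M F_cont borel_measurable_const) auto

lemma Lv_measurable:
  assumes "0 \<le> s" "s < t" "0 < Im z"
  shows "Lv s t z \<in> borel_measurable M"
proof -
  have "(\<lambda>\<omega>. G (sol s t z \<omega>)) \<in> borel_measurable M"
    using assms sol_comp_measurable[OF G_cont, of s t z] by (auto intro: measurable_Fil_M[of t])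
  then show ?thesis
    unfolding Lv_def using assms
    by (intro borel_measurable_times borel_measurable_diff borel_measurable_const Mv_measurable Qv_measurable)
qed

lemma filterlim_four_power: "filterlim (\<lambda>j. 4 ^ j :: nat) at_top sequentially"
proof (rule filterlim_at_top_mono[OF filterlim_ident])
  have "j \<le> 4 ^ j" for j :: nat
    using less_exp[of j] power_mono[of 2 "4 :: nat" j] by linarith
  then show "\<forall>\<^sub>F j in sequentially. j \<le> (4 ^ j :: nat)" by simp
qed

text \<open>All that is almost surely known for one fixed triple (s, t, z). The null set depends on
  the triple, so pathwise conclusions may draw on countably many triples only.\<close>

lemma ito_AE:
  assumes s: "0 \<le> s" "s < t" and z: "0 < Im z"
  shows "AE \<omega> in M. (\<lambda>j. \<Sum>k<4 ^ j. F (sol s (node s t j k) z \<omega>) * complex_of_real (incr s t j k \<omega>)) \<longlonglongrightarrow> Mv s t z \<omega>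
    \<and> (\<lambda>j. \<Sum>k<4 ^ j. (F (sol s (node s t j k) z \<omega>))\<^sup>2 * complex_of_real (mesh s t j)) \<longlonglongrightarrow> Qv s t z \<omega>
    \<and> cmod (Qv s t z \<omega>) \<le> C\<^sup>2 * (t - s)
    \<and> Lv s t z \<omega> = path_logderiv \<omega> s t z"
proof -
  \<comment> \<open>\<open>sol\<close> never drops below Im z. The bound depends on the height,
    which is harmless: it serves the vanishing of the quadratic variation errors, not the size of
    the limit.\<close>
  have bd: "cmod (deriv F (sol s r z \<omega>)) \<le> K1 (Im z)" for r \<omega>
    using z sol_Im_ge by (intro dF_bound)
  have ReF: "continuous_on upper_half_plane (\<lambda>w. Re (deriv F w))" and ImF: "continuous_on upper_half_plane (\<lambda>w. Im (deriv F w))"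
    by (intro continuous_intros dF_cont)+
  have "AE \<omega> in M. (\<lambda>j. \<Sum>k<4 ^ j. 1 * ((incr s t j k \<omega>)\<^sup>2 - mesh s t j)) \<longlonglongrightarrow> 0"
    by (rule quadratic_variation_AE[OF s, where X = "\<lambda>_ _. 1" and c = 1]) auto
  moreover have "AE \<omega> in M. (\<lambda>j. \<Sum>k<4 ^ j. Re (deriv F (sol s (node s t j k) z \<omega>)) * ((incr s t j k \<omega>)\<^sup>2 - mesh s t j)) \<longlonglongrightarrow> 0"
    by (rule quadratic_variation_AE[OF s, where X = "\<lambda>r \<omega>. Re (deriv F (sol s r z \<omega>))" and c = "K1 (Im z)"])
       (auto intro!: node_meas[OF s z ReF] order_trans[OF abs_Re_le_cmod bd])
  moreover have "AE \<omega> in M. (\<lambda>j. \<Sum>k<4 ^ j. Im (deriv F (sol s (node s t j k) z \<omega>)) * ((incr s t j k \<omega>)\<^sup>2 - mesh s t j)) \<longlonglongrightarrow> 0"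
    by (rule quadratic_variation_AE[OF s, where X = "\<lambda>r \<omega>. Im (deriv F (sol s r z \<omega>))" and c = "K1 (Im z)"])
       (auto intro!: node_meas[OF s z ImF] order_trans[OF abs_Im_le_cmod bd])
  ultimately show ?thesis using AE_continuous_path
  proof eventually_elim
    case (elim \<omega>)
    interpret driven_flow F C A \<alpha> "\<lambda>t. B t \<omega>" by (rule driven_flow_path[OF elim(4)])
    have sol: "sol s (node s t j k) z \<omega> = path_flow \<omega> s (node s t j k) z" if "k < 4 ^ j" for j k
      using sol_eq[OF elim(4) s(1) node_in(1)[OF s(2) that] z] .
    have solt: "sol s t z \<omega> = path_flow \<omega> s t z" using sol_eq[OF elim(4)] s z by simp
    have four: "(0::nat) < 4 ^ j" for j by simp
    have qvF: "(\<lambda>j. \<Sum>k<4 ^ j. deriv F (path_flow \<omega> s (node s t j k) z) * complex_of_real ((incr s t j k \<omega>)\<^sup>2 - mesh s t j)) \<longlonglongrightarrow> 0"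
    proof -
      have "(\<lambda>j. Complex (\<Sum>k<4 ^ j. Re (deriv F (sol s (node s t j k) z \<omega>)) * ((incr s t j k \<omega>)\<^sup>2 - mesh s t j))
          (\<Sum>k<4 ^ j. Im (deriv F (sol s (node s t j k) z \<omega>)) * ((incr s t j k \<omega>)\<^sup>2 - mesh s t j))) \<longlonglongrightarrow> Complex 0 0"
        using elim(2,3) by (rule tendsto_Complex)
      moreover have "Complex (\<Sum>k<4 ^ j. Re (deriv F (sol s (node s t j k) z \<omega>)) * ((incr s t j k \<omega>)\<^sup>2 - mesh s t j))
          (\<Sum>k<4 ^ j. Im (deriv F (sol s (node s t j k) z \<omega>)) * ((incr s t j k \<omega>)\<^sup>2 - mesh s t j))
        = (\<Sum>k<4 ^ j. deriv F (path_flow \<omega> s (node s t j k) z) * complex_of_real ((incr s t j k \<omega>)\<^sup>2 - mesh s t j))" for j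
        by (simp add: complex_eq_iff sol del: of_real_diff)
      moreover have "Complex 0 0 = 0" by (simp add: complex_eq_iff)
      ultimately show ?thesis by simp
    qed
    have "(\<lambda>j. \<Sum>k<4 ^ j. F (path_flow \<omega> s (node s t j k) z) * complex_of_real (incr s t j k \<omega>))
      \<longlonglongrightarrow> G (path_flow \<omega> s t z) - G z - integral {s..t} (\<lambda>r. (F (path_flow \<omega> s r z))\<^sup>2) - logderiv s t z / 2"
      using ito_limit[OF s(1) less_imp_le[OF s(2)] z filterlim_four_power four] elim(1) qvF
      by (simp add: mesh_def node_def incr_def)
    then have M1: "(\<lambda>j. \<Sum>k<4 ^ j. F (sol s (node s t j k) z \<omega>) * complex_of_real (incr s t j k \<omega>))
      \<longlonglongrightarrow> G (path_flow \<omega> s t z) - G z - integral {s..t} (\<lambda>r. (F (path_flow \<omega> s r z))\<^sup>2) - logderiv s t z / 2"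
      by (simp add: sol)
    then have M2: "Mv s t z \<omega> = G (path_flow \<omega> s t z) - G z - integral {s..t} (\<lambda>r. (F (path_flow \<omega> s r z))\<^sup>2) - logderiv s t z / 2"
      unfolding Mv_def by (rule limI)
    have cF: "continuous_on {s..t} (\<lambda>r. F (path_flow \<omega> s r z))"
      using s z by (intro continuous_on_subset[OF flow_F_cont]) auto
    have "(\<lambda>j. \<Sum>k<4 ^ j. (F (path_flow \<omega> s (node s t j k) z))\<^sup>2 * complex_of_real (mesh s t j))
      \<longlonglongrightarrow> integral {s..t} (\<lambda>r. (F (path_flow \<omega> s r z))\<^sup>2)"
    proof -
      have "integral {node s t j k..node s t j (Suc k)} (\<lambda>_. 1) = complex_of_real (mesh s t j)" for j k
        using mesh_pos[OF s(2), of j] by (simp add: scaleR_conv_of_real node_def algebra_simps)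
      then show ?thesis
        using riemann_sum_product[OF continuous_on_power[OF cF, of 2] continuous_on_const[of _ 1]
            less_imp_le[OF s(2)] filterlim_four_power four]
        by (simp add: mesh_def node_def)
    qed
    then have Q1: "(\<lambda>j. \<Sum>k<4 ^ j. (F (sol s (node s t j k) z \<omega>))\<^sup>2 * complex_of_real (mesh s t j))
      \<longlonglongrightarrow> integral {s..t} (\<lambda>r. (F (path_flow \<omega> s r z))\<^sup>2)"
      by (simp add: sol)
    then have Q2: "Qv s t z \<omega> = integral {s..t} (\<lambda>r. (F (path_flow \<omega> s r z))\<^sup>2)"
      unfolding Qv_def by (rule limI)
    have "cmod (Qv s t z \<omega>) \<le> C\<^sup>2 * (t - s)"
      unfolding Q2
    proof (rule integral_bound)
      show "continuous_on {s..t} (\<lambda>r. (F (path_flow \<omega> s r z))\<^sup>2)" by (intro continuous_intros cF)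
      show "cmod ((F (path_flow \<omega> s r z))\<^sup>2) \<le> C\<^sup>2" if "r \<in> {s..t}" for r
        unfolding norm_power using that s z by (intro power_mono F_bound flow_in_H) auto
    qed (use s in simp)
    then show ?case using M1 M2 Q1 Q2 solt by (simp add: Lv_def)
  qed
qed

end

lemma affine_in_closed_segment:
  fixes z w :: complex
  assumes "u \<in> {0..1}"
  shows "z + of_real u * (w - z) \<in> closed_segment z w"
proof -
  have "z + of_real u * (w - z) = (1 - u) *\<^sub>R z + u *\<^sub>R w"
    by (simp add: scaleR_conv_of_real algebra_simps)
  then show ?thesis using assms unfolding in_segment by auto
qed

section \<open>Moment bounds uniform in the height\<close>

context brownian_flow
begin

definition bdg :: "nat \<Rightarrow> real" where
  "bdg m = burkholder_const m * exp (burkholder_const m)"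

lemma bdg_nonneg: "0 \<le> bdg m"
  by (simp add: bdg_def burkholder_const_nonneg)

lemma stochastic_sum_measurable:
  fixes f :: "real \<Rightarrow> 'a \<Rightarrow> real"
  assumes s: "0 \<le> s" "s < t" and f: "\<And>r. s \<le> r \<Longrightarrow> r \<le> t \<Longrightarrow> f r \<in> borel_measurable (Fil r)"
  shows "(\<lambda>\<omega>. \<Sum>k<4 ^ j. f (node s t j k) \<omega> * incr s t j k \<omega>) \<in> borel_measurable M"
proof (intro borel_measurable_sum borel_measurable_times incr_measurable[OF s])
  fix k assume "k \<in> {..<(4::nat) ^ j}"
  then have "s \<le> node s t j k" "node s t j k \<le> t" using node_in[OF s(2)] by auto
  with f s show "f (node s t j k) \<in> borel_measurable M" by (intro measurable_Fil_M[of "node s t j k"]) auto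
qed

lemma stochastic_sum_moment:
  fixes f :: "real \<Rightarrow> 'a \<Rightarrow> real"
  assumes s: "0 \<le> s" "s < t" and f: "\<And>r. s \<le> r \<Longrightarrow> r \<le> t \<Longrightarrow> f r \<in> borel_measurable (Fil r)"
    and b: "\<And>r. s \<le> r \<Longrightarrow> r \<le> t \<Longrightarrow> (\<integral>\<^sup>+\<omega>. ennreal (f r \<omega> ^ (2 * m)) \<partial>M) \<le> ennreal b" "0 \<le> b" and m: "1 \<le> m"
    and lim: "AE \<omega> in M. (\<lambda>j. \<Sum>k<4 ^ j. f (node s t j k) \<omega> * incr s t j k \<omega>) \<longlonglongrightarrow> Y \<omega>"
  shows "(\<integral>\<^sup>+\<omega>. ennreal (Y \<omega> ^ (2 * m)) \<partial>M) \<le> ennreal (bdg m * (t - s) ^ m * b)"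
proof (rule nn_integral_fatou)
  fix j
  let ?D = "\<lambda>\<omega>. \<Sum>k<4 ^ j. f (node s t j k) \<omega> * incr s t j k \<omega>"
  have [measurable]: "?D \<in> borel_measurable M" by (rule stochastic_sum_measurable[OF s f])
  show "(\<lambda>\<omega>. ennreal (?D \<omega> ^ (2 * m))) \<in> borel_measurable M" by measurable
  have "(\<integral>\<^sup>+\<omega>. ennreal (transform_sum (\<lambda>x. x) s (mesh s t j) (\<lambda>k. f (node s t j k)) (4 ^ j) \<omega> ^ (2 * m)) \<partial>M)
      \<le> ennreal (burkholder_const m * exp (burkholder_const m) * (real (4 ^ j) * mesh s t j) ^ m * b)"
  proof (rule martingale_transform_moment[OF s(1) mesh_pos[OF s(2)]])
    fix k assume k: "k < (4::nat) ^ j"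
    then have n: "s \<le> node s t j k" "node s t j k \<le> t" using node_in[OF s(2)] by auto
    show "f (node s t j k) \<in> borel_measurable (Fil (s + real k * mesh s t j))"
      using f[OF n] by (simp add: node_def)
    show "(\<integral>\<^sup>+\<omega>. ennreal (f (node s t j k) \<omega> ^ (2 * m)) \<partial>M) \<le> ennreal b" using b(1)[OF n] .
  qed (use b m in auto)
  then show "(\<integral>\<^sup>+\<omega>. ennreal (?D \<omega> ^ (2 * m)) \<partial>M) \<le> ennreal (bdg m * (t - s) ^ m * b)"
    by (simp add: transform_sum_incr bdg_def mesh_total)
next
  show "AE \<omega> in M. (\<lambda>j. ennreal ((\<Sum>k<4 ^ j. f (node s t j k) \<omega> * incr s t j k \<omega>) ^ (2 * m))) \<longlonglongrightarrow> ennreal (Y \<omega> ^ (2 * m))"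
    using lim by eventually_elim (intro tendsto_ennrealI tendsto_power)
qed

lemma stochastic_sum_exp:
  fixes f :: "real \<Rightarrow> 'a \<Rightarrow> real"
  assumes s: "0 \<le> s" "s < t" and f: "\<And>r. s \<le> r \<Longrightarrow> r \<le> t \<Longrightarrow> f r \<in> borel_measurable (Fil r)"
    and c: "\<And>r \<omega>. \<bar>f r \<omega>\<bar> \<le> c"
    and lim: "AE \<omega> in M. (\<lambda>j. \<Sum>k<4 ^ j. f (node s t j k) \<omega> * incr s t j k \<omega>) \<longlonglongrightarrow> Y \<omega>"
  shows "(\<integral>\<^sup>+\<omega>. ennreal (exp (\<theta> * Y \<omega>)) \<partial>M) \<le> ennreal (exp ((t - s) * \<theta>\<^sup>2 * c\<^sup>2 / 2))"
proof (rule nn_integral_fatou)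
  fix j
  let ?D = "\<lambda>\<omega>. \<Sum>k<4 ^ j. f (node s t j k) \<omega> * incr s t j k \<omega>"
  have [measurable]: "?D \<in> borel_measurable M" by (rule stochastic_sum_measurable[OF s f])
  show "(\<lambda>\<omega>. ennreal (exp (\<theta> * ?D \<omega>))) \<in> borel_measurable M" by measurable
  have "(\<integral>\<^sup>+\<omega>. ennreal (exp (\<theta> * transform_sum (\<lambda>x. x) s (mesh s t j) (\<lambda>k. f (node s t j k)) (4 ^ j) \<omega>)) \<partial>M)
      \<le> ennreal (exp (real (4 ^ j) * mesh s t j * \<theta>\<^sup>2 * c\<^sup>2 / 2))"
  proof (rule martingale_transform_exp[OF s(1) mesh_pos[OF s(2)] _ c])
    fix k assume k: "k < (4::nat) ^ j"
    then have n: "s \<le> node s t j k" "node s t j k \<le> t" using node_in[OF s(2)] by auto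
    show "f (node s t j k) \<in> borel_measurable (Fil (s + real k * mesh s t j))"
      using f[OF n] by (simp add: node_def)
  qed
  then show "(\<integral>\<^sup>+\<omega>. ennreal (exp (\<theta> * ?D \<omega>)) \<partial>M) \<le> ennreal (exp ((t - s) * \<theta>\<^sup>2 * c\<^sup>2 / 2))"
    by (simp add: transform_sum_incr mesh_total)
next
  show "AE \<omega> in M. (\<lambda>j. ennreal (exp (\<theta> * (\<Sum>k<4 ^ j. f (node s t j k) \<omega> * incr s t j k \<omega>)))) \<longlonglongrightarrow> ennreal (exp (\<theta> * Y \<omega>))"
    using lim by eventually_elim (intro tendsto_ennrealI tendsto_exp tendsto_mult_left)
qed

text \<open>Jensen's inequality on each partition, then Fatou's lemma.\<close>

lemma riemann_sum_moment:
  fixes f :: "real \<Rightarrow> 'a \<Rightarrow> real"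
  assumes s: "0 \<le> s" "s < t" and f: "\<And>r. s \<le> r \<Longrightarrow> r \<le> t \<Longrightarrow> f r \<in> borel_measurable (Fil r)"
    and b: "\<And>r. s \<le> r \<Longrightarrow> r \<le> t \<Longrightarrow> (\<integral>\<^sup>+\<omega>. ennreal (f r \<omega> ^ (2 * m)) \<partial>M) \<le> ennreal b" "0 \<le> b"
    and lim: "AE \<omega> in M. (\<lambda>j. \<Sum>k<4 ^ j. f (node s t j k) \<omega> * mesh s t j) \<longlonglongrightarrow> Y \<omega>"
  shows "(\<integral>\<^sup>+\<omega>. ennreal (Y \<omega> ^ (2 * m)) \<partial>M) \<le> ennreal ((t - s) ^ (2 * m) * b)"
proof (rule nn_integral_fatou)
  fix j
  let ?D = "\<lambda>\<omega>. \<Sum>k<4 ^ j. f (node s t j k) \<omega> * mesh s t j"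
  have fn: "f (node s t j k) \<in> borel_measurable M" "(\<integral>\<^sup>+\<omega>. ennreal (f (node s t j k) \<omega> ^ (2 * m)) \<partial>M) \<le> ennreal b"
    if "k < 4 ^ j" for k
    using node_in[OF s(2) that] f b(1) s by (auto intro: measurable_Fil_M[of "node s t j k"])
  then have [measurable]: "?D \<in> borel_measurable M"
    by (intro borel_measurable_sum borel_measurable_times borel_measurable_const) auto
  show "(\<lambda>\<omega>. ennreal (?D \<omega> ^ (2 * m))) \<in> borel_measurable M" by measurable
  \<comment> \<open>The factor (4^j)^(2m - 1) of Jensen's inequality times the power 2m of the mesh;
    summed over the 4^j nodes it gives (t - s)^(2m).\<close>
  define c where "c = (t - s) ^ (2 * m) / 4 ^ j"
  have c: "0 \<le> c" using s by (simp add: c_def)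
  have "(\<integral>\<^sup>+\<omega>. ennreal (?D \<omega> ^ (2 * m)) \<partial>M) \<le> (\<integral>\<^sup>+\<omega>. (\<Sum>k<4 ^ j. ennreal c * ennreal (f (node s t j k) \<omega> ^ (2 * m))) \<partial>M)"
  proof (rule nn_integral_mono)
    fix \<omega>
    have "?D \<omega> ^ (2 * m) \<le> real (4 ^ j) ^ (2 * m) / real (4 ^ j) * (\<Sum>k<4 ^ j. (f (node s t j k) \<omega> * mesh s t j) ^ (2 * m))"
      by (rule power_mean_sum_le) auto
    also have "\<dots> = c * (\<Sum>k<4 ^ j. f (node s t j k) \<omega> ^ (2 * m))"
      by (simp add: c_def mesh_def power_mult_distrib power_divide sum_distrib_left sum_divide_distrib mult_ac)
    finally have "ennreal (?D \<omega> ^ (2 * m)) \<le> ennreal (\<Sum>k<4 ^ j. c * f (node s t j k) \<omega> ^ (2 * m))"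
      by (simp add: sum_distrib_left ennreal_leI)
    also have "\<dots> = (\<Sum>k<4 ^ j. ennreal c * ennreal (f (node s t j k) \<omega> ^ (2 * m)))"
      using c by (simp add: sum_ennreal[symmetric] ennreal_mult zero_le_even_power)
    finally show "ennreal (?D \<omega> ^ (2 * m)) \<le> (\<Sum>k<4 ^ j. ennreal c * ennreal (f (node s t j k) \<omega> ^ (2 * m)))" .
  qed
  also have "\<dots> = (\<Sum>k<4 ^ j. ennreal c * (\<integral>\<^sup>+\<omega>. ennreal (f (node s t j k) \<omega> ^ (2 * m)) \<partial>M))"
    using fn(1) by (subst nn_integral_sum) (auto intro!: sum.cong nn_integral_cmult borel_measurable_times borel_measurable_const)
  also have "\<dots> \<le> (\<Sum>k<(4::nat) ^ j. ennreal c * ennreal b)"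
    using fn(2) by (intro sum_mono mult_left_mono) auto
  also have "\<dots> = ennreal ((t - s) ^ (2 * m) * b)"
  proof -
    have "(\<Sum>k<(4::nat) ^ j. ennreal c * ennreal b) = (\<Sum>k<(4::nat) ^ j. ennreal (c * b))"
      using c b(2) by (simp add: ennreal_mult)
    also have "\<dots> = ennreal (\<Sum>k<(4::nat) ^ j. c * b)" using c b(2) by (intro sum_ennreal) auto
    also have "(\<Sum>k<(4::nat) ^ j. c * b) = (t - s) ^ (2 * m) * b" by (simp add: c_def)
    finally show ?thesis .
  qed
  finally show "(\<integral>\<^sup>+\<omega>. ennreal (?D \<omega> ^ (2 * m)) \<partial>M) \<le> ennreal ((t - s) ^ (2 * m) * b)" .
next
  show "AE \<omega> in M. (\<lambda>j. ennreal ((\<Sum>k<4 ^ j. f (node s t j k) \<omega> * mesh s t j) ^ (2 * m))) \<longlonglongrightarrow> ennreal (Y \<omega> ^ (2 * m))"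
    using lim by eventually_elim (intro tendsto_ennrealI tendsto_power)
qed

lemma complex_moment_le:
  fixes Y :: "'a \<Rightarrow> complex"
  assumes [measurable]: "Y \<in> borel_measurable M" and "0 \<le> b"
    and "(\<integral>\<^sup>+\<omega>. ennreal (Re (Y \<omega>) ^ (2 * m)) \<partial>M) \<le> ennreal b" "(\<integral>\<^sup>+\<omega>. ennreal (Im (Y \<omega>) ^ (2 * m)) \<partial>M) \<le> ennreal b"
  shows "(\<integral>\<^sup>+\<omega>. ennreal (cmod (Y \<omega>) ^ (2 * m)) \<partial>M) \<le> ennreal (2 ^ (2 * m) * 2 * b)"
proof -
  have "(\<integral>\<^sup>+\<omega>. ennreal (cmod (Y \<omega>) ^ (2 * m)) \<partial>M)
      \<le> (\<integral>\<^sup>+\<omega>. ennreal (2 ^ (2 * m)) * (ennreal (Re (Y \<omega>) ^ (2 * m)) + ennreal (Im (Y \<omega>) ^ (2 * m))) \<partial>M)"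
    by (intro nn_integral_mono)
       (simp add: ennreal_plus[symmetric] ennreal_mult[symmetric] zero_le_even_power ennreal_leI cmod_power_le del: ennreal_plus)
  also have "\<dots> = ennreal (2 ^ (2 * m)) * ((\<integral>\<^sup>+\<omega>. ennreal (Re (Y \<omega>) ^ (2 * m)) \<partial>M) + (\<integral>\<^sup>+\<omega>. ennreal (Im (Y \<omega>) ^ (2 * m)) \<partial>M))"
    by (subst nn_integral_cmult) (auto simp: nn_integral_add)
  also have "\<dots> \<le> ennreal (2 ^ (2 * m)) * (ennreal b + ennreal b)"
    using assms by (intro mult_left_mono add_mono) auto
  also have "\<dots> = ennreal (2 ^ (2 * m) * 2 * b)"
    using assms(2) by (simp add: ennreal_plus[symmetric] ennreal_mult[symmetric] del: ennreal_plus)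
  finally show ?thesis .
qed

lemma complex_stochastic_sum_moment:
  fixes g :: "real \<Rightarrow> 'a \<Rightarrow> complex"
  assumes s: "0 \<le> s" "s < t" and g: "\<And>r. s \<le> r \<Longrightarrow> r \<le> t \<Longrightarrow> g r \<in> borel_measurable (Fil r)"
    and b: "\<And>r. s \<le> r \<Longrightarrow> r \<le> t \<Longrightarrow> (\<integral>\<^sup>+\<omega>. ennreal (cmod (g r \<omega>) ^ (2 * m)) \<partial>M) \<le> ennreal b" "0 \<le> b" and m: "1 \<le> m"
    and Y: "Y \<in> borel_measurable M"
    and lim: "AE \<omega> in M. (\<lambda>j. \<Sum>k<4 ^ j. g (node s t j k) \<omega> * complex_of_real (incr s t j k \<omega>)) \<longlonglongrightarrow> Y \<omega>"
  shows "(\<integral>\<^sup>+\<omega>. ennreal (cmod (Y \<omega>) ^ (2 * m)) \<partial>M) \<le> ennreal (2 ^ (2 * m) * 2 * (bdg m * (t - s) ^ m * b))"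
proof (rule complex_moment_le[OF Y])
  show "0 \<le> bdg m * (t - s) ^ m * b" using s b bdg_nonneg by simp
  have b': "(\<integral>\<^sup>+\<omega>. ennreal (Re (g r \<omega>) ^ (2 * m)) \<partial>M) \<le> ennreal b" "(\<integral>\<^sup>+\<omega>. ennreal (Im (g r \<omega>) ^ (2 * m)) \<partial>M) \<le> ennreal b"
    if "s \<le> r" "r \<le> t" for r
    using b(1)[OF that] by (auto intro!: order_trans[OF nn_integral_mono[OF ennreal_leI] b(1)[OF that]] Re_Im_power_le)
  show "(\<integral>\<^sup>+\<omega>. ennreal (Re (Y \<omega>) ^ (2 * m)) \<partial>M) \<le> ennreal (bdg m * (t - s) ^ m * b)"
  proof (rule stochastic_sum_moment[OF s _ b'(1) b(2) m])
    show "(\<lambda>\<omega>. Re (g r \<omega>)) \<in> borel_measurable (Fil r)" if "s \<le> r" "r \<le> t" for r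
      using g[OF that] by measurable
    show "AE \<omega> in M. (\<lambda>j. \<Sum>k<4 ^ j. Re (g (node s t j k) \<omega>) * incr s t j k \<omega>) \<longlonglongrightarrow> Re (Y \<omega>)"
      using lim by eventually_elim (drule tendsto_Re, simp)
  qed
  show "(\<integral>\<^sup>+\<omega>. ennreal (Im (Y \<omega>) ^ (2 * m)) \<partial>M) \<le> ennreal (bdg m * (t - s) ^ m * b)"
  proof (rule stochastic_sum_moment[OF s _ b'(2) b(2) m])
    show "(\<lambda>\<omega>. Im (g r \<omega>)) \<in> borel_measurable (Fil r)" if "s \<le> r" "r \<le> t" for r
      using g[OF that] by measurable
    show "AE \<omega> in M. (\<lambda>j. \<Sum>k<4 ^ j. Im (g (node s t j k) \<omega>) * incr s t j k \<omega>) \<longlonglongrightarrow> Im (Y \<omega>)"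
      using lim by eventually_elim (drule tendsto_Im, simp)
  qed
qed

lemma complex_riemann_sum_moment:
  fixes g :: "real \<Rightarrow> 'a \<Rightarrow> complex"
  assumes s: "0 \<le> s" "s < t" and g: "\<And>r. s \<le> r \<Longrightarrow> r \<le> t \<Longrightarrow> g r \<in> borel_measurable (Fil r)"
    and b: "\<And>r. s \<le> r \<Longrightarrow> r \<le> t \<Longrightarrow> (\<integral>\<^sup>+\<omega>. ennreal (cmod (g r \<omega>) ^ (2 * m)) \<partial>M) \<le> ennreal b" "0 \<le> b"
    and Y: "Y \<in> borel_measurable M"
    and lim: "AE \<omega> in M. (\<lambda>j. \<Sum>k<4 ^ j. g (node s t j k) \<omega> * complex_of_real (mesh s t j)) \<longlonglongrightarrow> Y \<omega>"
  shows "(\<integral>\<^sup>+\<omega>. ennreal (cmod (Y \<omega>) ^ (2 * m)) \<partial>M) \<le> ennreal (2 ^ (2 * m) * 2 * ((t - s) ^ (2 * m) * b))"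
proof (rule complex_moment_le[OF Y])
  show "0 \<le> (t - s) ^ (2 * m) * b" using s b by simp
  have b': "(\<integral>\<^sup>+\<omega>. ennreal (Re (g r \<omega>) ^ (2 * m)) \<partial>M) \<le> ennreal b" "(\<integral>\<^sup>+\<omega>. ennreal (Im (g r \<omega>) ^ (2 * m)) \<partial>M) \<le> ennreal b"
    if "s \<le> r" "r \<le> t" for r
    using b(1)[OF that] by (auto intro!: order_trans[OF nn_integral_mono[OF ennreal_leI] b(1)[OF that]] Re_Im_power_le)
  show "(\<integral>\<^sup>+\<omega>. ennreal (Re (Y \<omega>) ^ (2 * m)) \<partial>M) \<le> ennreal ((t - s) ^ (2 * m) * b)"
  proof (rule riemann_sum_moment[OF s _ b'(1) b(2)])
    show "(\<lambda>\<omega>. Re (g r \<omega>)) \<in> borel_measurable (Fil r)" if "s \<le> r" "r \<le> t" for r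
      using g[OF that] by measurable
    show "AE \<omega> in M. (\<lambda>j. \<Sum>k<4 ^ j. Re (g (node s t j k) \<omega>) * mesh s t j) \<longlonglongrightarrow> Re (Y \<omega>)"
      using lim by eventually_elim (drule tendsto_Re, simp)
  qed
  show "(\<integral>\<^sup>+\<omega>. ennreal (Im (Y \<omega>) ^ (2 * m)) \<partial>M) \<le> ennreal ((t - s) ^ (2 * m) * b)"
  proof (rule riemann_sum_moment[OF s _ b'(2) b(2)])
    show "(\<lambda>\<omega>. Im (g r \<omega>)) \<in> borel_measurable (Fil r)" if "s \<le> r" "r \<le> t" for r
      using g[OF that] by measurable
    show "AE \<omega> in M. (\<lambda>j. \<Sum>k<4 ^ j. Im (g (node s t j k) \<omega>) * mesh s t j) \<longlonglongrightarrow> Im (Y \<omega>)"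
      using lim by eventually_elim (drule tendsto_Im, simp)
  qed
qed

text \<open>The increment is the discrete stochastic integral of the constant 1 over a single
  step.\<close>

lemma increment_exp:
  assumes s: "0 \<le> s" "s < t"
  shows "(\<integral>\<^sup>+\<omega>. ennreal (exp (\<theta> * (B t \<omega> - B s \<omega>))) \<partial>M) \<le> ennreal (exp ((t - s) * \<theta>\<^sup>2 / 2))"
  using martingale_transform_exp[of s "t - s" 1 "\<lambda>_ _. 1" 1 \<theta>] s by (simp add: transform_sum_def)

lemma increment_moment:
  assumes s: "0 \<le> s" "s < t" and m: "1 \<le> m"
  shows "(\<integral>\<^sup>+\<omega>. ennreal ((B t \<omega> - B s \<omega>) ^ (2 * m)) \<partial>M) \<le> ennreal (bdg m * (t - s) ^ m)"
  using martingale_transform_moment[of s "t - s" 1 "\<lambda>_ _. 1" m 1] s m by (simp add: transform_sum_def bdg_def emeasure_space_1)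

lemma F_sol_measurable:
  "0 \<le> s \<Longrightarrow> s \<le> r \<Longrightarrow> 0 < Im z \<Longrightarrow> (\<lambda>\<omega>. F (sol s r z \<omega>)) \<in> borel_measurable (Fil r)"
  by (rule sol_comp_measurable[OF F_cont])

lemma F_sol_bound: "0 < Im z \<Longrightarrow> cmod (F (sol s r z \<omega>)) \<le> C"
  using sol_Im_ge[of z s r \<omega>] by (intro F_bound) linarith

lemma Mv_exp:
  assumes s: "0 \<le> s" "s < t" and z: "0 < Im z"
  shows "(\<integral>\<^sup>+\<omega>. ennreal (exp (\<theta> * Re (Mv s t z \<omega>))) \<partial>M) \<le> ennreal (exp ((t - s) * \<theta>\<^sup>2 * C\<^sup>2 / 2))"
proof (rule stochastic_sum_exp[OF s, where f = "\<lambda>r \<omega>. Re (F (sol s r z \<omega>))"])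
  show "(\<lambda>\<omega>. Re (F (sol s r z \<omega>))) \<in> borel_measurable (Fil r)" if "s \<le> r" for r
    using F_sol_measurable[OF s(1) that z] by measurable
  show "\<bar>Re (F (sol s r z \<omega>))\<bar> \<le> C" for r \<omega>
    by (rule order_trans[OF abs_Re_le_cmod F_sol_bound[OF z]])
  show "AE \<omega> in M. (\<lambda>j. \<Sum>k<4 ^ j. Re (F (sol s (node s t j k) z \<omega>)) * incr s t j k \<omega>) \<longlonglongrightarrow> Re (Mv s t z \<omega>)"
    using ito_AE[OF s z] by eventually_elim (drule conjunct1, drule tendsto_Re, simp)
qed

lemma Mv_moment:
  assumes s: "0 \<le> s" "s < t" and z: "0 < Im z" and m: "1 \<le> m"
  shows "(\<integral>\<^sup>+\<omega>. ennreal (cmod (Mv s t z \<omega>) ^ (2 * m)) \<partial>M) \<le> ennreal (2 ^ (2 * m) * 2 * (bdg m * (t - s) ^ m * C ^ (2 * m)))"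
proof (rule complex_stochastic_sum_moment[OF s _ _ _ m Mv_measurable[OF s z]])
  show "(\<lambda>\<omega>. F (sol s r z \<omega>)) \<in> borel_measurable (Fil r)" if "s \<le> r" for r
    using F_sol_measurable[OF s(1) that z] .
  have "(\<integral>\<^sup>+\<omega>. ennreal (cmod (F (sol s r z \<omega>)) ^ (2 * m)) \<partial>M) \<le> (\<integral>\<^sup>+\<omega>. ennreal (C ^ (2 * m)) \<partial>M)" for r
    by (intro nn_integral_mono ennreal_leI power_mono F_sol_bound z) auto
  then show "(\<integral>\<^sup>+\<omega>. ennreal (cmod (F (sol s r z \<omega>)) ^ (2 * m)) \<partial>M) \<le> ennreal (C ^ (2 * m))" for r
    by (simp add: emeasure_space_1)
  show "AE \<omega> in M. (\<lambda>j. \<Sum>k<4 ^ j. F (sol s (node s t j k) z \<omega>) * complex_of_real (incr s t j k \<omega>)) \<longlonglongrightarrow> Mv s t z \<omega>"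
    using ito_AE[OF s z] by eventually_elim blast
qed (use C_ge in auto)

text \<open>In \<open>Qv\<close> the difference of squares factors and the sum of the two values is
  at most 2C, so both parts reduce to moments of F(Z) - F(W).\<close>

lemma Mv_Qv_diff_moment:
  assumes s: "0 \<le> s" "s < t" and z: "0 < Im z" and w: "0 < Im w" and m: "1 \<le> m"
    and b: "\<And>r. s \<le> r \<Longrightarrow> r \<le> t \<Longrightarrow> (\<integral>\<^sup>+\<omega>. ennreal (cmod (F (sol s r z \<omega>) - F (sol s r w \<omega>)) ^ (2 * m)) \<partial>M) \<le> ennreal b" "0 \<le> b"
  shows "(\<integral>\<^sup>+\<omega>. ennreal (cmod (Mv s t z \<omega> - Mv s t w \<omega>) ^ (2 * m)) \<partial>M) \<le> ennreal (2 ^ (2 * m) * 2 * (bdg m * (t - s) ^ m * b))"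
    and "(\<integral>\<^sup>+\<omega>. ennreal (cmod (Qv s t z \<omega> - Qv s t w \<omega>) ^ (2 * m)) \<partial>M) \<le> ennreal (2 ^ (2 * m) * 2 * ((t - s) ^ (2 * m) * ((2 * C) ^ (2 * m) * b)))"
proof -
  have meas: "(\<lambda>\<omega>. F (sol s r z \<omega>) - F (sol s r w \<omega>)) \<in> borel_measurable (Fil r)"
    "(\<lambda>\<omega>. (F (sol s r z \<omega>))\<^sup>2 - (F (sol s r w \<omega>))\<^sup>2) \<in> borel_measurable (Fil r)" if "s \<le> r" for r
    using F_sol_measurable[OF s(1) that z] F_sol_measurable[OF s(1) that w] by measurable
  show "(\<integral>\<^sup>+\<omega>. ennreal (cmod (Mv s t z \<omega> - Mv s t w \<omega>) ^ (2 * m)) \<partial>M) \<le> ennreal (2 ^ (2 * m) * 2 * (bdg m * (t - s) ^ m * b))"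
  proof (rule complex_stochastic_sum_moment[OF s meas(1) b m])
    show "(\<lambda>\<omega>. Mv s t z \<omega> - Mv s t w \<omega>) \<in> borel_measurable M"
      using Mv_measurable[OF s z] Mv_measurable[OF s w] by measurable
    show "AE \<omega> in M. (\<lambda>j. \<Sum>k<4 ^ j. (F (sol s (node s t j k) z \<omega>) - F (sol s (node s t j k) w \<omega>)) * complex_of_real (incr s t j k \<omega>))
        \<longlonglongrightarrow> Mv s t z \<omega> - Mv s t w \<omega>"
      using ito_AE[OF s z] ito_AE[OF s w]
    proof eventually_elim
      case (elim \<omega>)
      from tendsto_diff[OF elim(1)[THEN conjunct1] elim(2)[THEN conjunct1]] show ?case
        by (simp add: left_diff_distrib sum_subtractf)
    qed
  qed auto
  show "(\<integral>\<^sup>+\<omega>. ennreal (cmod (Qv s t z \<omega> - Qv s t w \<omega>) ^ (2 * m)) \<partial>M) \<le> ennreal (2 ^ (2 * m) * 2 * ((t - s) ^ (2 * m) * ((2 * C) ^ (2 * m) * b)))"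
  proof (rule complex_riemann_sum_moment[OF s meas(2)])
    show "(\<lambda>\<omega>. Qv s t z \<omega> - Qv s t w \<omega>) \<in> borel_measurable M"
      using Qv_measurable[OF s z] Qv_measurable[OF s w] by measurable
    show "0 \<le> (2 * C) ^ (2 * m) * b" using b by (simp add: zero_le_even_power)
    fix r assume r: "s \<le> r" "r \<le> t"
    have "(\<integral>\<^sup>+\<omega>. ennreal (cmod ((F (sol s r z \<omega>))\<^sup>2 - (F (sol s r w \<omega>))\<^sup>2) ^ (2 * m)) \<partial>M)
       \<le> (\<integral>\<^sup>+\<omega>. ennreal ((2 * C) ^ (2 * m)) * ennreal (cmod (F (sol s r z \<omega>) - F (sol s r w \<omega>)) ^ (2 * m)) \<partial>M)"
    proof (rule nn_integral_mono)
      fix \<omega>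
      have "cmod (F (sol s r z \<omega>) + F (sol s r w \<omega>)) \<le> 2 * C"
        using norm_triangle_ineq[of "F (sol s r z \<omega>)" "F (sol s r w \<omega>)"] F_sol_bound[OF z, of s r \<omega>] F_sol_bound[OF w, of s r \<omega>]
        by linarith
      then have "cmod (F (sol s r z \<omega>) + F (sol s r w \<omega>)) * cmod (F (sol s r z \<omega>) - F (sol s r w \<omega>))
          \<le> 2 * C * cmod (F (sol s r z \<omega>) - F (sol s r w \<omega>))" by (rule mult_right_mono) simp
      moreover have "cmod ((F (sol s r z \<omega>))\<^sup>2 - (F (sol s r w \<omega>))\<^sup>2)
          = cmod (F (sol s r z \<omega>) + F (sol s r w \<omega>)) * cmod (F (sol s r z \<omega>) - F (sol s r w \<omega>))"
        by (simp add: norm_mult[symmetric] power2_eq_square algebra_simps)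
      ultimately have "cmod ((F (sol s r z \<omega>))\<^sup>2 - (F (sol s r w \<omega>))\<^sup>2) ^ (2 * m) \<le> (2 * C * cmod (F (sol s r z \<omega>) - F (sol s r w \<omega>))) ^ (2 * m)"
        by (intro power_mono) auto
      then show "ennreal (cmod ((F (sol s r z \<omega>))\<^sup>2 - (F (sol s r w \<omega>))\<^sup>2) ^ (2 * m))
          \<le> ennreal ((2 * C) ^ (2 * m)) * ennreal (cmod (F (sol s r z \<omega>) - F (sol s r w \<omega>)) ^ (2 * m))"
        by (simp add: ennreal_mult[symmetric] zero_le_even_power power_mult_distrib ennreal_leI)
    qed
    also have "\<dots> = ennreal ((2 * C) ^ (2 * m)) * (\<integral>\<^sup>+\<omega>. ennreal (cmod (F (sol s r z \<omega>) - F (sol s r w \<omega>)) ^ (2 * m)) \<partial>M)"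
      using measurable_Fil_M[OF _ meas(1)[OF r(1)]] r s by (intro nn_integral_cmult) auto
    also have "\<dots> \<le> ennreal ((2 * C) ^ (2 * m)) * ennreal b"
      using b(1)[OF r] by (intro mult_left_mono) auto
    finally show "(\<integral>\<^sup>+\<omega>. ennreal (cmod ((F (sol s r z \<omega>))\<^sup>2 - (F (sol s r w \<omega>))\<^sup>2) ^ (2 * m)) \<partial>M) \<le> ennreal ((2 * C) ^ (2 * m) * b)"
      using b(2) by (simp add: ennreal_mult[symmetric] zero_le_even_power)
  next
    show "AE \<omega> in M. (\<lambda>j. \<Sum>k<4 ^ j. ((F (sol s (node s t j k) z \<omega>))\<^sup>2 - (F (sol s (node s t j k) w \<omega>))\<^sup>2) * complex_of_real (mesh s t j))
        \<longlonglongrightarrow> Qv s t z \<omega> - Qv s t w \<omega>"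
      using ito_AE[OF s z] ito_AE[OF s w]
    proof eventually_elim
      case (elim \<omega>)
      from tendsto_diff[OF elim(1)[THEN conjunct2, THEN conjunct1] elim(2)[THEN conjunct2, THEN conjunct1]] show ?case
        by (simp add: left_diff_distrib sum_subtractf)
    qed
  qed
qed

lemma sol_increment_AE:
  assumes s: "0 \<le> s" "s \<le> t" and z: "0 < Im z"
  shows "AE \<omega> in M. cmod (sol s t z \<omega> - z) \<le> C * (t - s) + \<bar>B t \<omega> - B s \<omega>\<bar>"
  using AE_continuous_path
proof eventually_elim
  case (elim \<omega>)
  interpret driven_flow F C A \<alpha> "\<lambda>t. B t \<omega>" by (rule driven_flow_path[OF elim])
  show ?case using flow_increment_bound[of s s t z] sol_eq[OF elim s z] s z by simp
qed

text \<open>Ito's formula read as a bound: \<open>G\<close> is Lipschitz, the displacement of the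
  trajectory is under control and so is the integral of F^2; only the stochastic integral and the
  Brownian increment remain. The height of z has disappeared.\<close>

lemma Lv_bound_AE:
  assumes s: "0 \<le> s" "s < t" and z: "0 < Im z"
  shows "AE \<omega> in M. cmod (Lv s t z \<omega> + 2 * Mv s t z \<omega>) \<le> 4 * C\<^sup>2 * (t - s) + 2 * C * \<bar>B t \<omega> - B s \<omega>\<bar>"
  using ito_AE[OF s z] sol_increment_AE[OF s(1) less_imp_le[OF s(2)] z]
proof eventually_elim
  case (elim \<omega>)
  have "cmod (G (sol s t z \<omega>) - G z) \<le> C * cmod (sol s t z \<omega> - z)"
    using z sol_Im_ge[of z s t \<omega>] by (intro G_lip) linarith+
  also have "\<dots> \<le> C * (C * (t - s) + \<bar>B t \<omega> - B s \<omega>\<bar>)" using elim(2) C_ge by (intro mult_left_mono) auto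
  finally have 1: "cmod (G (sol s t z \<omega>) - G z) \<le> C * (C * (t - s) + \<bar>B t \<omega> - B s \<omega>\<bar>)" .
  have "Lv s t z \<omega> + 2 * Mv s t z \<omega> = 2 * ((G (sol s t z \<omega>) - G z) - Qv s t z \<omega>)"
    by (simp add: Lv_def algebra_simps)
  then have "cmod (Lv s t z \<omega> + 2 * Mv s t z \<omega>) \<le> 2 * (cmod (G (sol s t z \<omega>) - G z) + cmod (Qv s t z \<omega>))"
    by (simp only: norm_mult norm_numeral) (intro mult_left_mono norm_triangle_ineq4, simp)
  also have "\<dots> \<le> 2 * (C * (C * (t - s) + \<bar>B t \<omega> - B s \<omega>\<bar>) + C\<^sup>2 * (t - s))"
    using 1 elim(1) by simp
  finally show ?case by (simp add: power2_eq_square algebra_simps)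
qed

text \<open>A deterministic factor and four exponential moments: of \<theta> times the Brownian
  increment and of \<theta>' times the real part of \<open>Mv\<close>, with both signs. The choices
  \<theta> = 4pC and \<theta>' = 4p in \<open>exp_Lv_moment\<close> make \<theta>^2 / 2 and
  \<theta>'^2 C^2 / 2 both equal to 8 p^2 C^2.\<close>

definition deriv_const :: "nat \<Rightarrow> real" where
  "deriv_const p = exp (4 * real p * C\<^sup>2) * (4 * exp (8 * (real p)\<^sup>2 * C\<^sup>2))"

text \<open>The Brownian increment and the stochastic integral are dependent. Their contributions
  are separated by bounding the average of two exponents by the larger one, hence one exponential by
  a sum of four; this takes the place of the Cauchy-Schwarz inequality.\<close>

lemma exp_Lv_moment:
  assumes s: "0 \<le> s" "s < t" "t - s \<le> 1" and z: "0 < Im z"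
  shows "(\<integral>\<^sup>+\<omega>. ennreal (exp (Re (Lv s t z \<omega>)) ^ p) \<partial>M) \<le> ennreal (deriv_const p)"
proof -
  define a where "a = 4 * real p * C\<^sup>2"
  define \<theta> where "\<theta> = 4 * real p * C"
  define \<theta>' where "\<theta>' = 4 * real p"
  let ?D = "\<lambda>\<omega>. B t \<omega> - B s \<omega>" and ?R = "\<lambda>\<omega>. Re (Mv s t z \<omega>)"
  have [measurable]: "?D \<in> borel_measurable M"
    using increment_measurable[of s t] s by (intro measurable_Fil_M[of t]) auto
  have [measurable]: "Mv s t z \<in> borel_measurable M" by (rule Mv_measurable[OF s(1,2) z])
  have "(\<integral>\<^sup>+\<omega>. ennreal (exp (Re (Lv s t z \<omega>)) ^ p) \<partial>M)
      \<le> (\<integral>\<^sup>+\<omega>. ennreal (exp a) * (ennreal (exp (\<theta> * ?D \<omega>)) + ennreal (exp (- \<theta> * ?D \<omega>)) + ennreal (exp (\<theta>' * ?R \<omega>)) + ennreal (exp (- \<theta>' * ?R \<omega>))) \<partial>M)"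
  proof (rule nn_integral_mono_AE)
    show "AE \<omega> in M. ennreal (exp (Re (Lv s t z \<omega>)) ^ p)
      \<le> ennreal (exp a) * (ennreal (exp (\<theta> * ?D \<omega>)) + ennreal (exp (- \<theta> * ?D \<omega>)) + ennreal (exp (\<theta>' * ?R \<omega>)) + ennreal (exp (- \<theta>' * ?R \<omega>)))"
      using Lv_bound_AE[OF s(1,2) z]
    proof eventually_elim
      case (elim \<omega>)
      have "Re (Lv s t z \<omega>) + 2 * ?R \<omega> \<le> cmod (Lv s t z \<omega> + 2 * Mv s t z \<omega>)"
        using complex_Re_le_cmod[of "Lv s t z \<omega> + 2 * Mv s t z \<omega>"] by simp
      also note elim
      also have "4 * C\<^sup>2 * (t - s) + 2 * C * \<bar>?D \<omega>\<bar> \<le> 4 * C\<^sup>2 + 2 * C * \<bar>?D \<omega>\<bar>"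
        using s by (simp add: mult_left_le)
      finally have "Re (Lv s t z \<omega>) \<le> 4 * C\<^sup>2 + 2 * C * \<bar>?D \<omega>\<bar> + 2 * \<bar>?R \<omega>\<bar>" by linarith
      then have "real p * Re (Lv s t z \<omega>) \<le> real p * (4 * C\<^sup>2 + 2 * C * \<bar>?D \<omega>\<bar> + 2 * \<bar>?R \<omega>\<bar>)"
        by (rule mult_left_mono) simp
      also have "\<dots> = a + (\<bar>\<theta> * ?D \<omega>\<bar> + \<bar>\<theta>' * ?R \<omega>\<bar>) / 2"
      proof -
        have "\<bar>\<theta> * ?D \<omega>\<bar> = 4 * real p * C * \<bar>?D \<omega>\<bar>" "\<bar>\<theta>' * ?R \<omega>\<bar> = 4 * real p * \<bar>?R \<omega>\<bar>"
          using C_ge by (simp_all add: \<theta>_def \<theta>'_def abs_mult)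
        then show ?thesis by (simp add: a_def algebra_simps)
      qed
      also have "\<dots> \<le> a + max \<bar>\<theta> * ?D \<omega>\<bar> \<bar>\<theta>' * ?R \<omega>\<bar>" by simp
      finally have "exp (real p * Re (Lv s t z \<omega>)) \<le> exp (a + max \<bar>\<theta> * ?D \<omega>\<bar> \<bar>\<theta>' * ?R \<omega>\<bar>)" by simp
      also have "\<dots> = exp a * exp (max \<bar>\<theta> * ?D \<omega>\<bar> \<bar>\<theta>' * ?R \<omega>\<bar>)" by (rule exp_add)
      also have "exp (max \<bar>\<theta> * ?D \<omega>\<bar> \<bar>\<theta>' * ?R \<omega>\<bar>) \<le> exp (\<theta> * ?D \<omega>) + exp (- \<theta> * ?D \<omega>) + exp (\<theta>' * ?R \<omega>) + exp (- \<theta>' * ?R \<omega>)"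
      proof -
        have "exp \<bar>x\<bar> \<le> exp x + exp (- x)" for x :: real by (auto simp: abs_if)
        note this[of "\<theta> * ?D \<omega>"] this[of "\<theta>' * ?R \<omega>"]
        then show ?thesis using
          exp_ge_zero[of "\<theta> * ?D \<omega>"] exp_ge_zero[of "- (\<theta> * ?D \<omega>)"]
          exp_ge_zero[of "\<theta>' * ?R \<omega>"] exp_ge_zero[of "- (\<theta>' * ?R \<omega>)"]
          unfolding max_def mult_minus_left by (simp del: exp_ge_zero)
      qed
      finally show ?case
        by (simp add: exp_of_nat_mult ennreal_plus[symmetric] ennreal_mult[symmetric] ennreal_leI del: ennreal_plus)
    qed
  qed
  also have "\<dots> = ennreal (exp a) * ((\<integral>\<^sup>+\<omega>. ennreal (exp (\<theta> * ?D \<omega>)) \<partial>M) + (\<integral>\<^sup>+\<omega>. ennreal (exp (- \<theta> * ?D \<omega>)) \<partial>M)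
      + (\<integral>\<^sup>+\<omega>. ennreal (exp (\<theta>' * ?R \<omega>)) \<partial>M) + (\<integral>\<^sup>+\<omega>. ennreal (exp (- \<theta>' * ?R \<omega>)) \<partial>M))"
    by (simp add: nn_integral_cmult nn_integral_add)
  also have "\<dots> \<le> ennreal (exp a) * (ennreal (exp (8 * (real p)\<^sup>2 * C\<^sup>2)) + ennreal (exp (8 * (real p)\<^sup>2 * C\<^sup>2))
      + ennreal (exp (8 * (real p)\<^sup>2 * C\<^sup>2)) + ennreal (exp (8 * (real p)\<^sup>2 * C\<^sup>2)))"
  proof -
    have le: "exp ((t - s) * x / 2) \<le> exp (x / 2)" if "0 \<le> x" for x
      using s that by (simp add: mult_left_le_one_le)
    have 1: "ennreal (exp ((t - s) * \<theta>\<^sup>2 / 2)) \<le> ennreal (exp (8 * (real p)\<^sup>2 * C\<^sup>2))"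
      using le[of "\<theta>\<^sup>2"] by (intro ennreal_leI) (simp add: \<theta>_def power_mult_distrib mult_ac)
    have 2: "ennreal (exp ((t - s) * \<theta>'\<^sup>2 * C\<^sup>2 / 2)) \<le> ennreal (exp (8 * (real p)\<^sup>2 * C\<^sup>2))"
      using le[of "\<theta>'\<^sup>2 * C\<^sup>2"] by (intro ennreal_leI) (simp add: \<theta>'_def power_mult_distrib mult_ac)
    show ?thesis
      using increment_exp[OF s(1,2), of \<theta>] increment_exp[OF s(1,2), of "- \<theta>"]
        Mv_exp[OF s(1,2) z, of \<theta>'] Mv_exp[OF s(1,2) z, of "- \<theta>'"] 1 2
      by (intro mult_left_mono add_mono) (auto intro: order_trans)
  qed
  also have "\<dots> = ennreal (deriv_const p)"
    by (simp add: deriv_const_def a_def ennreal_plus[symmetric] ennreal_mult[symmetric] del: ennreal_plus)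
  finally show ?thesis .
qed

text \<open>Summing over finitely many points of the segment from z to w, instead of integrating
  \<phi>' along it, avoids joint measurability in the point. The number n of pieces depends on the
  height, but only an average over the pieces enters the bound, so n disappears on taking
  expectations.\<close>

lemma flow_difference_AE:
  assumes s: "0 \<le> s" "s < t" and z: "0 < Im z" and w: "0 < Im w" and p: "even p"
  obtains n :: nat where "0 < n" "AE \<omega> in M. cmod (sol s t z \<omega> - sol s t w \<omega>) ^ p
    \<le> cmod (z - w) ^ p / real n * (\<Sum>k<n. 2 ^ p * (exp (Re (Lv s t (z + of_real (real k / real n) * (w - z)) \<omega>)) ^ p + 1))"
proof -
  define y where "y = min (Im z) (Im w)"
  have y: "0 < y" using z w by (simp add: y_def)
  define K where "K = 4 * K2 y * (t - s) * exp (6 * K1 y * (t - s))"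
  have K: "0 \<le> K" using s K2_pos[OF y] by (simp add: K_def)
  \<comment> \<open>Large enough that the quadratic Taylor error of a piece is at most its length;
    this is the summand 1 next to exp(Re L).\<close>
  obtain n :: nat where n: "K * cmod (w - z) < real n" "0 < n"
    by (metis reals_Archimedean2 gr0I less_le_trans mult_nonneg_nonneg K norm_ge_zero of_nat_0 not_le)
  define \<zeta> where "\<zeta> k = z + of_real (real k / real n) * (w - z)" for k :: nat
  have \<zeta>_Im: "y \<le> Im (\<zeta> k)" if "k \<le> n" for k
  proof -
    have "real k / real n \<in> {0..1}" using that n by auto
    then have "\<zeta> k \<in> closed_segment z w" unfolding \<zeta>_def by (rule affine_in_closed_segment)
    moreover have "closed_segment z w \<subseteq> {v. y \<le> Im v}"
      by (rule closed_segment_subset) (auto simp: y_def convex_Im_ge)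
    ultimately show ?thesis by auto
  qed
  then have \<zeta>_H: "0 < Im (\<zeta> k)" if "k \<le> n" for k using that y by (meson less_le_trans)
  have d\<zeta>: "\<zeta> (Suc k) - \<zeta> k = (w - z) / of_nat n" for k
    by (simp add: \<zeta>_def add_divide_distrib algebra_simps)
  have ends: "\<zeta> 0 = z" "\<zeta> n = w" using n by (auto simp: \<zeta>_def)
  have "AE \<omega> in M. \<forall>k\<in>{..<n}. Lv s t (\<zeta> k) \<omega> = path_logderiv \<omega> s t (\<zeta> k)"
    by (rule AE_finite_allI) (use ito_AE[OF s \<zeta>_H] in \<open>auto elim!: AE_mp intro!: AE_I2\<close>)
  with AE_continuous_path have "AE \<omega> in M. cmod (sol s t z \<omega> - sol s t w \<omega>) ^ p
    \<le> cmod (z - w) ^ p / real n * (\<Sum>k<n. 2 ^ p * (exp (Re (Lv s t (\<zeta> k) \<omega>)) ^ p + 1))"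
  proof eventually_elim
    case (elim \<omega>)
    interpret driven_flow F C A \<alpha> "\<lambda>t. B t \<omega>" by (rule driven_flow_path[OF elim(1)])
    have step: "cmod (\<phi> s t (\<zeta> (Suc k)) - \<phi> s t (\<zeta> k)) \<le> cmod (w - z) / real n * (exp (Re (Lv s t (\<zeta> k) \<omega>)) + 1)"
      if "k < n" for k
    proof -
      let ?d = "cmod (w - z) / real n"
      have d: "cmod (\<zeta> (Suc k) - \<zeta> k) = ?d" by (simp add: d\<zeta> norm_divide)
      have "cmod (\<phi> s t (\<zeta> (Suc k)) - \<phi> s t (\<zeta> k) - (\<zeta> (Suc k) - \<zeta> k) * exp (logderiv s t (\<zeta> k))) \<le> K * ?d ^ 2"
        unfolding K_def d[symmetric] using s y that \<zeta>_Im by (intro flow_taylor) auto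
      also have "K * ?d ^ 2 \<le> ?d"
      proof -
        have "K * ?d \<le> 1" using n by (simp add: divide_le_eq)
        then have "(K * ?d) * ?d \<le> 1 * ?d" by (rule mult_right_mono) auto
        then show ?thesis by (simp add: power2_eq_square mult_ac)
      qed
      finally have 1: "cmod (\<phi> s t (\<zeta> (Suc k)) - \<phi> s t (\<zeta> k) - (\<zeta> (Suc k) - \<zeta> k) * exp (logderiv s t (\<zeta> k))) \<le> ?d" .
      have 2: "cmod ((\<zeta> (Suc k) - \<zeta> k) * exp (logderiv s t (\<zeta> k))) = ?d * exp (Re (Lv s t (\<zeta> k) \<omega>))"
        using elim(2) that by (simp add: norm_mult d norm_exp_eq_Re)
      show ?thesis
        using 1 2 norm_triangle_sub[of "\<phi> s t (\<zeta> (Suc k)) - \<phi> s t (\<zeta> k)" "(\<zeta> (Suc k) - \<zeta> k) * exp (logderiv s t (\<zeta> k))"]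
        by (simp add: distrib_left)
    qed
    have "cmod (\<phi> s t w - \<phi> s t z) = cmod (\<Sum>k<n. \<phi> s t (\<zeta> (Suc k)) - \<phi> s t (\<zeta> k))"
      using sum_lessThan_telescope[of "\<lambda>k. \<phi> s t (\<zeta> k)" n] by (simp only: ends)
    also have "\<dots> \<le> (\<Sum>k<n. cmod (w - z) / real n * (exp (Re (Lv s t (\<zeta> k) \<omega>)) + 1))"
      by (intro sum_norm_le step) auto
    finally have "cmod (\<phi> s t w - \<phi> s t z) ^ p \<le> (\<Sum>k<n. cmod (w - z) / real n * (exp (Re (Lv s t (\<zeta> k) \<omega>)) + 1)) ^ p"
      by (intro power_mono) auto
    also have "\<dots> \<le> real n ^ p / real n * (\<Sum>k<n. (cmod (w - z) / real n * (exp (Re (Lv s t (\<zeta> k) \<omega>)) + 1)) ^ p)"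
      by (rule power_mean_sum_le[OF p n(2)])
    also have "\<dots> = cmod (w - z) ^ p / real n * (\<Sum>k<n. (exp (Re (Lv s t (\<zeta> k) \<omega>)) + 1) ^ p)"
      using n(2) by (simp add: power_mult_distrib power_divide sum_distrib_left)
    also have "\<dots> \<le> cmod (w - z) ^ p / real n * (\<Sum>k<n. 2 ^ p * (exp (Re (Lv s t (\<zeta> k) \<omega>)) ^ p + 1 ^ p))"
      by (intro mult_left_mono sum_mono power_sum2_le) auto
    finally show ?case
      using sol_eq[OF elim(1)] s z w by (simp add: norm_minus_commute)
  qed
  with n(2) show thesis unfolding \<zeta>_def by (rule that)
qed

definition lip_const :: "nat \<Rightarrow> real" where
  "lip_const p = 2 ^ p * (deriv_const p + 1)"

lemma deriv_const_nonneg: "0 \<le> deriv_const p"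
  by (simp add: deriv_const_def)

lemma lip_const_ge_1: "1 \<le> lip_const p"
proof -
  have "1 * 1 \<le> 2 ^ p * (deriv_const p + 1)"
    using deriv_const_nonneg by (intro mult_mono) auto
  then show ?thesis by (simp add: lip_const_def)
qed

text \<open>An average of moments, each at most \<open>deriv_const p\<close>, so that neither n nor
  the height survives: in the mean of order p the flow is Lipschitz up to the boundary.\<close>

lemma sol_difference_moment:
  assumes s: "0 \<le> s" "s \<le> t" "t - s \<le> 1" and z: "0 < Im z" and w: "0 < Im w" and p: "even p"
  shows "(\<integral>\<^sup>+\<omega>. ennreal (cmod (sol s t z \<omega> - sol s t w \<omega>) ^ p) \<partial>M) \<le> ennreal (lip_const p * cmod (z - w) ^ p)"
proof (cases "s = t")
  case True
  have "AE \<omega> in M. cmod (sol s t z \<omega> - sol s t w \<omega>) ^ p = cmod (z - w) ^ p"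
    using AE_continuous_path
  proof eventually_elim
    case (elim \<omega>)
    interpret driven_flow F C A \<alpha> "\<lambda>t. B t \<omega>" by (rule driven_flow_path[OF elim])
    show ?case using sol_eq[OF elim] s z w True by simp
  qed
  then have "(\<integral>\<^sup>+\<omega>. ennreal (cmod (sol s t z \<omega> - sol s t w \<omega>) ^ p) \<partial>M) = (\<integral>\<^sup>+\<omega>. ennreal (cmod (z - w) ^ p) \<partial>M)"
    by (intro nn_integral_cong_AE) auto
  also have "\<dots> \<le> ennreal (lip_const p * cmod (z - w) ^ p)"
    using mult_right_mono[OF lip_const_ge_1, of "cmod (z - w) ^ p" p] by (auto simp: emeasure_space_1 intro!: ennreal_leI)
  finally show ?thesis .
next
  case False
  then have st: "s < t" using s by simp
  obtain n :: nat where n: "0 < n" and ae: "AE \<omega> in M. cmod (sol s t z \<omega> - sol s t w \<omega>) ^ p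
    \<le> cmod (z - w) ^ p / real n * (\<Sum>k<n. 2 ^ p * (exp (Re (Lv s t (z + of_real (real k / real n) * (w - z)) \<omega>)) ^ p + 1))"
    using flow_difference_AE[OF s(1) st z w p] .
  define \<zeta> where "\<zeta> k = z + of_real (real k / real n) * (w - z)" for k :: nat
  have \<zeta>_H: "0 < Im (\<zeta> k)" if "k < n" for k
  proof -
    have "real k / real n \<in> {0..1}" using that n by auto
    then have "\<zeta> k \<in> closed_segment z w" unfolding \<zeta>_def by (rule affine_in_closed_segment)
    moreover have "closed_segment z w \<subseteq> upper_half_plane"
      by (rule closed_segment_subset[OF _ _ convex_H]) (use z w in auto)
    ultimately show ?thesis by auto
  qed
  define c where "c = cmod (z - w) ^ p / real n"
  have c: "0 \<le> c" by (simp add: c_def)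
  have [measurable]: "(\<lambda>\<omega>. exp (Re (Lv s t (\<zeta> k) \<omega>)) ^ p) \<in> borel_measurable M" if "k < n" for k
    using Lv_measurable[OF s(1) st \<zeta>_H[OF that]] by measurable
  have "(\<integral>\<^sup>+\<omega>. ennreal (cmod (sol s t z \<omega> - sol s t w \<omega>) ^ p) \<partial>M)
      \<le> (\<integral>\<^sup>+\<omega>. (\<Sum>k<n. ennreal (c * 2 ^ p) * (ennreal (exp (Re (Lv s t (\<zeta> k) \<omega>)) ^ p) + 1)) \<partial>M)"
  proof (rule nn_integral_mono_AE)
    show "AE \<omega> in M. ennreal (cmod (sol s t z \<omega> - sol s t w \<omega>) ^ p)
      \<le> (\<Sum>k<n. ennreal (c * 2 ^ p) * (ennreal (exp (Re (Lv s t (\<zeta> k) \<omega>)) ^ p) + 1))"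
      using ae
    proof eventually_elim
      case (elim \<omega>)
      have "ennreal (cmod (sol s t z \<omega> - sol s t w \<omega>) ^ p) \<le> ennreal (\<Sum>k<n. c * 2 ^ p * (exp (Re (Lv s t (\<zeta> k) \<omega>)) ^ p + 1))"
        using elim by (intro ennreal_leI) (simp add: c_def \<zeta>_def sum_distrib_left mult.assoc)
      also have "\<dots> = (\<Sum>k<n. ennreal (c * 2 ^ p * (exp (Re (Lv s t (\<zeta> k) \<omega>)) ^ p + 1)))"
        using c by (intro sum_ennreal[symmetric]) auto
      also have "\<dots> = (\<Sum>k<n. ennreal (c * 2 ^ p) * (ennreal (exp (Re (Lv s t (\<zeta> k) \<omega>)) ^ p) + 1))"
        using c by (simp add: ennreal_mult)
      finally show ?case .
    qed
  qed
  also have "\<dots> = (\<Sum>k<n. ennreal (c * 2 ^ p) * ((\<integral>\<^sup>+\<omega>. ennreal (exp (Re (Lv s t (\<zeta> k) \<omega>)) ^ p) \<partial>M) + 1))"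
    by (subst nn_integral_sum) (auto intro!: sum.cong simp: nn_integral_cmult nn_integral_add emeasure_space_1)
  also have "\<dots> \<le> (\<Sum>k<n. ennreal (c * 2 ^ p) * (ennreal (deriv_const p) + 1))"
    by (intro sum_mono mult_left_mono add_mono exp_Lv_moment[OF s(1) st s(3)] \<zeta>_H) auto
  also have "\<dots> = (\<Sum>k<n. ennreal (c * lip_const p))"
    using c deriv_const_nonneg[of p] by (simp add: lip_const_def ennreal_mult mult.assoc)
  also have "\<dots> = ennreal (\<Sum>k<n. c * lip_const p)"
    using c lip_const_ge_1[of p] by (intro sum_ennreal) auto
  also have "(\<Sum>k<n. c * lip_const p) = lip_const p * cmod (z - w) ^ p" using n by (simp add: c_def)
  finally show ?thesis .
qed

text \<open>Hoelder continuity of F asks for moments of |Z - W|^(\<alpha> p). With \<rho> the ratio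
  of |Z - W| to |z - w|, \<rho>^(\<alpha> p) is at most 1 + \<rho>^p, which reduces them to the
  moment of order p.\<close>

lemma F_sol_difference_moment:
  assumes s: "0 \<le> s" "s \<le> t" "t - s \<le> 1" and z: "0 < Im z" and w: "0 < Im w" and p: "even p" "0 < p"
  shows "(\<integral>\<^sup>+\<omega>. ennreal (cmod (F (sol s t z \<omega>) - F (sol s t w \<omega>)) ^ p) \<partial>M)
    \<le> ennreal (A ^ p * (1 + lip_const p) * cmod (z - w) powr (\<alpha> * real p))"
proof (cases "z = w")
  case True then show ?thesis using p by simp
next
  case False
  then have d: "0 < cmod (z - w)" by simp
  define D where "D = A ^ p * cmod (z - w) powr (\<alpha> * real p)"
  have D: "0 \<le> D" using A_ge by (simp add: D_def)
  have [measurable]: "sol s t z \<in> borel_measurable M" "sol s t w \<in> borel_measurable M"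
    using sol_measurable_M[OF s(1,2)] z w by auto
  have pt: "cmod (F u - F v) ^ p \<le> D * (1 + cmod (u - v) ^ p / cmod (z - w) ^ p)" if "0 < Im u" "0 < Im v" for u v
  proof -
    define \<rho> where "\<rho> = cmod (u - v) / cmod (z - w)"
    have \<rho>: "0 \<le> \<rho>" "cmod (u - v) = \<rho> * cmod (z - w)" using d by (auto simp: \<rho>_def)
    have "cmod (F u - F v) ^ p \<le> (A * cmod (u - v) powr \<alpha>) ^ p"
      using F_holder[OF that] by (intro power_mono) auto
    also have "\<dots> = A ^ p * (\<rho> powr \<alpha>) ^ p * (cmod (z - w) powr \<alpha>) ^ p"
      using \<rho> d by (simp add: powr_mult power_mult_distrib)
    also have "\<dots> = D * (\<rho> powr \<alpha>) ^ p"
      using d by (simp add: D_def powr_powr[symmetric] powr_realpow)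
    also have "(\<rho> powr \<alpha>) ^ p \<le> 1 + \<rho> ^ p"
    proof (cases "\<rho> \<le> 1")
      case True
      then have "(\<rho> powr \<alpha>) ^ p \<le> 1" using \<rho>(1) \<alpha>_pos by (intro power_le_one powr_le1) auto
      then show ?thesis using \<rho>(1) by (simp add: add_increasing2)
    next
      case False
      then have "\<rho> powr \<alpha> \<le> \<rho> powr 1" using \<alpha>_le by (intro powr_mono) auto
      then have "(\<rho> powr \<alpha>) ^ p \<le> \<rho> ^ p" using False by (intro power_mono) auto
      then show ?thesis by simp
    qed
    finally show ?thesis using D by (simp add: \<rho>_def power_divide mult_left_mono)
  qed
  have "(\<integral>\<^sup>+\<omega>. ennreal (cmod (F (sol s t z \<omega>) - F (sol s t w \<omega>)) ^ p) \<partial>M)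
      \<le> (\<integral>\<^sup>+\<omega>. ennreal D + ennreal (D / cmod (z - w) ^ p) * ennreal (cmod (sol s t z \<omega> - sol s t w \<omega>) ^ p) \<partial>M)"
  proof (rule nn_integral_mono)
    fix \<omega>
    have "0 < Im (sol s t z \<omega>)" "0 < Im (sol s t w \<omega>)"
      using sol_Im_ge[of z s t \<omega>] sol_Im_ge[of w s t \<omega>] z w by linarith+
    from pt[OF this] show "ennreal (cmod (F (sol s t z \<omega>) - F (sol s t w \<omega>)) ^ p)
        \<le> ennreal D + ennreal (D / cmod (z - w) ^ p) * ennreal (cmod (sol s t z \<omega> - sol s t w \<omega>) ^ p)"
      using D by (simp add: ennreal_mult[symmetric] ennreal_plus[symmetric] ennreal_leI distrib_left del: ennreal_plus)
  qed
  also have "\<dots> = ennreal D + ennreal (D / cmod (z - w) ^ p) * (\<integral>\<^sup>+\<omega>. ennreal (cmod (sol s t z \<omega> - sol s t w \<omega>) ^ p) \<partial>M)"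
    by (simp add: nn_integral_add nn_integral_cmult emeasure_space_1)
  also have "\<dots> \<le> ennreal D + ennreal (D / cmod (z - w) ^ p) * ennreal (lip_const p * cmod (z - w) ^ p)"
    by (intro add_left_mono mult_left_mono sol_difference_moment s z w p) auto
  also have "\<dots> = ennreal (D + D / cmod (z - w) ^ p * (lip_const p * cmod (z - w) ^ p))"
    using D lip_const_ge_1[of p] by (simp add: ennreal_mult[symmetric] ennreal_plus[symmetric] del: ennreal_plus)
  also have "D + D / cmod (z - w) ^ p * (lip_const p * cmod (z - w) ^ p) = A ^ p * (1 + lip_const p) * cmod (z - w) powr (\<alpha> * real p)"
    using d by (simp add: D_def algebra_simps)
  finally show ?thesis .
qed

text \<open>The stochastic integral and the Brownian increment give (t - s)^m; the drift term gives
  (t - s)^(2m), which is no larger because t - s is at most 1.\<close>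

lemma Lv_moment:
  assumes m: "1 \<le> m"
  obtains K where "0 \<le> K" "\<And>s t z. 0 \<le> s \<Longrightarrow> s < t \<Longrightarrow> t - s \<le> 1 \<Longrightarrow> 0 < Im z \<Longrightarrow>
    (\<integral>\<^sup>+\<omega>. ennreal (cmod (Lv s t z \<omega>) ^ (2 * m)) \<partial>M) \<le> ennreal (K * (t - s) ^ m)"
proof -
  define p where "p = 2 * m"
  define a where "a = 4 ^ p * (4 * C\<^sup>2) ^ p"
  define b where "b = 4 ^ p * (2 * C) ^ p"
  define c where "c = 2 ^ p * (2 ^ p :: real)"
  define K where "K = a + b * bdg m + c * (2 ^ p * 2 * (bdg m * C ^ p))"
  have nn: "0 \<le> a" "0 \<le> b" "0 \<le> c" using C_ge by (auto simp: a_def b_def c_def)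
  show thesis
  proof
    show "0 \<le> K" using nn bdg_nonneg[of m] C_ge by (auto simp: K_def)
    fix s t :: real and z :: complex
    assume s: "0 \<le> s" "s < t" "t - s \<le> 1" and z: "0 < Im z"
    have [measurable]: "(\<lambda>\<omega>. B t \<omega> - B s \<omega>) \<in> borel_measurable M"
      using increment_measurable[of s t] s by (intro measurable_Fil_M[of t]) auto
    have [measurable]: "Mv s t z \<in> borel_measurable M" by (rule Mv_measurable[OF s(1,2) z])
    have "(\<integral>\<^sup>+\<omega>. ennreal (cmod (Lv s t z \<omega>) ^ p) \<partial>M)
        \<le> (\<integral>\<^sup>+\<omega>. ennreal (a * (t - s) ^ m) + ennreal b * ennreal ((B t \<omega> - B s \<omega>) ^ p) + ennreal c * ennreal (cmod (Mv s t z \<omega>) ^ p) \<partial>M)"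
    proof (rule nn_integral_mono_AE)
      show "AE \<omega> in M. ennreal (cmod (Lv s t z \<omega>) ^ p)
        \<le> ennreal (a * (t - s) ^ m) + ennreal b * ennreal ((B t \<omega> - B s \<omega>) ^ p) + ennreal c * ennreal (cmod (Mv s t z \<omega>) ^ p)"
        using Lv_bound_AE[OF s(1,2) z]
      proof eventually_elim
        case (elim \<omega>)
        let ?u = "4 * C\<^sup>2 * (t - s)" and ?v = "2 * C * \<bar>B t \<omega> - B s \<omega>\<bar>" and ?w = "2 * cmod (Mv s t z \<omega>)"
        have nn': "0 \<le> ?u" "0 \<le> ?v" "0 \<le> ?w" using s C_ge by auto
        have "cmod (Lv s t z \<omega>) \<le> (?u + ?v) + ?w"
          using elim norm_triangle_ineq4[of "Lv s t z \<omega> + 2 * Mv s t z \<omega>" "2 * Mv s t z \<omega>"] by (simp add: norm_mult)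
        then have "cmod (Lv s t z \<omega>) ^ p \<le> ((?u + ?v) + ?w) ^ p" by (rule power_mono) simp
        also have "\<dots> \<le> 2 ^ p * ((?u + ?v) ^ p + ?w ^ p)" using nn' by (intro power_sum2_le) auto
        also have "\<dots> \<le> 2 ^ p * (2 ^ p * (?u ^ p + ?v ^ p) + ?w ^ p)"
          using nn' by (intro mult_left_mono add_right_mono power_sum2_le) auto
        also have "\<dots> = a * (t - s) ^ p + b * (B t \<omega> - B s \<omega>) ^ p + c * cmod (Mv s t z \<omega>) ^ p"
        proof -
          have "(2::real) ^ p * 2 ^ p = 4 ^ p" by (simp flip: power_mult_distrib)
          then show ?thesis
            by (simp add: a_def b_def c_def power_mult_distrib p_def power_even_abs distrib_left mult.assoc[symmetric])
        qed
        also have "\<dots> \<le> a * (t - s) ^ m + b * (B t \<omega> - B s \<omega>) ^ p + c * cmod (Mv s t z \<omega>) ^ p"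
          using s nn by (intro add_right_mono mult_left_mono power_decreasing) (auto simp: p_def)
        finally show ?case
          using nn s by (simp add: ennreal_mult[symmetric] ennreal_plus[symmetric] ennreal_leI p_def zero_le_even_power del: ennreal_plus)
      qed
    qed
    also have "\<dots> = ennreal (a * (t - s) ^ m) + ennreal b * (\<integral>\<^sup>+\<omega>. ennreal ((B t \<omega> - B s \<omega>) ^ p) \<partial>M)
        + ennreal c * (\<integral>\<^sup>+\<omega>. ennreal (cmod (Mv s t z \<omega>) ^ p) \<partial>M)"
      by (simp add: nn_integral_add nn_integral_cmult emeasure_space_1)
    also have "\<dots> \<le> ennreal (a * (t - s) ^ m) + ennreal b * ennreal (bdg m * (t - s) ^ m)
        + ennreal c * ennreal (2 ^ p * 2 * (bdg m * (t - s) ^ m * C ^ p))"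
      unfolding p_def by (intro add_mono mult_left_mono increment_moment Mv_moment s z m) auto
    also have "\<dots> = ennreal (K * (t - s) ^ m)"
      using nn s bdg_nonneg[of m] C_ge
      by (simp add: ennreal_mult[symmetric] ennreal_plus[symmetric] K_def algebra_simps del: ennreal_plus)
    finally show "(\<integral>\<^sup>+\<omega>. ennreal (cmod (Lv s t z \<omega>) ^ (2 * m)) \<partial>M) \<le> ennreal (K * (t - s) ^ m)" by (simp add: p_def)
  qed
qed

text \<open>Ito's formula for both points, subtracted. The integrand of the stochastic integral
  becomes F(Z) - F(W), of order |z - w|^\<alpha> in mean, while the terms in \<open>G\<close> are
  even of order |z - w|.\<close>

lemma Lv_difference_moment:
  assumes m: "1 \<le> m"
  obtains K where "0 \<le> K" "\<And>s t z w. 0 \<le> s \<Longrightarrow> s < t \<Longrightarrow> t - s \<le> 1 \<Longrightarrow> 0 < Im z \<Longrightarrow> 0 < Im w \<Longrightarrow> cmod (z - w) \<le> 2 \<Longrightarrow>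
    (\<integral>\<^sup>+\<omega>. ennreal (cmod (Lv s t z \<omega> - Lv s t w \<omega>) ^ (2 * m)) \<partial>M) \<le> ennreal (K * cmod (z - w) powr (\<alpha> * real (2 * m)))"
proof -
  define p where "p = 2 * m"
  have p: "even p" "0 < p" using m by (auto simp: p_def)
  define a where "a = 8 ^ p * C ^ p"
  define b where "b = A ^ p * (1 + lip_const p)"
  define K where "K = a * lip_const p * 2 ^ p + a * 2 ^ p + 8 ^ p * (2 ^ p * 2 * ((2 * C) ^ p * b)) + 8 ^ p * (2 ^ p * 2 * (bdg m * b))"
  have nn: "0 \<le> a" "0 \<le> b" "0 \<le> lip_const p" "0 \<le> bdg m"
    using C_ge A_ge lip_const_ge_1[of p] bdg_nonneg[of m] by (auto simp: a_def b_def)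
  show thesis
  proof
    show "0 \<le> K" using nn C_ge by (auto simp: K_def)
    fix s t :: real and z w :: complex
    assume s: "0 \<le> s" "s < t" "t - s \<le> 1" and z: "0 < Im z" and w: "0 < Im w" and zw: "cmod (z - w) \<le> 2"
    define d where "d = cmod (z - w) powr (\<alpha> * real p)"
    have d: "0 \<le> d" by (simp add: d_def)
    \<comment> \<open>The bound 2 is the estimate for the distance of neighbouring grid points of
      level 0. Halving gives a base at most 1, for which the exponent may be lowered from p to
      \<alpha> p.\<close>
    have dp: "cmod (z - w) ^ p \<le> 2 ^ p * d"
    proof (cases "z = w")
      case True then show ?thesis using p by (simp add: d_def zero_power)
    next
      case False
      then have pos: "0 < cmod (z - w) / 2" by simp
      have le1: "cmod (z - w) / 2 \<le> 1" using zw by simp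
      have "(cmod (z - w) / 2) ^ p = (cmod (z - w) / 2) powr (real p)" using pos by (simp add: powr_realpow)
      also have "\<dots> \<le> (cmod (z - w) / 2) powr (\<alpha> * real p)"
        using \<alpha>_le p le1 pos by (intro powr_mono') (auto simp: mult_left_le_one_le \<alpha>_pos less_imp_le)
      also have "\<dots> \<le> d" unfolding d_def using \<alpha>_pos by (intro powr_mono2) auto
      finally show ?thesis by (simp add: power_divide field_simps)
    qed
    have [measurable]: "sol s t z \<in> borel_measurable M" "sol s t w \<in> borel_measurable M"
      "Mv s t z \<in> borel_measurable M" "Mv s t w \<in> borel_measurable M"
      "Qv s t z \<in> borel_measurable M" "Qv s t w \<in> borel_measurable M"
      using sol_measurable_M s z w Mv_measurable Qv_measurable by auto
    have "(\<integral>\<^sup>+\<omega>. ennreal (cmod (Lv s t z \<omega> - Lv s t w \<omega>) ^ p) \<partial>M)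
        \<le> (\<integral>\<^sup>+\<omega>. ennreal a * ennreal (cmod (sol s t z \<omega> - sol s t w \<omega>) ^ p) + ennreal (a * 2 ^ p * d)
          + ennreal (8 ^ p) * ennreal (cmod (Qv s t z \<omega> - Qv s t w \<omega>) ^ p) + ennreal (8 ^ p) * ennreal (cmod (Mv s t z \<omega> - Mv s t w \<omega>) ^ p) \<partial>M)"
    proof (rule nn_integral_mono)
      fix \<omega>
      let ?x = "C * cmod (sol s t z \<omega> - sol s t w \<omega>)" and ?y = "C * cmod (z - w)"
        and ?q = "cmod (Qv s t z \<omega> - Qv s t w \<omega>)" and ?r = "cmod (Mv s t z \<omega> - Mv s t w \<omega>)"
      have nn': "0 \<le> ?x" "0 \<le> ?y" "0 \<le> ?q" "0 \<le> ?r" using C_ge by auto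
      have "0 < Im (sol s t z \<omega>)" "0 < Im (sol s t w \<omega>)"
        using sol_Im_ge[of z s t \<omega>] sol_Im_ge[of w s t \<omega>] z w by linarith+
      then have g1: "cmod (G (sol s t z \<omega>) - G (sol s t w \<omega>)) \<le> ?x" and g2: "cmod (G z - G w) \<le> ?y"
        using G_lip z w by auto
      have eq: "Lv s t z \<omega> - Lv s t w \<omega> = 2 * (((G (sol s t z \<omega>) - G (sol s t w \<omega>)) - (G z - G w))
          - ((Qv s t z \<omega> - Qv s t w \<omega>) + (Mv s t z \<omega> - Mv s t w \<omega>)))"
        by (simp add: Lv_def algebra_simps)
      have "cmod (Lv s t z \<omega> - Lv s t w \<omega>) = 2 * cmod (((G (sol s t z \<omega>) - G (sol s t w \<omega>)) - (G z - G w))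
          - ((Qv s t z \<omega> - Qv s t w \<omega>) + (Mv s t z \<omega> - Mv s t w \<omega>)))"
        unfolding eq by (simp only: norm_mult norm_numeral)
      also have "\<dots> \<le> 2 * ((?x + ?y) + (?q + ?r))"
        by (rule mult_left_mono[OF order_trans[OF norm_triangle_ineq4 add_mono[OF
              order_trans[OF norm_triangle_ineq4 add_mono[OF g1 g2]] norm_triangle_ineq]]]) simp
      finally have "cmod (Lv s t z \<omega> - Lv s t w \<omega>) ^ p \<le> (2 * ((?x + ?y) + (?q + ?r))) ^ p" by (rule power_mono) simp
      also have "\<dots> = 2 ^ p * ((?x + ?y) + (?q + ?r)) ^ p" by (rule power_mult_distrib)
      also have "\<dots> \<le> 2 ^ p * (2 ^ p * ((?x + ?y) ^ p + (?q + ?r) ^ p))"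
        using nn' by (intro mult_left_mono power_sum2_le) auto
      also have "\<dots> \<le> 2 ^ p * (2 ^ p * (2 ^ p * (?x ^ p + ?y ^ p) + 2 ^ p * (?q ^ p + ?r ^ p)))"
        using nn' by (intro mult_left_mono add_mono power_sum2_le) auto
      also have "\<dots> = 8 ^ p * (?x ^ p + ?y ^ p + ?q ^ p + ?r ^ p)"
      proof -
        have "(2::real) ^ p * (2 ^ p * 2 ^ p) = 8 ^ p" by (simp flip: power_mult_distrib)
        then show ?thesis by (simp add: distrib_left mult.assoc[symmetric])
      qed
      also have "\<dots> = a * cmod (sol s t z \<omega> - sol s t w \<omega>) ^ p + a * cmod (z - w) ^ p + 8 ^ p * ?q ^ p + 8 ^ p * ?r ^ p"
        by (simp add: a_def power_mult_distrib distrib_left mult.assoc)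
      also have "\<dots> \<le> a * cmod (sol s t z \<omega> - sol s t w \<omega>) ^ p + a * 2 ^ p * d + 8 ^ p * ?q ^ p + 8 ^ p * ?r ^ p"
        using mult_left_mono[OF dp nn(1)] by (simp add: mult.assoc)
      finally have "ennreal (cmod (Lv s t z \<omega> - Lv s t w \<omega>) ^ p)
          \<le> ennreal (a * cmod (sol s t z \<omega> - sol s t w \<omega>) ^ p + a * 2 ^ p * d + 8 ^ p * ?q ^ p + 8 ^ p * ?r ^ p)"
        by (rule ennreal_leI)
      also have "\<dots> = ennreal a * ennreal (cmod (sol s t z \<omega> - sol s t w \<omega>) ^ p) + ennreal (a * 2 ^ p * d)
          + ennreal (8 ^ p) * ennreal (?q ^ p) + ennreal (8 ^ p) * ennreal (?r ^ p)"
        using nn d by (simp add: ennreal_mult)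
      finally show "ennreal (cmod (Lv s t z \<omega> - Lv s t w \<omega>) ^ p) \<le> \<dots>" .
    qed
    also have "\<dots> = ennreal a * (\<integral>\<^sup>+\<omega>. ennreal (cmod (sol s t z \<omega> - sol s t w \<omega>) ^ p) \<partial>M) + ennreal (a * 2 ^ p * d)
          + ennreal (8 ^ p) * (\<integral>\<^sup>+\<omega>. ennreal (cmod (Qv s t z \<omega> - Qv s t w \<omega>) ^ p) \<partial>M)
          + ennreal (8 ^ p) * (\<integral>\<^sup>+\<omega>. ennreal (cmod (Mv s t z \<omega> - Mv s t w \<omega>) ^ p) \<partial>M)"
      by (simp add: nn_integral_add nn_integral_cmult emeasure_space_1)
    also have "\<dots> \<le> ennreal a * ennreal (lip_const p * (2 ^ p * d)) + ennreal (a * 2 ^ p * d)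
          + ennreal (8 ^ p) * ennreal (2 ^ p * 2 * ((2 * C) ^ p * (b * d)))
          + ennreal (8 ^ p) * ennreal (2 ^ p * 2 * (bdg m * (b * d)))"
    proof (intro add_mono mult_left_mono order_refl)
      have "(\<integral>\<^sup>+\<omega>. ennreal (cmod (sol s t z \<omega> - sol s t w \<omega>) ^ p) \<partial>M) \<le> ennreal (lip_const p * cmod (z - w) ^ p)"
        using s by (intro sol_difference_moment z w p) auto
      also have "\<dots> \<le> ennreal (lip_const p * (2 ^ p * d))" by (intro ennreal_leI mult_left_mono dp nn)
      finally show "(\<integral>\<^sup>+\<omega>. ennreal (cmod (sol s t z \<omega> - sol s t w \<omega>) ^ p) \<partial>M) \<le> ennreal (lip_const p * (2 ^ p * d))" .
      have bb: "(\<integral>\<^sup>+\<omega>. ennreal (cmod (F (sol s r z \<omega>) - F (sol s r w \<omega>)) ^ (2 * m)) \<partial>M) \<le> ennreal (b * d)" if "s \<le> r" "r \<le> t" for r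
        using F_sol_difference_moment[OF s(1) that(1) _ z w p] that s by (simp add: b_def d_def p_def)
      have tp: "(t - s) ^ k \<le> 1" for k using s by (intro power_le_one) auto
      have bd: "0 \<le> b * d" using nn d by simp
      have "(\<integral>\<^sup>+\<omega>. ennreal (cmod (Qv s t z \<omega> - Qv s t w \<omega>) ^ p) \<partial>M) \<le> ennreal (2 ^ p * 2 * ((t - s) ^ p * ((2 * C) ^ p * (b * d))))"
        unfolding p_def by (rule Mv_Qv_diff_moment(2)[OF s(1,2) z w m bb bd])
      also have "\<dots> \<le> ennreal (2 ^ p * 2 * (1 * ((2 * C) ^ p * (b * d))))"
        using bd C_ge by (intro ennreal_leI mult_left_mono mult_right_mono tp) auto
      finally show "(\<integral>\<^sup>+\<omega>. ennreal (cmod (Qv s t z \<omega> - Qv s t w \<omega>) ^ p) \<partial>M) \<le> ennreal (2 ^ p * 2 * ((2 * C) ^ p * (b * d)))" by simp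
      have "(\<integral>\<^sup>+\<omega>. ennreal (cmod (Mv s t z \<omega> - Mv s t w \<omega>) ^ p) \<partial>M) \<le> ennreal (2 ^ p * 2 * (bdg m * (t - s) ^ m * (b * d)))"
        unfolding p_def by (rule Mv_Qv_diff_moment(1)[OF s(1,2) z w m bb bd])
      also have "\<dots> \<le> ennreal (2 ^ p * 2 * (bdg m * 1 * (b * d)))"
        using bd nn by (intro ennreal_leI mult_left_mono mult_right_mono tp) auto
      finally show "(\<integral>\<^sup>+\<omega>. ennreal (cmod (Mv s t z \<omega> - Mv s t w \<omega>) ^ p) \<partial>M) \<le> ennreal (2 ^ p * 2 * (bdg m * (b * d)))" by simp
    qed auto
    also have "\<dots> = ennreal (K * d)"
    proof -
      have "ennreal a * ennreal (lip_const p * (2 ^ p * d)) + ennreal (a * 2 ^ p * d)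
          + ennreal (8 ^ p) * ennreal (2 ^ p * 2 * ((2 * C) ^ p * (b * d)))
          + ennreal (8 ^ p) * ennreal (2 ^ p * 2 * (bdg m * (b * d)))
        = ennreal (a * (lip_const p * (2 ^ p * d)) + a * 2 ^ p * d + 8 ^ p * (2 ^ p * 2 * ((2 * C) ^ p * (b * d))) + 8 ^ p * (2 ^ p * 2 * (bdg m * (b * d))))"
        using nn d C_ge by (simp add: ennreal_mult)
      also have "a * (lip_const p * (2 ^ p * d)) + a * 2 ^ p * d + 8 ^ p * (2 ^ p * 2 * ((2 * C) ^ p * (b * d))) + 8 ^ p * (2 ^ p * 2 * (bdg m * (b * d))) = K * d"
        by (simp only: K_def distrib_right mult.assoc)
      finally show ?thesis .
    qed
    finally show "(\<integral>\<^sup>+\<omega>. ennreal (cmod (Lv s t z \<omega> - Lv s t w \<omega>) ^ (2 * m)) \<partial>M) \<le> ennreal (K * cmod (z - w) powr (\<alpha> * real (2 * m)))"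
      by (simp add: p_def d_def)
  qed
qed

end

section \<open>Kolmogorov's criterion on dyadic times and grid points\<close>

lemma two_powr_power: "((2::real) powr x) ^ k = 2 powr (x * real k)"
  by (subst powr_realpow[symmetric]) (simp_all add: powr_powr)

lemma inverse_two_power: "1 / (2::real) ^ n = 2 powr - real n"
  by (simp add: powr_minus powr_realpow divide_inverse)

lemma two_power: "(2::real) ^ n = 2 powr real n"
  by (simp add: powr_realpow)

lemma min_le_powr_interpolation:
  fixes a b :: real
  assumes "0 \<le> a" "0 \<le> b" "x \<le> a" "x \<le> b" "0 \<le> \<theta>" "\<theta> \<le> 1"
  shows "x \<le> a powr \<theta> * b powr (1 - \<theta>)"
proof (cases "0 < x")
  case True
  have "x = x powr \<theta> * x powr (1 - \<theta>)" using True by (simp flip: powr_add)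
  also have "\<dots> \<le> a powr \<theta> * b powr (1 - \<theta>)"
    using assms True by (intro mult_mono powr_mono2) auto
  finally show ?thesis .
next
  case False
  then show ?thesis by (meson mult_nonneg_nonneg not_less order_trans powr_ge_zero)
qed

text \<open>The Borel-Cantelli part of Kolmogorov's criterion: the sum of all the variables has finite expectation.\<close>

lemma AE_bounded_family:
  fixes X :: "nat \<Rightarrow> nat \<Rightarrow> 'i \<Rightarrow> 'a \<Rightarrow> real"
  assumes fin: "\<And>n l. finite (S n l)"
    and X: "\<And>n l i. i \<in> S n l \<Longrightarrow> X n l i \<in> borel_measurable M" "\<And>n l i \<omega>. 0 \<le> X n l i \<omega>"
    and c: "\<And>n l i. i \<in> S n l \<Longrightarrow> (\<integral>\<^sup>+\<omega>. ennreal (X n l i \<omega>) \<partial>M) \<le> ennreal (c n l)" "\<And>n l. 0 \<le> c n l"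
    and sum: "\<And>n l. real (card (S n l)) * c n l \<le> D * (1 / 2) ^ n * (1 / 2) ^ l" and D: "0 \<le> D"
  shows "AE \<omega> in M. \<exists>K\<ge>0. \<forall>n l. \<forall>i\<in>S n l. X n l i \<omega> \<le> K"
proof -
  define Y where "Y n l \<omega> = (\<Sum>i\<in>S n l. ennreal (X n l i \<omega>))" for n l \<omega>
  define T where "T \<omega> = (\<Sum>n. \<Sum>l. Y n l \<omega>)" for \<omega>
  have Xm: "(\<lambda>\<omega>. ennreal (X n l i \<omega>)) \<in> borel_measurable M" if "i \<in> S n l" for n l i
    using X(1)[OF that] by (rule measurable_compose) simp
  have Ym: "Y n l \<in> borel_measurable M" for n l
    unfolding Y_def by (rule borel_measurable_sum[OF Xm])
  have Ym': "(\<lambda>\<omega>. \<Sum>l. Y n l \<omega>) \<in> borel_measurable M" for n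
    by (rule borel_measurable_suminf_order[OF Ym])
  have T_meas: "T \<in> borel_measurable M"
    unfolding T_def by (rule borel_measurable_suminf_order[OF Ym'])
  have half: "(\<Sum>l. ennreal ((1 / 2) ^ l)) = 2"
  proof -
    have "(\<Sum>l. ennreal ((1 / 2) ^ l)) = ennreal (\<Sum>l. (1 / 2) ^ l)"
      by (rule suminf_ennreal2) (auto intro: summable_geometric)
    also have "(\<Sum>l. (1 / 2 :: real) ^ l) = 1 / (1 - 1 / 2)"
      by (rule suminf_geometric) simp
    finally show ?thesis by simp
  qed
  have "(\<integral>\<^sup>+\<omega>. T \<omega> \<partial>M) = (\<Sum>n. \<Sum>l. \<Sum>i\<in>S n l. \<integral>\<^sup>+\<omega>. ennreal (X n l i \<omega>) \<partial>M)"
    unfolding T_def nn_integral_suminf[OF Ym'] nn_integral_suminf[OF Ym] unfolding Y_def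
    by (intro suminf_cong nn_integral_sum Xm)
  also have "\<dots> \<le> (\<Sum>n. \<Sum>l. ennreal D * ennreal ((1 / 2) ^ n) * ennreal ((1 / 2) ^ l))"
  proof (intro suminf_le summableI)
    fix n l
    have "(\<Sum>i\<in>S n l. \<integral>\<^sup>+\<omega>. ennreal (X n l i \<omega>) \<partial>M) \<le> (\<Sum>i\<in>S n l. ennreal (c n l))"
      by (intro sum_mono c)
    also have "\<dots> = ennreal (real (card (S n l)) * c n l)"
      using c(2) by (simp add: ennreal_mult ennreal_of_nat_eq_real_of_nat)
    also have "\<dots> \<le> ennreal (D * (1 / 2) ^ n * (1 / 2) ^ l)" by (intro ennreal_leI sum)
    also have "\<dots> = ennreal D * ennreal ((1 / 2) ^ n) * ennreal ((1 / 2) ^ l)" using D by (simp add: ennreal_mult)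
    finally show "(\<Sum>i\<in>S n l. \<integral>\<^sup>+\<omega>. ennreal (X n l i \<omega>) \<partial>M) \<le> ennreal D * ennreal ((1 / 2) ^ n) * ennreal ((1 / 2) ^ l)" .
  qed
  also have "\<dots> = (\<Sum>n. ennreal D * ennreal ((1 / 2) ^ n) * 2)"
    by (simp only: ennreal_suminf_cmult half)
  also have "\<dots> = (\<Sum>n. (ennreal D * 2) * ennreal ((1 / 2) ^ n))"
    by (intro suminf_cong) (simp only: mult_ac)
  also have "\<dots> = ennreal D * 2 * 2" by (simp only: ennreal_suminf_cmult half)
  also have "\<dots> < \<infinity>" by (simp add: ennreal_mult_less_top)
  finally have "AE \<omega> in M. T \<omega> \<noteq> \<infinity>" using T_meas by (intro nn_integral_PInf_AE) auto
  then show ?thesis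
  proof eventually_elim
    case (elim \<omega>)
    show ?case
    proof (intro exI[of _ "enn2real (T \<omega>)"] conjI allI ballI)
      fix n l i assume i: "i \<in> S n l"
      have "ennreal (X n l i \<omega>) \<le> (\<Sum>i\<in>S n l. ennreal (X n l i \<omega>))"
        using fin i by (intro member_le_sum) auto
      also have "\<dots> \<le> (\<Sum>l. Y n l \<omega>)"
        using sum_le_suminf[of "\<lambda>l. Y n l \<omega>" "{l}"] by (simp add: Y_def[symmetric])
      also have "\<dots> \<le> T \<omega>"
        unfolding T_def using sum_le_suminf[of "\<lambda>n. \<Sum>l. Y n l \<omega>" "{n}"] by simp
      finally have "ennreal (X n l i \<omega>) \<le> T \<omega>" .
      then have "enn2real (ennreal (X n l i \<omega>)) \<le> enn2real (T \<omega>)"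
        using elim by (intro enn2real_mono) (auto simp: top.not_eq_extremum)
      then show "X n l i \<omega> \<le> enn2real (T \<omega>)" using X(2) by simp
    qed simp
  qed
qed

text \<open>The index k stands for the dyadic interval from k/2^n to (k + 1)/2^n, and the range of k
  selects those contained in {0..N}.\<close>

definition dyadic_index :: "nat \<Rightarrow> nat \<Rightarrow> nat set" where
  "dyadic_index N n = {k. k < N * 2 ^ n}"

text \<open>The elementary steps of level l, from the grid point (i, j) by (a, b), along which
  \<open>grid_holder\<close> asks for increments.\<close>

definition grid_index :: "nat \<Rightarrow> nat \<Rightarrow> (int \<times> int \<times> int \<times> int) set" where
  "grid_index N l = {(i, j, a, b). \<bar>a\<bar> \<le> 1 \<and> \<bar>b\<bar> \<le> 1 \<and> grid_point l i j \<in> half_box N \<and> grid_point l (i + a) (j + b) \<in> half_box N}"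

text \<open>With n = N 2^l there are at most 2n + 1 <= 3n columns, n rows above the real line and 9
  steps, hence the bound 27 n^2.\<close>

lemma grid_index_card:
  assumes "1 \<le> N"
  shows "finite (grid_index N l)" "card (grid_index N l) \<le> 27 * N\<^sup>2 * 4 ^ l"
proof -
  define n :: int where "n = int N * 2 ^ l"
  have "n = int (N * 2 ^ l)" "0 < N * 2 ^ l" using assms by (auto simp: n_def)
  then have n: "1 \<le> n" by linarith
  have sub: "grid_index N l \<subseteq> {-n..n} \<times> {1..n} \<times> {-1..1} \<times> {-1..1}"
  proof
    fix p assume "p \<in> grid_index N l"
    then obtain i j a b where p: "p = (i, j, a, b)" "\<bar>a\<bar> \<le> 1" "\<bar>b\<bar> \<le> 1" "grid_point l i j \<in> half_box N"
      by (auto simp: grid_index_def)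
    then have "\<bar>of_int i / 2 ^ l :: real\<bar> \<le> real N" "0 < (of_int j / 2 ^ l :: real)" "(of_int j / 2 ^ l :: real) \<le> real N"
      by (auto simp: grid_point_def half_box_def)
    then have "\<bar>real_of_int i\<bar> \<le> of_int n" "0 < real_of_int j" "real_of_int j \<le> of_int n"
      by (auto simp: n_def divide_le_eq zero_less_divide_iff)
    then have "\<bar>i\<bar> \<le> n" "0 < j" "j \<le> n" by linarith+
    then show "p \<in> {-n..n} \<times> {1..n} \<times> {-1..1} \<times> {-1..1}" using p(2,3) by (auto simp: p(1))
  qed
  then show "finite (grid_index N l)" by (rule finite_subset) auto
  have "card (grid_index N l) \<le> card ({-n..n} \<times> {1..n} \<times> {-1..1::int} \<times> {-1..1::int})"
    using sub by (intro card_mono) auto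
  also have "\<dots> = nat (2 * n + 1) * (nat n * 9)" by (simp add: card_cartesian_product)
  also have "\<dots> \<le> nat (3 * n) * (nat n * 9)" using n by (intro mult_right_mono nat_mono) auto
  also have "\<dots> = 27 * (nat n)\<^sup>2" using n by (simp add: nat_mult_distrib power2_eq_square)
  also have "nat n = N * 2 ^ l" by (simp add: n_def nat_mult_distrib nat_power_eq)
  also have "27 * (N * 2 ^ l)\<^sup>2 = 27 * N\<^sup>2 * 4 ^ l" by (simp add: power_mult_distrib power2_eq_square flip: power_mult_distrib)
  finally show "card (grid_index N l) \<le> 27 * N\<^sup>2 * 4 ^ l" .
qed

lemma grid_point_dist:
  assumes "\<bar>a\<bar> \<le> 1" "\<bar>b\<bar> \<le> 1"
  shows "cmod (grid_point l (i + a) (j + b) - grid_point l i j) \<le> 2 * (1 / 2 ^ l)"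
proof -
  have "cmod (grid_point l (i + a) (j + b) - grid_point l i j) \<le> \<bar>of_int a / 2 ^ l\<bar> + \<bar>of_int b / 2 ^ l\<bar>"
    using cmod_le[of "grid_point l (i + a) (j + b) - grid_point l i j"]
    by (simp add: grid_point_def diff_divide_distrib[symmetric])
  also have "\<dots> \<le> 1 / 2 ^ l + 1 / 2 ^ l"
  proof -
    have "\<bar>real_of_int a\<bar> \<le> 1" "\<bar>real_of_int b\<bar> \<le> 1" using assms by linarith+
    then show ?thesis by (intro add_mono) (auto simp: divide_right_mono)
  qed
  finally show ?thesis by simp
qed

context brownian_flow
begin

text \<open>One moment, two bounds: small in time by the triangle inequality, small in space by
  \<open>Lv_difference_moment\<close>. Their geometric mean is small in both at once.\<close>

lemma Lv_interpolated_moment: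
  assumes m: "1 \<le> m" and \<theta>: "0 \<le> \<theta>" "\<theta> \<le> 1"
  obtains K where "0 \<le> K" "\<And>s t z w. 0 \<le> s \<Longrightarrow> s < t \<Longrightarrow> t - s \<le> 1 \<Longrightarrow> 0 < Im z \<Longrightarrow> 0 < Im w \<Longrightarrow> cmod (z - w) \<le> 2 \<Longrightarrow>
    (\<integral>\<^sup>+\<omega>. ennreal (cmod (Lv s t z \<omega> - Lv s t w \<omega>) ^ (2 * m)) \<partial>M)
      \<le> ennreal (K * (t - s) powr (real m * \<theta>) * cmod (z - w) powr (\<alpha> * real (2 * m) * (1 - \<theta>)))"
proof -
  obtain K1 where K1: "0 \<le> K1" "\<And>s t z. 0 \<le> s \<Longrightarrow> s < t \<Longrightarrow> t - s \<le> 1 \<Longrightarrow> 0 < Im z \<Longrightarrow>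
    (\<integral>\<^sup>+\<omega>. ennreal (cmod (Lv s t z \<omega>) ^ (2 * m)) \<partial>M) \<le> ennreal (K1 * (t - s) ^ m)"
    using Lv_moment[OF m] by blast
  obtain K2 where K2: "0 \<le> K2" "\<And>s t z w. 0 \<le> s \<Longrightarrow> s < t \<Longrightarrow> t - s \<le> 1 \<Longrightarrow> 0 < Im z \<Longrightarrow> 0 < Im w \<Longrightarrow> cmod (z - w) \<le> 2 \<Longrightarrow>
    (\<integral>\<^sup>+\<omega>. ennreal (cmod (Lv s t z \<omega> - Lv s t w \<omega>) ^ (2 * m)) \<partial>M) \<le> ennreal (K2 * cmod (z - w) powr (\<alpha> * real (2 * m)))"
    using Lv_difference_moment[OF m] by blast
  define K3 where "K3 = 2 ^ (2 * m) * (2 * K1)"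
  have K3: "0 \<le> K3" using K1 by (simp add: K3_def)
  show thesis
  proof
    show "0 \<le> K3 powr \<theta> * K2 powr (1 - \<theta>)" by simp
    fix s t :: real and z w :: complex
    assume s: "0 \<le> s" "s < t" "t - s \<le> 1" and z: "0 < Im z" and w: "0 < Im w" and zw: "cmod (z - w) \<le> 2"
    have [measurable]: "Lv s t z \<in> borel_measurable M" "Lv s t w \<in> borel_measurable M"
      using Lv_measurable s z w by auto
    let ?I = "\<integral>\<^sup>+\<omega>. ennreal (cmod (Lv s t z \<omega> - Lv s t w \<omega>) ^ (2 * m)) \<partial>M"
    have "?I \<le> (\<integral>\<^sup>+\<omega>. ennreal (2 ^ (2 * m)) * (ennreal (cmod (Lv s t z \<omega>) ^ (2 * m)) + ennreal (cmod (Lv s t w \<omega>) ^ (2 * m))) \<partial>M)"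
    proof (rule nn_integral_mono)
      fix \<omega>
      have "cmod (Lv s t z \<omega> - Lv s t w \<omega>) ^ (2 * m) \<le> (cmod (Lv s t z \<omega>) + cmod (Lv s t w \<omega>)) ^ (2 * m)"
        by (intro power_mono norm_triangle_ineq4) auto
      also have "\<dots> \<le> 2 ^ (2 * m) * (cmod (Lv s t z \<omega>) ^ (2 * m) + cmod (Lv s t w \<omega>) ^ (2 * m))"
        by (intro power_sum2_le) auto
      finally show "ennreal (cmod (Lv s t z \<omega> - Lv s t w \<omega>) ^ (2 * m))
          \<le> ennreal (2 ^ (2 * m)) * (ennreal (cmod (Lv s t z \<omega>) ^ (2 * m)) + ennreal (cmod (Lv s t w \<omega>) ^ (2 * m)))"
        by (simp add: ennreal_mult[symmetric] ennreal_plus[symmetric] ennreal_leI del: ennreal_plus)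
    qed
    also have "\<dots> = ennreal (2 ^ (2 * m)) * ((\<integral>\<^sup>+\<omega>. ennreal (cmod (Lv s t z \<omega>) ^ (2 * m)) \<partial>M) + (\<integral>\<^sup>+\<omega>. ennreal (cmod (Lv s t w \<omega>) ^ (2 * m)) \<partial>M))"
      by (simp add: nn_integral_cmult nn_integral_add)
    also have "\<dots> \<le> ennreal (2 ^ (2 * m)) * (ennreal (K1 * (t - s) ^ m) + ennreal (K1 * (t - s) ^ m))"
      by (intro mult_left_mono add_mono K1 s z w) auto
    also have "\<dots> = ennreal (K3 * (t - s) ^ m)"
      using K1(1) s by (simp add: ennreal_mult[symmetric] ennreal_plus[symmetric] K3_def mult_ac del: ennreal_plus)
    finally have 1: "?I \<le> ennreal (K3 * (t - s) ^ m)" .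
    have 2: "?I \<le> ennreal (K2 * cmod (z - w) powr (\<alpha> * real (2 * m)))" using K2(2)[OF s z w zw] .
    have fin: "?I < \<infinity>" using 1 by (simp add: le_less_trans)
    define x where "x = enn2real ?I"
    have I: "?I = ennreal x" using fin by (simp add: x_def)
    have x0: "0 \<le> x" by (simp add: x_def)
    have "x \<le> (K3 * (t - s) ^ m) powr \<theta> * (K2 * cmod (z - w) powr (\<alpha> * real (2 * m))) powr (1 - \<theta>)"
      using 1 2 K3 K2(1) s x0 unfolding I by (intro min_le_powr_interpolation \<theta>) auto
    also have "\<dots> = K3 powr \<theta> * K2 powr (1 - \<theta>) * (t - s) powr (real m * \<theta>) * cmod (z - w) powr (\<alpha> * real (2 * m) * (1 - \<theta>))"
      using K3 K2(1) s by (simp add: powr_mult powr_powr powr_realpow[symmetric] mult_ac)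
    finally show "?I \<le> ennreal (K3 powr \<theta> * K2 powr (1 - \<theta>) * (t - s) powr (real m * \<theta>) * cmod (z - w) powr (\<alpha> * real (2 * m) * (1 - \<theta>)))"
      unfolding I by (rule ennreal_leI)
  qed
qed

lemma dyadic_interval:
  "(0::real) \<le> real k / 2 ^ n" "real k / 2 ^ n < real (Suc k) / 2 ^ n" "real (Suc k) / 2 ^ n - real k / 2 ^ n = 1 / 2 ^ n"
  by (auto simp: divide_strict_right_mono diff_divide_distrib[symmetric])

lemma card_dyadic_index: "finite (dyadic_index N n)" "card (dyadic_index N n) = N * 2 ^ n"
  by (auto simp: dyadic_index_def)

lemma power_le_imp_le_max:
  fixes x K :: real
  assumes "x ^ p \<le> K" "0 < p" "0 \<le> x"
  shows "x \<le> max 1 K"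
  using assms self_le_power[of x p] by (cases "x \<le> 1") auto

text \<open>There will be about 2^n intervals, each with a weighted moment of order 2^(2men)
  2^(-mn); the condition on m makes their total at most a multiple of 2^(-n).\<close>

lemma large_even_moment:
  fixes e :: real
  assumes "e < 1 / 2"
  obtains m :: nat where "1 \<le> m" "2 < real m * (1 - 2 * e)"
proof -
  obtain m :: nat where m: "2 / (1 - 2 * e) < real m" using reals_Archimedean2 by blast
  have "0 < 2 / (1 - 2 * e)" using assms by simp
  then have "1 \<le> m" using m by (cases m) auto
  moreover have "2 < real m * (1 - 2 * e)" using m assms by (simp add: divide_less_eq)
  ultimately show thesis by (rule that)
qed

lemma dyadic_moment_AE:
  fixes Y :: "nat \<Rightarrow> nat \<Rightarrow> 'a \<Rightarrow> real"
  assumes m: "1 \<le> m" "2 < real m * (1 - 2 * e)" and K0: "0 \<le> K0"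
    and [measurable]: "\<And>n k. Y n k \<in> borel_measurable M"
    and moment: "\<And>n k. (\<integral>\<^sup>+\<omega>. ennreal (Y n k \<omega> ^ (2 * m)) \<partial>M) \<le> ennreal (K0 * (1 / 2 ^ n) ^ m)"
  shows "AE \<omega> in M. \<exists>K\<ge>0. \<forall>n. \<forall>k\<in>dyadic_index N n. \<bar>Y n k \<omega>\<bar> \<le> K * (2 powr - e) ^ n"
proof -
  define wt where "wt n = (2::real) powr (e * real n)" for n :: nat
  \<comment> \<open>Only the level l = 0 is occupied, which turns the doubly indexed
    \<open>AE_bounded_family\<close> into a statement about n alone.\<close>
  define S where "S n l = (if l = 0 then dyadic_index N n else {})" for n l :: nat
  define X where "X n l k \<omega> = (Y n k \<omega> * wt n) ^ (2 * m)" for n l k :: nat and \<omega>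
  define c where "c n l = wt n ^ (2 * m) * (K0 * (1 / 2 ^ n) ^ m)" for n l :: nat
  have wt: "0 < wt n" for n by (simp add: wt_def)
  have "AE \<omega> in M. \<exists>K\<ge>0. \<forall>n l. \<forall>k\<in>S n l. X n l k \<omega> \<le> K"
  proof (rule AE_bounded_family)
    show "finite (S n l)" for n l using card_dyadic_index by (simp add: S_def)
    show "X n l k \<in> borel_measurable M" for n l k unfolding X_def by measurable
    show "0 \<le> X n l k \<omega>" for n l k \<omega> by (simp add: X_def zero_le_even_power)
    show "(\<integral>\<^sup>+\<omega>. ennreal (X n l k \<omega>) \<partial>M) \<le> ennreal (c n l)" for n l k
    proof -
      have "(\<integral>\<^sup>+\<omega>. ennreal (X n l k \<omega>) \<partial>M) = (\<integral>\<^sup>+\<omega>. ennreal (wt n ^ (2 * m)) * ennreal (Y n k \<omega> ^ (2 * m)) \<partial>M)"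
        using wt[of n] by (simp add: X_def power_mult_distrib ennreal_mult[symmetric] zero_le_even_power mult.commute)
      also have "\<dots> = ennreal (wt n ^ (2 * m)) * (\<integral>\<^sup>+\<omega>. ennreal (Y n k \<omega> ^ (2 * m)) \<partial>M)"
        by (intro nn_integral_cmult) measurable
      also have "\<dots> \<le> ennreal (wt n ^ (2 * m)) * ennreal (K0 * (1 / 2 ^ n) ^ m)"
        by (intro mult_left_mono moment) simp
      also have "\<dots> = ennreal (c n l)" using K0 wt[of n] by (simp add: c_def ennreal_mult)
      finally show ?thesis .
    qed
    show "0 \<le> c n l" for n l using K0 wt[of n] by (simp add: c_def)
    show "0 \<le> real N * K0" using K0 by simp
    show "real (card (S n l)) * c n l \<le> real N * K0 * (1 / 2) ^ n * (1 / 2) ^ l" for n l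
    proof (cases "l = 0")
      case True
      have "2 ^ n * (wt n ^ (2 * m) * (1 / 2 ^ n) ^ m) = 2 powr (real n * (1 - real m * (1 - 2 * e)))"
        unfolding wt_def inverse_two_power two_powr_power unfolding two_power powr_add[symmetric]
        by (rule arg_cong[where f = "\<lambda>x. 2 powr x"]) (simp add: algebra_simps)
      also have "\<dots> \<le> 2 powr (real n * (- 1))" using m(2) by (intro powr_mono mult_left_mono) auto
      also have "\<dots> = (1 / 2) ^ n" using inverse_two_power[of n] by (simp add: power_one_over)
      finally have "(real N * K0) * (2 ^ n * (wt n ^ (2 * m) * (1 / 2 ^ n) ^ m)) \<le> (real N * K0) * (1 / 2) ^ n"
        using K0 by (intro mult_left_mono) auto
      then show ?thesis using True by (simp add: S_def c_def card_dyadic_index mult_ac)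
    qed (use K0 in \<open>simp add: S_def\<close>)
  qed
  then show ?thesis
  proof eventually_elim
    case (elim \<omega>)
    then obtain K where K: "0 \<le> K" "\<And>n k. k \<in> dyadic_index N n \<Longrightarrow> X n 0 k \<omega> \<le> K" by (auto simp: S_def)
    have "\<bar>Y n k \<omega>\<bar> \<le> max 1 K * (2 powr - e) ^ n" if k: "k \<in> dyadic_index N n" for n k
    proof -
      have "(\<bar>Y n k \<omega>\<bar> * wt n) ^ (2 * m) \<le> K"
        using K(2)[OF k] by (simp add: X_def power_mult_distrib power_even_abs)
      then have "\<bar>Y n k \<omega>\<bar> * wt n \<le> max 1 K"
        using m(1) wt[of n] by (intro power_le_imp_le_max) auto
      then have "\<bar>Y n k \<omega>\<bar> \<le> max 1 K / wt n" using wt[of n] by (simp add: pos_le_divide_eq)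
      also have "\<dots> = max 1 K * (2 powr - e) ^ n"
        unfolding wt_def two_powr_power by (simp add: powr_minus divide_inverse)
      finally show ?thesis .
    qed
    then show ?case by (intro exI[of _ "max 1 K"]) auto
  qed
qed

lemma brownian_dyadic_AE:
  assumes "\<eta> < 1 / 2"
  shows "AE \<omega> in M. \<exists>K\<ge>0. \<forall>n. \<forall>k\<in>dyadic_index N n. \<bar>B (real (Suc k) / 2 ^ n) \<omega> - B (real k / 2 ^ n) \<omega>\<bar> \<le> K * (2 powr - \<eta>) ^ n"
proof -
  obtain m :: nat where m: "1 \<le> m" "2 < real m * (1 - 2 * \<eta>)" by (rule large_even_moment[OF assms])
  show ?thesis
  proof (rule dyadic_moment_AE[OF m bdg_nonneg[of m]])
    fix n k
    note I = dyadic_interval[of k n]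
    show "(\<lambda>\<omega>. B (real (Suc k) / 2 ^ n) \<omega> - B (real k / 2 ^ n) \<omega>) \<in> borel_measurable M"
      using I increment_measurable[of "real k / 2 ^ n" "real (Suc k) / 2 ^ n"]
      by (intro measurable_Fil_M[of "real (Suc k) / 2 ^ n"]) auto
    show "(\<integral>\<^sup>+\<omega>. ennreal ((B (real (Suc k) / 2 ^ n) \<omega> - B (real k / 2 ^ n) \<omega>) ^ (2 * m)) \<partial>M) \<le> ennreal (bdg m * (1 / 2 ^ n) ^ m)"
      using increment_moment[OF I(1,2) m(1)] unfolding I(3) .
  qed
qed

text \<open>The weight \<open>wt\<close> normalises the increments so that one random constant
  bounds them all. The grid points accumulate at the real line, which does no harm since the moments
  do not depend on the height.\<close>

lemma Lv_grid_AE: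
  assumes \<eta>: "0 < \<eta>" "\<eta> < \<alpha>" and N: "1 \<le> N" and \<epsilon>: "\<epsilon> = (\<alpha> - \<eta>) / (8 * \<alpha>)"
  shows "AE \<omega> in M. \<exists>K\<ge>0. \<forall>n. \<forall>k\<in>dyadic_index N n. \<forall>l. \<forall>(i, j, a, b)\<in>grid_index N l.
    cmod (Lv (real k / 2 ^ n) (real (Suc k) / 2 ^ n) (grid_point l (i + a) (j + b)) \<omega>
      - Lv (real k / 2 ^ n) (real (Suc k) / 2 ^ n) (grid_point l i j) \<omega>) \<le> K * (2 powr - \<epsilon>) ^ n * (2 powr - \<eta>) ^ l"
proof -
  \<comment> \<open>This weight places \<alpha>(1 - \<theta>) midway between \<eta> and \<alpha>,
    leaving half of the gap for convergence in space. Since \<epsilon> = \<theta>/4, the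
    normalisation 2^(2m\<epsilon>n) uses up half of the gain 2^(-m\<theta>n) in time.\<close>
  define \<theta> where "\<theta> = 4 * \<epsilon>"
  have \<theta>: "0 < \<theta>" "\<theta> \<le> 1" "\<alpha> * (1 - \<theta>) = (\<alpha> + \<eta>) / 2"
    using \<eta> by (auto simp: \<theta>_def \<epsilon> field_simps)
  \<comment> \<open>The exponents to beat are 1 - m\<theta>/2 for n, with 2^n intervals, and 2 -
    m(\<alpha> - \<eta>) for l, with about 4^l grid steps; both must fall below -1.\<close>
  obtain m :: nat where m: "max (4 / \<theta>) (3 / (\<alpha> - \<eta>)) < real m" using reals_Archimedean2 by blast
  have "0 < 4 / \<theta>" using \<theta> by simp
  then have m1: "1 \<le> m" using m by (cases m) auto
  have m2: "4 < real m * \<theta>" "3 < real m * (\<alpha> - \<eta>)" using m \<theta> \<eta> by (auto simp: divide_less_eq)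
  obtain K0 where K0: "0 \<le> K0" "\<And>s t z w. 0 \<le> s \<Longrightarrow> s < t \<Longrightarrow> t - s \<le> 1 \<Longrightarrow> 0 < Im z \<Longrightarrow> 0 < Im w \<Longrightarrow> cmod (z - w) \<le> 2 \<Longrightarrow>
    (\<integral>\<^sup>+\<omega>. ennreal (cmod (Lv s t z \<omega> - Lv s t w \<omega>) ^ (2 * m)) \<partial>M)
      \<le> ennreal (K0 * (t - s) powr (real m * \<theta>) * cmod (z - w) powr (\<alpha> * real (2 * m) * (1 - \<theta>)))"
    using Lv_interpolated_moment[OF m1 less_imp_le[OF \<theta>(1)] \<theta>(2)] by blast
  define \<beta> where "\<beta> = real m * (\<alpha> + \<eta>)"
  have \<beta>: "\<alpha> * real (2 * m) * (1 - \<theta>) = \<beta>" "0 \<le> \<beta>"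
  proof -
    have "\<alpha> * real (2 * m) * (1 - \<theta>) = 2 * real m * (\<alpha> * (1 - \<theta>))" by simp
    then show "\<alpha> * real (2 * m) * (1 - \<theta>) = \<beta>" unfolding \<theta>(3) by (simp add: \<beta>_def)
    show "0 \<le> \<beta>" using \<eta> by (simp add: \<beta>_def)
  qed
  define \<Delta> where "\<Delta> n k l q \<omega> = (case q of (i, j, a, b) \<Rightarrow>
    Lv (real k / 2 ^ n) (real (Suc k) / 2 ^ n) (grid_point l (i + a) (j + b)) \<omega>
      - Lv (real k / 2 ^ n) (real (Suc k) / 2 ^ n) (grid_point l i j) \<omega>)" for n k l :: nat and q :: "int \<times> int \<times> int \<times> int" and \<omega>
  define wt where "wt n l = (2::real) powr (\<epsilon> * real n + \<eta> * real l)" for n l :: nat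
  define S where "S n l = dyadic_index N n \<times> grid_index N l" for n l
  define X where "X n l = (\<lambda>(k, q) \<omega>. (cmod (\<Delta> n k l q \<omega>) * wt n l) ^ (2 * m))" for n l :: nat
  define c where "c n l = wt n l ^ (2 * m) * (K0 * (1 / 2 ^ n) powr (real m * \<theta>) * (2 * (1 / 2 ^ l)) powr \<beta>)" for n l :: nat
  have wt: "0 < wt n l" for n l by (simp add: wt_def)
  have meas: "\<Delta> n k l q \<in> borel_measurable M" if "q \<in> grid_index N l" for n k l q
  proof -
    obtain i j a b where q: "q = (i, j, a, b)" by (cases q)
    have "0 < Im (grid_point l i j)" "0 < Im (grid_point l (i + a) (j + b))"
      using that by (auto simp: q grid_index_def half_box_def)
    then have [measurable]: "Lv (real k / 2 ^ n) (real (Suc k) / 2 ^ n) (grid_point l i j) \<in> borel_measurable M"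
      "Lv (real k / 2 ^ n) (real (Suc k) / 2 ^ n) (grid_point l (i + a) (j + b)) \<in> borel_measurable M"
      by (intro Lv_measurable dyadic_interval; simp)+
    show ?thesis unfolding \<Delta>_def q by (simp del: of_nat_Suc)
  qed
  have "AE \<omega> in M. \<exists>K\<ge>0. \<forall>n l. \<forall>p\<in>S n l. X n l p \<omega> \<le> K"
  proof (rule AE_bounded_family)
    show "finite (S n l)" for n l using card_dyadic_index grid_index_card[OF N] by (simp add: S_def)
    show "X n l p \<in> borel_measurable M" if "p \<in> S n l" for n l p
    proof -
      have p: "p = (fst p, snd p)" "snd p \<in> grid_index N l" using that by (auto simp: S_def)
      have [measurable]: "\<Delta> n (fst p) l (snd p) \<in> borel_measurable M" by (rule meas[OF p(2)])
      show ?thesis unfolding X_def case_prod_beta by simp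
    qed
    show "0 \<le> X n l p \<omega>" for n l p \<omega> by (simp add: X_def zero_le_even_power split: prod.split)
    show "(\<integral>\<^sup>+\<omega>. ennreal (X n l p \<omega>) \<partial>M) \<le> ennreal (c n l)" if "p \<in> S n l" for n l p
    proof -
      obtain k i j a b where p: "p = (k, (i, j, a, b))" by (rule prod_cases5)
      with that have q: "(i, j, a, b) \<in> grid_index N l" by (simp add: S_def)
      let ?w = "grid_point l (i + a) (j + b)" and ?z = "grid_point l i j"
      have zw: "0 < Im ?z" "0 < Im ?w" "cmod (?w - ?z) \<le> 2 * (1 / 2 ^ l)"
        using q grid_point_dist by (auto simp: grid_index_def half_box_def)
      have "(1::real) / 2 ^ l \<le> 1" by simp
      then have zw2: "cmod (?w - ?z) \<le> 2" using zw(3) by linarith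
      have [measurable]: "\<Delta> n k l (i, j, a, b) \<in> borel_measurable M" by (rule meas[OF q])
      have "(\<integral>\<^sup>+\<omega>. ennreal (X n l p \<omega>) \<partial>M)
          = (\<integral>\<^sup>+\<omega>. ennreal (wt n l ^ (2 * m)) * ennreal (cmod (\<Delta> n k l (i, j, a, b) \<omega>) ^ (2 * m)) \<partial>M)"
        using wt[of n l] by (simp add: X_def p power_mult_distrib ennreal_mult[symmetric] mult.commute)
      also have "\<dots> = ennreal (wt n l ^ (2 * m)) * (\<integral>\<^sup>+\<omega>. ennreal (cmod (\<Delta> n k l (i, j, a, b) \<omega>) ^ (2 * m)) \<partial>M)"
        by (intro nn_integral_cmult) measurable
      also have "\<dots> \<le> ennreal (wt n l ^ (2 * m)) * ennreal (K0 * (1 / 2 ^ n) powr (real m * \<theta>) * (2 * (1 / 2 ^ l)) powr \<beta>)"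
      proof (rule mult_left_mono)
        have "(\<integral>\<^sup>+\<omega>. ennreal (cmod (\<Delta> n k l (i, j, a, b) \<omega>) ^ (2 * m)) \<partial>M)
            \<le> ennreal (K0 * (1 / 2 ^ n) powr (real m * \<theta>) * cmod (?w - ?z) powr \<beta>)"
          using K0(2)[OF dyadic_interval(1,2)[of k n] _ zw(2,1) zw2] unfolding dyadic_interval(3) \<beta>(1) by (simp add: \<Delta>_def)
        also have "\<dots> \<le> ennreal (K0 * (1 / 2 ^ n) powr (real m * \<theta>) * (2 * (1 / 2 ^ l)) powr \<beta>)"
          using K0(1) zw(3) \<beta>(2) by (intro ennreal_leI mult_left_mono powr_mono2) auto
        finally show "(\<integral>\<^sup>+\<omega>. ennreal (cmod (\<Delta> n k l (i, j, a, b) \<omega>) ^ (2 * m)) \<partial>M)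
            \<le> ennreal (K0 * (1 / 2 ^ n) powr (real m * \<theta>) * (2 * (1 / 2 ^ l)) powr \<beta>)" .
      qed simp
      also have "\<dots> = ennreal (c n l)" using K0(1) wt[of n l] by (simp add: c_def ennreal_mult)
      finally show ?thesis .
    qed
    show "0 \<le> c n l" for n l using K0(1) wt[of n l] by (simp add: c_def)
    show "0 \<le> real N * 27 * real (N\<^sup>2) * K0 * 2 powr \<beta>" using K0(1) by simp
    show "real (card (S n l)) * c n l \<le> real N * 27 * real (N\<^sup>2) * K0 * 2 powr \<beta> * (1 / 2) ^ n * (1 / 2) ^ l" for n l
    proof -
      have "real (card (grid_index N l)) \<le> real (27 * N\<^sup>2 * 4 ^ l)"
        using grid_index_card(2)[OF N, of l] by (simp only: of_nat_le_iff)
      then have "real (card (S n l)) \<le> real N * 2 ^ n * (27 * real (N\<^sup>2) * 4 ^ l)"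
        by (simp add: S_def card_cartesian_product card_dyadic_index mult_left_mono)
      then have "real (card (S n l)) * c n l \<le> real N * 2 ^ n * (27 * real (N\<^sup>2) * 4 ^ l) * c n l"
        using K0(1) wt[of n l] by (intro mult_right_mono) (auto simp: c_def)
      also have "\<dots> = real N * 27 * real (N\<^sup>2) * K0 * (2 ^ n * 4 ^ l * (wt n l ^ (2 * m) * ((1 / 2 ^ n) powr (real m * \<theta>) * (2 * (1 / 2 ^ l)) powr \<beta>)))"
        by (simp add: c_def mult_ac)
      finally have 1: "real (card (S n l)) * c n l \<le> real N * 27 * real (N\<^sup>2) * K0 * (2 ^ n * 4 ^ l * (wt n l ^ (2 * m) * ((1 / 2 ^ n) powr (real m * \<theta>) * (2 * (1 / 2 ^ l)) powr \<beta>)))" .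
      have "2 ^ n * 4 ^ l * (wt n l ^ (2 * m) * ((1 / 2 ^ n) powr (real m * \<theta>) * (2 * (1 / 2 ^ l)) powr \<beta>))
          = 2 powr (\<beta> + real n * (1 - real m * \<theta> / 2) + real l * (2 - real m * (\<alpha> - \<eta>)))"
      proof -
        have e1: "(2::real) ^ n = 2 powr real n" by (rule two_power)
        have e2: "(4::real) ^ l = 2 powr (2 * real l)" using two_power[of "2 * l"] by (simp add: power_mult)
        have e3: "wt n l ^ (2 * m) = 2 powr ((\<epsilon> * real n + \<eta> * real l) * real (2 * m))"
          unfolding wt_def by (rule two_powr_power)
        have e4: "(1 / 2 ^ n) powr (real m * \<theta>) = (2::real) powr (- real n * (real m * \<theta>))"
          unfolding inverse_two_power powr_powr ..
        have e5: "(2 * (1 / 2 ^ l)) powr \<beta> = (2::real) powr ((1 - real l) * \<beta>)"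
        proof -
          have "2 * (1 / 2 ^ l) = (2::real) powr (1 - real l)"
            unfolding inverse_two_power by (simp add: powr_diff powr_minus divide_inverse)
          then show ?thesis by (simp only: powr_powr)
        qed
        show ?thesis
          unfolding e3 e4 e5 unfolding e1 e2 powr_add[symmetric]
          by (rule arg_cong[where f = "\<lambda>x. 2 powr x"]) (simp add: \<beta>_def \<theta>_def algebra_simps)
      qed
      also have "\<dots> \<le> 2 powr (\<beta> + real n * (- 1) + real l * (- 1))"
        using m2 by (intro powr_mono add_mono mult_left_mono) auto
      also have "\<dots> = 2 powr \<beta> * ((1 / 2 ^ n) * (1 / 2 ^ l))"
        unfolding inverse_two_power powr_add[symmetric] by (simp add: algebra_simps)
      finally have "real N * 27 * real (N\<^sup>2) * K0 * (2 ^ n * 4 ^ l * (wt n l ^ (2 * m) * ((1 / 2 ^ n) powr (real m * \<theta>) * (2 * (1 / 2 ^ l)) powr \<beta>)))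
          \<le> real N * 27 * real (N\<^sup>2) * K0 * (2 powr \<beta> * ((1 / 2 ^ n) * (1 / 2 ^ l)))"
        using K0(1) by (intro mult_left_mono) auto
      with 1 show ?thesis by (simp add: power_one_over mult.assoc)
    qed
  qed
  then show ?thesis
  proof eventually_elim
    case (elim \<omega>)
    then obtain K where K: "0 \<le> K" "\<And>n l p. p \<in> S n l \<Longrightarrow> X n l p \<omega> \<le> K" by auto
    have "cmod (\<Delta> n k l q \<omega>) \<le> max 1 K * (2 powr - \<epsilon>) ^ n * (2 powr - \<eta>) ^ l"
      if "k \<in> dyadic_index N n" "q \<in> grid_index N l" for n k l q
    proof -
      have "(cmod (\<Delta> n k l q \<omega>) * wt n l) ^ (2 * m) \<le> K"
        using K(2)[of "(k, q)" n l] that by (simp add: X_def S_def)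
      then have "cmod (\<Delta> n k l q \<omega>) * wt n l \<le> max 1 K"
        using m1 wt[of n l] by (intro power_le_imp_le_max) auto
      then have "cmod (\<Delta> n k l q \<omega>) \<le> max 1 K / wt n l" using wt[of n l] by (simp add: pos_le_divide_eq)
      also have "\<dots> = max 1 K * (2 powr - \<epsilon>) ^ n * (2 powr - \<eta>) ^ l"
        unfolding wt_def two_powr_power by (simp add: powr_add powr_minus divide_inverse)
      finally show ?thesis .
    qed
    then show ?case by (intro exI[of _ "max 1 K"]) (fastforce simp: \<Delta>_def)
  qed
qed

lemma Lv_base_AE:
  assumes "\<epsilon> < 1 / 2" and z: "0 < Im z"
  shows "AE \<omega> in M. \<exists>K\<ge>0. \<forall>n. \<forall>k\<in>dyadic_index N n. cmod (Lv (real k / 2 ^ n) (real (Suc k) / 2 ^ n) z \<omega>) \<le> K * (2 powr - \<epsilon>) ^ n"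
proof -
  obtain m :: nat where m: "1 \<le> m" "2 < real m * (1 - 2 * \<epsilon>)" by (rule large_even_moment[OF assms(1)])
  obtain K0 where K0: "0 \<le> K0" "\<And>s t z. 0 \<le> s \<Longrightarrow> s < t \<Longrightarrow> t - s \<le> 1 \<Longrightarrow> 0 < Im z \<Longrightarrow>
    (\<integral>\<^sup>+\<omega>. ennreal (cmod (Lv s t z \<omega>) ^ (2 * m)) \<partial>M) \<le> ennreal (K0 * (t - s) ^ m)"
    using Lv_moment[OF m(1)] by blast
  have "AE \<omega> in M. \<exists>K\<ge>0. \<forall>n. \<forall>k\<in>dyadic_index N n. \<bar>cmod (Lv (real k / 2 ^ n) (real (Suc k) / 2 ^ n) z \<omega>)\<bar> \<le> K * (2 powr - \<epsilon>) ^ n"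
  proof (rule dyadic_moment_AE[OF m K0(1)])
    fix n k
    note I = dyadic_interval[of k n]
    show "(\<lambda>\<omega>. cmod (Lv (real k / 2 ^ n) (real (Suc k) / 2 ^ n) z \<omega>)) \<in> borel_measurable M"
      using Lv_measurable[OF I(1,2) z] by measurable
    show "(\<integral>\<^sup>+\<omega>. ennreal (cmod (Lv (real k / 2 ^ n) (real (Suc k) / 2 ^ n) z \<omega>) ^ (2 * m)) \<partial>M) \<le> ennreal (K0 * (1 / 2 ^ n) ^ m)"
      using K0(2)[OF I(1,2) _ z] unfolding I(3) by simp
  qed
  then show ?thesis by simp
qed

text \<open>\<open>Lv\<close> equals L simultaneously for all dyadic intervals and grid points, as
  these are countable, and for a continuous path L is continuous in z; so the grid estimate extends
  to the whole box. The bound for L itself follows from the one at the base point i.\<close>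

lemma logderiv_dyadic_AE:
  assumes \<eta>: "0 < \<eta>" "\<eta> < \<alpha>" and N: "1 \<le> N" and \<epsilon>: "\<epsilon> = (\<alpha> - \<eta>) / (8 * \<alpha>)"
  shows "AE \<omega> in M. \<exists>K\<ge>0. \<forall>n. \<forall>k\<in>dyadic_index N n. \<forall>z\<in>half_box N. \<forall>w\<in>half_box N.
      cmod (path_logderiv \<omega> (real k / 2 ^ n) (real (Suc k) / 2 ^ n) z) \<le> K * (2 powr - \<epsilon>) ^ n \<and>
      cmod (path_logderiv \<omega> (real k / 2 ^ n) (real (Suc k) / 2 ^ n) z - path_logderiv \<omega> (real k / 2 ^ n) (real (Suc k) / 2 ^ n) w)
        \<le> K * (2 powr - \<epsilon>) ^ n * cmod (z - w) powr \<eta>"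
proof -
  have \<epsilon>': "0 < \<epsilon>" "\<epsilon> < 1 / 2" using \<eta> by (auto simp: \<epsilon> field_simps)
  have \<eta>1: "\<eta> \<le> 1" using \<eta> \<alpha>_le by simp
  have "AE \<omega> in M. \<forall>n k l i j. 0 < Im (grid_point l i j) \<longrightarrow>
      Lv (real k / 2 ^ n) (real (Suc k) / 2 ^ n) (grid_point l i j) \<omega> = path_logderiv \<omega> (real k / 2 ^ n) (real (Suc k) / 2 ^ n) (grid_point l i j)"
  proof (intro AE_all_countable[THEN iffD2] allI)
    fix n k l :: nat and i j :: int
    show "AE \<omega> in M. 0 < Im (grid_point l i j) \<longrightarrow>
      Lv (real k / 2 ^ n) (real (Suc k) / 2 ^ n) (grid_point l i j) \<omega> = path_logderiv \<omega> (real k / 2 ^ n) (real (Suc k) / 2 ^ n) (grid_point l i j)"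
    proof (cases "0 < Im (grid_point l i j)")
      case True
      show ?thesis using ito_AE[OF dyadic_interval(1,2)[of k n] True] by eventually_elim blast
    qed simp
  qed
  moreover have "AE \<omega> in M. \<exists>K\<ge>0. \<forall>n. \<forall>k\<in>dyadic_index N n. cmod (Lv (real k / 2 ^ n) (real (Suc k) / 2 ^ n) (grid_point 0 0 1) \<omega>) \<le> K * (2 powr - \<epsilon>) ^ n"
    by (rule Lv_base_AE[OF \<epsilon>'(2)]) (simp add: grid_point_def)
  ultimately show ?thesis using AE_continuous_path Lv_grid_AE[OF \<eta> N \<epsilon>]
  proof eventually_elim
    case (elim \<omega>)
    interpret driven_flow F C A \<alpha> "\<lambda>t. B t \<omega>" by (rule driven_flow_path[OF elim(3)])
    obtain K1 where K1: "0 \<le> K1" "\<And>n k. k \<in> dyadic_index N n \<Longrightarrow> cmod (Lv (real k / 2 ^ n) (real (Suc k) / 2 ^ n) (grid_point 0 0 1) \<omega>) \<le> K1 * (2 powr - \<epsilon>) ^ n"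
      using elim(2) by blast
    obtain K2 where K2: "0 \<le> K2" "\<And>n k l i j a b. k \<in> dyadic_index N n \<Longrightarrow> (i, j, a, b) \<in> grid_index N l \<Longrightarrow>
      cmod (Lv (real k / 2 ^ n) (real (Suc k) / 2 ^ n) (grid_point l (i + a) (j + b)) \<omega>
      - Lv (real k / 2 ^ n) (real (Suc k) / 2 ^ n) (grid_point l i j) \<omega>) \<le> K2 * (2 powr - \<epsilon>) ^ n * (2 powr - \<eta>) ^ l"
      using elim(4) by fast
    \<comment> \<open>The box has diameter at most 4N and \<open>grid_holder\<close> applies to
      distances up to 1, so a segment is cut into \<open>J\<close> pieces.\<close>
    define J where "J = 4 * N"
    define K3 where "K3 = K2 * chain_const \<eta> * real J"
    have K3: "0 \<le> K3" using K2(1) chain_const_pos[OF \<eta>(1)] by (simp add: K3_def)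
    have diff: "cmod (logderiv (real k / 2 ^ n) (real (Suc k) / 2 ^ n) z - logderiv (real k / 2 ^ n) (real (Suc k) / 2 ^ n) w)
        \<le> K3 * (2 powr - \<epsilon>) ^ n * cmod (z - w) powr \<eta>" if k: "k \<in> dyadic_index N n" and z: "z \<in> half_box N" and w: "w \<in> half_box N" for n k z w
    proof -
      let ?f = "logderiv (real k / 2 ^ n) (real (Suc k) / 2 ^ n)"
      have cont: "continuous_on upper_half_plane ?f"
        using dyadic_interval[of k n] by (intro logderiv_cont_space) auto
      have local: "cmod (?f u - ?f v) \<le> K2 * (2 powr - \<epsilon>) ^ n * chain_const \<eta> * cmod (u - v) powr \<eta>"
        if "u \<in> half_box N" "v \<in> half_box N" "cmod (u - v) \<le> 1" for u v
      proof (rule grid_holder[OF cont \<eta>(1) \<eta>1 _ _ that])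
        show "0 \<le> K2 * (2 powr - \<epsilon>) ^ n" using K2(1) by simp
        fix l i j a b assume g: "\<bar>a\<bar> \<le> (1::int)" "\<bar>b\<bar> \<le> (1::int)" "grid_point l i j \<in> half_box N" "grid_point l (i + a) (j + b) \<in> half_box N"
        then have "(i, j, a, b) \<in> grid_index N l" by (simp add: grid_index_def)
        note bound = K2(2)[OF k this]
        have im: "0 < Im (grid_point l i j)" "0 < Im (grid_point l (i + a) (j + b))" using g by (auto simp: half_box_def)
        show "cmod (?f (grid_point l (i + a) (j + b)) - ?f (grid_point l i j)) \<le> K2 * (2 powr - \<epsilon>) ^ n * (2 powr - \<eta>) ^ l"
          using bound unfolding elim(1)[rule_format, OF im(1)] elim(1)[rule_format, OF im(2)] .
      qed
      have J: "0 < J" using N by (simp add: J_def)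
      define \<zeta> where "\<zeta> i = z + of_real (real i / real J) * (w - z)" for i :: nat
      have \<zeta>_box: "\<zeta> i \<in> half_box N" if "i \<le> J" for i
        using closed_segment_subset[OF z w convex_box] affine_in_closed_segment[of "real i / real J" z w] that J
        by (auto simp: \<zeta>_def)
      have d\<zeta>: "cmod (\<zeta> (Suc i) - \<zeta> i) = cmod (z - w) / real J" for i
      proof -
        have "\<zeta> (Suc i) - \<zeta> i = (w - z) / of_nat J" by (simp add: \<zeta>_def add_divide_distrib algebra_simps)
        then show ?thesis by (simp add: norm_divide norm_minus_commute)
      qed
      have ends: "\<zeta> 0 = z" "\<zeta> J = w" using J by (auto simp: \<zeta>_def)
      have zw: "cmod (z - w) \<le> real J"
      proof -
        have "\<bar>Re (z - w)\<bar> \<le> 2 * real N" "\<bar>Im (z - w)\<bar> \<le> 2 * real N" using z w by (auto simp: half_box_def)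
        then show ?thesis using cmod_le[of "z - w"] by (simp add: J_def)
      qed
      have "cmod (?f w - ?f z) = cmod (\<Sum>i<J. ?f (\<zeta> (Suc i)) - ?f (\<zeta> i))"
        using sum_lessThan_telescope[of "\<lambda>i. ?f (\<zeta> i)" J] by (simp only: ends)
      also have "\<dots> \<le> (\<Sum>i<J. K2 * (2 powr - \<epsilon>) ^ n * chain_const \<eta> * (cmod (z - w) / real J) powr \<eta>)"
      proof (rule sum_norm_le)
        fix i assume "i \<in> {..<J}"
        then show "cmod (?f (\<zeta> (Suc i)) - ?f (\<zeta> i)) \<le> K2 * (2 powr - \<epsilon>) ^ n * chain_const \<eta> * (cmod (z - w) / real J) powr \<eta>"
          using local[of "\<zeta> (Suc i)" "\<zeta> i"] \<zeta>_box[of i] \<zeta>_box[of "Suc i"] zw J unfolding d\<zeta> by (auto simp: divide_le_eq)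
      qed
      also have "\<dots> \<le> (\<Sum>i<J. K2 * (2 powr - \<epsilon>) ^ n * chain_const \<eta> * cmod (z - w) powr \<eta>)"
      proof (intro sum_mono mult_left_mono powr_mono2)
        show "cmod (z - w) / real J \<le> cmod (z - w)" using J by (simp add: divide_le_eq mult_le_cancel_left1)
        show "0 \<le> K2 * (2 powr - \<epsilon>) ^ n * chain_const \<eta>" using K2(1) chain_const_pos[OF \<eta>(1)] by simp
      qed (use \<eta> in auto)
      also have "\<dots> = K3 * (2 powr - \<epsilon>) ^ n * cmod (z - w) powr \<eta>" by (simp add: K3_def)
      finally show ?thesis by (simp add: norm_minus_commute)
    qed
    have base_box: "grid_point 0 0 1 \<in> half_box N" using N by (simp add: grid_point_def half_box_def)
    define K4 where "K4 = K1 + K3 * (4 * real N) powr \<eta>"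
    have sup: "cmod (logderiv (real k / 2 ^ n) (real (Suc k) / 2 ^ n) z) \<le> K4 * (2 powr - \<epsilon>) ^ n"
      if k: "k \<in> dyadic_index N n" and z: "z \<in> half_box N" for n k z
    proof -
      let ?f = "logderiv (real k / 2 ^ n) (real (Suc k) / 2 ^ n)" and ?i = "grid_point 0 0 1"
      have "\<bar>Re (z - ?i)\<bar> \<le> 2 * real N" "\<bar>Im (z - ?i)\<bar> \<le> 2 * real N" using z base_box by (auto simp: half_box_def)
      then have "cmod (z - ?i) \<le> 4 * real N" using cmod_le[of "z - ?i"] by simp
      then have "cmod (z - ?i) powr \<eta> \<le> (4 * real N) powr \<eta>" using \<eta> by (intro powr_mono2) auto
      then have "K3 * (2 powr - \<epsilon>) ^ n * cmod (z - ?i) powr \<eta> \<le> K3 * (2 powr - \<epsilon>) ^ n * (4 * real N) powr \<eta>"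
        using K3 by (intro mult_left_mono) auto
      moreover have "cmod (?f ?i) \<le> K1 * (2 powr - \<epsilon>) ^ n"
        using K1(2)[OF k] elim(1) base_box by (auto simp: half_box_def)
      ultimately have "cmod (?f z) \<le> K1 * (2 powr - \<epsilon>) ^ n + K3 * (2 powr - \<epsilon>) ^ n * (4 * real N) powr \<eta>"
        using diff[OF k z base_box] norm_triangle_sub[of "?f z" "?f ?i"] by linarith
      then show ?thesis by (simp add: K4_def algebra_simps)
    qed
    have K4: "0 \<le> K4" using K1 K3 by (simp add: K4_def)
    show ?case
    proof (intro exI[of _ "K3 + K4"] conjI allI ballI)
      fix n k z w assume kz: "k \<in> dyadic_index N n" "z \<in> half_box N" "w \<in> half_box N"
      show "cmod (logderiv (real k / 2 ^ n) (real (Suc k) / 2 ^ n) z) \<le> (K3 + K4) * (2 powr - \<epsilon>) ^ n"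
        by (rule order_trans[OF sup[OF kz(1,2)]]) (use K3 in \<open>auto intro!: mult_right_mono\<close>)
      show "cmod (logderiv (real k / 2 ^ n) (real (Suc k) / 2 ^ n) z - logderiv (real k / 2 ^ n) (real (Suc k) / 2 ^ n) w)
          \<le> (K3 + K4) * (2 powr - \<epsilon>) ^ n * cmod (z - w) powr \<eta>"
        by (rule order_trans[OF diff[OF kz]]) (use K4 in \<open>auto intro!: mult_right_mono\<close>)
    qed (use K3 K4 in simp)
  qed
qed

end

section \<open>Regular driving paths\<close>

text \<open>The interval is cut into \<open>J\<close> steps of length at most 1, each covered by
  \<open>dyadic_holder\<close>.\<close>

lemma dyadic_holder_long:
  fixes f :: "real \<Rightarrow> 'b::real_normed_vector"
  assumes cont: "continuous_on {a..b} f" and \<epsilon>: "0 < \<epsilon>" and K: "0 \<le> K"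
    and inc: "\<And>n k. of_int k / 2 ^ n \<in> {a..b} \<Longrightarrow> of_int (k + 1) / 2 ^ n \<in> {a..b} \<Longrightarrow>
      norm (f (of_int (k + 1) / 2 ^ n) - f (of_int k / 2 ^ n)) \<le> K * (2 powr - \<epsilon>) ^ n"
    and u: "a \<le> u" "u \<le> v" "v \<le> b" "v - u \<le> real J"
  shows "norm (f v - f u) \<le> real J * (K * chain_const \<epsilon>) * (v - u) powr \<epsilon>"
proof (cases "J = 0")
  case True then show ?thesis using u by simp
next
  case False
  define h where "h = (v - u) / real J"
  have h: "0 \<le> h" "real J * h = v - u" "h \<le> 1" "h \<le> v - u"
    using False u by (auto simp: h_def divide_le_eq mult_le_cancel_left1)
  define x where "x i = u + real i * h" for i :: nat
  have x: "a \<le> x i" "x i \<le> b" if "i \<le> J" for i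
  proof -
    have "real i * h \<le> real J * h" using that h by (intro mult_right_mono) auto
    then show "a \<le> x i" "x i \<le> b" using h u by (auto simp: x_def add_increasing2)
  qed
  have dx: "x (Suc i) - x i = h" for i by (simp add: x_def algebra_simps)
  have "norm (f v - f u) = norm (\<Sum>i<J. f (x (Suc i)) - f (x i))"
    using sum_lessThan_telescope[of "\<lambda>i. f (x i)" J] h(2) by (simp add: x_def)
  also have "\<dots> \<le> (\<Sum>i<J. K * chain_const \<epsilon> * h powr \<epsilon>)"
  proof (rule sum_norm_le)
    fix i assume "i \<in> {..<J}"
    then show "norm (f (x (Suc i)) - f (x i)) \<le> K * chain_const \<epsilon> * h powr \<epsilon>"
      using dyadic_holder[OF cont \<epsilon> K inc, of "x i" "x (Suc i)"] x[of i] x[of "Suc i"] dx[of i] h by simp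
  qed
  also have "\<dots> \<le> (\<Sum>i<J. K * chain_const \<epsilon> * (v - u) powr \<epsilon>)"
    using K chain_const_pos[OF \<epsilon>] h \<epsilon> by (intro sum_mono mult_left_mono powr_mono2) auto
  finally show ?thesis by (simp add: mult_ac)
qed

lemma powr_le_mult_powr:
  fixes x a a' Q :: real
  assumes "0 \<le> x" "x \<le> Q" "1 \<le> Q" "0 < a'" "a' \<le> a"
  shows "x powr a \<le> Q powr a * x powr a'"
proof -
  have "x powr a = x powr (a - a') * x powr a'" by (simp flip: powr_add)
  also have "\<dots> \<le> Q powr (a - a') * x powr a'"
    using assms by (intro mult_right_mono powr_mono2) auto
  also have "\<dots> \<le> Q powr a * x powr a'"
    using assms by (intro mult_right_mono powr_mono) auto
  finally show ?thesis .
qed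

text \<open>The interface between probability and analysis: almost every path satisfies these
  bounds, and what is derived from them is deterministic. The exponents increase to 1/2 and \<alpha>
  along a countable family, so that one null set takes care of every \<eta>.\<close>

locale regular_flow = driven_flow +
  assumes regular_path: "\<And>N j :: nat. \<exists>K\<ge>0. \<forall>n. \<forall>k\<in>dyadic_index N n.
      \<bar>U (real (Suc k) / 2 ^ n) - U (real k / 2 ^ n)\<bar> \<le> K * (2 powr - (1 / 2 * (1 - 1 / (real j + 2)))) ^ n"
    and regular_logderiv: "\<And>N j :: nat. 1 \<le> N \<Longrightarrow> \<exists>\<epsilon>>0. \<exists>K\<ge>0. \<forall>n. \<forall>k\<in>dyadic_index N n. \<forall>z\<in>half_box N. \<forall>w\<in>half_box N.
      cmod (logderiv (real k / 2 ^ n) (real (Suc k) / 2 ^ n) z) \<le> K * (2 powr - \<epsilon>) ^ n \<and>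
      cmod (logderiv (real k / 2 ^ n) (real (Suc k) / 2 ^ n) z - logderiv (real k / 2 ^ n) (real (Suc k) / 2 ^ n) w)
        \<le> K * (2 powr - \<epsilon>) ^ n * cmod (z - w) powr (\<alpha> * (1 - 1 / (real j + 2)))"
begin

lemma exponent_below:
  fixes \<eta> a :: real
  assumes "0 < \<eta>" "\<eta> < a"
  obtains j :: nat where "\<eta> \<le> a * (1 - 1 / (real j + 2))" "0 < a * (1 - 1 / (real j + 2))"
proof -
  obtain j :: nat where j: "a / (a - \<eta>) < real j" using reals_Archimedean2 by blast
  have a: "0 < a" using assms by simp
  have "a < (a - \<eta>) * (real j + 2)"
  proof -
    have "a < (a - \<eta>) * real j" using j assms by (simp add: divide_less_eq mult.commute)
    also have "\<dots> \<le> (a - \<eta>) * (real j + 2)" using assms by (intro mult_left_mono) auto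
    finally show ?thesis .
  qed
  then have "a / (real j + 2) < a - \<eta>" by (simp add: divide_less_eq)
  then have "\<eta> \<le> a * (1 - 1 / (real j + 2))" by (simp add: right_diff_distrib)
  then show thesis using assms(1) that by (meson less_le_trans)
qed

lemma int_dyadic_index:
  assumes "0 \<le> a" "b \<le> real N" "of_int k / 2 ^ n \<in> {a..b}" "of_int (k + 1) / 2 ^ n \<in> {a..b}"
  obtains k' where "k = int k'" "k' \<in> dyadic_index N n" "of_int k / 2 ^ n = real k' / 2 ^ n" "of_int (k + 1) / 2 ^ n = real (Suc k') / 2 ^ n"
proof -
  have "0 \<le> (of_int k / 2 ^ n :: real)" using assms by auto
  then have "0 \<le> (of_int k / 2 ^ n * 2 ^ n :: real)" by (rule mult_nonneg_nonneg) simp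
  then have "0 \<le> k" by simp
  then obtain k' where k': "k = int k'" using nonneg_int_cases by blast
  have "real (Suc k') / 2 ^ n \<le> real N" using assms k' by (auto simp: add.commute)
  then have "real (Suc k') \<le> real (N * 2 ^ n)" by (simp add: divide_le_eq)
  then have "k' \<in> dyadic_index N n" unfolding dyadic_index_def by (simp only: of_nat_le_iff mem_Collect_eq Suc_le_eq)
  then show thesis using k' by (intro that) auto
qed

lemma path_holder:
  assumes \<eta>: "0 < \<eta>" "\<eta> < 1 / 2"
  obtains K where "0 \<le> K" "\<And>s t. 0 \<le> s \<Longrightarrow> s \<le> t \<Longrightarrow> t \<le> real T \<Longrightarrow> \<bar>U t - U s\<bar> \<le> K * (t - s) powr \<eta>"
proof -
  obtain j :: nat where j: "\<eta> \<le> 1 / 2 * (1 - 1 / (real j + 2))" using exponent_below[OF \<eta>] by blast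
  obtain K where K: "0 \<le> K" "\<And>n k. k \<in> dyadic_index T n \<Longrightarrow>
      \<bar>U (real (Suc k) / 2 ^ n) - U (real k / 2 ^ n)\<bar> \<le> K * (2 powr - (1 / 2 * (1 - 1 / (real j + 2)))) ^ n"
    using regular_path[of T j] by blast
  have le: "(2 powr - (1 / 2 * (1 - 1 / (real j + 2)))) ^ n \<le> ((2::real) powr - \<eta>) ^ n" for n
    using j by (intro power_mono powr_mono) auto
  show thesis
  proof
    show "0 \<le> real T * (K * chain_const \<eta>)" using K(1) chain_const_pos[OF \<eta>(1)] by simp
    fix s t assume st: "0 \<le> s" "s \<le> t" "t \<le> real T"
    have "norm (U t - U s) \<le> real T * (K * chain_const \<eta>) * (t - s) powr \<eta>"
    proof (rule dyadic_holder_long[OF _ \<eta>(1) K(1)])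
      show "continuous_on {0..real T} U" by (rule continuous_on_subset[OF contU]) auto
      fix n and k :: int
      assume k: "of_int k / 2 ^ n \<in> {0..real T}" "of_int (k + 1) / 2 ^ n \<in> {0..real T}"
      obtain k' where k': "k' \<in> dyadic_index T n" "of_int k / 2 ^ n = real k' / 2 ^ n" "of_int (k + 1) / 2 ^ n = real (Suc k') / 2 ^ n"
        using int_dyadic_index[OF order_refl order_refl k] by metis
      show "norm (U (of_int (k + 1) / 2 ^ n) - U (of_int k / 2 ^ n)) \<le> K * (2 powr - \<eta>) ^ n"
        unfolding k'(2,3) real_norm_def by (rule order_trans[OF K(2)[OF k'(1)] mult_left_mono[OF le K(1)]])
    qed (use st in auto)
    then show "\<bar>U t - U s\<bar> \<le> real T * (K * chain_const \<eta>) * (t - s) powr \<eta>" by simp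
  qed
qed

text \<open>Up to time T a trajectory moves by at most C T plus the oscillation of the driving path,
  whatever its starting point and time.\<close>

lemma trajectory_box:
  obtains N where "1 \<le> N" "R \<le> N" "T \<le> N" "\<And>s t z. 0 \<le> s \<Longrightarrow> s \<le> t \<Longrightarrow> t \<le> real T \<Longrightarrow> z \<in> half_box R \<Longrightarrow> \<phi> s t z \<in> half_box N"
proof -
  have "continuous_on {0..real T} U" by (rule continuous_on_subset[OF contU]) auto
  then have "bounded (U ` {0..real T})" by (intro compact_imp_bounded compact_continuous_image) auto
  then obtain b where "\<forall>x\<in>U ` {0..real T}. norm x \<le> b" unfolding bounded_iff by blast
  then have b: "\<bar>U t\<bar> \<le> b" if "t \<in> {0..real T}" for t using that by simp
  obtain N0 :: nat where N0: "C * real T + 2 * b < real N0" using reals_Archimedean2 by blast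
  show thesis
  proof
    show "1 \<le> R + T + N0 + 1" "R \<le> R + T + N0 + 1" "T \<le> R + T + N0 + 1" by auto
    fix s t z assume s: "0 \<le> s" "s \<le> t" "t \<le> real T" and z: "z \<in> half_box R"
    have zi: "0 < Im z" using z by (simp add: half_box_def)
    have "cmod (\<phi> s t z - z) \<le> C * (t - s) + \<bar>U t - U s\<bar>"
      using flow_increment_bound[of s s t z] s zi by simp
    also have "\<dots> \<le> C * real T + 2 * b"
      using b(1)[of t] b(1)[of s] s C_ge by (intro add_mono mult_left_mono) auto
    finally have "cmod (\<phi> s t z - z) \<le> real N0" using N0 by simp
    then have "\<bar>Re (\<phi> s t z) - Re z\<bar> \<le> real N0" "\<bar>Im (\<phi> s t z) - Im z\<bar> \<le> real N0"
      using abs_Re_le_cmod[of "\<phi> s t z - z"] abs_Im_le_cmod[of "\<phi> s t z - z"] by auto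
    then show "\<phi> s t z \<in> half_box (R + T + N0 + 1)"
      using z flow_in_H[of s z t] s zi by (auto simp: half_box_def)
  qed
qed

text \<open>Over a dyadic interval {a..b} after s, L(s, b, z) - L(s, a, z) equals L(a, b, .) at the
  point \<phi>(s, a, z), which lies in a larger box where the regularity of the path gives a uniform
  bound. Chaining in time then works for arbitrary real s.\<close>

lemma logderiv_time_holder:
  obtains K \<epsilon> where "0 \<le> K" "0 < \<epsilon>" "\<And>s a b z. 0 \<le> s \<Longrightarrow> s \<le> a \<Longrightarrow> a \<le> b \<Longrightarrow> b \<le> real T \<Longrightarrow> z \<in> half_box R \<Longrightarrow>
    cmod (logderiv s b z - logderiv s a z) \<le> K * (b - a) powr \<epsilon>"
proof -
  obtain N where N: "1 \<le> N" "T \<le> N" "\<And>s t z. 0 \<le> s \<Longrightarrow> s \<le> t \<Longrightarrow> t \<le> real T \<Longrightarrow> z \<in> half_box R \<Longrightarrow> \<phi> s t z \<in> half_box N"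
    using trajectory_box[of R T] by metis
  obtain \<epsilon> K where K: "0 < \<epsilon>" "0 \<le> K" "\<And>n k z. k \<in> dyadic_index N n \<Longrightarrow> z \<in> half_box N \<Longrightarrow>
      cmod (logderiv (real k / 2 ^ n) (real (Suc k) / 2 ^ n) z) \<le> K * (2 powr - \<epsilon>) ^ n"
    using regular_logderiv[OF N(1), of 0] by blast
  show thesis
  proof
    show "0 \<le> real T * (K * chain_const \<epsilon>)" using K chain_const_pos[OF K(1)] by simp
    show "0 < \<epsilon>" by fact
    fix s a b z assume s: "0 \<le> s" "s \<le> a" "a \<le> b" "b \<le> real T" and z: "z \<in> half_box R"
    have zi: "0 < Im z" using z by (simp add: half_box_def)
    show "cmod (logderiv s b z - logderiv s a z) \<le> real T * (K * chain_const \<epsilon>) * (b - a) powr \<epsilon>"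
    proof (rule dyadic_holder_long[OF _ K(1,2)])
      show "continuous_on {s..real T} (\<lambda>r. logderiv s r z)"
        using s zi by (intro continuous_on_subset[OF logderiv_cont]) auto
      fix n and k :: int
      assume k: "of_int k / 2 ^ n \<in> {s..real T}" "of_int (k + 1) / 2 ^ n \<in> {s..real T}"
      have TN: "real T \<le> real N" using N(2) by simp
      obtain k' where k': "k' \<in> dyadic_index N n" "of_int k / 2 ^ n = real k' / 2 ^ n" "of_int (k + 1) / 2 ^ n = real (Suc k') / 2 ^ n"
        using int_dyadic_index[OF s(1) TN k] by metis
      have le: "s \<le> real k' / 2 ^ n" "real k' / 2 ^ n \<le> real T" "real k' / 2 ^ n \<le> real (Suc k') / 2 ^ n"
        using k k' by (auto simp: divide_right_mono)
      show "norm (logderiv s (of_int (k + 1) / 2 ^ n) z - logderiv s (of_int k / 2 ^ n) z) \<le> K * (2 powr - \<epsilon>) ^ n"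
        using K(3)[OF k'(1) N(3)[OF s(1) le(1,2) z]] logderiv_split[OF s(1) le(1,3) zi] unfolding k'(2,3) by simp
    qed (use s in auto)
  qed
qed

text \<open>\<phi>' = exp L is bounded on the box uniformly up to the real line, and the box is
  convex.\<close>

lemma flow_space_lipschitz:
  obtains \<Lambda> where "1 \<le> \<Lambda>" "\<And>s t z w. 0 \<le> s \<Longrightarrow> s \<le> t \<Longrightarrow> t \<le> real T \<Longrightarrow> z \<in> half_box R \<Longrightarrow> w \<in> half_box R \<Longrightarrow>
    cmod (\<phi> s t z - \<phi> s t w) \<le> \<Lambda> * cmod (z - w)"
proof -
  obtain K \<epsilon> where K: "0 \<le> K" "0 < \<epsilon>" "\<And>s a b z. 0 \<le> s \<Longrightarrow> s \<le> a \<Longrightarrow> a \<le> b \<Longrightarrow> b \<le> real T \<Longrightarrow> z \<in> half_box R \<Longrightarrow>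
    cmod (logderiv s b z - logderiv s a z) \<le> K * (b - a) powr \<epsilon>"
    using logderiv_time_holder[of T R] by blast
  show thesis
  proof
    show "1 \<le> exp (K * real T powr \<epsilon>)" using K by simp
    fix s t z w assume s: "0 \<le> s" "s \<le> t" "t \<le> real T" and zw: "z \<in> half_box R" "w \<in> half_box R"
    show "cmod (\<phi> s t z - \<phi> s t w) \<le> exp (K * real T powr \<epsilon>) * cmod (z - w)"
    proof (rule field_differentiable_bound[OF convex_box _ _ zw])
      fix v assume v: "v \<in> half_box R"
      then have vi: "0 < Im v" by (simp add: half_box_def)
      show "(\<phi> s t has_field_derivative exp (logderiv s t v)) (at v within half_box R)"
        by (rule DERIV_subset[OF flow_has_field_derivative]) (use s vi in auto)
      have "cmod (logderiv s t v - logderiv s s v) \<le> K * (t - s) powr \<epsilon>" by (rule K(3)) (use s v in auto)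
      also have "\<dots> \<le> K * real T powr \<epsilon>" using K s by (intro mult_left_mono powr_mono2) auto
      finally have "cmod (logderiv s t v) \<le> K * real T powr \<epsilon>" by (simp add: logderiv_def)
      then show "cmod (exp (logderiv s t v)) \<le> exp (K * real T powr \<epsilon>)"
        using complex_Re_le_cmod[of "logderiv s t v"] by (simp add: norm_exp_eq_Re)
    qed
  qed
qed

text \<open>The same chaining in time, now for L(s, r, z) - L(s, r, w): its increment over a dyadic
  interval compares L at the positions of two trajectories, whose distance is at most \<Lambda> |z -
  w|.\<close>

lemma logderiv_space_holder:
  assumes \<eta>: "0 < \<eta>" "\<eta> < \<alpha>"
  obtains K where "0 \<le> K" "\<And>s t z w. 0 \<le> s \<Longrightarrow> s \<le> t \<Longrightarrow> t \<le> real T \<Longrightarrow> z \<in> half_box R \<Longrightarrow> w \<in> half_box R \<Longrightarrow>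
    cmod (logderiv s t z - logderiv s t w) \<le> K * cmod (z - w) powr \<eta>"
proof -
  obtain N where N: "1 \<le> N" "T \<le> N" "\<And>s t z. 0 \<le> s \<Longrightarrow> s \<le> t \<Longrightarrow> t \<le> real T \<Longrightarrow> z \<in> half_box R \<Longrightarrow> \<phi> s t z \<in> half_box N"
    using trajectory_box[of R T] by metis
  obtain \<Lambda> where \<Lambda>: "1 \<le> \<Lambda>" "\<And>s t z w. 0 \<le> s \<Longrightarrow> s \<le> t \<Longrightarrow> t \<le> real T \<Longrightarrow> z \<in> half_box R \<Longrightarrow> w \<in> half_box R \<Longrightarrow>
    cmod (\<phi> s t z - \<phi> s t w) \<le> \<Lambda> * cmod (z - w)"
    using flow_space_lipschitz[of T R] by blast
  obtain j :: nat where j: "\<eta> \<le> \<alpha> * (1 - 1 / (real j + 2))" "0 < \<alpha> * (1 - 1 / (real j + 2))" using exponent_below[OF \<eta>] by blast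
  define \<beta> where "\<beta> = \<alpha> * (1 - 1 / (real j + 2))"
  have \<beta>: "\<eta> \<le> \<beta>" "0 < \<beta>" using j by (auto simp: \<beta>_def)
  obtain \<epsilon> K where K: "0 < \<epsilon>" "0 \<le> K" "\<And>n k z w. k \<in> dyadic_index N n \<Longrightarrow> z \<in> half_box N \<Longrightarrow> w \<in> half_box N \<Longrightarrow>
      cmod (logderiv (real k / 2 ^ n) (real (Suc k) / 2 ^ n) z - logderiv (real k / 2 ^ n) (real (Suc k) / 2 ^ n) w)
        \<le> K * (2 powr - \<epsilon>) ^ n * cmod (z - w) powr \<beta>"
    using regular_logderiv[OF N(1), of j] unfolding \<beta>_def by blast
  \<comment> \<open>At least the diameter of the box and at least 1, so that the exponent can be
    lowered from \<beta> to \<eta> at a bounded cost.\<close>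
  define Q where "Q = 4 * real R + 1"
  show thesis
  proof
    show "0 \<le> real T * (K * \<Lambda> powr \<beta> * chain_const \<epsilon>) * real T powr \<epsilon> * Q powr \<beta>"
      using K chain_const_pos[OF K(1)] by simp
    fix s t z w assume s: "0 \<le> s" "s \<le> t" "t \<le> real T" and z: "z \<in> half_box R" and w: "w \<in> half_box R"
    have zi: "0 < Im z" and wi: "0 < Im w" using z w by (auto simp: half_box_def)
    let ?D = "\<lambda>r. logderiv s r z - logderiv s r w"
    have "cmod (?D t - ?D s) \<le> real T * ((K * \<Lambda> powr \<beta> * cmod (z - w) powr \<beta>) * chain_const \<epsilon>) * (t - s) powr \<epsilon>"
    proof (rule dyadic_holder_long[OF _ K(1)])
      show "continuous_on {s..real T} ?D"
        using s zi wi by (intro continuous_intros continuous_on_subset[OF logderiv_cont]) auto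
      show "0 \<le> K * \<Lambda> powr \<beta> * cmod (z - w) powr \<beta>" using K by simp
      fix n and k :: int
      assume k: "of_int k / 2 ^ n \<in> {s..real T}" "of_int (k + 1) / 2 ^ n \<in> {s..real T}"
      have TN: "real T \<le> real N" using N(2) by simp
      obtain k' where k': "k' \<in> dyadic_index N n" "of_int k / 2 ^ n = real k' / 2 ^ n" "of_int (k + 1) / 2 ^ n = real (Suc k') / 2 ^ n"
        using int_dyadic_index[OF s(1) TN k] by metis
      have le: "s \<le> real k' / 2 ^ n" "real k' / 2 ^ n \<le> real T" "real k' / 2 ^ n \<le> real (Suc k') / 2 ^ n"
        using k k' by (auto simp: divide_right_mono)
      let ?a = "real k' / 2 ^ n" and ?b = "real (Suc k') / 2 ^ n"
      have "cmod (?D ?b - ?D ?a) = cmod (logderiv ?a ?b (\<phi> s ?a z) - logderiv ?a ?b (\<phi> s ?a w))"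
        using logderiv_split[OF s(1) le(1,3) zi] logderiv_split[OF s(1) le(1,3) wi] by simp
      also have "\<dots> \<le> K * (2 powr - \<epsilon>) ^ n * cmod (\<phi> s ?a z - \<phi> s ?a w) powr \<beta>"
        by (intro K(3) k' N(3) s le z w)
      also have "\<dots> \<le> K * (2 powr - \<epsilon>) ^ n * (\<Lambda> * cmod (z - w)) powr \<beta>"
        using K \<beta> \<Lambda>(2)[OF s(1) le(1,2) z w] by (intro mult_left_mono powr_mono2) auto
      also have "\<dots> = K * \<Lambda> powr \<beta> * cmod (z - w) powr \<beta> * (2 powr - \<epsilon>) ^ n"
        using \<Lambda>(1) by (simp add: powr_mult)
      finally show "norm (?D (of_int (k + 1) / 2 ^ n) - ?D (of_int k / 2 ^ n)) \<le> K * \<Lambda> powr \<beta> * cmod (z - w) powr \<beta> * (2 powr - \<epsilon>) ^ n"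
        unfolding k'(2,3) .
    qed (use s in auto)
    then have "cmod (?D t) \<le> real T * (K * \<Lambda> powr \<beta> * chain_const \<epsilon>) * (t - s) powr \<epsilon> * cmod (z - w) powr \<beta>"
      by (simp add: logderiv_def mult_ac)
    also have "\<dots> \<le> real T * (K * \<Lambda> powr \<beta> * chain_const \<epsilon>) * real T powr \<epsilon> * (Q powr \<beta> * cmod (z - w) powr \<eta>)"
    proof (intro mult_mono powr_le_mult_powr)
      have "\<bar>Re (z - w)\<bar> \<le> 2 * real R" "\<bar>Im (z - w)\<bar> \<le> 2 * real R" using z w by (auto simp: half_box_def)
      then show "cmod (z - w) \<le> Q" using cmod_le[of "z - w"] by (simp add: Q_def)
      show "(t - s) powr \<epsilon> \<le> real T powr \<epsilon>" using s K by (intro powr_mono2) auto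
    qed (use K \<beta> \<eta> chain_const_pos[OF K(1)] in \<open>auto simp: Q_def\<close>)
    finally show "cmod (?D t) \<le> real T * (K * \<Lambda> powr \<beta> * chain_const \<epsilon>) * real T powr \<epsilon> * Q powr \<beta> * cmod (z - w) powr \<eta>"
      by (simp add: mult_ac)
  qed
qed

text \<open>For short times \<open>\<phi>'\<close> is close to 1, so the flow is bi-Lipschitz; the flow property propagates this.\<close>

lemma flow_lower_bound:
  obtains c where "0 < c" "\<And>s t z w. 0 \<le> s \<Longrightarrow> s \<le> t \<Longrightarrow> t \<le> real T \<Longrightarrow> z \<in> half_box R \<Longrightarrow> w \<in> half_box R \<Longrightarrow>
    c * cmod (z - w) \<le> cmod (\<phi> s t z - \<phi> s t w)"
proof -
  obtain N where N: "1 \<le> N" "R \<le> N" "\<And>s t z. 0 \<le> s \<Longrightarrow> s \<le> t \<Longrightarrow> t \<le> real T \<Longrightarrow> z \<in> half_box R \<Longrightarrow> \<phi> s t z \<in> half_box N"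
    using trajectory_box[of R T] by metis
  obtain K \<epsilon> where K: "0 \<le> K" "0 < \<epsilon>" "\<And>s a b z. 0 \<le> s \<Longrightarrow> s \<le> a \<Longrightarrow> a \<le> b \<Longrightarrow> b \<le> real T \<Longrightarrow> z \<in> half_box N \<Longrightarrow>
    cmod (logderiv s b z - logderiv s a z) \<le> K * (b - a) powr \<epsilon>"
    using logderiv_time_holder[of T N] by blast
  have "isCont (exp :: complex \<Rightarrow> complex) 0" by simp
  then obtain d where d: "0 < d" "\<And>v :: complex. cmod v < d \<Longrightarrow> cmod (exp v - 1) < 1 / 2"
    unfolding continuous_at_eps_delta using half_gt_zero_iff[of 1]
    by (metis (no_types, opaque_lifting) diff_zero dist_norm exp_zero zero_less_one)
  \<comment> \<open>Chosen so that K \<delta>^\<epsilon> = d K / (2(K + 1)), which is below d even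
    when K = 0.\<close>
  define \<delta> where "\<delta> = (d / (2 * (K + 1))) powr (1 / \<epsilon>)"
  have \<delta>: "0 < \<delta>" using d K by (simp add: \<delta>_def)
  have \<delta>K: "K * \<delta> powr \<epsilon> < d"
  proof -
    have "\<delta> powr \<epsilon> = d / (2 * (K + 1))" using d K by (simp add: \<delta>_def powr_powr)
    then have "K * \<delta> powr \<epsilon> = d * (K / (2 * (K + 1)))" by simp
    also have "\<dots> < d * 1" using d K by (intro mult_strict_left_mono) (auto simp: divide_less_eq)
    finally show ?thesis by simp
  qed
  have short: "1 / 2 * cmod (z - w) \<le> cmod (\<phi> s t z - \<phi> s t w)"
    if s: "0 \<le> s" "s \<le> t" "t \<le> real T" "t - s \<le> \<delta>" and zw: "z \<in> half_box N" "w \<in> half_box N" for s t z w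
  proof -
    \<comment> \<open>\<phi> minus the identity has derivative exp L - 1 of modulus at most 1/2, so
      the flow shrinks distances at most by half.\<close>
    have "cmod ((\<phi> s t z - z) - (\<phi> s t w - w)) \<le> 1 / 2 * cmod (z - w)"
    proof (rule field_differentiable_bound[OF convex_box _ _ zw])
      fix v assume v: "v \<in> half_box N"
      then have vi: "0 < Im v" by (simp add: half_box_def)
      show "((\<lambda>v. \<phi> s t v - v) has_field_derivative exp (logderiv s t v) - 1) (at v within half_box N)"
        by (intro DERIV_diff DERIV_ident DERIV_subset[OF flow_has_field_derivative]) (use s vi in auto)
      have "cmod (logderiv s t v - logderiv s s v) \<le> K * (t - s) powr \<epsilon>" by (rule K(3)) (use s v in auto)
      also have "\<dots> \<le> K * \<delta> powr \<epsilon>" using K s by (intro mult_left_mono powr_mono2) auto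
      finally have "cmod (logderiv s t v) < d" using \<delta>K by (simp add: logderiv_def)
      then show "cmod (exp (logderiv s t v) - 1) \<le> 1 / 2" using d(2) by (simp add: less_imp_le)
    qed
    moreover have "z - w = (\<phi> s t z - \<phi> s t w) - ((\<phi> s t z - z) - (\<phi> s t w - w))" by simp
    then have "cmod (z - w) \<le> cmod (\<phi> s t z - \<phi> s t w) + cmod ((\<phi> s t z - z) - (\<phi> s t w - w))"
      by (metis norm_triangle_ineq4)
    ultimately show ?thesis by linarith
  qed
  have iter: "(1 / 2) ^ k * cmod (z - w) \<le> cmod (\<phi> s t z - \<phi> s t w)"
    if "0 \<le> s" "s \<le> t" "t \<le> real T" "t - s \<le> real k * \<delta>" "z \<in> half_box R" "w \<in> half_box R" for k s t z w
    using that
  proof (induction k arbitrary: t)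
    case 0
    then show ?case by (auto simp: half_box_def)
  next
    case (Suc k)
    have zi: "0 < Im z" "0 < Im w" using Suc.prems by (auto simp: half_box_def)
    \<comment> \<open>Splits off a last step of length at most \<delta>, so that the induction
      hypothesis covers the time from s to r.\<close>
    define r where "r = max s (t - \<delta>)"
    have r: "s \<le> r" "r \<le> t" "r \<le> real T" "t - r \<le> \<delta>" "r - s \<le> real k * \<delta>"
      using Suc.prems \<delta> by (auto simp: r_def max_def algebra_simps)
    have "(1 / 2) ^ Suc k * cmod (z - w) \<le> 1 / 2 * cmod (\<phi> s r z - \<phi> s r w)"
      using Suc.IH[of r] Suc.prems r by simp
    also have "\<dots> \<le> cmod (\<phi> r t (\<phi> s r z) - \<phi> r t (\<phi> s r w))"
      using Suc.prems r by (intro short N(3)) auto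
    also have "\<dots> = cmod (\<phi> s t z - \<phi> s t w)"
      using flow_semigroup[OF Suc.prems(1) r(1,2)] zi by simp
    finally show ?case .
  qed
  obtain k :: nat where k: "real T / \<delta> < real k" using reals_Archimedean2 by blast
  show thesis
  proof
    show "0 < (1 / 2 :: real) ^ k" by simp
    fix s t z w assume a: "0 \<le> s" "s \<le> t" "t \<le> real T" "z \<in> half_box R" "w \<in> half_box R"
    have "t - s \<le> real k * \<delta>" using k \<delta> a by (simp add: divide_less_eq)
    then show "(1 / 2) ^ k * cmod (z - w) \<le> cmod (\<phi> s t z - \<phi> s t w)" using a by (intro iter)
  qed
qed

end

section \<open>Extension to the boundary\<close>

definition piece :: "nat \<Rightarrow> ((real \<times> real) \<times> complex) set" where
  "piece n = {((s, t), z). 0 \<le> s \<and> s \<le> t \<and> t \<le> real n \<and> z \<in> half_box n}"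

definition closed_box :: "nat \<Rightarrow> complex set" where
  "closed_box n = {z. \<bar>Re z\<bar> \<le> real n \<and> 0 \<le> Im z \<and> Im z \<le> real n}"

definition closed_piece :: "nat \<Rightarrow> ((real \<times> real) \<times> complex) set" where
  "closed_piece n = {((s, t), z). 0 \<le> s \<and> s \<le> t \<and> t \<le> real n \<and> z \<in> closed_box n}"

text \<open>\<open>piece n\<close> reaches down to the real line, so a Hoelder bound on it amounts
  to uniform continuity up to the boundary and thereby to a continuous extension.\<close>

definition locally_holder :: "(((real \<times> real) \<times> complex) \<Rightarrow> complex) \<Rightarrow> bool" where
  "locally_holder f \<longleftrightarrow> (\<forall>n. \<exists>K\<ge>0. \<exists>e>0. \<forall>p\<in>piece n. \<forall>q\<in>piece n. dist (f p) (f q) \<le> K * dist p q powr e)"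

text \<open>Vertical shifts are isometries, so estimates for differences pass to the boundary with
  unchanged constants.\<close>

definition shift_up :: "nat \<Rightarrow> (real \<times> real) \<times> complex \<Rightarrow> (real \<times> real) \<times> complex" where
  "shift_up i p = (fst p, snd p + Complex 0 (1 / real (Suc i)))"

definition boundary_extension :: "(((real \<times> real) \<times> complex) \<Rightarrow> complex) \<Rightarrow> ((real \<times> real) \<times> complex) \<Rightarrow> complex" where
  "boundary_extension f p = (if 0 < Im (snd p) then f p else lim (\<lambda>i. f (shift_up i p)))"

lemma dist_shift_up: "dist (shift_up i p) (shift_up i q) = dist p q"
  by (simp add: shift_up_def dist_prod_def dist_norm)

lemma shift_up_tendsto: "(\<lambda>i. shift_up i p) \<longlonglongrightarrow> p"
proof -
  have "(\<lambda>i. Complex 0 (1 / real (Suc i))) \<longlonglongrightarrow> Complex 0 0"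
    by (intro tendsto_Complex tendsto_const LIMSEQ_Suc[OF lim_1_over_n])
  moreover have "Complex 0 0 = 0" by (simp add: complex_eq_iff)
  ultimately have "(\<lambda>i. (fst p, snd p + Complex 0 (1 / real (Suc i)))) \<longlonglongrightarrow> (fst p, snd p + 0)"
    by (intro tendsto_Pair tendsto_add tendsto_const) simp
  then show ?thesis by (simp add: shift_up_def)
qed

lemma shift_up_piece: "p \<in> closed_piece n \<Longrightarrow> shift_up i p \<in> piece (Suc n)"
proof -
  assume p: "p \<in> closed_piece n"
  obtain e where e: "1 / real (Suc i) = e" "0 < e" "e \<le> 1" by simp
  show ?thesis
    using p e(2,3) unfolding shift_up_def e(1) by (auto simp: closed_piece_def piece_def closed_box_def half_box_def)
qed

lemma bounded_subset_closed_piece: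
  assumes "bounded K" "K \<subseteq> time_simplex \<times> closed_upper_half_plane"
  obtains n where "K \<subseteq> closed_piece n"
proof -
  obtain b where b: "\<And>p. p \<in> K \<Longrightarrow> norm p \<le> b" using assms(1) by (auto simp: bounded_iff)
  obtain n :: nat where n: "b < real n" using reals_Archimedean2 by blast
  have "K \<subseteq> closed_piece n"
  proof
    fix p assume p: "p \<in> K"
    obtain s t z where pe: "p = ((s, t), z)" by (metis prod.exhaust)
    have "norm z \<le> b" "norm (s, t) \<le> b"
      using b[OF p] norm_snd_le[of z "(s, t)"] norm_fst_le[of "(s, t)" z] by (auto simp: pe)
    then have "norm z \<le> b" "norm t \<le> b" using norm_snd_le[of t s] by auto
    then show "p \<in> closed_piece n"
      using assms(2) p n abs_Re_le_cmod[of z] abs_Im_le_cmod[of z] by (auto simp: pe closed_piece_def closed_box_def)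
  qed
  then show thesis by (rule that)
qed

lemma point_in_closed_piece:
  assumes "p \<in> time_simplex \<times> closed_upper_half_plane"
  obtains n where "p \<in> closed_piece n"
  using bounded_subset_closed_piece[of "{p}"] assms by auto

text \<open>The Hoelder bound turns the convergent sequence of shifted points into a Cauchy sequence
  of values; at interior points its limit agrees with \<open>f\<close>.\<close>

lemma boundary_extension_tendsto:
  assumes f: "locally_holder f" and p: "p \<in> time_simplex \<times> closed_upper_half_plane"
  shows "(\<lambda>i. f (shift_up i p)) \<longlonglongrightarrow> boundary_extension f p"
proof -
  obtain n where n: "p \<in> closed_piece n" by (rule point_in_closed_piece[OF p])
  obtain K e where K: "0 \<le> K" "0 < e" "\<And>p q. p \<in> piece (Suc n) \<Longrightarrow> q \<in> piece (Suc n) \<Longrightarrow> dist (f p) (f q) \<le> K * dist p q powr e"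
    using f unfolding locally_holder_def by blast
  \<comment> \<open>K + 1 takes the place of K in the denominator because K may be 0.\<close>
  have small: "\<exists>d>0. \<forall>x. 0 \<le> x \<and> x < d \<longrightarrow> K * x powr e < r" if r: "0 < r" for r
  proof (intro exI[of _ "(r / (K + 1)) powr (1 / e)"] conjI allI impI)
    show "0 < (r / (K + 1)) powr (1 / e)" using r K by simp
    fix x assume x: "0 \<le> x \<and> x < (r / (K + 1)) powr (1 / e)"
    have "x powr e \<le> ((r / (K + 1)) powr (1 / e)) powr e" using x K by (intro powr_mono2) auto
    also have "\<dots> = r / (K + 1)" using r K by (simp add: powr_powr)
    finally have "K * x powr e \<le> K * (r / (K + 1))" using K by (intro mult_left_mono) auto
    also have "\<dots> < r" using r K by (simp add: field_simps)
    finally show "K * x powr e < r" .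
  qed
  show ?thesis
  proof (cases "0 < Im (snd p)")
    case True
    then have pp: "p \<in> piece (Suc n)" using n by (auto simp: closed_piece_def piece_def closed_box_def half_box_def)
    have "(\<lambda>i. f (shift_up i p)) \<longlonglongrightarrow> f p"
    proof (rule metric_LIMSEQ_I)
      fix r :: real assume "0 < r"
      then obtain d where d: "0 < d" "\<And>x. 0 \<le> x \<Longrightarrow> x < d \<Longrightarrow> K * x powr e < r" using small by blast
      obtain no where no: "\<forall>i\<ge>no. dist (shift_up i p) p < d" using metric_LIMSEQ_D[OF shift_up_tendsto d(1)] by blast
      have "\<forall>i\<ge>no. dist (f (shift_up i p)) (f p) < r"
        using no d(2) K(3)[OF shift_up_piece[OF n] pp] by (meson le_less_trans zero_le_dist)
      then show "\<exists>no. \<forall>i\<ge>no. dist (f (shift_up i p)) (f p) < r" by blast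
    qed
    then show ?thesis using True by (simp add: boundary_extension_def)
  next
    case False
    have "Cauchy (\<lambda>i. f (shift_up i p))"
    proof (rule metric_CauchyI)
      fix r :: real assume "0 < r"
      then obtain d where d: "0 < d" "\<And>x. 0 \<le> x \<Longrightarrow> x < d \<Longrightarrow> K * x powr e < r" using small by blast
      have "Cauchy (\<lambda>i. shift_up i p)" using shift_up_tendsto by (rule LIMSEQ_imp_Cauchy)
      then obtain M where M: "\<forall>i\<ge>M. \<forall>j\<ge>M. dist (shift_up i p) (shift_up j p) < d" using d(1) unfolding Cauchy_def by blast
      have "\<forall>i\<ge>M. \<forall>j\<ge>M. dist (f (shift_up i p)) (f (shift_up j p)) < r"
        using M d(2) K(3)[OF shift_up_piece[OF n] shift_up_piece[OF n]] by (meson le_less_trans zero_le_dist)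
      then show "\<exists>M. \<forall>i\<ge>M. \<forall>j\<ge>M. dist (f (shift_up i p)) (f (shift_up j p)) < r" by blast
    qed
    then have "convergent (\<lambda>i. f (shift_up i p))" by (rule Cauchy_convergent)
    then show ?thesis using False by (simp add: boundary_extension_def convergent_LIMSEQ_iff)
  qed
qed

lemma closed_piece_subset: "closed_piece n \<subseteq> time_simplex \<times> closed_upper_half_plane"
  by (auto simp: closed_piece_def closed_box_def)

text \<open>The bound is assumed on the next larger piece, since a shift upwards by at most 1 can
  leave the given one.\<close>

lemma boundary_extension_holder:
  assumes f: "locally_holder f"
    and K: "\<And>p q. p \<in> piece (Suc n) \<Longrightarrow> q \<in> piece (Suc n) \<Longrightarrow> dist (f p) (f q) \<le> K * dist p q powr e"
    and p: "p \<in> closed_piece n" and q: "q \<in> closed_piece n"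
  shows "dist (boundary_extension f p) (boundary_extension f q) \<le> K * dist p q powr e"
proof (rule LIMSEQ_le_const2)
  show "(\<lambda>i. dist (f (shift_up i p)) (f (shift_up i q))) \<longlonglongrightarrow> dist (boundary_extension f p) (boundary_extension f q)"
    using p q closed_piece_subset[of n] by (intro tendsto_dist boundary_extension_tendsto f) auto
  have "dist (f (shift_up i p)) (f (shift_up i q)) \<le> K * dist p q powr e" for i
    using K[OF shift_up_piece[OF p, of i] shift_up_piece[OF q, of i]] by (simp only: dist_shift_up)
  then show "\<exists>N. \<forall>i\<ge>N. dist (f (shift_up i p)) (f (shift_up i q)) \<le> K * dist p q powr e" by blast
qed

lemma boundary_extension_continuous:
  assumes f: "locally_holder f"
  shows "continuous_on (time_simplex \<times> closed_upper_half_plane) (boundary_extension f)"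
  unfolding continuous_on_iff
proof (intro ballI allI impI)
  let ?X = "time_simplex \<times> closed_upper_half_plane"
  fix p and r :: real assume p: "p \<in> ?X" and r: "0 < r"
  have "bounded (?X \<inter> cball p 1)" by (rule bounded_subset[OF bounded_cball]) auto
  then obtain n where n: "?X \<inter> cball p 1 \<subseteq> closed_piece n"
    by (rule bounded_subset_closed_piece) auto
  obtain K e where K: "0 \<le> K" "0 < e" "\<And>p q. p \<in> piece (Suc n) \<Longrightarrow> q \<in> piece (Suc n) \<Longrightarrow> dist (f p) (f q) \<le> K * dist p q powr e"
    using f unfolding locally_holder_def by blast
  define d where "d = min 1 ((r / (K + 1)) powr (1 / e))"
  show "\<exists>d>0. \<forall>q\<in>?X. dist q p < d \<longrightarrow> dist (boundary_extension f q) (boundary_extension f p) < r"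
  proof (intro exI[of _ d] conjI ballI impI)
    show "0 < d" using r K by (simp add: d_def)
    fix q assume q: "q \<in> ?X" "dist q p < d"
    then have "q \<in> ?X \<inter> cball p 1" "p \<in> ?X \<inter> cball p 1"
      using p unfolding Int_iff mem_cball by (auto simp only: d_def dist_commute dist_self min_less_iff_conj less_imp_le zero_le_one)
    then have "q \<in> closed_piece n" "p \<in> closed_piece n"
      using n by blast+
    then have "dist (boundary_extension f q) (boundary_extension f p) \<le> K * dist q p powr e"
      by (intro boundary_extension_holder[OF f K(3)])
    also have "dist q p powr e \<le> ((r / (K + 1)) powr (1 / e)) powr e"
      using q(2) K by (intro powr_mono2) (auto simp: d_def)
    also have "\<dots> = r / (K + 1)" using r K by (simp add: powr_powr)
    finally have "dist (boundary_extension f q) (boundary_extension f p) \<le> K * (r / (K + 1))"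
      using K(1) by (simp add: mult_left_mono)
    also have "\<dots> < r" using r K by (simp add: field_simps)
    finally show "dist (boundary_extension f q) (boundary_extension f p) < r" .
  qed
qed

lemma boundary_extension_interior: "0 < Im z \<Longrightarrow> boundary_extension f (st, z) = f (st, z)"
  by (simp add: boundary_extension_def)

lemma holder_onI:
  assumes "\<And>x y. x \<in> S \<Longrightarrow> y \<in> S \<Longrightarrow> dist (f x) (f y) \<le> K * dist x y powr \<eta>"
  shows "holder_on \<eta> S f"
  unfolding holder_on_def
proof (rule bdd_aboveI[of _ K], clarify)
  fix x y assume "x \<in> S" "y \<in> S" "x \<noteq> y"
  then show "dist (f x) (f y) / dist x y powr \<eta> \<le> K" using assms by (simp add: divide_le_eq)
qed

context regular_flow
begin

definition flow_map :: "(real \<times> real) \<times> complex \<Rightarrow> complex" where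
  "flow_map = (\<lambda>((s, t), z). \<phi> s t z)"

definition logderiv_map :: "(real \<times> real) \<times> complex \<Rightarrow> complex" where
  "logderiv_map = (\<lambda>((s, t), z). logderiv s t z)"

text \<open>To compare two triples with \<open>s \<le> s'\<close>, change first \<open>t\<close>, then \<open>s\<close>, then \<open>z\<close>; this way the times stay ordered.\<close>

lemma piece_pair_induct:
  assumes p: "p \<in> piece n" and q: "q \<in> piece n" and K: "0 \<le> K"
    and t_part: "\<And>s t t' z. 0 \<le> s \<Longrightarrow> s \<le> t \<Longrightarrow> t \<le> t' \<Longrightarrow> t' \<le> real n \<Longrightarrow> z \<in> half_box n \<Longrightarrow>
      dist (f ((s, t), z)) (f ((s, t'), z)) \<le> K * (t' - t) powr e"
    and s_part: "\<And>s s' t z. 0 \<le> s \<Longrightarrow> s \<le> s' \<Longrightarrow> s' \<le> t \<Longrightarrow> t \<le> real n \<Longrightarrow> z \<in> half_box n \<Longrightarrow>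
      dist (f ((s, t), z)) (f ((s', t), z)) \<le> K * (s' - s) powr e"
    and z_part: "\<And>s t z w. 0 \<le> s \<Longrightarrow> s \<le> t \<Longrightarrow> t \<le> real n \<Longrightarrow> z \<in> half_box n \<Longrightarrow> w \<in> half_box n \<Longrightarrow>
      dist (f ((s, t), z)) (f ((s, t), w)) \<le> K * dist z w powr e"
    and e: "0 < e"
  shows "dist (f p) (f q) \<le> 3 * K * dist p q powr e"
proof -
  have core: "dist (f ((s, t), z)) (f ((s', t'), z')) \<le> 3 * K * dist ((s, t), z) ((s', t'), z') powr e"
    if P: "((s, t), z) \<in> piece n" "((s', t'), z') \<in> piece n" "s \<le> s'" for s t z s' t' z'
  proof -
    define d where "d = dist ((s, t), z) ((s', t'), z')"
    have ds: "dist (s, t) (s', t') \<le> d" "dist z z' \<le> d"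
      using dist_fst_le[of "((s, t), z)" "((s', t'), z')"] dist_snd_le[of "((s, t), z)" "((s', t'), z')"] by (auto simp: d_def)
    have dd: "\<bar>s - s'\<bar> \<le> d" "\<bar>t - t'\<bar> \<le> d"
      using ds(1) dist_fst_le[of "(s, t)" "(s', t')"] dist_snd_le[of "(s, t)" "(s', t')"] by (auto simp: dist_real_def)
    have in1: "0 \<le> s" "s \<le> t" "t \<le> real n" "z \<in> half_box n" "0 \<le> s'" "s' \<le> t'" "t' \<le> real n" "z' \<in> half_box n"
      using P by (auto simp: piece_def)
    have "dist (f ((s, t), z)) (f ((s, t'), z)) \<le> K * \<bar>t - t'\<bar> powr e"
    proof (cases "t \<le> t'")
      case True then show ?thesis using t_part[of s t t' z] in1 by simp
    next
      case False then show ?thesis using t_part[of s t' t z] in1 P(3) by (simp add: dist_commute)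
    qed
    also have "\<dots> \<le> K * d powr e" using K dd e by (intro mult_left_mono powr_mono2) auto
    finally have 1: "dist (f ((s, t), z)) (f ((s, t'), z)) \<le> K * d powr e" .
    have "dist (f ((s, t'), z)) (f ((s', t'), z)) \<le> K * (s' - s) powr e" using s_part[of s s' t' z] in1 P(3) by simp
    also have "\<dots> \<le> K * d powr e" using K dd e P(3) by (intro mult_left_mono powr_mono2) auto
    finally have 2: "dist (f ((s, t'), z)) (f ((s', t'), z)) \<le> K * d powr e" .
    have "dist (f ((s', t'), z)) (f ((s', t'), z')) \<le> K * dist z z' powr e" using z_part[of s' t' z z'] in1 by simp
    also have "\<dots> \<le> K * d powr e" using K ds e by (intro mult_left_mono powr_mono2) auto
    finally have 3: "dist (f ((s', t'), z)) (f ((s', t'), z')) \<le> K * d powr e" .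
    show ?thesis
      using 1 2 3 dist_triangle[of "f ((s, t), z)" "f ((s', t'), z')" "f ((s, t'), z)"]
        dist_triangle[of "f ((s, t'), z)" "f ((s', t'), z')" "f ((s', t'), z)"] unfolding d_def by linarith
  qed
  obtain s t z where pe: "p = ((s, t), z)" by (metis prod.exhaust)
  obtain s' t' z' where qe: "q = ((s', t'), z')" by (metis prod.exhaust)
  show ?thesis
  proof (cases "s \<le> s'")
    case True then show ?thesis using core p q unfolding pe qe by blast
  next
    case False
    then have "dist (f q) (f p) \<le> 3 * K * dist q p powr e" using core[of s' t' z' s t z] p q unfolding pe qe by simp
    then show ?thesis by (simp add: dist_commute)
  qed
qed

lemma box_mono: "m \<le> n \<Longrightarrow> z \<in> half_box m \<Longrightarrow> z \<in> half_box n"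
  by (auto simp: half_box_def)

lemma box_dist: "z \<in> half_box n \<Longrightarrow> w \<in> half_box n \<Longrightarrow> dist z w \<le> 4 * real n + 1"
proof -
  assume "z \<in> half_box n" "w \<in> half_box n"
  then have "\<bar>Re (z - w)\<bar> \<le> 2 * real n" "\<bar>Im (z - w)\<bar> \<le> 2 * real n" by (auto simp: half_box_def)
  then show ?thesis using cmod_le[of "z - w"] by (simp add: dist_norm)
qed

lemma flow_time_holder:
  assumes \<eta>: "0 < \<eta>" "\<eta> < 1 / 2"
  obtains K where "0 \<le> K" "\<And>s r t z. 0 \<le> s \<Longrightarrow> s \<le> r \<Longrightarrow> r \<le> t \<Longrightarrow> t \<le> real n \<Longrightarrow> 0 < Im z \<Longrightarrow>
    cmod (\<phi> s t z - \<phi> s r z) \<le> K * (t - r) powr \<eta>"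
proof -
  obtain K1 where K1: "0 \<le> K1" "\<And>s t. 0 \<le> s \<Longrightarrow> s \<le> t \<Longrightarrow> t \<le> real n \<Longrightarrow> \<bar>U t - U s\<bar> \<le> K1 * (t - s) powr \<eta>"
    using path_holder[OF \<eta>] by blast
  define Q where "Q = real n + 1"
  show thesis
  proof
    show "0 \<le> C * Q + K1" using C_ge K1 by (simp add: Q_def)
    fix s r t z assume s: "0 \<le> s" "s \<le> r" "r \<le> t" "t \<le> real n" and z: "0 < Im z"
    have "cmod (\<phi> s t z - \<phi> s r z) \<le> C * (t - r) + \<bar>U t - U r\<bar>" using s z by (intro flow_increment_bound) auto
    also have "t - r \<le> Q * (t - r) powr \<eta>"
    proof (cases "t = r")
      case False
      then show ?thesis using powr_le_mult_powr[of "t - r" Q \<eta> 1] s \<eta> by (simp add: Q_def)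
    qed simp
    also have "\<bar>U t - U r\<bar> \<le> K1 * (t - r) powr \<eta>" using s by (intro K1(2)) auto
    finally show "cmod (\<phi> s t z - \<phi> s r z) \<le> (C * Q + K1) * (t - r) powr \<eta>"
      using C_ge by (simp add: algebra_simps)
  qed
qed

lemma flow_map_holder:
  assumes \<eta>: "0 < \<eta>" "\<eta> < 1 / 2"
  obtains K where "0 \<le> K" "\<And>p q. p \<in> piece n \<Longrightarrow> q \<in> piece n \<Longrightarrow> dist (flow_map p) (flow_map q) \<le> K * dist p q powr \<eta>"
proof -
  obtain N where N: "n \<le> N" "\<And>s t z. 0 \<le> s \<Longrightarrow> s \<le> t \<Longrightarrow> t \<le> real n \<Longrightarrow> z \<in> half_box n \<Longrightarrow> \<phi> s t z \<in> half_box N"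
    using trajectory_box[of n n] by metis
  obtain \<Lambda> where \<Lambda>: "1 \<le> \<Lambda>" "\<And>s t z w. 0 \<le> s \<Longrightarrow> s \<le> t \<Longrightarrow> t \<le> real n \<Longrightarrow> z \<in> half_box N \<Longrightarrow> w \<in> half_box N \<Longrightarrow>
    cmod (\<phi> s t z - \<phi> s t w) \<le> \<Lambda> * cmod (z - w)"
    using flow_space_lipschitz[of n N] by blast
  obtain K where K: "0 \<le> K" "\<And>s r t z. 0 \<le> s \<Longrightarrow> s \<le> r \<Longrightarrow> r \<le> t \<Longrightarrow> t \<le> real n \<Longrightarrow> 0 < Im z \<Longrightarrow>
    cmod (\<phi> s t z - \<phi> s r z) \<le> K * (t - r) powr \<eta>"
    using flow_time_holder[OF \<eta>] by blast
  define Q where "Q = 4 * real n + 1"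
  define K' where "K' = \<Lambda> * (K + Q)"
  have K': "0 \<le> K'" "K \<le> K'" "\<Lambda> * K \<le> K'" "\<Lambda> * Q \<le> K'"
  proof -
    have Q: "0 \<le> Q" by (simp add: Q_def)
    then show "0 \<le> K'" "\<Lambda> * K \<le> K'" "\<Lambda> * Q \<le> K'" using \<Lambda>(1) K(1) by (auto simp: K'_def intro!: mult_left_mono)
    have "1 * K \<le> \<Lambda> * (K + Q)" using \<Lambda>(1) K(1) Q by (intro mult_mono) auto
    then show "K \<le> K'" by (simp add: K'_def)
  qed
  show thesis
  proof
    show "0 \<le> 3 * K'" using K' by simp
    fix p q assume "p \<in> piece n" "q \<in> piece n"
    then show "dist (flow_map p) (flow_map q) \<le> 3 * K' * dist p q powr \<eta>"
    proof (rule piece_pair_induct[OF _ _ K'(1)])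
      fix s t t' z assume s: "0 \<le> s" "s \<le> t" "t \<le> t'" "t' \<le> real n" and z: "z \<in> half_box n"
      have "cmod (\<phi> s t' z - \<phi> s t z) \<le> K * (t' - t) powr \<eta>" using s z by (intro K(2)) (auto simp: half_box_def)
      also have "\<dots> \<le> K' * (t' - t) powr \<eta>" using K' by (intro mult_right_mono) auto
      finally show "dist (flow_map ((s, t), z)) (flow_map ((s, t'), z)) \<le> K' * (t' - t) powr \<eta>"
        by (simp add: flow_map_def dist_norm norm_minus_commute)
    next
      fix s s' t z assume s: "0 \<le> s" "s \<le> s'" "s' \<le> t" "t \<le> real n" and z: "z \<in> half_box n"
      have zi: "0 < Im z" using z by (simp add: half_box_def)
      \<comment> \<open>By the semigroup property, changing the starting time from s to s' amounts
        to changing the starting point at time s' from z to \<phi>(s, s', z).\<close>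
      have "cmod (\<phi> s t z - \<phi> s' t z) = cmod (\<phi> s' t (\<phi> s s' z) - \<phi> s' t z)"
        using flow_semigroup[OF s(1-3) zi] by simp
      also have "\<dots> \<le> \<Lambda> * cmod (\<phi> s s' z - \<phi> s s z)"
        using \<Lambda>(2)[of s' t "\<phi> s s' z" z] N(2)[of s s' z] box_mono[OF N(1) z] s z zi by simp
      also have "\<dots> \<le> \<Lambda> * (K * (s' - s) powr \<eta>)"
        using \<Lambda>(1) s zi by (intro mult_left_mono K(2)) auto
      also have "\<dots> \<le> K' * (s' - s) powr \<eta>" using K'(3) by (simp add: mult.assoc[symmetric] mult_right_mono)
      finally show "dist (flow_map ((s, t), z)) (flow_map ((s', t), z)) \<le> K' * (s' - s) powr \<eta>"
        by (simp add: flow_map_def dist_norm)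
    next
      fix s t z w assume s: "0 \<le> s" "s \<le> t" "t \<le> real n" and z: "z \<in> half_box n" and w: "w \<in> half_box n"
      have "cmod (\<phi> s t z - \<phi> s t w) \<le> \<Lambda> * cmod (z - w)"
        using \<Lambda>(2)[of s t z w] box_mono[OF N(1)] s z w by simp
      also have "cmod (z - w) \<le> Q * cmod (z - w) powr \<eta>"
      proof (cases "z = w")
        case False
        then show ?thesis
          using powr_le_mult_powr[of "cmod (z - w)" Q \<eta> 1] box_dist[OF z w] \<eta> by (simp add: Q_def dist_norm)
      qed simp
      also have "\<Lambda> * (Q * cmod (z - w) powr \<eta>) \<le> K' * cmod (z - w) powr \<eta>"
        using K'(4) by (simp add: mult.assoc[symmetric] mult_right_mono)
      finally show "dist (flow_map ((s, t), z)) (flow_map ((s, t), w)) \<le> K' * dist z w powr \<eta>"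
        using \<Lambda>(1) by (simp add: flow_map_def dist_norm)
    qed (use \<eta> in auto)
  qed
qed

lemma flow_map_locally_holder: "locally_holder flow_map"
  unfolding locally_holder_def
proof
  fix n
  obtain K where "0 \<le> K" "\<And>p q. p \<in> piece n \<Longrightarrow> q \<in> piece n \<Longrightarrow> dist (flow_map p) (flow_map q) \<le> K * dist p q powr (1 / 4)"
    using flow_map_holder[of "1 / 4" n] by auto
  then show "\<exists>K\<ge>0. \<exists>e>0. \<forall>p\<in>piece n. \<forall>q\<in>piece n. dist (flow_map p) (flow_map q) \<le> K * dist p q powr e"
    by (intro exI[of _ K] conjI exI[of _ "1 / 4 :: real"]) auto
qed

lemma logderiv_map_locally_holder: "locally_holder logderiv_map"
  unfolding locally_holder_def
proof
  fix n
  obtain N where N: "n \<le> N" "\<And>s t z. 0 \<le> s \<Longrightarrow> s \<le> t \<Longrightarrow> t \<le> real n \<Longrightarrow> z \<in> half_box n \<Longrightarrow> \<phi> s t z \<in> half_box N"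
    using trajectory_box[of n n] by metis
  obtain K where K: "0 \<le> K" "\<And>s r t z. 0 \<le> s \<Longrightarrow> s \<le> r \<Longrightarrow> r \<le> t \<Longrightarrow> t \<le> real n \<Longrightarrow> 0 < Im z \<Longrightarrow>
    cmod (\<phi> s t z - \<phi> s r z) \<le> K * (t - r) powr (1 / 4)"
    using flow_time_holder[of "1 / 4" n] by auto
  obtain K1 \<epsilon> where K1: "0 \<le> K1" "0 < \<epsilon>" "\<And>s a b z. 0 \<le> s \<Longrightarrow> s \<le> a \<Longrightarrow> a \<le> b \<Longrightarrow> b \<le> real n \<Longrightarrow> z \<in> half_box n \<Longrightarrow>
    cmod (logderiv s b z - logderiv s a z) \<le> K1 * (b - a) powr \<epsilon>"
    using logderiv_time_holder[of n n] by blast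
  define \<eta> where "\<eta> = \<alpha> / 2"
  have \<eta>: "0 < \<eta>" "\<eta> < \<alpha>" using \<alpha>_pos by (auto simp: \<eta>_def)
  obtain K2 where K2: "0 \<le> K2" "\<And>s t z w. 0 \<le> s \<Longrightarrow> s \<le> t \<Longrightarrow> t \<le> real n \<Longrightarrow> z \<in> half_box N \<Longrightarrow> w \<in> half_box N \<Longrightarrow>
    cmod (logderiv s t z - logderiv s t w) \<le> K2 * cmod (z - w) powr \<eta>"
    using logderiv_space_holder[OF \<eta>, of n N] by blast
  \<comment> \<open>\<epsilon> comes from time increments of L. Changing the starting time moves the
    starting point by an amount of order |s' - s|^(1/4), which L turns into the power
    \<eta>/4.\<close>
  define e where "e = min \<epsilon> (\<eta> / 4)"
  have e: "0 < e" "e \<le> \<epsilon>" "e \<le> \<eta> / 4" "e \<le> \<eta>" using K1(2) \<eta> by (auto simp: e_def)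
  define Q where "Q = 4 * real n + 1"
  have Q: "1 \<le> Q" by (simp add: Q_def)
  define K' where "K' = K1 * Q powr \<epsilon> + K2 * (K powr \<eta>) * Q powr (\<eta> / 4) + K2 * Q powr \<eta>"
  have K': "0 \<le> K'" "K1 * Q powr \<epsilon> \<le> K'" "K1 * Q powr \<epsilon> + K2 * (K powr \<eta>) * Q powr (\<eta> / 4) \<le> K'" "K2 * Q powr \<eta> \<le> K'"
    using K1(1) K2(1) by (auto simp: K'_def)
  have time: "cmod (logderiv s b z - logderiv s a z) \<le> K1 * Q powr \<epsilon> * (b - a) powr e"
    if "0 \<le> s" "s \<le> a" "a \<le> b" "b \<le> real n" "z \<in> half_box n" for s a b z
  proof -
    have "cmod (logderiv s b z - logderiv s a z) \<le> K1 * (b - a) powr \<epsilon>" by (rule K1(3)[OF that])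
    also have "\<dots> \<le> K1 * (Q powr \<epsilon> * (b - a) powr e)"
      using that K1(1) e by (intro mult_left_mono powr_le_mult_powr) (auto simp: Q_def)
    finally show ?thesis by (simp add: mult.assoc)
  qed
  have "dist (logderiv_map p) (logderiv_map q) \<le> 3 * K' * dist p q powr e" if "p \<in> piece n" "q \<in> piece n" for p q
    using that
  proof (rule piece_pair_induct[OF _ _ K'(1)])
    fix s t t' z assume s: "0 \<le> s" "s \<le> t" "t \<le> t'" "t' \<le> real n" and z: "z \<in> half_box n"
    have "cmod (logderiv s t' z - logderiv s t z) \<le> K1 * Q powr \<epsilon> * (t' - t) powr e" by (rule time[OF s z])
    also have "\<dots> \<le> K' * (t' - t) powr e" using K' by (intro mult_right_mono) auto
    finally show "dist (logderiv_map ((s, t), z)) (logderiv_map ((s, t'), z)) \<le> K' * (t' - t) powr e"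
      by (simp add: logderiv_map_def dist_norm norm_minus_commute)
  next
    fix s s' t z assume s: "0 \<le> s" "s \<le> s'" "s' \<le> t" "t \<le> real n" and z: "z \<in> half_box n"
    have zi: "0 < Im z" using z by (simp add: half_box_def)
    have "cmod (logderiv s s' z - logderiv s s z) \<le> K1 * Q powr \<epsilon> * (s' - s) powr e"
      using s by (intro time z) auto
    then have 1: "cmod (logderiv s s' z) \<le> K1 * Q powr \<epsilon> * (s' - s) powr e" by (simp add: logderiv_def)
    have "cmod (logderiv s' t (\<phi> s s' z) - logderiv s' t z) \<le> K2 * cmod (\<phi> s s' z - \<phi> s s z) powr \<eta>"
      using K2(2)[of s' t "\<phi> s s' z" z] N(2)[of s s' z] box_mono[OF N(1) z] s z zi by simp
    also have "\<dots> \<le> K2 * (K * (s' - s) powr (1 / 4)) powr \<eta>"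
      using K2(1) K(2)[of s s s' z] s zi \<eta> by (intro mult_left_mono powr_mono2) auto
    also have "\<dots> = K2 * K powr \<eta> * (s' - s) powr (\<eta> / 4)"
      using K(1) by (simp add: powr_mult powr_powr)
    also have "\<dots> \<le> K2 * K powr \<eta> * (Q powr (\<eta> / 4) * (s' - s) powr e)"
      using s K2(1) e by (intro mult_left_mono powr_le_mult_powr) (auto simp: Q_def)
    finally have 2: "cmod (logderiv s' t (\<phi> s s' z) - logderiv s' t z) \<le> K2 * K powr \<eta> * Q powr (\<eta> / 4) * (s' - s) powr e"
      by (simp add: mult.assoc)
    have eq: "logderiv s t z - logderiv s' t z = logderiv s s' z + (logderiv s' t (\<phi> s s' z) - logderiv s' t z)"
      using logderiv_split[OF s(1-3) zi] by simp
    have "cmod (logderiv s t z - logderiv s' t z) \<le> (K1 * Q powr \<epsilon> + K2 * (K powr \<eta>) * Q powr (\<eta> / 4)) * (s' - s) powr e"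
      unfolding eq distrib_right by (rule norm_triangle_le[OF add_mono[OF 1 2]])
    also have "\<dots> \<le> K' * (s' - s) powr e" using K' by (intro mult_right_mono) auto
    finally show "dist (logderiv_map ((s, t), z)) (logderiv_map ((s', t), z)) \<le> K' * (s' - s) powr e"
      by (simp add: logderiv_map_def dist_norm)
  next
    fix s t z w assume s: "0 \<le> s" "s \<le> t" "t \<le> real n" and z: "z \<in> half_box n" and w: "w \<in> half_box n"
    have "cmod (logderiv s t z - logderiv s t w) \<le> K2 * cmod (z - w) powr \<eta>"
      using K2(2)[of s t z w] box_mono[OF N(1)] s z w by simp
    also have "\<dots> \<le> K2 * (Q powr \<eta> * cmod (z - w) powr e)"
      using K2(1) e box_dist[OF z w] Q by (intro mult_left_mono powr_le_mult_powr) (auto simp: Q_def dist_norm)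
    also have "\<dots> \<le> K' * cmod (z - w) powr e"
      using K'(4) by (simp add: mult.assoc[symmetric] mult_right_mono)
    finally show "dist (logderiv_map ((s, t), z)) (logderiv_map ((s, t), w)) \<le> K' * dist z w powr e"
      by (simp add: logderiv_map_def dist_norm)
  qed (use e in auto)
  then show "\<exists>K\<ge>0. \<exists>e>0. \<forall>p\<in>piece n. \<forall>q\<in>piece n. dist (logderiv_map p) (logderiv_map q) \<le> K * dist p q powr e"
    using K'(1) e(1) by (intro exI[of _ "3 * K'"] conjI exI[of _ e]) auto
qed

end

context regular_flow
begin

definition flow_ext :: "(real \<times> real) \<times> complex \<Rightarrow> complex" where
  "flow_ext = boundary_extension flow_map"

text \<open>The logarithm is extended first, because the Hoelder bounds are bounds for L;
  exponentiation comes last.\<close>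

definition deriv_ext :: "(real \<times> real) \<times> complex \<Rightarrow> complex" where
  "deriv_ext p = exp (boundary_extension logderiv_map p)"

lemma continuous_extension_flow:
  "continuous_extension (time_simplex \<times> upper_half_plane) (time_simplex \<times> closed_upper_half_plane)
     (\<lambda>((s, t), z). \<phi> s t z) flow_ext"
  unfolding continuous_extension_def flow_ext_def
  using boundary_extension_continuous[OF flow_map_locally_holder]
  by (auto simp: boundary_extension_interior flow_map_def)

lemma continuous_extension_deriv:
  "continuous_extension (time_simplex \<times> upper_half_plane) (time_simplex \<times> closed_upper_half_plane)
     (\<lambda>((s, t), z). deriv (\<phi> s t) z) deriv_ext"
  unfolding continuous_extension_def deriv_ext_def
  using boundary_extension_continuous[OF logderiv_map_locally_holder]
  by (auto simp: boundary_extension_interior logderiv_map_def deriv_flow intro!: continuous_on_exp)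

lemma flow_ext_holder:
  assumes \<eta>: "0 < \<eta>" "\<eta> < 1 / 2" and K: "compact K" "K \<subseteq> time_simplex \<times> closed_upper_half_plane"
  shows "holder_on \<eta> K flow_ext"
proof -
  obtain n where n: "K \<subseteq> closed_piece n" by (rule bounded_subset_closed_piece[OF compact_imp_bounded[OF K(1)] K(2)])
  obtain c where c: "\<And>p q. p \<in> piece (Suc n) \<Longrightarrow> q \<in> piece (Suc n) \<Longrightarrow> dist (flow_map p) (flow_map q) \<le> c * dist p q powr \<eta>"
    using flow_map_holder[OF \<eta>, of "Suc n"] by blast
  show ?thesis
    unfolding flow_ext_def
    by (rule holder_onI, rule boundary_extension_holder[OF flow_map_locally_holder c]) (use n in auto)
qed

lemma shift_up_pair: "shift_up i (st, z) = (st, z + Complex 0 (1 / real (Suc i)))"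
  by (simp add: shift_up_def)

lemma flow_ext_tendsto:
  assumes "0 \<le> s" "s \<le> t" "0 \<le> Im z"
  shows "(\<lambda>i. \<phi> s t (z + Complex 0 (1 / real (Suc i)))) \<longlonglongrightarrow> flow_ext ((s, t), z)"
  using boundary_extension_tendsto[OF flow_map_locally_holder, of "((s, t), z)"] assms
  by (simp add: flow_ext_def flow_map_def shift_up_pair del: of_nat_Suc)

lemma logderiv_ext_tendsto:
  assumes "0 \<le> s" "s \<le> t" "0 \<le> Im z"
  shows "(\<lambda>i. logderiv s t (z + Complex 0 (1 / real (Suc i)))) \<longlonglongrightarrow> boundary_extension logderiv_map ((s, t), z)"
  using boundary_extension_tendsto[OF logderiv_map_locally_holder, of "((s, t), z)"] assms
  by (simp add: logderiv_map_def shift_up_pair del: of_nat_Suc)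

lemma shift_in_box:
  assumes "z \<in> closed_box n"
  shows "z + Complex 0 (1 / real (Suc i)) \<in> half_box (Suc n)"
proof -
  obtain e where e: "1 / real (Suc i) = e" "0 < e" "e \<le> 1" by simp
  show ?thesis using assms e(2,3) unfolding e(1) by (auto simp: closed_box_def half_box_def)
qed

text \<open>The bi-Lipschitz lower bound survives the passage to the boundary; injectivity and
  continuity of the inverse rest on it.\<close>

lemma flow_ext_lower_bound:
  assumes st: "0 \<le> s" "s \<le> t"
  obtains c where "0 < c" "\<And>z w. z \<in> closed_box n \<Longrightarrow> w \<in> closed_box n \<Longrightarrow>
    c * cmod (z - w) \<le> cmod (flow_ext ((s, t), z) - flow_ext ((s, t), w))"
proof -
  obtain T :: nat where T: "t \<le> real T" using real_arch_simple by blast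
  obtain c where c: "0 < c" "\<And>s t z w. 0 \<le> s \<Longrightarrow> s \<le> t \<Longrightarrow> t \<le> real T \<Longrightarrow> z \<in> half_box (Suc n) \<Longrightarrow> w \<in> half_box (Suc n) \<Longrightarrow>
    c * cmod (z - w) \<le> cmod (\<phi> s t z - \<phi> s t w)"
    using flow_lower_bound[of T "Suc n"] by blast
  show thesis
  proof
    show "0 < c" by fact
    fix z w assume z: "z \<in> closed_box n" and w: "w \<in> closed_box n"
    let ?e = "\<lambda>i. Complex 0 (1 / real (Suc i))"
    show "c * cmod (z - w) \<le> cmod (flow_ext ((s, t), z) - flow_ext ((s, t), w))"
    proof (rule LIMSEQ_le_const)
      show "(\<lambda>i. cmod (\<phi> s t (z + ?e i) - \<phi> s t (w + ?e i))) \<longlonglongrightarrow> cmod (flow_ext ((s, t), z) - flow_ext ((s, t), w))"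
        using st z w by (intro tendsto_norm tendsto_diff flow_ext_tendsto) (auto simp: closed_box_def)
      have "c * cmod (z - w) \<le> cmod (\<phi> s t (z + ?e i) - \<phi> s t (w + ?e i))" for i
        using c(2)[OF st T shift_in_box[OF z, of i] shift_in_box[OF w, of i]] by simp
      then show "\<exists>N. \<forall>i\<ge>N. c * cmod (z - w) \<le> cmod (\<phi> s t (z + ?e i) - \<phi> s t (w + ?e i))" by blast
    qed
  qed
qed

lemma in_closed_box:
  assumes "0 \<le> Im z" "cmod z \<le> real n"
  shows "z \<in> closed_box n"
  using assms abs_Re_le_cmod[of z] abs_Im_le_cmod[of z] by (auto simp: closed_box_def)

lemma flow_ext_inj:
  assumes st: "0 \<le> s" "s \<le> t"
  shows "inj_on (\<lambda>z. flow_ext ((s, t), z)) closed_upper_half_plane"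
proof (rule inj_onI)
  fix z w assume zw: "z \<in> closed_upper_half_plane" "w \<in> closed_upper_half_plane" and eq: "flow_ext ((s, t), z) = flow_ext ((s, t), w)"
  obtain n :: nat where n: "max (cmod z) (cmod w) \<le> real n" using real_arch_simple by blast
  obtain c where c: "0 < c" "\<And>z w. z \<in> closed_box n \<Longrightarrow> w \<in> closed_box n \<Longrightarrow>
    c * cmod (z - w) \<le> cmod (flow_ext ((s, t), z) - flow_ext ((s, t), w))"
    using flow_ext_lower_bound[OF st, where n = n] by metis
  have "z \<in> closed_box n" "w \<in> closed_box n" using n zw by (auto intro: in_closed_box)
  from c(2)[OF this] eq c(1) show "z = w" by (simp add: mult_le_0_iff)
qed

text \<open>A bound for |\<phi>(s, t, z) - z| that does not depend on z. It makes the extended flow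
  proper: preimages of bounded sets are bounded.\<close>

definition displacement :: "real \<Rightarrow> real \<Rightarrow> real" where
  "displacement s t = C * (t - s) + \<bar>U t - U s\<bar>"

lemma flow_ext_displacement:
  assumes st: "0 \<le> s" "s \<le> t" and z: "0 \<le> Im z"
  shows "cmod (flow_ext ((s, t), z) - z) \<le> displacement s t"
proof (rule LIMSEQ_le_const2)
  let ?e = "\<lambda>i. Complex 0 (1 / real (Suc i))"
  have "(\<lambda>i. snd (shift_up i ((s, t), z))) \<longlonglongrightarrow> snd ((s, t), z)"
    by (intro tendsto_snd shift_up_tendsto)
  then have "(\<lambda>i. z + ?e i) \<longlonglongrightarrow> z" by (simp add: shift_up_pair del: of_nat_Suc)
  then show "(\<lambda>i. cmod (\<phi> s t (z + ?e i) - (z + ?e i))) \<longlonglongrightarrow> cmod (flow_ext ((s, t), z) - z)"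
    by (intro tendsto_norm tendsto_diff flow_ext_tendsto st z)
  have "cmod (\<phi> s t (z + ?e i) - (z + ?e i)) \<le> displacement s t" for i
  proof -
    have zi: "0 < Im (z + ?e i)" using z by (simp add: add_nonneg_pos)
    show ?thesis using flow_increment_bound[OF st(1) order_refl st(2) zi] st zi by (simp add: displacement_def)
  qed
  then show "\<exists>N. \<forall>i\<ge>N. cmod (\<phi> s t (z + ?e i) - (z + ?e i)) \<le> displacement s t" by blast
qed

lemma flow_ext_cont:
  assumes st: "0 \<le> s" "s \<le> t"
  shows "continuous_on closed_upper_half_plane (\<lambda>z. flow_ext ((s, t), z))"
proof -
  have "continuous_on (time_simplex \<times> closed_upper_half_plane) flow_ext"
    using continuous_extension_flow by (simp add: continuous_extension_def)
  then show ?thesis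
    by (rule continuous_on_compose2) (use st in \<open>auto intro!: continuous_intros\<close>)
qed

text \<open>A convergent sequence of image points has bounded preimages, by
  \<open>displacement\<close>; a subsequence of these converges in the closed half plane, where the
  extended flow is continuous.\<close>

lemma closure_planar_evolution:
  assumes st: "0 \<le> s" "s \<le> t"
  shows "closure (planar_evolution F U s t) = (\<lambda>z. flow_ext ((s, t), z)) ` closed_upper_half_plane"
proof (intro equalityI subsetI)
  fix y assume "y \<in> closure (planar_evolution F U s t)"
  then obtain x where x: "\<And>i. x i \<in> planar_evolution F U s t" "x \<longlonglongrightarrow> y" unfolding closure_sequential by blast
  have "\<exists>z. 0 < Im z \<and> x i = \<phi> s t z" for i using x(1)[of i] by (auto simp: planar_evolution_def)
  then obtain z where z: "\<And>i. 0 < Im (z i)" "\<And>i. x i = \<phi> s t (z i)" by metis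
  have xe: "x i = flow_ext ((s, t), z i)" for i
    using z by (simp add: flow_ext_def boundary_extension_interior flow_map_def)
  obtain b where b: "\<And>i. cmod (x i) \<le> b"
    using convergent_imp_Bseq[OF convergentI[OF x(2)]] unfolding Bseq_def by blast
  let ?S = "{z. 0 \<le> Im z} \<inter> cball 0 (b + displacement s t)"
  have "z i \<in> ?S" for i
  proof -
    have "cmod (x i - z i) \<le> displacement s t" unfolding xe using z(1)[of i] by (intro flow_ext_displacement st) simp
    then have "cmod (z i) \<le> cmod (x i) + displacement s t"
      using norm_triangle_ineq4[of "x i" "x i - z i"] by simp
    then show ?thesis using b[of i] z(1)[of i] by simp
  qed
  moreover have "compact ?S" by (intro closed_Int_compact closed_halfspace_Im_ge compact_cball)
  ultimately obtain l r where l: "l \<in> ?S" "strict_mono (r :: nat \<Rightarrow> nat)" "(z \<circ> r) \<longlonglongrightarrow> l"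
    unfolding compact_def by metis
  have "(\<lambda>i. flow_ext ((s, t), (z \<circ> r) i)) \<longlonglongrightarrow> flow_ext ((s, t), l)"
    by (rule continuous_on_tendsto_compose[OF flow_ext_cont[OF st] l(3)]) (use l z in \<open>auto simp: less_imp_le\<close>)
  moreover have "(\<lambda>i. flow_ext ((s, t), (z \<circ> r) i)) \<longlonglongrightarrow> y"
    using LIMSEQ_subseq_LIMSEQ[OF x(2) l(2)] by (simp add: xe[symmetric] o_def)
  ultimately have "y = flow_ext ((s, t), l)" by (rule LIMSEQ_unique[symmetric])
  then show "y \<in> (\<lambda>z. flow_ext ((s, t), z)) ` closed_upper_half_plane" using l(1) by auto
next
  fix y assume "y \<in> (\<lambda>z. flow_ext ((s, t), z)) ` closed_upper_half_plane"
  then obtain z where z: "0 \<le> Im z" "y = flow_ext ((s, t), z)" by auto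
  have "\<phi> s t (z + Complex 0 (1 / real (Suc i))) \<in> planar_evolution F U s t" for i
    unfolding planar_evolution_def using z(1) by (intro imageI) (simp add: add_nonneg_pos)
  then show "y \<in> closure (planar_evolution F U s t)"
    unfolding closure_sequential z(2) using flow_ext_tendsto[OF st z(1)]
    by (intro exI[of _ "\<lambda>i. \<phi> s t (z + Complex 0 (1 / real (Suc i)))"] conjI allI)
qed

lemma planar_evolution_eq:
  "0 \<le> s \<Longrightarrow> s \<le> t \<Longrightarrow> planar_evolution F U s t = (\<lambda>z. flow_ext ((s, t), z)) ` upper_half_plane"
  by (auto simp: planar_evolution_def flow_ext_def boundary_extension_interior flow_map_def)

lemma open_planar_evolution:
  assumes st: "0 \<le> s" "s \<le> t"
  shows "open (planar_evolution F U s t)"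
  unfolding planar_evolution_def
proof (rule open_mapping_thm3[OF flow_holomorphic[OF st] open_H])
  show "inj_on (\<phi> s t) upper_half_plane"
  proof (rule inj_onI)
    fix z w assume "z \<in> upper_half_plane" "w \<in> upper_half_plane" "\<phi> s t z = \<phi> s t w"
    then show "z = w"
      using inj_onD[OF flow_ext_inj[OF st], of z w] by (simp add: flow_ext_def boundary_extension_interior flow_map_def)
  qed
qed

text \<open>The image of the open half plane is open and the extension is injective, so what the
  closed half plane adds is exactly the image of the real line.\<close>

lemma frontier_planar_evolution:
  assumes st: "0 \<le> s" "s \<le> t"
  shows "frontier (planar_evolution F U s t) = range (\<lambda>x. flow_ext ((s, t), complex_of_real x))"
proof -
  let ?g = "\<lambda>z. flow_ext ((s, t), z)"
  have "frontier (planar_evolution F U s t) = ?g ` closed_upper_half_plane - ?g ` upper_half_plane"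
    unfolding frontier_def closure_planar_evolution[OF st]
    using interior_open[OF open_planar_evolution[OF st]] planar_evolution_eq[OF st] by simp
  also have "\<dots> = ?g ` (closed_upper_half_plane - upper_half_plane)"
    by (rule inj_on_image_set_diff[OF flow_ext_inj[OF st], symmetric]) auto
  also have "closed_upper_half_plane - upper_half_plane = range complex_of_real"
  proof (intro equalityI subsetI)
    fix z assume "z \<in> closed_upper_half_plane - upper_half_plane"
    then have "z = complex_of_real (Re z)" by (simp add: complex_eq_iff)
    then show "z \<in> range complex_of_real" by (rule range_eqI)
  qed auto
  finally show ?thesis by (simp add: image_image)
qed

lemma jordan_arc_frontier:
  assumes st: "0 \<le> s" "s \<le> t"
  shows "jordan_arc_param (\<lambda>x. flow_ext ((s, t), complex_of_real x)) (frontier (planar_evolution F U s t))"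
proof -
  define \<gamma> where "\<gamma> x = flow_ext ((s, t), complex_of_real x)" for x
  have inj: "inj \<gamma>"
  proof (rule injI)
    fix x y assume "\<gamma> x = \<gamma> y"
    then have "complex_of_real x = complex_of_real y"
      using inj_onD[OF flow_ext_inj[OF st], of "complex_of_real x" "complex_of_real y"] by (simp add: \<gamma>_def)
    then show "x = y" by simp
  qed
  have cont: "continuous_on UNIV \<gamma>"
    unfolding \<gamma>_def by (rule continuous_on_compose2[OF flow_ext_cont[OF st]]) (auto intro!: continuous_intros)
  have inv_cont: "continuous_on (range \<gamma>) (inv \<gamma>)"
    unfolding continuous_on_iff
  proof (intro ballI allI impI)
    fix y and e :: real assume "y \<in> range \<gamma>" and e: "0 < e"
    then obtain x where x: "y = \<gamma> x" by blast
    obtain n :: nat where n: "cmod y + 1 + displacement s t \<le> real n" using real_arch_simple by blast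
    obtain c where c: "0 < c" "\<And>z w. z \<in> closed_box n \<Longrightarrow> w \<in> closed_box n \<Longrightarrow>
      c * cmod (z - w) \<le> cmod (flow_ext ((s, t), z) - flow_ext ((s, t), w))"
      using flow_ext_lower_bound[OF st, where n = n] by metis
    \<comment> \<open>Values near y come only from points of one bounded box, on which the lower
      bound with a single constant c makes the inverse Lipschitz.\<close>
    have near: "complex_of_real x' \<in> closed_box n" if "dist (\<gamma> x') y < 1" for x'
    proof -
      have "cmod (\<gamma> x' - of_real x') \<le> displacement s t" unfolding \<gamma>_def by (intro flow_ext_displacement st) simp
      then have "cmod (of_real x') \<le> cmod (\<gamma> x') + displacement s t"
        using norm_triangle_ineq4[of "\<gamma> x'" "\<gamma> x' - of_real x'"] by simp
      moreover have "cmod (\<gamma> x') \<le> cmod y + 1"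
        using that norm_triangle_sub[of "\<gamma> x'" y] by (simp add: dist_norm)
      ultimately show ?thesis using n by (intro in_closed_box) auto
    qed
    show "\<exists>d>0. \<forall>y'\<in>range \<gamma>. dist y' y < d \<longrightarrow> dist (inv \<gamma> y') (inv \<gamma> y) < e"
    proof (intro exI[of _ "min 1 (c * e)"] conjI ballI impI)
      show "0 < min 1 (c * e)" using c e by simp
      fix y' assume "y' \<in> range \<gamma>" and d: "dist y' y < min 1 (c * e)"
      then obtain x' where x': "y' = \<gamma> x'" by blast
      have "complex_of_real x' \<in> closed_box n" "complex_of_real x \<in> closed_box n"
        using near[of x'] near[of x] d x x' by auto
      from c(2)[OF this] have "c * \<bar>x' - x\<bar> \<le> dist y' y"
        by (simp add: x x' \<gamma>_def dist_norm flip: of_real_diff)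
      then have "c * \<bar>x' - x\<bar> < c * e" using d by simp
      then have "\<bar>x' - x\<bar> < e" using c(1) by simp
      then show "dist (inv \<gamma> y') (inv \<gamma> y) < e" using inj by (simp add: x x' dist_real_def)
    qed
  qed
  have "homeomorphism UNIV (range \<gamma>) \<gamma> (inv \<gamma>)"
    unfolding homeomorphism_def using inj cont inv_cont by (auto simp: image_image)
  then show ?thesis
    unfolding jordan_arc_param_def frontier_planar_evolution[OF st] \<gamma>_def by blast
qed

lemma boundary_continuous:
  "continuous_on (time_simplex \<times> (UNIV :: real set)) (\<lambda>(st, x). flow_ext (st, complex_of_real x))"
proof -
  have "continuous_on (time_simplex \<times> closed_upper_half_plane) flow_ext"
    using continuous_extension_flow by (simp add: continuous_extension_def)
  then show ?thesis
    unfolding case_prod_beta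
    by (rule continuous_on_compose2) (auto intro!: continuous_intros)
qed

lemma deriv_ext_holder:
  assumes st: "0 \<le> s" "s \<le> t" and \<eta>: "0 < \<eta>" "\<eta> < \<alpha>" and K: "compact K" "K \<subseteq> closed_upper_half_plane"
  shows "holder_on \<eta> K (\<lambda>z. deriv_ext ((s, t), z))"
proof -
  let ?L = "\<lambda>z. boundary_extension logderiv_map ((s, t), z)"
  obtain b where b: "\<And>z. z \<in> K \<Longrightarrow> cmod z \<le> b" using compact_imp_bounded[OF K(1)] by (auto simp: bounded_iff)
  obtain n :: nat where n: "max b t \<le> real n" using real_arch_simple by blast
  have Kn: "z \<in> closed_box n" if "z \<in> K" for z using b[OF that] n K(2) that by (intro in_closed_box) auto
  obtain c where c: "0 \<le> c" "\<And>s t z w. 0 \<le> s \<Longrightarrow> s \<le> t \<Longrightarrow> t \<le> real n \<Longrightarrow> z \<in> half_box (Suc n) \<Longrightarrow> w \<in> half_box (Suc n) \<Longrightarrow>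
    cmod (logderiv s t z - logderiv s t w) \<le> c * cmod (z - w) powr \<eta>"
    using logderiv_space_holder[OF \<eta>, of n "Suc n"] by blast
  have L: "cmod (?L z - ?L w) \<le> c * cmod (z - w) powr \<eta>" if z: "z \<in> K" and w: "w \<in> K" for z w
  proof (rule LIMSEQ_le_const2)
    let ?e = "\<lambda>i. Complex 0 (1 / real (Suc i))"
    show "(\<lambda>i. cmod (logderiv s t (z + ?e i) - logderiv s t (w + ?e i))) \<longlonglongrightarrow> cmod (?L z - ?L w)"
      using st z w K(2) by (intro tendsto_norm tendsto_diff logderiv_ext_tendsto) auto
    have "cmod (logderiv s t (z + ?e i) - logderiv s t (w + ?e i)) \<le> c * cmod (z - w) powr \<eta>" for i
      using c(2)[OF st _ shift_in_box[OF Kn[OF z], of i] shift_in_box[OF Kn[OF w], of i]] n by simp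
    then show "\<exists>N. \<forall>i\<ge>N. cmod (logderiv s t (z + ?e i) - logderiv s t (w + ?e i)) \<le> c * cmod (z - w) powr \<eta>" by blast
  qed
  have "continuous_on K ?L"
    by (rule continuous_on_compose2[OF boundary_extension_continuous[OF logderiv_map_locally_holder]])
       (use st K in \<open>auto intro!: continuous_intros\<close>)
  then have "bounded (?L ` K)" using K(1) by (intro compact_imp_bounded compact_continuous_image)
  \<comment> \<open>The Hoelder exponent passes from L to exp L because exp is Lipschitz on a ball
    containing all values of L.\<close>
  then obtain M where M: "\<And>z. z \<in> K \<Longrightarrow> ?L z \<in> cball 0 M" by (auto simp: bounded_iff)
  show ?thesis
  proof (rule holder_onI)
    fix z w assume z: "z \<in> K" and w: "w \<in> K"
    have "cmod (exp (?L z) - exp (?L w)) \<le> exp M * cmod (?L z - ?L w)"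
    proof (rule field_differentiable_bound[OF convex_cball _ _ M[OF z] M[OF w]])
      fix v :: complex assume "v \<in> cball 0 M"
      then show "cmod (exp v) \<le> exp M" using complex_Re_le_cmod[of v] by (simp add: norm_exp_eq_Re)
      show "(exp has_field_derivative exp v) (at v within cball 0 M)"
        by (rule has_field_derivative_at_within[OF DERIV_exp])
    qed
    also have "\<dots> \<le> exp M * (c * cmod (z - w) powr \<eta>)" by (intro mult_left_mono L z w) auto
    finally show "dist (deriv_ext ((s, t), z)) (deriv_ext ((s, t), w)) \<le> exp M * c * dist z w powr \<eta>"
      by (simp add: deriv_ext_def dist_norm mult.assoc)
  qed
qed

end

text \<open>For each of the countably many pairs (N, j), \<epsilon> is the exponent that
  \<open>logderiv_dyadic_AE\<close> ties to \<eta> = \<alpha>(1 - 1/(j + 2)); the union of the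
  exceptional sets is still a null set.\<close>

lemma (in brownian_flow) regular_flow_AE: "AE \<omega> in M. regular_flow F C A \<alpha> (\<lambda>t. B t \<omega>)"
proof -
  have "AE \<omega> in M. \<forall>N j :: nat. \<exists>K\<ge>0. \<forall>n. \<forall>k\<in>dyadic_index N n.
      \<bar>B (real (Suc k) / 2 ^ n) \<omega> - B (real k / 2 ^ n) \<omega>\<bar> \<le> K * (2 powr - (1 / 2 * (1 - 1 / (real j + 2)))) ^ n"
    by (intro AE_all_countable[THEN iffD2] allI brownian_dyadic_AE) (auto simp: divide_less_eq)
  moreover have "AE \<omega> in M. \<forall>N j :: nat. 1 \<le> N \<longrightarrow> (\<exists>\<epsilon>>0. \<exists>K\<ge>0. \<forall>n. \<forall>k\<in>dyadic_index N n. \<forall>z\<in>half_box N. \<forall>w\<in>half_box N.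
      cmod (path_logderiv \<omega> (real k / 2 ^ n) (real (Suc k) / 2 ^ n) z) \<le> K * (2 powr - \<epsilon>) ^ n \<and>
      cmod (path_logderiv \<omega> (real k / 2 ^ n) (real (Suc k) / 2 ^ n) z - path_logderiv \<omega> (real k / 2 ^ n) (real (Suc k) / 2 ^ n) w)
        \<le> K * (2 powr - \<epsilon>) ^ n * cmod (z - w) powr (\<alpha> * (1 - 1 / (real j + 2))))"
  proof (intro AE_all_countable[THEN iffD2] allI)
    fix N j :: nat
    let ?\<eta> = "\<alpha> * (1 - 1 / (real j + 2))"
    have \<eta>: "0 < ?\<eta>" "?\<eta> < \<alpha>" using \<alpha>_pos by (auto simp: divide_less_eq)
    have \<epsilon>: "0 < (\<alpha> - ?\<eta>) / (8 * \<alpha>)" using \<alpha>_pos \<eta> by simp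
    show "AE \<omega> in M. 1 \<le> N \<longrightarrow> (\<exists>\<epsilon>>0. \<exists>K\<ge>0. \<forall>n. \<forall>k\<in>dyadic_index N n. \<forall>z\<in>half_box N. \<forall>w\<in>half_box N.
      cmod (path_logderiv \<omega> (real k / 2 ^ n) (real (Suc k) / 2 ^ n) z) \<le> K * (2 powr - \<epsilon>) ^ n \<and>
      cmod (path_logderiv \<omega> (real k / 2 ^ n) (real (Suc k) / 2 ^ n) z - path_logderiv \<omega> (real k / 2 ^ n) (real (Suc k) / 2 ^ n) w)
        \<le> K * (2 powr - \<epsilon>) ^ n * cmod (z - w) powr ?\<eta>)"
    proof (cases "1 \<le> N")
      case True
      show ?thesis
        using logderiv_dyadic_AE[OF \<eta> True refl] by eventually_elim (use \<epsilon> in blast)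
    qed simp
  qed
  ultimately show ?thesis using AE_continuous_path
  proof eventually_elim
    case (elim \<omega>)
    show ?case
      using elim(1,2) by (intro regular_flow.intro driven_flow_path[OF elim(3)] regular_flow_axioms.intro) blast+
  qed
qed

theorem theorem1:
  fixes \<alpha> :: real and F :: "complex \<Rightarrow> complex"
    and M :: "'a measure" and Fil :: "real \<Rightarrow> 'a measure" and B :: "real \<Rightarrow> 'a \<Rightarrow> real"
  assumes "0 < \<alpha>" and "\<alpha> \<le> 1"
    and "F holomorphic_on upper_half_plane"
    and "F ` upper_half_plane \<subseteq> upper_half_plane"
    and "bounded (F ` upper_half_plane)"
    and "holder_on \<alpha> upper_half_plane F"
    and "standard_brownian_motion M Fil B"
  shows "AE \<omega> in M.
    (let U = (\<lambda>t. B t \<omega>) in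
      (\<exists>\<Phi> :: (real \<times> real) \<times> complex \<Rightarrow> complex.
         continuous_extension (time_simplex \<times> upper_half_plane) (time_simplex \<times> closed_upper_half_plane)
           (\<lambda>((s, t), z). flow F U s t z) \<Phi> \<and>
         (\<forall>\<eta> K. 0 < \<eta> \<and> \<eta> < 1 / 2 \<and> compact K \<and> K \<subseteq> time_simplex \<times> closed_upper_half_plane
            \<longrightarrow> holder_on \<eta> K \<Phi>) \<and>
         (\<forall>s t. 0 \<le> s \<and> s \<le> t \<longrightarrow> inj_on (\<lambda>z. \<Phi> ((s, t), z)) closed_upper_half_plane) \<and>
         (\<forall>s t. 0 \<le> s \<and> s \<le> t \<longrightarrow>
            jordan_arc_param (\<lambda>x. \<Phi> ((s, t), complex_of_real x)) (frontier (planar_evolution F U s t))) \<and>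
         continuous_on (time_simplex \<times> (UNIV :: real set)) (\<lambda>(st, x). \<Phi> (st, complex_of_real x))) \<and>
      (\<exists>\<Phi>' :: (real \<times> real) \<times> complex \<Rightarrow> complex.
         continuous_extension (time_simplex \<times> upper_half_plane) (time_simplex \<times> closed_upper_half_plane)
           (\<lambda>((s, t), z). deriv (flow F U s t) z) \<Phi>' \<and>
         (\<forall>s t \<eta> K. 0 \<le> s \<and> s \<le> t \<and> 0 < \<eta> \<and> \<eta> < \<alpha> \<and> compact K \<and> K \<subseteq> closed_upper_half_plane
            \<longrightarrow> holder_on \<eta> K (\<lambda>z. \<Phi>' ((s, t), z)))))"
proof -
  obtain b where b: "\<And>z. 0 < Im z \<Longrightarrow> cmod (F z) \<le> b" using assms(5) by (auto simp: bounded_iff)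
  obtain a where a: "\<And>z w. 0 < Im z \<Longrightarrow> 0 < Im w \<Longrightarrow> z \<noteq> w \<Longrightarrow> dist (F z) (F w) / dist z w powr \<alpha> \<le> a"
    using assms(6) unfolding holder_on_def bdd_above_def by blast
  \<comment> \<open>The maxima with 1 and 0 supply the normalisations of the locale. The Hoelder
    seminorm runs over distinct points, so z = w is treated apart.\<close>
  interpret brownian_flow M Fil B F "max 1 b" "max 0 a" \<alpha>
  proof (intro brownian_flow.intro assms(7) holomorphic_drift.intro)
    fix z w :: complex assume z: "0 < Im z" and w: "0 < Im w"
    show "cmod (F z - F w) \<le> max 0 a * cmod (z - w) powr \<alpha>"
    proof (cases "z = w")
      case False
      have "cmod (F z - F w) \<le> a * cmod (z - w) powr \<alpha>"
        using a[OF z w False] False by (simp add: dist_norm divide_le_eq)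
      also have "\<dots> \<le> max 0 a * cmod (z - w) powr \<alpha>" by (intro mult_right_mono) auto
      finally show ?thesis .
    qed simp
  qed (use assms(1-4) b in \<open>auto intro: le_max_iff_disj[THEN iffD2]\<close>)
  show ?thesis
    using regular_flow_AE
  proof eventually_elim
    case (elim \<omega>)
    interpret regular_flow F "max 1 b" "max 0 a" \<alpha> "\<lambda>t. B t \<omega>" by (rule elim)
    show ?case
      unfolding Let_def
    proof (intro conjI exI)
      show "continuous_extension (time_simplex \<times> upper_half_plane) (time_simplex \<times> closed_upper_half_plane)
           (\<lambda>((s, t), z). flow F (\<lambda>t. B t \<omega>) s t z) flow_ext"
        by (rule continuous_extension_flow)
      show "continuous_extension (time_simplex \<times> upper_half_plane) (time_simplex \<times> closed_upper_half_plane)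
           (\<lambda>((s, t), z). deriv (flow F (\<lambda>t. B t \<omega>) s t) z) deriv_ext"
        by (rule continuous_extension_deriv)
    qed (use flow_ext_holder flow_ext_inj jordan_arc_frontier boundary_continuous deriv_ext_holder in auto)
  qed
qed

end
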